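(* Let $r\ge 1$ and let $\mathcal L$ be the Fourier multiplier operator on $\mathbb T^2$ with symbol $b:\mathbb Z^2\to\mathbb R$ satisfying $|b(\mathbf k)|\le C|\mathbf k|^{r-1}$ for all $\mathbf k\in\mathbb Z^2$ with $|\mathbf k|\ge N_0$, for some constants $C>0$, $N_0\ge 0$. Put $\lambda_{\mathbf k}=k_1 b(\mathbf k)$ for $\mathbf k=(k_1,k_2)\in\mathbb Z^2$, so that $\partial_x\mathcal L\psi_{\mathbf k}=i\lambda_{\mathbf k}\psi_{\mathbf k}$. Let $\mathbb J\subset\mathbb Z^2$ be a maximal subset such that $\lambda_{\mathbf k}\ne\lambda_{\mathbf k'}$ for all distinct $\mathbf k,\mathbf k'\in\mathbb J$, and suppose that $$\gamma:=\inf_{\mathbf k,\mathbf k'\in\mathbb J,\ \mathbf k\ne\mathbf k'}|\lambda_{\mathbf k}-\lambda_{\mathbf k'}|>0.$$ Assume that one of the following two sets of conditions holds. (A) For all $(k_1,k_2)\in\mathbb Z^2$: $\lambda_{(-k_1,k_2)}=\lambda_{(k_1,k_2)}$ and $\lambda_{(k_1,-k_2)}=-\lambda_{(k_1,k_2)}$; if $k_1\ne0$, the unique solution $j_2\in\mathbb Z$ of $\lambda_{(k_1,j_2)}=\lambda_{(k_1,k_2)}$ is $j_2=k_2$; if $k_2\ne0$, the only solutions $j_1\in\mathbb Z$ of $\lambda_{(j_1,k_2)}=\lambda_{(k_1,k_2)}$ are $j_1=\pm k_1$. (B) For all $(k_1,k_2)\in\mathbb Z^2$: $\lambda_{(-k_1,k_2)}=-\lambda_{(k_1,k_2)}$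 and $\lambda_{(k_1,-k_2)}=\lambda_{(k_1,k_2)}$; if $k_1\ne0$, the only solutions $j_2\in\mathbb Z$ of $\lambda_{(k_1,j_2)}=\lambda_{(k_1,k_2)}$ are $j_2=\pm k_2$; if $k_2\ne0$, the unique solution $j_1\in\mathbb Z$ of $\lambda_{(j_1,k_2)}=\lambda_{(k_1,k_2)}$ is $j_1=k_1$. Let $s\ge0$ and $\lambda>0$ be given. Then there exists a bounded linear operator $K_\lambda$ from $H^s_p(\mathbb T^2)$ to $H^s_p(\mathbb T^2)$ such that, for every $u_0\in H^s_p(\mathbb T^2)$, the unique solution $u$ of the closed-loop system $$u\in C([0,+\infty);H^s_p(\mathbb T^2)),\qquad \partial_tu(t)=\partial_x\mathcal Lu(t)+GK_\lambda u(t)\in H^{s-r}_p(\mathbb T^2),\ t>0,\qquad u(0)=u_0,$$ satisfies $$\|u(\cdot,t)-\widehat{u_0}(0,0)\|_{H^s_p(\mathbb T^2)}\le Me^{-\lambda t}\|u_0-\widehat{u_0}(0,0)\|_{H^s_p(\mathbb T^2)}$$ for all $t\ge0$ and some positive constant $M=M(g_1,g_2,\lambda,s)$.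
   Context: $\mathbb T=\mathbb R/2\pi\mathbb Z$, $\mathbb T^2=\mathbb R^2/(2\pi\mathbb Z)^2$, $|\mathbf k|=\sqrt{k_1^2+k_2^2}$. For a distribution $u$ on $\mathbb T^2$, $\widehat u(\mathbf k)=\frac1{(2\pi)^2}\langle u,e^{-i\mathbf k\cdot\mathbf x}\rangle$. $H^s_p(\mathbb T^2)$ is the space of distributions $u$ on $\mathbb T^2$ with $\|u\|^2_{H^s_p(\mathbb T^2)}=(2\pi)^2\sum_{\mathbf k\in\mathbb Z^2}(1+|\mathbf k|)^{2s}|\widehat u(\mathbf k)|^2<\infty$. $\psi_{\mathbf k}(\mathbf x)=\frac1{2\pi}e^{i\mathbf k\cdot\mathbf x}$. The operator $\mathcal L$ is defined by $\widehat{\mathcal Lu}(\mathbf k)=b(\mathbf k)\widehat u(\mathbf k)$. The functions $g_1,g_2\in C^\infty(\mathbb T)$ are fixed, non-negative, real-valued, with $\int_{\mathbb T}g_1(x)dx=1=\int_{\mathbb T}g_2(y)dy$, and such that $\omega_1=\{x\in\mathbb T: g_1(x)>0\}$ and $\omega_2=\{y\in\mathbb T:g_2(y)>0\}$ are open intervals, with $\operatorname{supp}g_i=\overline{\omega_i}$. The operator $G:H^s_p(\mathbb T^2)\to H^s_p(\mathbb T^2)$, $s\ge0$, is $$G(\phi)(x,y)=g_2(y)\,G_1(\phi)(x,y)+g_1(x)\,G_2(\phi)(x,y),$$ $$G_1(\phi)(x,y)=\tfrac1{2\pi}\phi(x,y)-\tfrac1{(2\pi)^2}\int_0^{2\pi}\phi(x',y)dx',\qquad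 G_2(\phi)(x,y)=\tfrac1{2\pi}\phi(x,y)-\tfrac1{(2\pi)^2}\int_0^{2\pi}\phi(x,y')dy'.$$ Solutions are understood in the mild sense: $u(t)=U(t)u_0+\int_0^tU(t-t')GK_\lambda u(t')dt'$, where $U(t)$ is the unitary group given by $\widehat{U(t)\varphi}(\mathbf k)=e^{ik_1b(\mathbf k)t}\widehat\varphi(\mathbf k)$. The number $\widehat{u_0}(0,0)$ is regarded as a constant function on $\mathbb T^2$. The constant $M$ does not depend on $u_0$ or $t$ (the operator $\mathcal L$ being fixed). *)

theory Defs
  imports "HOL-Analysis.Analysis"
begin

(* Functions on the torus (R / 2 pi Z)^d, d = 1, 2, are 2 pi-periodic functions on R^d. *)

section \<open>Test functions and distributions on the two-dimensional torus\<close>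

definition periodic1 :: "(real \<Rightarrow> 'a) \<Rightarrow> bool" where
  "periodic1 g \<longleftrightarrow> (\<forall>x. g (x + 2 * pi) = g x)"

definition periodic2 :: "(real \<times> real \<Rightarrow> 'a) \<Rightarrow> bool" where
  "periodic2 f \<longleftrightarrow> (\<forall>x y. f (x + 2 * pi, y) = f (x, y) \<and> f (x, y + 2 * pi) = f (x, y))"

definition pdx :: "(real \<times> real \<Rightarrow> complex) \<Rightarrow> real \<times> real \<Rightarrow> complex" where
  "pdx f = (\<lambda>(x, y). vector_derivative (\<lambda>x'. f (x', y)) (at x))"

definition pdy :: "(real \<times> real \<Rightarrow> complex) \<Rightarrow> real \<times> real \<Rightarrow> complex" where
  "pdy f = (\<lambda>(x, y). vector_derivative (\<lambda>y'. f (x, y')) (at y))"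

primrec Ck :: "nat \<Rightarrow> (real \<times> real \<Rightarrow> complex) \<Rightarrow> bool" where
  "Ck 0 f \<longleftrightarrow> continuous_on UNIV f"
| "Ck (Suc n) f \<longleftrightarrow> continuous_on UNIV f \<and>
     (\<forall>x y. (\<lambda>x'. f (x', y)) differentiable (at x) \<and> (\<lambda>y'. f (x, y')) differentiable (at y)) \<and>
     Ck n (pdx f) \<and> Ck n (pdy f)"

definition test_fun :: "(real \<times> real \<Rightarrow> complex) set" where
  "test_fun = {\<phi>. periodic2 \<phi> \<and> (\<forall>n. Ck n \<phi>)}"

type_synonym functional = "(real \<times> real \<Rightarrow> complex) \<Rightarrow> complex"

(* Distributions are the complex-linear functionals on test_fun that are bounded by a C^N norm
   (B ranges over the upper bounds of that norm).  They are made extensional, i.e. undefined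
   outside test_fun, so that equality of functionals is equality of distributions. *)
definition distribution :: "functional \<Rightarrow> bool" where
  "distribution u \<longleftrightarrow> u \<in> extensional test_fun \<and>
     (\<forall>\<phi>\<in>test_fun. \<forall>\<psi>\<in>test_fun. \<forall>a b.
        u (\<lambda>p. a * \<phi> p + b * \<psi> p) = a * u \<phi> + b * u \<psi>) \<and>
     (\<exists>C N. \<forall>\<phi>\<in>test_fun. \<forall>B.
        (\<forall>m n p. m + n \<le> N \<longrightarrow> cmod ((pdx ^^ m) ((pdy ^^ n) \<phi>) p) \<le> B) \<longrightarrow>
        cmod (u \<phi>) \<le> C * B)"

definition dist_lin :: "complex \<Rightarrow> functional \<Rightarrow> complex \<Rightarrow> functional \<Rightarrow> functional" where
  "dist_lin a u b v = (\<lambda>\<phi>\<in>test_fun. a * u \<phi> + b * v \<phi>)"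

abbreviation dist_add :: "functional \<Rightarrow> functional \<Rightarrow> functional" where
  "dist_add u v \<equiv> dist_lin 1 u 1 v"

abbreviation dist_diff :: "functional \<Rightarrow> functional \<Rightarrow> functional" where
  "dist_diff u v \<equiv> dist_lin 1 u (- 1) v"

definition dist_of_fun :: "(real \<times> real \<Rightarrow> complex) \<Rightarrow> functional" where
  "dist_of_fun f = (\<lambda>\<phi>\<in>test_fun. integral (cbox (0, 0) (2 * pi, 2 * pi)) (\<lambda>p. f p * \<phi> p))"

definition const_dist :: "complex \<Rightarrow> functional" where
  "const_dist c = dist_of_fun (\<lambda>_. c)"

definition dist_dx :: "functional \<Rightarrow> functional" where
  "dist_dx u = (\<lambda>\<phi>\<in>test_fun. - u (pdx \<phi>))"

section \<open>Fourier coefficients, multipliers and Sobolev spaces\<close>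

definition fourier :: "functional \<Rightarrow> int \<times> int \<Rightarrow> complex" where
  "fourier u k = u (\<lambda>(x, y). cis (- (of_int (fst k) * x + of_int (snd k) * y))) / (2 * pi)\<^sup>2"

(* A distribution is determined by its Fourier coefficients, and the description below is proper
   whenever m grows at most polynomially. *)
definition multiplier :: "(int \<times> int \<Rightarrow> complex) \<Rightarrow> functional \<Rightarrow> functional" where
  "multiplier m u = (THE v. distribution v \<and> (\<forall>k. fourier v k = m k * fourier u k))"

definition freq_norm :: "int \<times> int \<Rightarrow> real" where
  "freq_norm k = sqrt ((of_int (fst k))\<^sup>2 + (of_int (snd k))\<^sup>2)"

definition Hs_weight :: "real \<Rightarrow> functional \<Rightarrow> int \<times> int \<Rightarrow> real" where
  "Hs_weight s u k = (1 + freq_norm k) powr (2 * s) * (cmod (fourier u k))\<^sup>2"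

definition Hs :: "real \<Rightarrow> functional set" where
  "Hs s = {u. distribution u \<and> Hs_weight s u summable_on UNIV}"

definition Hs_norm :: "real \<Rightarrow> functional \<Rightarrow> real" where
  "Hs_norm s u = sqrt ((2 * pi)\<^sup>2 * (\<Sum>\<^sub>\<infinity>k. Hs_weight s u k))"

definition bounded_linear_Hs :: "real \<Rightarrow> (functional \<Rightarrow> functional) \<Rightarrow> bool" where
  "bounded_linear_Hs s K \<longleftrightarrow> (\<forall>u\<in>Hs s. K u \<in> Hs s) \<and>
     (\<forall>u\<in>Hs s. \<forall>v\<in>Hs s. \<forall>a b. K (dist_lin a u b v) = dist_lin a (K u) b (K v)) \<and>
     (\<exists>C. \<forall>u\<in>Hs s. Hs_norm s (K u) \<le> C * Hs_norm s u)"

section \<open>The control operator\<close>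

(* The set of x with g x > 0 is the lift to R of the image in T of an interval (a, b). *)
definition control_profile :: "(real \<Rightarrow> real) \<Rightarrow> bool" where
  "control_profile g \<longleftrightarrow> periodic1 g \<and> (\<forall>n x. (deriv ^^ n) g differentiable (at x)) \<and>
     (\<forall>x. g x \<ge> 0) \<and> integral {0..2 * pi} g = 1 \<and>
     (\<exists>a b. a < b \<and> {x. g x > 0} = {x. \<exists>n::int. x + 2 * pi * of_int n \<in> {a<..<b}}) \<and>
     closure {x. g x \<noteq> 0} = closure {x. g x > 0}"

definition mult_dist :: "(real \<times> real \<Rightarrow> complex) \<Rightarrow> functional \<Rightarrow> functional" where
  "mult_dist g u = (\<lambda>\<phi>\<in>test_fun. u (\<lambda>p. g p * \<phi> p))"

(* The partial integrals of a distribution over one period in x, respectively y, by duality: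
   for an integrable function f, Fubini gives
   < integral of f(x', y) dx', phi > = < f, integral of phi(x', y) dx' >. *)
definition int_x :: "functional \<Rightarrow> functional" where
  "int_x u = (\<lambda>\<phi>\<in>test_fun. u (\<lambda>(x, y). integral {0..2 * pi} (\<lambda>x'. \<phi> (x', y))))"

definition int_y :: "functional \<Rightarrow> functional" where
  "int_y u = (\<lambda>\<phi>\<in>test_fun. u (\<lambda>(x, y). integral {0..2 * pi} (\<lambda>y'. \<phi> (x, y'))))"

definition G1 :: "functional \<Rightarrow> functional" where
  "G1 u = dist_lin (1 / (2 * pi)) u (- 1 / (2 * pi)\<^sup>2) (int_x u)"

definition G2 :: "functional \<Rightarrow> functional" where
  "G2 u = dist_lin (1 / (2 * pi)) u (- 1 / (2 * pi)\<^sup>2) (int_y u)"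

definition G :: "(real \<Rightarrow> real) \<Rightarrow> (real \<Rightarrow> real) \<Rightarrow> functional \<Rightarrow> functional" where
  "G g1 g2 u = dist_add (mult_dist (\<lambda>(x, y). of_real (g2 y)) (G1 u))
                        (mult_dist (\<lambda>(x, y). of_real (g1 x)) (G2 u))"

section \<open>The closed-loop system\<close>

definition L_op :: "(int \<times> int \<Rightarrow> real) \<Rightarrow> functional \<Rightarrow> functional" where
  "L_op b = multiplier (\<lambda>k. of_real (b k))"

definition eigen :: "(int \<times> int \<Rightarrow> real) \<Rightarrow> int \<times> int \<Rightarrow> real" where
  "eigen b k = of_int (fst k) * b k"

definition U_group :: "(int \<times> int \<Rightarrow> real) \<Rightarrow> real \<Rightarrow> functional \<Rightarrow> functional" where
  "U_group b t = multiplier (\<lambda>k. cis (of_int (fst k) * b k * t))"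

definition continuous_Hs :: "real \<Rightarrow> (real \<Rightarrow> functional) \<Rightarrow> bool" where
  "continuous_Hs s u \<longleftrightarrow> (\<forall>t\<ge>0. u t \<in> Hs s \<and>
     ((\<lambda>t'. Hs_norm s (dist_diff (u t') (u t))) \<longlongrightarrow> 0) (at t within {0..}))"

(* u(t) = U(t) u0 + integral over [0,t] of U(t - tau) F(u(tau)) d tau, the integral of a
   curve of distributions being taken after pairing with each test function. *)
definition mild_solution ::
  "real \<Rightarrow> (int \<times> int \<Rightarrow> real) \<Rightarrow> (functional \<Rightarrow> functional) \<Rightarrow> functional \<Rightarrow>
   (real \<Rightarrow> functional) \<Rightarrow> bool" where
  "mild_solution s b F u0 u \<longleftrightarrow> continuous_Hs s u \<and>
     (\<forall>t\<ge>0. \<forall>\<phi>\<in>test_fun.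
        ((\<lambda>\<tau>. U_group b (t - \<tau>) (F (u \<tau>)) \<phi>) has_integral (u t \<phi> - U_group b t u0 \<phi>)) {0..t})"

definition has_Hs_derivative ::
  "real \<Rightarrow> (real \<Rightarrow> functional) \<Rightarrow> functional \<Rightarrow> real \<Rightarrow> bool" where
  "has_Hs_derivative \<sigma> u v t \<longleftrightarrow> v \<in> Hs \<sigma> \<and>
     ((\<lambda>h. Hs_norm \<sigma> (dist_diff (dist_lin (1 / of_real h) (u (t + h)) (- 1 / of_real h) (u t)) v))
        \<longlongrightarrow> 0) (at 0)"

section \<open>Hypotheses on the spectrum\<close>

definition maximal_separated :: "(int \<times> int \<Rightarrow> real) \<Rightarrow> (int \<times> int) set \<Rightarrow> bool" where
  "maximal_separated l J \<longleftrightarrow> inj_on l J \<and> (\<forall>J'. J \<subseteq> J' \<and> inj_on l J' \<longrightarrow> J' = J)"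

definition cond_A :: "(int \<times> int \<Rightarrow> real) \<Rightarrow> bool" where
  "cond_A l \<longleftrightarrow> (\<forall>k1 k2.
     l (- k1, k2) = l (k1, k2) \<and> l (k1, - k2) = - l (k1, k2) \<and>
     (k1 \<noteq> 0 \<longrightarrow> (\<forall>j2. l (k1, j2) = l (k1, k2) \<longleftrightarrow> j2 = k2)) \<and>
     (k2 \<noteq> 0 \<longrightarrow> (\<forall>j1. l (j1, k2) = l (k1, k2) \<longleftrightarrow> j1 = k1 \<or> j1 = - k1)))"

definition cond_B :: "(int \<times> int \<Rightarrow> real) \<Rightarrow> bool" where
  "cond_B l \<longleftrightarrow> (\<forall>k1 k2.
     l (- k1, k2) = - l (k1, k2) \<and> l (k1, - k2) = l (k1, k2) \<and>
     (k1 \<noteq> 0 \<longrightarrow> (\<forall>j2. l (k1, j2) = l (k1, k2) \<longleftrightarrow> j2 = k2 \<or> j2 = - k2)) \<and>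
     (k2 \<noteq> 0 \<longrightarrow> (\<forall>j1. l (j1, k2) = l (k1, k2) \<longleftrightarrow> j1 = k1)))"

end

theory Submission
  imports Defs
begin

text \<open>On Fourier coefficients the control acts by a matrix \<open>G\<close> with rapid off-diagonal decay. If \<open>T\<close> is
  boundedly invertible and \<open>i \<lambda>\<^sub>k T k j - T k j \<mu>\<^sub>j = G k j\<close>, where \<open>\<mu>\<^sub>0 = 0\<close> and
  \<open>\<mu>\<^sub>j = i \<lambda>\<^sub>j - rate\<close> for \<open>j \<noteq> 0\<close>, then the feedback \<open>K = - T\<^sup>-\<^sup>1\<close> conjugates the
  closed loop to the diagonal system with eigenvalues \<open>\<mu>\<^sub>j\<close>; the constant mode is fixed because \<open>T\<close> acts
  trivially on it. Invertibility of \<open>T\<close> on square-summable sequences is coercivity: its entries carry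
  \<open>1 / (rate + i (\<lambda>\<^sub>k - \<lambda>\<^sub>j)) = \<integral>\<^sub>0\<^sup>\<infinity> e\<^bsup>-(rate + i (\<lambda>\<^sub>k - \<lambda>\<^sub>j)) t\<^esup> dt\<close>, and restricting to a long bounded time window an
  Ingham argument with the gap \<open>\<gamma>\<close> leaves only pairs with \<open>\<lambda>\<^sub>k = \<lambda>\<^sub>j\<close>, where at most the two
  frequencies \<open>\<plusminus> k\<close> interact and \<open>|ghat g n| < 1\<close> for \<open>n \<noteq> 0\<close> suffices. Conjugating with the
  weight \<open>(R + |k|)\<^sup>s\<close> changes \<open>T\<close> by \<open>O(1/R)\<close>, so coercivity, hence invertibility, passes to \<open>H\<^sup>s\<close>.\<close>

section \<open>Square-summable families\<close>

text \<open>The conjugation is the computation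
  \<open>(i \<Lambda> - G T^-1) T = i \<Lambda> T - G = T \<mu>\<close>, where \<Lambda> is the
  diagonal operator of the \<lambda>. The obstacle is that \<open>T\<close> is not close to a
  diagonal operator: where \<open>\<lambda>\<^sub>k - \<lambda>\<^sub>j\<close> is small compared
  with the rate, the entry is about \<open>G k j / rate\<close>, so for a large rate diagonal
  dominance fails. Coercivity of the real part is used instead, because it adds over pieces and
  survives the removal of nonnegative parts. The term with \<open>g2(y)\<close> keeps the first
  frequency and the term with \<open>g1(x)\<close> the second, so \<open>T\<close> splits into forms
  on rows and columns of the lattice, which is where (A) and (B) control coincidences of \<lambda>.
  On one row, \<open>g >= 0\<close> makes the form an integral over \<open>(y, t)\<close> of
  \<open>g(y) exp(- rate t) |sum a_j exp(i j y + i \<lambda>_j t)|^2\<close>, so the exponential may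
  be replaced by any smaller weight. A parabola on a window is taken: its transform decays
  quadratically, and its mass grows with the cube of the window length, so a long window makes all
  nonresonant pairs negligible. The constants depend on the gap, the rate and the profiles only,
  hence are the same on the infinitely many rows.\<close>

typedef 'i ell2 = "{a :: 'i \<Rightarrow> complex. (\<lambda>i. (cmod (a i))\<^sup>2) summable_on UNIV}"
  morphisms coef Abs_ell2
  by (rule exI[of _ "\<lambda>_. 0"]) simp

setup_lifting type_definition_ell2

lemma coef_square_summable: "(\<lambda>i. (cmod (coef x i))\<^sup>2) summable_on UNIV"
  using coef[of x] by simp

lemma ell2_eqI: "(\<And>i. coef x i = coef y i) \<Longrightarrow> x = y"
  by (metis coef_inject ext)

lemma summable_on_real_comparison:
  fixes f g :: "'i \<Rightarrow> real"
  assumes "g summable_on A" "\<And>i. i \<in> A \<Longrightarrow> \<bar>f i\<bar> \<le> g i"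
  shows "f summable_on A"
proof -
  have "(\<lambda>i. norm (f i)) summable_on A"
    by (rule Infinite_Sum.abs_summable_on_comparison_test'[OF assms(1)]) (use assms(2) in auto)
  then show ?thesis by (rule Infinite_Sum.abs_summable_summable)
qed

lemma cmod_add_square_le: "(cmod (a + b))\<^sup>2 \<le> 2 * (cmod a)\<^sup>2 + 2 * (cmod b)\<^sup>2"
proof -
  have "(cmod (a + b))\<^sup>2 \<le> (cmod a + cmod b)\<^sup>2"
    by (rule power_mono) (auto simp: norm_triangle_ineq)
  also have "\<dots> \<le> 2 * (cmod a)\<^sup>2 + 2 * (cmod b)\<^sup>2"
    using zero_le_power2[of "cmod a - cmod b"] by (simp add: power2_eq_square algebra_simps)
  finally show ?thesis .
qed

lemma mult_le_half_squares: "a * b \<le> (a\<^sup>2 + b\<^sup>2) / 2" for a b :: real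
  using zero_le_power2[of "a - b"] by (simp add: power2_eq_square algebra_simps)

lemma square_summable_add:
  assumes "(\<lambda>i. (cmod (a i))\<^sup>2) summable_on A" "(\<lambda>i. (cmod (b i))\<^sup>2) summable_on A"
  shows "(\<lambda>i. (cmod (a i + b i))\<^sup>2) summable_on A"
  by (rule summable_on_real_comparison[where g = "\<lambda>i. 2 * (cmod (a i))\<^sup>2 + 2 * (cmod (b i))\<^sup>2"])
    (auto intro!: summable_on_add summable_on_cmult_right assms cmod_add_square_le)

lemma square_summable_mult:
  assumes "(\<lambda>i. (cmod (a i))\<^sup>2) summable_on A" "(\<lambda>i. (cmod (b i))\<^sup>2) summable_on A"
  shows "(\<lambda>i. cmod (a i) * cmod (b i)) summable_on A"
proof (rule summable_on_real_comparison)
  show "(\<lambda>i. 1/2 * ((cmod (a i))\<^sup>2 + (cmod (b i))\<^sup>2)) summable_on A"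
    by (intro summable_on_cmult_right summable_on_add assms)
  show "\<bar>cmod (a i) * cmod (b i)\<bar> \<le> 1/2 * ((cmod (a i))\<^sup>2 + (cmod (b i))\<^sup>2)" for i
    using mult_le_half_squares[of "cmod (a i)" "cmod (b i)"] by (simp add: abs_mult)
qed

lemma Re_mult_cnj_self: "Re (z * cnj z) = (cmod z)\<^sup>2"
  by (simp only: complex_norm_square[symmetric] Re_complex_of_real)

lemma abs_Re_mult_cnj_le: "\<bar>Re (a * cnj b)\<bar> \<le> cmod a * cmod b"
  by (metis abs_Re_le_cmod complex_mod_cnj norm_mult)

instantiation ell2 :: (type) real_inner
begin

lift_definition zero_ell2 :: "'a ell2" is "\<lambda>_. 0" by simp
lift_definition plus_ell2 :: "'a ell2 \<Rightarrow> 'a ell2 \<Rightarrow> 'a ell2" is "\<lambda>a b i. a i + b i"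
  by (rule square_summable_add)
lift_definition uminus_ell2 :: "'a ell2 \<Rightarrow> 'a ell2" is "\<lambda>a i. - a i" by simp
definition minus_ell2 :: "'a ell2 \<Rightarrow> 'a ell2 \<Rightarrow> 'a ell2" where "minus_ell2 x y = x + - y"
lift_definition scaleR_ell2 :: "real \<Rightarrow> 'a ell2 \<Rightarrow> 'a ell2" is "\<lambda>r a i. of_real r * a i"
  by (simp add: norm_mult power_mult_distrib summable_on_cmult_right)
text \<open>Only the real part of the Hermitian product is kept: coercivity concerns real parts, and
  the class \<open>real_inner\<close> asks for a real form.\<close>

definition inner_ell2 :: "'a ell2 \<Rightarrow> 'a ell2 \<Rightarrow> real" where
  "inner_ell2 x y = (\<Sum>\<^sub>\<infinity>i. Re (coef x i * cnj (coef y i)))"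
definition norm_ell2 :: "'a ell2 \<Rightarrow> real" where "norm_ell2 x = sqrt (inner x x)"
definition sgn_ell2 :: "'a ell2 \<Rightarrow> 'a ell2" where "sgn_ell2 x = scaleR (inverse (norm x)) x"
definition dist_ell2 :: "'a ell2 \<Rightarrow> 'a ell2 \<Rightarrow> real" where "dist_ell2 x y = norm (x - y)"
definition uniformity_ell2 :: "('a ell2 \<times> 'a ell2) filter" where
  "uniformity_ell2 = (INF e\<in>{0 <..}. principal {(x, y). dist x y < e})"
definition open_ell2 :: "'a ell2 set \<Rightarrow> bool" where
  "open_ell2 U \<longleftrightarrow> (\<forall>x\<in>U. \<forall>\<^sub>F (x', y) in uniformity. x' = x \<longrightarrow> y \<in> U)"

lemma inner_ell2_summable: "(\<lambda>i. Re (coef x i * cnj (coef y i))) summable_on UNIV"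
  by (rule summable_on_real_comparison[OF square_summable_mult[OF coef_square_summable[of x] coef_square_summable[of y]]])
    (rule abs_Re_mult_cnj_le)

instance
proof
  fix x y z :: "'a ell2" and r q :: real
  show "x + y + z = x + (y + z)" by (transfer) (simp add: add.assoc)
  show "x + y = y + x" by (transfer) (simp add: add.commute)
  show "0 + x = x" by transfer simp
  show "- x + x = 0" by transfer simp
  show "x - y = x + - y" by (rule minus_ell2_def)
  show "r *\<^sub>R (x + y) = r *\<^sub>R x + r *\<^sub>R y" by transfer (simp add: algebra_simps)
  show "(r + q) *\<^sub>R x = r *\<^sub>R x + q *\<^sub>R x" by transfer (simp add: algebra_simps)
  show "r *\<^sub>R q *\<^sub>R x = (r * q) *\<^sub>R x" by transfer (simp add: algebra_simps)
  show "1 *\<^sub>R x = x" by transfer simp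
  show "sgn x = inverse (norm x) *\<^sub>R x" by (simp add: sgn_ell2_def)
  show "dist x y = norm (x - y)" by (rule dist_ell2_def)
  show "uniformity = (INF e\<in>{0 <..}. principal {(x, y :: 'a ell2). dist x y < e})"
    by (rule uniformity_ell2_def)
  show "\<And>U :: 'a ell2 set. open U \<longleftrightarrow> (\<forall>x\<in>U. \<forall>\<^sub>F (x', y) in uniformity. x' = x \<longrightarrow> y \<in> U)"
    by (rule open_ell2_def)
  show "x \<bullet> y = y \<bullet> x"
    unfolding inner_ell2_def by (intro infsum_cong) (simp add: algebra_simps)
  show "(x + y) \<bullet> z = x \<bullet> z + y \<bullet> z"
    using infsum_add[OF inner_ell2_summable[of x z] inner_ell2_summable[of y z]]
    by (simp add: inner_ell2_def plus_ell2.rep_eq algebra_simps)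
  show "(r *\<^sub>R x) \<bullet> y = r * (x \<bullet> y)"
    unfolding inner_ell2_def
    by (subst infsum_cmult_right'[symmetric], intro infsum_cong)
      (simp add: scaleR_ell2.rep_eq algebra_simps)
  show "0 \<le> x \<bullet> x"
    unfolding inner_ell2_def by (intro infsum_nonneg) simp
  show "x \<bullet> x = 0 \<longleftrightarrow> x = 0"
  proof
    assume *: "x \<bullet> x = 0"
    show "x = 0"
    proof (rule ell2_eqI)
      fix i
      have "Re (coef x i * cnj (coef x i)) = 0"
        by (rule nonneg_infsum_le_0D[OF _ inner_ell2_summable])
          (use * in \<open>auto simp: inner_ell2_def\<close>)
      then show "coef x i = coef 0 i"
        unfolding Re_mult_cnj_self by (simp add: zero_ell2.rep_eq)
    qed
  qed (simp add: inner_ell2_def zero_ell2.rep_eq)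
  show "norm x = sqrt (x \<bullet> x)" by (rule norm_ell2_def)
qed

end

section \<open>Norm, completeness and finite truncations\<close>

lemmas coef_simps [simp] = zero_ell2.rep_eq plus_ell2.rep_eq uminus_ell2.rep_eq scaleR_ell2.rep_eq

lemma coef_minus [simp]: "coef (x - y) i = coef x i - coef y i"
  using plus_ell2.rep_eq[of x "- y"] by simp

lemma norm_ell2_square: "(norm x)\<^sup>2 = (\<Sum>\<^sub>\<infinity>i. (cmod (coef x i))\<^sup>2)" for x :: "'i ell2"
  unfolding power2_norm_eq_inner inner_ell2_def Re_mult_cnj_self ..

lemma sum_coef_le_norm:
  fixes x :: "'i ell2"
  assumes "finite A"
  shows "(\<Sum>i\<in>A. (cmod (coef x i))\<^sup>2) \<le> (norm x)\<^sup>2"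
  unfolding norm_ell2_square
  by (rule finite_sum_le_infsum[OF coef_square_summable assms]) auto

lemma norm_coef_le: "cmod (coef x i) \<le> norm x" for x :: "'i ell2"
  by (rule power2_le_imp_le) (use sum_coef_le_norm[of "{i}" x] in auto)

lemma norm_ell2_leI:
  fixes x :: "'i ell2"
  assumes "\<And>A. finite A \<Longrightarrow> (\<Sum>i\<in>A. (cmod (coef x i))\<^sup>2) \<le> B\<^sup>2" "0 \<le> B"
  shows "norm x \<le> B"
proof -
  have "(norm x)\<^sup>2 \<le> B\<^sup>2"
    unfolding norm_ell2_square
    by (rule infsum_le_finite_sums[OF coef_square_summable]) (use assms in auto)
  then show ?thesis using assms(2) by (rule power2_le_imp_le)
qed

lemma square_summableI:
  assumes "\<And>A. finite A \<Longrightarrow> (\<Sum>i\<in>A. (cmod (a i))\<^sup>2) \<le> B"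
  shows "(\<lambda>i. (cmod (a i))\<^sup>2) summable_on UNIV"
  by (rule nonneg_bdd_above_summable_on) (use assms in \<open>auto intro!: bdd_aboveI2[of _ _ B]\<close>)

text \<open>Coordinates converge, and the Cauchy estimate restricted to a finite index set passes to
  the limit with a bound that does not depend on the set. Completeness of the type is what the fixed
  point theorem in \<open>coercive_surj\<close> asks for.\<close>

instance ell2 :: (type) complete_space
proof
  fix X :: "nat \<Rightarrow> 'a ell2"
  assume X: "Cauchy X"
  have "convergent (\<lambda>n. coef (X n) i)" for i
  proof (rule Cauchy_convergent, rule metric_CauchyI)
    fix e :: real assume "e > 0"
    then obtain M where M: "\<And>m n. m \<ge> M \<Longrightarrow> n \<ge> M \<Longrightarrow> dist (X m) (X n) < e"
      using metric_CauchyD[OF X] by metis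
    show "\<exists>M. \<forall>m\<ge>M. \<forall>n\<ge>M. dist (coef (X m) i) (coef (X n) i) < e"
    proof (intro exI allI impI)
      fix m n assume "m \<ge> M" "n \<ge> M"
      then have "cmod (coef (X m - X n) i) < e"
        using M[of m n] norm_coef_le[of "X m - X n" i] by (simp add: dist_norm)
      then show "dist (coef (X m) i) (coef (X n) i) < e" by (simp add: dist_norm)
    qed
  qed
  then obtain a where a: "\<And>i. (\<lambda>n. coef (X n) i) \<longlonglongrightarrow> a i"
    unfolding convergent_def by metis
  have close: "(\<Sum>i\<in>A. (cmod (coef (X m) i - a i))\<^sup>2) \<le> e\<^sup>2"
    if M: "\<And>m n. m \<ge> M \<Longrightarrow> n \<ge> M \<Longrightarrow> dist (X m) (X n) < e" and "m \<ge> M" "finite A" for e M m A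
  proof (rule LIMSEQ_le_const2)
    show "(\<lambda>n. \<Sum>i\<in>A. (cmod (coef (X m) i - coef (X n) i))\<^sup>2)
            \<longlonglongrightarrow> (\<Sum>i\<in>A. (cmod (coef (X m) i - a i))\<^sup>2)"
      by (intro tendsto_intros a)
    show "\<exists>N. \<forall>n\<ge>N. (\<Sum>i\<in>A. (cmod (coef (X m) i - coef (X n) i))\<^sup>2) \<le> e\<^sup>2"
    proof (intro exI[of _ M] allI impI)
      fix n assume "n \<ge> M"
      then have "norm (X m - X n) \<le> e" using M[of m n] \<open>m \<ge> M\<close> by (simp add: dist_norm)
      then have "(norm (X m - X n))\<^sup>2 \<le> e\<^sup>2" by (intro power_mono) auto
      then show "(\<Sum>i\<in>A. (cmod (coef (X m) i - coef (X n) i))\<^sup>2) \<le> e\<^sup>2"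
        using sum_coef_le_norm[OF \<open>finite A\<close>, of "X m - X n"] by simp
    qed
  qed
  obtain M1 where M1: "\<And>m n. m \<ge> M1 \<Longrightarrow> n \<ge> M1 \<Longrightarrow> dist (X m) (X n) < 1"
    using metric_CauchyD[OF X, of 1] by auto
  have "(\<lambda>i. (cmod (coef (X M1) i - a i))\<^sup>2) summable_on UNIV"
    by (rule square_summableI[where B = "1\<^sup>2"]) (rule close[OF M1], auto)
  from square_summable_add[OF this, of "\<lambda>i. - coef (X M1) i"]
  have "(\<lambda>i. (cmod (a i))\<^sup>2) summable_on UNIV"
    using coef_square_summable[of "X M1"] by (simp add: norm_minus_commute)
  then have ca: "coef (Abs_ell2 a) = a" by (simp add: Abs_ell2_inverse)
  have "X \<longlonglongrightarrow> Abs_ell2 a"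
  proof (rule metric_LIMSEQ_I)
    fix e :: real assume "e > 0"
    then obtain M where M: "\<And>m n. m \<ge> M \<Longrightarrow> n \<ge> M \<Longrightarrow> dist (X m) (X n) < e/2"
      using metric_CauchyD[OF X, of "e/2"] by auto
    have "dist (X m) (Abs_ell2 a) \<le> e/2" if "m \<ge> M" for m
      unfolding dist_norm
      by (rule norm_ell2_leI) (use close[OF M that] \<open>e > 0\<close> in \<open>auto simp: ca\<close>)
    then show "\<exists>no. \<forall>n\<ge>no. dist (X n) (Abs_ell2 a) < e"
      using \<open>e > 0\<close> by (metis field_sum_of_halves less_add_same_cancel1 half_gt_zero order_le_less_trans)
  qed
  then show "convergent X" by (auto simp: convergent_def)
qed

lift_definition truncate :: "'i set \<Rightarrow> 'i ell2 \<Rightarrow> 'i ell2" is "\<lambda>A a i. if i \<in> A then a i else 0"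
proof -
  fix A and a :: "'i \<Rightarrow> complex"
  assume "(\<lambda>i. (cmod (a i))\<^sup>2) summable_on UNIV"
  then show "(\<lambda>i. (cmod (if i \<in> A then a i else 0))\<^sup>2) summable_on UNIV"
    by (rule summable_on_real_comparison) auto
qed

text \<open>The squared error is the tail of a convergent series. This density carries inequalities
  known for finite supports to all of \<open>ell2\<close>.\<close>

lemma truncate_tendsto: "((\<lambda>A. truncate A x) \<longlongrightarrow> x) (finite_subsets_at_top UNIV)"
proof -
  have "((\<lambda>A. (norm x)\<^sup>2 - (\<Sum>i\<in>A. (cmod (coef x i))\<^sup>2)) \<longlongrightarrow> (norm x)\<^sup>2 - (norm x)\<^sup>2)
      (finite_subsets_at_top UNIV)"
    unfolding norm_ell2_square by (intro tendsto_diff tendsto_const infsum_tendsto coef_square_summable)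
  moreover have "(norm (truncate A x - x))\<^sup>2 = (norm x)\<^sup>2 - (\<Sum>i\<in>A. (cmod (coef x i))\<^sup>2)" if "finite A" for A
  proof -
    have 1: "(norm (truncate A x - x))\<^sup>2 = (\<Sum>\<^sub>\<infinity>i. (cmod (coef x i))\<^sup>2 - (if i \<in> A then (cmod (coef x i))\<^sup>2 else 0))"
      unfolding norm_ell2_square by (intro infsum_cong) (auto simp: truncate.rep_eq)
    have 2: "((\<lambda>i. if i \<in> A then (cmod (coef x i))\<^sup>2 else 0) has_sum (\<Sum>i\<in>A. (cmod (coef x i))\<^sup>2)) UNIV"
      by (rule has_sum_finite_neutralI[OF that]) auto
    have "((\<lambda>i. (cmod (coef x i))\<^sup>2 - (if i \<in> A then (cmod (coef x i))\<^sup>2 else 0)) has_sum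
        ((norm x)\<^sup>2 - (\<Sum>i\<in>A. (cmod (coef x i))\<^sup>2))) UNIV"
      unfolding norm_ell2_square
      using has_sum_add[OF has_sum_infsum[OF coef_square_summable] has_sum_uminusI[OF 2]] by simp
    then show ?thesis unfolding 1 by (rule infsumI)
  qed
  ultimately have "((\<lambda>A. (norm (truncate A x - x))\<^sup>2) \<longlongrightarrow> (norm x)\<^sup>2 - (norm x)\<^sup>2) (finite_subsets_at_top UNIV)"
    by (subst tendsto_cong[OF eventually_finite_subsets_at_top_weakI]) auto
  from tendsto_real_sqrt[OF this] show ?thesis
    by (simp add: tendsto_norm_zero_iff LIM_zero_iff)
qed

section \<open>Kernel operators\<close>

text \<open>The hypothesis of Schur's test, a common bound for absolute row and column sums. Finite
  partial sums are used so that a bound comes without a separate summability claim.\<close>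

definition schur :: "('i \<Rightarrow> 'i \<Rightarrow> complex) \<Rightarrow> real \<Rightarrow> bool" where
  "schur M S \<longleftrightarrow> (\<forall>k A. finite A \<longrightarrow> (\<Sum>j\<in>A. cmod (M k j)) \<le> S) \<and>
                (\<forall>j A. finite A \<longrightarrow> (\<Sum>k\<in>A. cmod (M k j)) \<le> S)"

lemma schur_nonneg: "schur M S \<Longrightarrow> 0 \<le> S"
  unfolding schur_def by (metis finite.emptyI sum.empty)

text \<open>After \<open>a b <= (a^2 + b^2) / 2\<close>, column sums absorb the squares of
  \<open>a\<close> and row sums those of \<open>b\<close>.\<close>

lemma schur_bilinear:
  assumes "schur M S" "finite A" "finite B"
  shows "(\<Sum>k\<in>A. \<Sum>j\<in>B. cmod (M k j) * (a j * b k)) \<le> S * ((\<Sum>j\<in>B. (a j)\<^sup>2) + (\<Sum>k\<in>A. (b k)\<^sup>2)) / 2"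
proof -
  have "(\<Sum>k\<in>A. \<Sum>j\<in>B. cmod (M k j) * (a j * b k))
      \<le> (\<Sum>k\<in>A. \<Sum>j\<in>B. cmod (M k j) * (((a j)\<^sup>2 + (b k)\<^sup>2) / 2))"
    by (intro sum_mono mult_left_mono mult_le_half_squares) auto
  also have "\<dots> = ((\<Sum>k\<in>A. \<Sum>j\<in>B. cmod (M k j) * (a j)\<^sup>2) + (\<Sum>k\<in>A. \<Sum>j\<in>B. cmod (M k j) * (b k)\<^sup>2)) / 2"
    by (simp add: sum_divide_distrib sum.distrib algebra_simps add_divide_distrib)
  also have "(\<Sum>k\<in>A. \<Sum>j\<in>B. cmod (M k j) * (a j)\<^sup>2) = (\<Sum>j\<in>B. (\<Sum>k\<in>A. cmod (M k j)) * (a j)\<^sup>2)"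
    by (subst sum.swap) (simp add: sum_distrib_right)
  also have "\<dots> \<le> (\<Sum>j\<in>B. S * (a j)\<^sup>2)"
    using assms by (intro sum_mono mult_right_mono) (auto simp: schur_def)
  also have "(\<Sum>k\<in>A. \<Sum>j\<in>B. cmod (M k j) * (b k)\<^sup>2) = (\<Sum>k\<in>A. (\<Sum>j\<in>B. cmod (M k j)) * (b k)\<^sup>2)"
    by (simp add: sum_distrib_right)
  also have "\<dots> \<le> (\<Sum>k\<in>A. S * (b k)\<^sup>2)"
    using assms by (intro sum_mono mult_right_mono) (auto simp: schur_def)
  finally show ?thesis by (simp add: sum_distrib_left algebra_simps)
qed

text \<open>Cauchy-Schwarz with \<open>|M| = sqrt |M| * sqrt |M|\<close>: the first factor is a row
  sum, and the second becomes column sums after summation over \<open>k\<close>.\<close>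

lemma schur_square:
  assumes "schur M S" "finite A" "finite B"
  shows "(\<Sum>k\<in>A. (\<Sum>j\<in>B. cmod (M k j) * a j)\<^sup>2) \<le> S\<^sup>2 * (\<Sum>j\<in>B. (a j)\<^sup>2)"
proof -
  have S: "0 \<le> S" by (rule schur_nonneg[OF assms(1)])
  have "(\<Sum>j\<in>B. cmod (M k j) * a j)\<^sup>2 \<le> S * (\<Sum>j\<in>B. cmod (M k j) * (a j)\<^sup>2)" for k
  proof -
    have "(\<Sum>j\<in>B. cmod (M k j) * a j)\<^sup>2 = (\<Sum>j\<in>B. sqrt (cmod (M k j)) * (sqrt (cmod (M k j)) * a j))\<^sup>2"
      by (simp add: mult.assoc[symmetric])
    also have "\<dots> \<le> (\<Sum>j\<in>B. (sqrt (cmod (M k j)))\<^sup>2) * (\<Sum>j\<in>B. (sqrt (cmod (M k j)) * a j)\<^sup>2)"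
      by (rule Cauchy_Schwarz_ineq_sum)
    also have "\<dots> = (\<Sum>j\<in>B. cmod (M k j)) * (\<Sum>j\<in>B. cmod (M k j) * (a j)\<^sup>2)"
      by (simp add: power_mult_distrib)
    also have "\<dots> \<le> S * (\<Sum>j\<in>B. cmod (M k j) * (a j)\<^sup>2)"
      using assms by (intro mult_right_mono) (auto simp: schur_def intro!: sum_nonneg)
    finally show ?thesis .
  qed
  then have "(\<Sum>k\<in>A. (\<Sum>j\<in>B. cmod (M k j) * a j)\<^sup>2) \<le> (\<Sum>k\<in>A. S * (\<Sum>j\<in>B. cmod (M k j) * (a j)\<^sup>2))"
    by (rule sum_mono)
  also have "\<dots> = S * (\<Sum>j\<in>B. (\<Sum>k\<in>A. cmod (M k j)) * (a j)\<^sup>2)"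
    by (simp add: sum_distrib_left[symmetric]) (subst sum.swap, simp add: sum_distrib_right)
  also have "\<dots> \<le> S * (\<Sum>j\<in>B. S * (a j)\<^sup>2)"
    using assms S by (intro mult_left_mono sum_mono mult_right_mono) (auto simp: schur_def)
  finally show ?thesis by (simp add: power2_eq_square sum_distrib_left mult.assoc)
qed

lemma schur_summable:
  assumes "schur M S" "(\<lambda>i. (cmod (a i))\<^sup>2) summable_on UNIV"
  shows "(\<lambda>j. cmod (M k j) * cmod (a j)) summable_on UNIV"
proof (rule nonneg_bdd_above_summable_on)
  define N where "N = (\<Sum>\<^sub>\<infinity>i. (cmod (a i))\<^sup>2)"
  show "bdd_above (sum (\<lambda>j. cmod (M k j) * cmod (a j)) ` {F. F \<subseteq> UNIV \<and> finite F})"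
  proof (rule bdd_aboveI2)
    fix F :: "'a set" assume "F \<in> {F. F \<subseteq> UNIV \<and> finite F}"
    then have F: "finite F" by simp
    have "(\<Sum>j\<in>F. cmod (M k j) * cmod (a j))\<^sup>2 \<le> S\<^sup>2 * (\<Sum>j\<in>F. (cmod (a j))\<^sup>2)"
      using schur_square[OF assms(1) _ F, of "{k}"] by simp
    also have "\<dots> \<le> S\<^sup>2 * N"
      unfolding N_def by (intro mult_left_mono finite_sum_le_infsum assms F) auto
    finally show "(\<Sum>j\<in>F. cmod (M k j) * cmod (a j)) \<le> sqrt (S\<^sup>2 * N)"
      by (rule real_le_rsqrt)
  qed
qed auto

text \<open>Acts on arbitrary families, not on the type \<open>ell2\<close>, so that one operator
  serves all weighted spaces at once; \<open>kop2\<close> is its version on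
  \<open>ell2\<close>.\<close>

definition kop :: "('i \<Rightarrow> 'i \<Rightarrow> complex) \<Rightarrow> ('i \<Rightarrow> complex) \<Rightarrow> 'i \<Rightarrow> complex" where
  "kop M a k = (\<Sum>\<^sub>\<infinity>j. M k j * a j)"

lemma schur_summable':
  assumes "schur M S" "(\<lambda>i. (cmod (a i))\<^sup>2) summable_on UNIV"
  shows "(\<lambda>j. M k j * a j) summable_on UNIV"
  by (rule Infinite_Sum.abs_summable_summable) (use schur_summable[OF assms, of k] in \<open>simp add: norm_mult\<close>)

text \<open>\<open>schur_square\<close> holds for every finite set \<open>B\<close> of columns; the
  limit over \<open>B\<close> is taken inside the finite sum over \<open>A\<close>.\<close>

lemma kop_bounded:
  assumes "schur M S" "(\<lambda>i. (cmod (a i))\<^sup>2) summable_on UNIV" "finite A"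
  shows "(\<Sum>k\<in>A. (cmod (kop M a k))\<^sup>2) \<le> S\<^sup>2 * (\<Sum>\<^sub>\<infinity>i. (cmod (a i))\<^sup>2)"
proof (rule tendsto_upperbound)
  show "((\<lambda>B. \<Sum>k\<in>A. (cmod (\<Sum>j\<in>B. M k j * a j))\<^sup>2) \<longlongrightarrow> (\<Sum>k\<in>A. (cmod (kop M a k))\<^sup>2))
      (finite_subsets_at_top UNIV)"
    unfolding kop_def by (intro tendsto_intros infsum_tendsto schur_summable'[OF assms(1,2)])
  show "\<forall>\<^sub>F B in finite_subsets_at_top UNIV. (\<Sum>k\<in>A. (cmod (\<Sum>j\<in>B. M k j * a j))\<^sup>2) \<le> S\<^sup>2 * (\<Sum>\<^sub>\<infinity>i. (cmod (a i))\<^sup>2)"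
  proof (rule eventually_finite_subsets_at_top_weakI)
    fix B :: "'a set" assume B: "finite B"
    have "(\<Sum>k\<in>A. (cmod (\<Sum>j\<in>B. M k j * a j))\<^sup>2) \<le> (\<Sum>k\<in>A. (\<Sum>j\<in>B. cmod (M k j) * cmod (a j))\<^sup>2)"
      by (intro sum_mono power_mono order.trans[OF norm_sum]) (auto simp: norm_mult)
    also have "\<dots> \<le> S\<^sup>2 * (\<Sum>j\<in>B. (cmod (a j))\<^sup>2)"
      by (rule schur_square[OF assms(1,3) B])
    also have "\<dots> \<le> S\<^sup>2 * (\<Sum>\<^sub>\<infinity>i. (cmod (a i))\<^sup>2)"
      by (intro mult_left_mono finite_sum_le_infsum assms B) auto
    finally show "(\<Sum>k\<in>A. (cmod (\<Sum>j\<in>B. M k j * a j))\<^sup>2) \<le> S\<^sup>2 * (\<Sum>\<^sub>\<infinity>i. (cmod (a i))\<^sup>2)" .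
  qed
qed simp

definition kop2 :: "('i \<Rightarrow> 'i \<Rightarrow> complex) \<Rightarrow> 'i ell2 \<Rightarrow> 'i ell2" where
  "kop2 M x = Abs_ell2 (kop M (coef x))"

lemma coef_kop2:
  assumes "schur M S"
  shows "coef (kop2 M x) = kop M (coef x)"
  unfolding kop2_def
  by (intro Abs_ell2_inverse CollectI square_summableI[OF kop_bounded[OF assms coef_square_summable]])

lemma norm_kop2_le:
  assumes "schur M S"
  shows "norm (kop2 M x) \<le> S * norm x"
proof (rule norm_ell2_leI)
  show "(\<Sum>i\<in>A. (cmod (coef (kop2 M x) i))\<^sup>2) \<le> (S * norm x)\<^sup>2" if "finite A" for A
    using kop_bounded[OF assms coef_square_summable[of x] that]
    unfolding coef_kop2[OF assms] power_mult_distrib norm_ell2_square .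
qed (use schur_nonneg[OF assms] in simp)

lemma kop_lin:
  assumes "schur M S" "(\<lambda>i. (cmod (a i))\<^sup>2) summable_on UNIV" "(\<lambda>i. (cmod (b i))\<^sup>2) summable_on UNIV"
  shows "kop M (\<lambda>i. c * a i + d * b i) k = c * kop M a k + d * kop M b k"
proof -
  have "kop M (\<lambda>i. c * a i + d * b i) k = (\<Sum>\<^sub>\<infinity>j. c * (M k j * a j) + d * (M k j * b j))"
    unfolding kop_def by (simp add: algebra_simps)
  also have "\<dots> = (\<Sum>\<^sub>\<infinity>j. c * (M k j * a j)) + (\<Sum>\<^sub>\<infinity>j. d * (M k j * b j))"
    by (intro infsum_add summable_on_cmult_right schur_summable'[OF assms(1)] assms(2,3))
  finally show ?thesis
    by (simp add: infsum_cmult_right' kop_def)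
qed

lemma bounded_linear_kop2:
  assumes "schur M S"
  shows "bounded_linear (kop2 M)"
proof (rule bounded_linear_intro[where K = S])
  fix x y :: "'a ell2" and r :: real
  show "kop2 M (x + y) = kop2 M x + kop2 M y"
    using kop_lin[OF assms coef_square_summable[of x] coef_square_summable[of y], of 1 1]
    by (intro ell2_eqI) (simp add: coef_kop2[OF assms])
  show "kop2 M (r *\<^sub>R x) = r *\<^sub>R kop2 M x"
    using kop_lin[OF assms coef_square_summable[of x] coef_square_summable[of x], of "of_real r" 0]
    by (intro ell2_eqI) (simp add: coef_kop2[OF assms])
  show "norm (kop2 M x) \<le> norm x * S"
    using norm_kop2_le[OF assms, of x] by (simp add: mult.commute)
qed

section \<open>Coercive quadratic forms and their invertibility\<close>

definition kform :: "('i \<Rightarrow> 'i \<Rightarrow> complex) \<Rightarrow> 'i set \<Rightarrow> ('i \<Rightarrow> complex) \<Rightarrow> real" where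
  "kform M A a = Re (\<Sum>k\<in>A. \<Sum>j\<in>A. M k j * a j * cnj (a k))"

text \<open>Tested on finitely supported families, where sums can be rearranged and split into rows
  freely; \<open>coercive_inner\<close> recovers the inequality on \<open>ell2\<close>.\<close>

definition coercive :: "('i \<Rightarrow> 'i \<Rightarrow> complex) \<Rightarrow> real \<Rightarrow> bool" where
  "coercive M c \<longleftrightarrow> (\<forall>A a. finite A \<longrightarrow> c * (\<Sum>k\<in>A. (cmod (a k))\<^sup>2) \<le> kform M A a)"

lemma kform_bound:
  assumes "schur M S" "finite A"
  shows "\<bar>kform M A a\<bar> \<le> S * (\<Sum>k\<in>A. (cmod (a k))\<^sup>2)"
proof -
  have "\<bar>kform M A a\<bar> \<le> cmod (\<Sum>k\<in>A. \<Sum>j\<in>A. M k j * a j * cnj (a k))"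
    unfolding kform_def by (rule abs_Re_le_cmod)
  also have "\<dots> \<le> (\<Sum>k\<in>A. \<Sum>j\<in>A. cmod (M k j * a j * cnj (a k)))"
    by (intro order.trans[OF norm_sum] sum_mono norm_sum)
  also have "\<dots> = (\<Sum>k\<in>A. \<Sum>j\<in>A. cmod (M k j) * (cmod (a j) * cmod (a k)))"
    by (simp add: norm_mult mult.assoc)
  also have "\<dots> \<le> S * (\<Sum>k\<in>A. (cmod (a k))\<^sup>2)"
    using schur_bilinear[OF assms(1,2,2), of "\<lambda>j. cmod (a j)" "\<lambda>j. cmod (a j)"] by simp
  finally show ?thesis .
qed

lemma kform_add: "kform (\<lambda>k j. M k j + N k j) A a = kform M A a + kform N A a"
  by (simp add: kform_def ring_distribs sum.distrib)

text \<open>By \<open>kform_bound\<close>, a difference with Schur bound \<open>d\<close> moves the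
  form by at most \<open>d\<close> times the squared norm. It serves twice: to discard the
  off-diagonal part of the bump kernel, and to pass to weighted norms.\<close>

lemma coercive_perturb:
  assumes "coercive M c" "schur (\<lambda>k j. M' k j - M k j) d"
  shows "coercive M' (c - d)"
  unfolding coercive_def
proof (intro allI impI)
  fix A :: "'a set" and a :: "'a \<Rightarrow> complex" assume A: "finite A"
  have "kform M' A a = kform M A a + kform (\<lambda>k j. M' k j - M k j) A a"
    by (simp add: kform_add[symmetric])
  moreover have "c * (\<Sum>k\<in>A. (cmod (a k))\<^sup>2) \<le> kform M A a"
    using assms(1) A by (simp add: coercive_def)
  ultimately show "(c - d) * (\<Sum>k\<in>A. (cmod (a k))\<^sup>2) \<le> kform M' A a"
    using kform_bound[OF assms(2) A, of a] by (simp add: left_diff_distrib)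
qed

text \<open>On a truncation the inner product is exactly \<open>kform\<close>; both sides are
  continuous and truncations converge.\<close>

lemma coercive_inner:
  assumes "coercive M c" "schur M S"
  shows "c * (norm x)\<^sup>2 \<le> kop2 M x \<bullet> x"
proof -
  let ?F = "finite_subsets_at_top UNIV"
  have "((\<lambda>A. kop2 M (truncate A x) \<bullet> truncate A x) \<longlongrightarrow> kop2 M x \<bullet> x) ?F"
    by (intro tendsto_intros bounded_linear.tendsto[OF bounded_linear_kop2[OF assms(2)]] truncate_tendsto)
  moreover have "((\<lambda>A. c * (norm (truncate A x))\<^sup>2) \<longlongrightarrow> c * (norm x)\<^sup>2) ?F"
    by (intro tendsto_intros truncate_tendsto)
  moreover have "c * (norm (truncate A x))\<^sup>2 \<le> kop2 M (truncate A x) \<bullet> truncate A x" if A: "finite A" for A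
  proof -
    have 1: "(norm (truncate A x))\<^sup>2 = (\<Sum>k\<in>A. (cmod (coef x k))\<^sup>2)"
      unfolding norm_ell2_square
      by (rule infsumI, rule has_sum_finite_neutralI[OF A]) (auto simp: truncate.rep_eq)
    have 2: "kop M (coef (truncate A x)) k = (\<Sum>j\<in>A. M k j * coef x j)" for k
      unfolding kop_def
      by (rule infsumI, rule has_sum_finite_neutralI[OF A]) (auto simp: truncate.rep_eq)
    have "kop2 M (truncate A x) \<bullet> truncate A x = (\<Sum>k\<in>A. Re ((\<Sum>j\<in>A. M k j * coef x j) * cnj (coef x k)))"
      unfolding inner_ell2_def coef_kop2[OF assms(2)] 2
      by (rule infsumI, rule has_sum_finite_neutralI[OF A]) (auto simp: truncate.rep_eq)
    also have "\<dots> = kform M A (coef x)"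
      by (simp add: kform_def sum_distrib_right)
    finally show ?thesis using assms(1) A unfolding 1 coercive_def by simp
  qed
  ultimately show ?thesis
    by (intro tendsto_le[of ?F]) (auto intro!: eventually_finite_subsets_at_top_weakI)
qed

text \<open>For small \<open>\<mu>\<close> the map \<open>x \<mapsto> \<mu> f + x - \<mu> M x\<close> is a contraction.\<close>

lemma coercive_surj:
  assumes "coercive M c" "schur M S" "c > 0"
  shows "\<exists>x. kop2 M x = f"
proof -
  interpret M: bounded_linear "kop2 M" by (rule bounded_linear_kop2[OF assms(2)])
  \<comment> \<open>Enlarging the bound by \<open>c\<close> gives \<open>0 < S'\<close> and
    \<open>c <= S'\<close> directly, so the radicand in \<open>q\<close> is nonnegative.\<close>
  define S' where "S' = S + c"
  have S': "S' > 0" "S' \<ge> c" "S \<le> S'"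
    using schur_nonneg[OF assms(2)] assms(3) by (auto simp: S'_def)
  \<comment> \<open>The minimiser of \<open>1 - 2 \<mu> c + \<mu>^2 S'^2\<close>, which bounds the
    squared contraction factor; the minimal value is the square of \<open>q\<close>.\<close>
  define \<mu> where "\<mu> = c / S'\<^sup>2"
  define q where "q = sqrt (1 - c\<^sup>2 / S'\<^sup>2)"
  have \<mu>: "\<mu> > 0" using assms(3) S' by (simp add: \<mu>_def)
  have contr: "norm (x - \<mu> *\<^sub>R kop2 M x) \<le> q * norm x" for x
  proof -
    have "(norm (x - \<mu> *\<^sub>R kop2 M x))\<^sup>2 = (norm x)\<^sup>2 - 2 * \<mu> * (kop2 M x \<bullet> x) + \<mu>\<^sup>2 * (norm (kop2 M x))\<^sup>2"
      unfolding power2_norm_eq_inner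
      by (simp add: inner_diff_left inner_diff_right inner_commute power2_eq_square algebra_simps)
    also have "\<dots> \<le> (norm x)\<^sup>2 - 2 * \<mu> * (c * (norm x)\<^sup>2) + \<mu>\<^sup>2 * (S' * norm x)\<^sup>2"
    proof -
      have "norm (kop2 M x) \<le> S' * norm x"
        using norm_kop2_le[OF assms(2), of x] S'(3) by (meson mult_right_mono norm_ge_zero order_trans)
      then have "(norm (kop2 M x))\<^sup>2 \<le> (S' * norm x)\<^sup>2" by (intro power_mono) auto
      then show ?thesis
        using mult_left_mono[OF coercive_inner[OF assms(1,2), of x], of "2 * \<mu>"] \<mu>
        by (intro add_mono diff_mono mult_left_mono) auto
    qed
    also have "\<dots> = (1 - c\<^sup>2 / S'\<^sup>2) * (norm x)\<^sup>2"
      using S' by (simp add: \<mu>_def power2_eq_square field_simps)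
    finally show ?thesis
      unfolding q_def by (metis norm_ge_zero real_le_rsqrt real_sqrt_mult real_sqrt_pow2 real_sqrt_power zero_le_power2 abs_norm_cancel real_sqrt_abs)
  qed
  have "\<exists>!x. \<mu> *\<^sub>R f + (x - \<mu> *\<^sub>R kop2 M x) = x"
  proof (rule banach_fix_type)
    have "c\<^sup>2 \<le> S'\<^sup>2" using S' assms(3) by (intro power_mono) auto
    then show "0 \<le> q" using S' by (simp add: q_def)
    show "q < 1" using S' assms(3) by (simp add: q_def)
    show "\<forall>x y. dist (\<mu> *\<^sub>R f + (x - \<mu> *\<^sub>R kop2 M x)) (\<mu> *\<^sub>R f + (y - \<mu> *\<^sub>R kop2 M y)) \<le> q * dist x y"
    proof (intro allI)
      fix x y
      have "\<mu> *\<^sub>R f + (x - \<mu> *\<^sub>R kop2 M x) - (\<mu> *\<^sub>R f + (y - \<mu> *\<^sub>R kop2 M y)) = (x - y) - \<mu> *\<^sub>R kop2 M (x - y)"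
        by (simp add: M.diff scaleR_diff_right)
      then show "dist (\<mu> *\<^sub>R f + (x - \<mu> *\<^sub>R kop2 M x)) (\<mu> *\<^sub>R f + (y - \<mu> *\<^sub>R kop2 M y)) \<le> q * dist x y"
        unfolding dist_norm using contr[of "x - y"] by (simp only:)
    qed
  qed
  then obtain x where "\<mu> *\<^sub>R f + (x - \<mu> *\<^sub>R kop2 M x) = x" by blast
  then have "\<mu> *\<^sub>R f = \<mu> *\<^sub>R kop2 M x" by (simp add: algebra_simps)
  then show ?thesis using \<mu> by auto
qed

lemma coercive_norm_le:
  assumes "coercive M c" "schur M S" "c > 0"
  shows "norm x \<le> norm (kop2 M x) / c"
proof (cases "x = 0")
  case False
  have "c * (norm x)\<^sup>2 \<le> norm (kop2 M x) * norm x"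
    using coercive_inner[OF assms(1,2), of x] norm_cauchy_schwarz[of "kop2 M x" x] by linarith
  then show ?thesis using False assms(3) by (simp add: power2_eq_square field_simps)
qed (use assms in simp)

section \<open>Weighted sequence spaces\<close>

definition wsq :: "('i \<Rightarrow> real) \<Rightarrow> ('i \<Rightarrow> complex) \<Rightarrow> bool" where
  "wsq W a \<longleftrightarrow> (\<lambda>k. (W k * cmod (a k))\<^sup>2) summable_on UNIV"

definition wnorm :: "('i \<Rightarrow> real) \<Rightarrow> ('i \<Rightarrow> complex) \<Rightarrow> real" where
  "wnorm W a = sqrt (\<Sum>\<^sub>\<infinity>k. (W k * cmod (a k))\<^sup>2)"

definition emb :: "('i \<Rightarrow> real) \<Rightarrow> ('i \<Rightarrow> complex) \<Rightarrow> 'i ell2" where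
  "emb W a = Abs_ell2 (\<lambda>k. of_real (W k) * a k)"

lemma wnorm_nonneg [simp]: "0 \<le> wnorm W a"
  by (simp add: wnorm_def infsum_nonneg)

lemma wsq_iff_ell2: "wsq W a \<longleftrightarrow> (\<lambda>k. (cmod (of_real (W k) * a k))\<^sup>2) summable_on UNIV"
  by (simp add: wsq_def norm_mult power_mult_distrib)

lemma coef_emb: "wsq W a \<Longrightarrow> coef (emb W a) k = of_real (W k) * a k"
  by (simp add: emb_def wsq_iff_ell2 Abs_ell2_inverse)

lemma norm_emb:
  assumes "wsq W a"
  shows "norm (emb W a) = wnorm W a"
proof -
  have "(norm (emb W a))\<^sup>2 = (\<Sum>\<^sub>\<infinity>k. (W k * cmod (a k))\<^sup>2)"
    unfolding norm_ell2_square coef_emb[OF assms] by (simp add: norm_mult power_mult_distrib)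
  then show ?thesis unfolding wnorm_def by (metis norm_ge_zero real_sqrt_unique)
qed

lemma sum_le_wnorm:
  assumes "wsq W a" "finite A"
  shows "(\<Sum>k\<in>A. (W k * cmod (a k))\<^sup>2) \<le> (wnorm W a)\<^sup>2"
  unfolding wnorm_def
  by (subst real_sqrt_pow2) (use assms in \<open>auto intro!: infsum_nonneg finite_sum_le_infsum simp: wsq_def\<close>)

lemma coef_le_wnorm:
  assumes "wsq W a" "0 \<le> W k"
  shows "W k * cmod (a k) \<le> wnorm W a"
  by (rule power2_le_imp_le) (use sum_le_wnorm[OF assms(1), of "{k}"] in auto)

lemma wsqI:
  assumes "\<And>A. finite A \<Longrightarrow> (\<Sum>k\<in>A. (W k * cmod (a k))\<^sup>2) \<le> B\<^sup>2" "0 \<le> B"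
  shows "wsq W a" "wnorm W a \<le> B"
proof -
  show *: "wsq W a"
    unfolding wsq_def
    by (rule nonneg_bdd_above_summable_on) (use assms in \<open>auto intro!: bdd_aboveI2[of _ _ "B\<^sup>2"]\<close>)
  have "(\<Sum>\<^sub>\<infinity>k. (W k * cmod (a k))\<^sup>2) \<le> B\<^sup>2"
    by (rule infsum_le_finite_sums) (use * assms in \<open>auto simp: wsq_def\<close>)
  then show "wnorm W a \<le> B"
    unfolding wnorm_def using assms(2) by (simp add: real_le_lsqrt)
qed

lemma wsq_lin:
  assumes "wsq W a" "wsq W b"
  shows "wsq W (\<lambda>k. c * a k + d * b k)"
proof -
  have *: "(\<lambda>k. (cmod (e * (of_real (W k) * a k)))\<^sup>2) summable_on UNIV" if "wsq W a" for e a
    using that by (simp add: wsq_def norm_mult power_mult_distrib summable_on_cmult_right)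
  show ?thesis
    using square_summable_add[OF *[OF assms(1), of c] *[OF assms(2), of d]]
    by (simp add: wsq_iff_ell2 algebra_simps)
qed

lemma wnorm_triangle:
  assumes "wsq W a" "wsq W b"
  shows "wnorm W (\<lambda>k. a k + b k) \<le> wnorm W a + wnorm W b"
proof -
  have s: "wsq W (\<lambda>k. a k + b k)" using wsq_lin[OF assms, of 1 1] by simp
  have "emb W (\<lambda>k. a k + b k) = emb W a + emb W b"
    by (rule ell2_eqI) (simp add: coef_emb assms s algebra_simps)
  then show ?thesis
    using norm_triangle_ineq[of "emb W a" "emb W b"] by (metis norm_emb assms s)
qed

lemma wnorm_cmult: "wnorm W (\<lambda>k. c * a k) = cmod c * wnorm W a"
proof -
  have "(\<Sum>\<^sub>\<infinity>k. (W k * cmod (c * a k))\<^sup>2) = (\<Sum>\<^sub>\<infinity>k. (cmod c)\<^sup>2 * (W k * cmod (a k))\<^sup>2)"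
    by (rule infsum_cong) (simp add: norm_mult power_mult_distrib algebra_simps)
  then show ?thesis
    by (simp add: wnorm_def infsum_cmult_right' real_sqrt_mult)
qed

lemma wnorm_mono:
  assumes "wsq W' a" "\<And>k. 0 \<le> W k" "\<And>k. W k * cmod (b k) \<le> D * (W' k * cmod (a k))" "0 \<le> D"
  shows "wsq W b" "wnorm W b \<le> D * wnorm W' a"
proof -
  have *: "(\<Sum>k\<in>A. (W k * cmod (b k))\<^sup>2) \<le> (D * wnorm W' a)\<^sup>2" if A: "finite A" for A
  proof -
    have "(\<Sum>k\<in>A. (W k * cmod (b k))\<^sup>2) \<le> (\<Sum>k\<in>A. (D * (W' k * cmod (a k)))\<^sup>2)"
      by (intro sum_mono power_mono assms mult_nonneg_nonneg) auto
    also have "\<dots> = D\<^sup>2 * (\<Sum>k\<in>A. (W' k * cmod (a k))\<^sup>2)"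
      by (simp add: power_mult_distrib sum_distrib_left)
    also have "\<dots> \<le> D\<^sup>2 * (wnorm W' a)\<^sup>2"
      by (intro mult_left_mono sum_le_wnorm assms A) auto
    finally show ?thesis by (simp add: power_mult_distrib)
  qed
  show "wsq W b" "wnorm W b \<le> D * wnorm W' a"
    using wsqI[of W b "D * wnorm W' a"] * assms(4) by auto
qed

text \<open>The matrix of \<open>W M W^-1\<close>. Multiplication by \<open>W\<close>, which is
  \<open>emb\<close>, is an isometry onto \<open>ell2\<close>, so \<open>M\<close> acts on the
  weighted space as \<open>conjk W M\<close> acts on \<open>ell2\<close>.\<close>

definition conjk :: "('i \<Rightarrow> real) \<Rightarrow> ('i \<Rightarrow> 'i \<Rightarrow> complex) \<Rightarrow> 'i \<Rightarrow> 'i \<Rightarrow> complex" where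
  "conjk W M k j = M k j * of_real (W k / W j)"

lemma conjk_emb:
  assumes "\<And>k. 0 < W k" "wsq W a"
  shows "conjk W M k j * coef (emb W a) j = of_real (W k) * (M k j * a j)"
  using assms(1)[of j] by (simp add: conjk_def coef_emb[OF assms(2)] of_real_divide)

lemma kop_conjk:
  assumes "\<And>k. 0 < W k" "wsq W a"
  shows "kop (conjk W M) (coef (emb W a)) k = of_real (W k) * kop M a k"
  unfolding kop_def conjk_emb[OF assms] by (rule infsum_cmult_right')

lemma kop_weighted_summable:
  assumes W: "\<And>k. 0 < W k" and S: "schur (conjk W M) S" and a: "wsq W a"
  shows "(\<lambda>j. cmod (M k j * a j)) summable_on UNIV"
proof -
  have "(\<lambda>j. cmod (of_real (W k) * (M k j * a j)) * inverse (W k)) summable_on UNIV"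
    using schur_summable[OF S coef_square_summable, of k "emb W a"]
    unfolding norm_mult[symmetric] conjk_emb[OF W a] by (rule summable_on_cmult_left)
  moreover have "cmod (of_real (W k) * (M k j * a j)) * inverse (W k) = cmod (M k j * a j)" for j
    using W[of k] by (simp add: norm_mult)
  ultimately show ?thesis by simp
qed

lemma kop_weighted:
  assumes W: "\<And>k. 0 < W k" and S: "schur (conjk W M) S" and a: "wsq W a"
  shows "wsq W (kop M a)" "wnorm W (kop M a) \<le> S * wnorm W a"
proof -
  have *: "(\<Sum>k\<in>A. (W k * cmod (kop M a k))\<^sup>2) \<le> (S * wnorm W a)\<^sup>2" if A: "finite A" for A
    using sum_coef_le_norm[OF A, of "kop2 (conjk W M) (emb W a)"]
      power_mono[OF norm_kop2_le[OF S, of "emb W a"], of 2]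
    by (simp add: coef_kop2[OF S] kop_conjk[OF W a] norm_emb[OF a] norm_mult power_mult_distrib)
  show "wsq W (kop M a)" "wnorm W (kop M a) \<le> S * wnorm W a"
    using wsqI[of W "kop M a" "S * wnorm W a"] * schur_nonneg[OF S] by auto
qed

lemma kop_weighted_lin:
  assumes W: "\<And>k. 0 < W k" and S: "schur (conjk W M) S" and a: "wsq W a" and b: "wsq W b"
  shows "kop M (\<lambda>k. c * a k + d * b k) = (\<lambda>k. c * kop M a k + d * kop M b k)"
proof
  fix k
  note s = Infinite_Sum.abs_summable_summable[OF kop_weighted_summable[OF W S]]
  have "kop M (\<lambda>k. c * a k + d * b k) k = (\<Sum>\<^sub>\<infinity>j. c * (M k j * a j) + d * (M k j * b j))"
    unfolding kop_def by (simp add: algebra_simps)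
  also have "\<dots> = (\<Sum>\<^sub>\<infinity>j. c * (M k j * a j)) + (\<Sum>\<^sub>\<infinity>j. d * (M k j * b j))"
    by (intro infsum_add summable_on_cmult_right s a b)
  finally show "kop M (\<lambda>k. c * a k + d * b k) k = c * kop M a k + d * kop M b k"
    by (simp add: infsum_cmult_right' kop_def)
qed

text \<open>The equation is solved in \<open>ell2\<close> for the conjugated kernel, and the
  solution is divided by the weight.\<close>

lemma kop_weighted_inverse:
  assumes W: "\<And>k. 0 < W k" and S: "schur (conjk W M) S" and c: "coercive (conjk W M) c" "c > 0"
  shows "wsq W f \<Longrightarrow> \<exists>a. wsq W a \<and> kop M a = f"
    and "wsq W a \<Longrightarrow> wnorm W a \<le> wnorm W (kop M a) / c"
proof -
  assume f: "wsq W f"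
  obtain x where x: "kop2 (conjk W M) x = emb W f"
    using coercive_surj[OF c(1) S c(2)] by blast
  define a where "a k = coef x k / of_real (W k)" for k
  have xa: "of_real (W k) * a k = coef x k" for k
    using W[of k] by (simp add: a_def)
  have a: "wsq W a"
    unfolding wsq_iff_ell2 xa by (rule coef_square_summable)
  have ex: "emb W a = x" by (rule ell2_eqI) (simp add: coef_emb[OF a] xa)
  have "kop M a k = f k" for k
  proof -
    have "of_real (W k) * kop M a k = coef (emb W f) k"
      unfolding kop_conjk[OF W a, symmetric] ex x[symmetric] coef_kop2[OF S] ..
    then show ?thesis using W[of k] by (simp add: coef_emb[OF f])
  qed
  then show "\<exists>a. wsq W a \<and> kop M a = f" using a by blast
next
  assume a: "wsq W a"
  have "kop2 (conjk W M) (emb W a) = emb W (kop M a)"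
    by (rule ell2_eqI)
      (simp add: coef_kop2[OF S] kop_conjk[OF W a] coef_emb[OF kop_weighted(1)[OF W S a]])
  then show "wnorm W a \<le> wnorm W (kop M a) / c"
    using coercive_norm_le[OF c(1) S c(2), of "emb W a"]
    by (simp add: norm_emb[OF a] norm_emb[OF kop_weighted(1)[OF W S a]])
qed

section \<open>Kernels with rapid off-diagonal decay\<close>

abbreviation jb :: "int \<times> int \<Rightarrow> real" where "jb k \<equiv> 1 + freq_norm k"

lemma freq_norm_eq_norm: "freq_norm k = norm (real_of_int (fst k), real_of_int (snd k))"
  by (simp add: freq_norm_def norm_Pair)

lemma freq_norm_nonneg [simp]: "0 \<le> freq_norm k"
  by (simp add: freq_norm_def)

lemma freq_norm_triangle: "freq_norm (k + j) \<le> freq_norm k + freq_norm j"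
  unfolding freq_norm_eq_norm
  by (rule order.trans[OF _ norm_triangle_ineq]) simp

lemma freq_norm_uminus [simp]: "freq_norm (- k) = freq_norm k"
  by (simp add: freq_norm_def)

lemma freq_norm_minus_commute: "freq_norm (k - j) = freq_norm (j - k)"
  using freq_norm_uminus[of "k - j"] by simp

lemma freq_norm_diff: "\<bar>freq_norm k - freq_norm j\<bar> \<le> freq_norm (k - j)"
  using freq_norm_triangle[of "k - j" j] freq_norm_triangle[of "j - k" k]
  by (simp add: freq_norm_minus_commute[of k j])

lemma abs_le_freq_norm: "\<bar>real_of_int (fst k)\<bar> \<le> freq_norm k" "\<bar>real_of_int (snd k)\<bar> \<le> freq_norm k"
  by (auto simp: freq_norm_def real_le_rsqrt)

lemma freq_norm_le: "freq_norm k \<le> \<bar>real_of_int (fst k)\<bar> + \<bar>real_of_int (snd k)\<bar>"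
  unfolding freq_norm_eq_norm using norm_Pair_le[of "real_of_int (fst k)" "real_of_int (snd k)"] by simp

lemma summable_on_int_square: "(\<lambda>n::int. 1 / (1 + \<bar>real_of_int n\<bar>)\<^sup>2) summable_on UNIV"
proof -
  have s: "summable (\<lambda>n. 1 / (1 + real n)\<^sup>2)"
    using summable_Suc_iff[of "\<lambda>n. inverse (real n ^ 2)"] inverse_power_summable[of 2, where 'a = real]
    by (simp add: field_simps)
  have n: "(\<lambda>n. 1 / (1 + real n)\<^sup>2) summable_on UNIV"
    using s by (intro summable_nonneg_imp_summable_on) auto
  have 1: "(\<lambda>n::int. 1 / (1 + \<bar>real_of_int n\<bar>)\<^sup>2) summable_on range int"
    by (subst summable_on_reindex) (use n in \<open>auto simp: o_def\<close>)
  have 2: "(\<lambda>n::int. 1 / (1 + \<bar>real_of_int n\<bar>)\<^sup>2) summable_on range (\<lambda>n. - int n)"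
    by (subst summable_on_reindex) (use n in \<open>auto simp: o_def inj_def\<close>)
  have "n \<in> range int \<union> range (\<lambda>n. - int n)" for n :: int
    by (cases "n \<ge> 0") (auto intro: range_eqI[of _ _ "nat n"] range_eqI[of _ _ "nat (- n)"])
  then have "(UNIV :: int set) = range int \<union> range (\<lambda>n. - int n)" by auto
  then show ?thesis using summable_on_union[OF 1 2] by simp
qed

text \<open>The exponent 4 comes from \<open>(1 + |m|)^2 (1 + |n|)^2 <= jb (m, n) ^ 4\<close>, which
  leaves a product of two convergent one-dimensional series.\<close>

lemma summable_on_jb4: "(\<lambda>k. 1 / jb k ^ 4) summable_on UNIV"
proof -
  define h where "h n = 1 / (1 + \<bar>real_of_int n\<bar>)\<^sup>2" for n
  have "(\<lambda>(m, n). h m * h n) summable_on (UNIV \<times> UNIV)"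
  proof (rule summable_on_SigmaI[where g = "\<lambda>m. h m * infsum h UNIV"])
    have h: "h summable_on UNIV" using summable_on_int_square by (simp add: h_def[abs_def])
    show "((\<lambda>n. case (m, n) of (m, n) \<Rightarrow> h m * h n) has_sum h m * infsum h UNIV) UNIV" for m
      using h by (simp add: has_sum_cmult_right)
    show "(\<lambda>m. h m * infsum h UNIV) summable_on UNIV"
      by (rule summable_on_cmult_left[OF h])
  qed (simp add: h_def)
  then have s: "(\<lambda>(m, n). h m * h n) summable_on UNIV" by simp
  show ?thesis
  proof (rule summable_on_real_comparison[OF s])
    fix k :: "int \<times> int"
    obtain m n where k: "k = (m, n)" by force
    have "(1 + \<bar>real_of_int m\<bar>)\<^sup>2 * (1 + \<bar>real_of_int n\<bar>)\<^sup>2 \<le> (jb k)\<^sup>2 * (jb k)\<^sup>2"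
      using abs_le_freq_norm[of k] by (intro mult_mono power_mono) (auto simp: k)
    then show "\<bar>1 / jb k ^ 4\<bar> \<le> (case k of (m, n) \<Rightarrow> h m * h n)"
      by (simp add: k h_def frac_le power_add[symmetric])
  qed
qed

definition jb_sum :: real where "jb_sum = (\<Sum>\<^sub>\<infinity>k. 1 / jb k ^ 4)"

lemma sum_jb4_le: "finite A \<Longrightarrow> inj_on f A \<Longrightarrow> (\<Sum>j\<in>A. 1 / jb (f j) ^ 4) \<le> jb_sum"
  using finite_sum_le_infsum[OF summable_on_jb4, of "f ` A"]
  by (simp add: sum.reindex jb_sum_def o_def)

text \<open>Both \<open>j |-> k - j\<close> and \<open>j |-> j - k\<close> are injective, so each
  row sum and each column sum is bounded by the one lattice sum \<open>jb_sum\<close>.\<close>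

lemma schurI:
  assumes "\<And>k j. cmod (M k j) * jb (k - j) ^ 4 \<le> C"
  shows "schur M (C * jb_sum)"
proof -
  have C: "0 \<le> C" using assms[of 0 0] by (rule order.trans[rotated]) simp
  have *: "cmod (M k j) \<le> C * (1 / jb (k - j) ^ 4)" for k j
  proof -
    have "0 < jb (k - j) ^ 4" by (intro zero_less_power add_pos_nonneg) auto
    then show ?thesis using assms[of k j] by (simp add: pos_le_divide_eq)
  qed
  show ?thesis
    unfolding schur_def
  proof (intro conjI allI impI)
    fix k and A :: "(int \<times> int) set" assume A: "finite A"
    have "(\<Sum>j\<in>A. cmod (M k j)) \<le> C * (\<Sum>j\<in>A. 1 / jb (k - j) ^ 4)"
      unfolding sum_distrib_left by (rule sum_mono) (rule *)
    also have "\<dots> \<le> C * jb_sum"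
      by (intro mult_left_mono sum_jb4_le A C) (auto simp: inj_on_def)
    finally show "(\<Sum>j\<in>A. cmod (M k j)) \<le> C * jb_sum" .
    have "(\<Sum>j\<in>A. cmod (M j k)) \<le> C * (\<Sum>j\<in>A. 1 / jb (j - k) ^ 4)"
      unfolding sum_distrib_left by (rule sum_mono) (rule *)
    also have "\<dots> \<le> C * jb_sum"
      by (intro mult_left_mono sum_jb4_le A C) (auto simp: inj_on_def)
    finally show "(\<Sum>j\<in>A. cmod (M j k)) \<le> C * jb_sum" .
  qed
qed

text \<open>Decay is required in \<open>k - j\<close> only, which is the behaviour of multiplication
  by a smooth function. Such kernels are bounded on Sobolev spaces of every real order, including
  the possibly negative order \<open>s - r\<close> in which the equation holds.\<close>

definition rapid :: "(int \<times> int \<Rightarrow> int \<times> int \<Rightarrow> complex) \<Rightarrow> bool" where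
  "rapid M \<longleftrightarrow> (\<forall>N::nat. \<exists>C. \<forall>k j. cmod (M k j) * jb (k - j) ^ N \<le> C)"

text \<open>\<open>R = 1\<close> is the Sobolev weight itself. A larger \<open>R\<close> gives the
  same space with an equivalent norm, but a weight that varies more slowly between neighbouring
  frequencies.\<close>

definition wgt :: "real \<Rightarrow> real \<Rightarrow> int \<times> int \<Rightarrow> real" where
  "wgt R \<sigma> k = (R + freq_norm k) powr \<sigma>"

lemma wgt_pos: "R \<ge> 1 \<Longrightarrow> 0 < wgt R \<sigma> k"
  using add_pos_nonneg[of R "freq_norm k"] by (simp add: wgt_def)

lemma exp_minus_one_le: "\<bar>exp x - 1\<bar> \<le> \<bar>x\<bar> * exp \<bar>x\<bar>" for x :: real
proof (cases "x \<ge> 0")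
  case True
  have "1 - x \<le> exp (- x)" using exp_ge_add_one_self[of "- x"] by simp
  then have "(1 - x) * exp x \<le> exp (- x) * exp x" by (rule mult_right_mono) simp
  then show ?thesis using True by (simp add: algebra_simps exp_minus_inverse mult.commute)
next
  case False
  have "1 - exp x \<le> - x" using exp_ge_add_one_self[of x] by linarith
  also have "\<dots> \<le> - x * exp (- x)" using False by simp
  finally show ?thesis using False by simp
qed

text \<open>With \<open>a\<close>, \<open>b\<close> the two shifted norms, the ratio is
  \<open>exp (\<sigma> (ln a - ln b))\<close>, and the logarithms differ by at most
  \<open>n / R\<close> and by at most \<open>ln (1 + n)\<close>. The second bound gives polynomial
  growth; the first, with \<open>exp_minus_one_le\<close>, gives the factor
  \<open>1 / R\<close>.\<close>

lemma wgt_ratio: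
  fixes k j :: "int \<times> int"
  assumes "R \<ge> 1"
  defines "n \<equiv> freq_norm (k - j)"
  shows "wgt R \<sigma> k / wgt R \<sigma> j \<le> (1 + n) powr \<bar>\<sigma>\<bar>"
    and "\<bar>wgt R \<sigma> k / wgt R \<sigma> j - 1\<bar> \<le> \<bar>\<sigma>\<bar> * n / R * (1 + n) powr \<bar>\<sigma>\<bar>"
proof -
  define a b where "a = R + freq_norm k" and "b = R + freq_norm j"
  have ab: "a \<ge> R" "b \<ge> R" "\<bar>a - b\<bar> \<le> n" "n \<ge> 0"
    using freq_norm_diff[of k j] by (auto simp: a_def b_def n_def)
  have l0: "ln x - ln y \<le> n / R \<and> ln x - ln y \<le> ln (1 + n)" if "x \<ge> R" "y \<ge> R" "\<bar>x - y\<bar> \<le> n" for x y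
  proof -
    have pos: "x > 0" "y > 0" using that assms by auto
    have "ln x - ln y = ln (x / y)" using pos by (simp add: ln_div)
    moreover have "ln (x / y) \<le> x / y - 1" by (rule ln_le_minus_one) (use pos in auto)
    moreover have "x / y - 1 \<le> n / R"
    proof -
      have "x / y - 1 = (x - y) / y" using pos by (simp add: field_simps)
      also have "\<dots> \<le> n / y" using that pos by (intro divide_right_mono) auto
      also have "\<dots> \<le> n / R" using that assms ab by (intro divide_left_mono mult_pos_pos) auto
      finally show ?thesis .
    qed
    moreover have "ln (x / y) \<le> ln (1 + n)"
    proof (subst ln_le_cancel_iff)
      have "x \<le> y + n * 1" using that by auto
      also have "\<dots> \<le> y + n * y" using ab that assms by (intro add_mono mult_left_mono) auto
      finally show "x / y \<le> 1 + n" using pos by (simp add: field_simps)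
    qed (use pos ab in auto)
    ultimately show ?thesis by simp
  qed
  have l: "\<bar>ln a - ln b\<bar> \<le> n / R" "\<bar>ln a - ln b\<bar> \<le> ln (1 + n)"
    using l0[of a b] l0[of b a] ab by (auto simp: abs_minus_commute)
  have pos: "a > 0" "b > 0" using ab assms by auto
  have r: "wgt R \<sigma> k / wgt R \<sigma> j = exp (\<sigma> * (ln a - ln b))"
    using pos by (simp add: wgt_def a_def[symmetric] b_def[symmetric] powr_def exp_diff algebra_simps)
  have e: "exp \<bar>\<sigma> * (ln a - ln b)\<bar> \<le> (1 + n) powr \<bar>\<sigma>\<bar>"
    using l(2) ab by (auto simp: powr_def abs_mult intro!: mult_left_mono)
  show "wgt R \<sigma> k / wgt R \<sigma> j \<le> (1 + n) powr \<bar>\<sigma>\<bar>"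
    unfolding r by (rule order.trans[OF _ e]) simp
  have "\<bar>wgt R \<sigma> k / wgt R \<sigma> j - 1\<bar> \<le> \<bar>\<sigma> * (ln a - ln b)\<bar> * exp \<bar>\<sigma> * (ln a - ln b)\<bar>"
    unfolding r by (rule exp_minus_one_le)
  also have "\<dots> \<le> (\<bar>\<sigma>\<bar> * (n / R)) * (1 + n) powr \<bar>\<sigma>\<bar>"
  proof (rule mult_mono)
    show "\<bar>\<sigma> * (ln a - ln b)\<bar> \<le> \<bar>\<sigma>\<bar> * (n / R)"
      unfolding abs_mult by (rule mult_left_mono[OF l(1)]) simp
  qed (use e ab assms in auto)
  finally show "\<bar>wgt R \<sigma> k / wgt R \<sigma> j - 1\<bar> \<le> \<bar>\<sigma>\<bar> * n / R * (1 + n) powr \<bar>\<sigma>\<bar>" by simp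
qed

lemma powr_le_jb_power: "jb k powr \<bar>\<sigma>\<bar> \<le> jb k ^ nat \<lceil>\<bar>\<sigma>\<bar>\<rceil>"
proof -
  have "jb k powr \<bar>\<sigma>\<bar> \<le> jb k powr real (nat \<lceil>\<bar>\<sigma>\<bar>\<rceil>)"
    by (rule powr_mono) (auto simp: real_nat_ceiling_ge)
  also have "\<dots> = jb k ^ nat \<lceil>\<bar>\<sigma>\<bar>\<rceil>"
    by (rule powr_realpow) (simp add: add_pos_nonneg)
  finally show ?thesis .
qed

text \<open>One constant \<open>S\<close> serves every \<open>R\<close>, so conjugation by the
  weight is a perturbation that can be made as small as desired.\<close>

lemma rapid_schur:
  assumes "rapid M"
  obtains S where "\<And>R. R \<ge> 1 \<Longrightarrow> schur (conjk (wgt R \<sigma>) M) S"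
    "\<And>R. R \<ge> 1 \<Longrightarrow> schur (\<lambda>k j. conjk (wgt R \<sigma>) M k j - M k j) (S / R)"
proof -
  define N where "N = nat \<lceil>\<bar>\<sigma>\<bar>\<rceil>"
  \<comment> \<open>\<open>N\<close> powers absorb the weight ratio, one absorbs the factor
    \<open>freq_norm (k - j)\<close> of the difference, and four are left for
    \<open>schurI\<close>.\<close>
  obtain C where C: "\<And>k j. cmod (M k j) * jb (k - j) ^ (N + 5) \<le> C"
    using assms unfolding rapid_def by blast
  have C0: "0 \<le> C" using C[of 0 0] by (rule order.trans[rotated]) simp
  define C' where "C' = (1 + \<bar>\<sigma>\<bar>) * C"
  have C'0: "C' \<ge> C" using C0 mult_nonneg_nonneg[of "\<bar>\<sigma>\<bar>" C] by (simp add: C'_def algebra_simps)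
  have 1: "schur (conjk (wgt R \<sigma>) M) (C' * jb_sum)" if R: "R \<ge> 1" for R
  proof (rule schurI)
    fix k j
    have j1: "jb (k - j) \<ge> 1" by simp
    have "cmod (conjk (wgt R \<sigma>) M k j) = cmod (M k j) * (wgt R \<sigma> k / wgt R \<sigma> j)"
      using wgt_pos[OF R, of \<sigma>] by (simp add: conjk_def norm_mult norm_divide del: of_real_divide less_imp_le)
        (simp add: less_imp_le abs_of_pos)
    also have "\<dots> \<le> cmod (M k j) * jb (k - j) ^ N"
      using wgt_ratio(1)[OF R, of \<sigma> k j] powr_le_jb_power[of "k - j" \<sigma>]
      unfolding N_def by (intro mult_left_mono) auto
    finally have "cmod (conjk (wgt R \<sigma>) M k j) * jb (k - j) ^ 4 \<le> cmod (M k j) * jb (k - j) ^ N * jb (k - j) ^ 5"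
      using power_increasing[OF _ j1, of 4 5] by (intro mult_mono) auto
    also have "\<dots> \<le> C" using C[of k j] by (simp add: power_add mult.assoc)
    finally show "cmod (conjk (wgt R \<sigma>) M k j) * jb (k - j) ^ 4 \<le> C'" using C'0 by simp
  qed
  have 2: "schur (\<lambda>k j. conjk (wgt R \<sigma>) M k j - M k j) (C' * jb_sum / R)" if R: "R \<ge> 1" for R
  proof -
    have "schur (\<lambda>k j. conjk (wgt R \<sigma>) M k j - M k j) (C' / R * jb_sum)"
    proof (rule schurI)
      fix k j
      let ?n = "freq_norm (k - j)"
      have "conjk (wgt R \<sigma>) M k j - M k j = M k j * of_real (wgt R \<sigma> k / wgt R \<sigma> j - 1)"
        by (simp add: conjk_def algebra_simps)
      then have "cmod (conjk (wgt R \<sigma>) M k j - M k j) = cmod (M k j) * \<bar>wgt R \<sigma> k / wgt R \<sigma> j - 1\<bar>"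
        by (simp only: norm_mult norm_of_real)
      also have "\<dots> \<le> cmod (M k j) * (\<bar>\<sigma>\<bar> * ?n / R * jb (k - j) powr \<bar>\<sigma>\<bar>)"
        by (intro mult_left_mono wgt_ratio(2)[OF R]) auto
      also have "\<dots> \<le> cmod (M k j) * (\<bar>\<sigma>\<bar> * jb (k - j) / R * jb (k - j) ^ N)"
        using R powr_le_jb_power[of "k - j" \<sigma>] unfolding N_def
        by (intro mult_left_mono mult_mono divide_right_mono) auto
      finally have "cmod (conjk (wgt R \<sigma>) M k j - M k j) * jb (k - j) ^ 4
          \<le> cmod (M k j) * (\<bar>\<sigma>\<bar> * jb (k - j) / R * jb (k - j) ^ N) * jb (k - j) ^ 4"
        by (intro mult_right_mono) auto
      also have "\<dots> = \<bar>\<sigma>\<bar> / R * (cmod (M k j) * jb (k - j) ^ (N + 5))"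
        by (simp add: power_add numeral_eq_Suc)
      also have "\<dots> \<le> \<bar>\<sigma>\<bar> / R * C"
        using R by (intro mult_left_mono C) auto
      also have "\<dots> \<le> C' / R"
        using R C0 by (simp add: C'_def field_simps)
      finally show "cmod (conjk (wgt R \<sigma>) M k j - M k j) * jb (k - j) ^ 4 \<le> C' / R" .
    qed
    then show ?thesis by simp
  qed
  show ?thesis using that[OF 1 2] .
qed

abbreviation hsq :: "real \<Rightarrow> (int \<times> int \<Rightarrow> complex) \<Rightarrow> bool" where "hsq \<sigma> \<equiv> wsq (wgt 1 \<sigma>)"
abbreviation hnorm :: "real \<Rightarrow> (int \<times> int \<Rightarrow> complex) \<Rightarrow> real" where "hnorm \<sigma> \<equiv> wnorm (wgt 1 \<sigma>)"

lemma rapid_bounded: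
  assumes "rapid M"
  obtains S where "S \<ge> 0" "\<And>a. hsq \<sigma> a \<Longrightarrow> hsq \<sigma> (kop M a)" "\<And>a. hsq \<sigma> a \<Longrightarrow> hnorm \<sigma> (kop M a) \<le> S * hnorm \<sigma> a"
proof -
  obtain S where S: "schur (conjk (wgt 1 \<sigma>) M) S"
    using rapid_schur[OF assms, of \<sigma>] by (metis order_refl)
  show ?thesis
    using that[of S] kop_weighted[OF wgt_pos[OF order_refl] S] schur_nonneg[OF S] by blast
qed

lemma rapid_summable:
  assumes "rapid M" "hsq \<sigma> a"
  shows "(\<lambda>j. cmod (M k j * a j)) summable_on UNIV"
proof -
  obtain S where S: "schur (conjk (wgt 1 \<sigma>) M) S"
    using rapid_schur[OF assms(1), of \<sigma>] by (metis order_refl)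
  show ?thesis by (rule kop_weighted_summable[OF wgt_pos[OF order_refl] S assms(2)])
qed

lemma rapid_lin:
  assumes "rapid M" "hsq \<sigma> a" "hsq \<sigma> b"
  shows "kop M (\<lambda>k. c * a k + d * b k) = (\<lambda>k. c * kop M a k + d * kop M b k)"
proof -
  obtain S where S: "schur (conjk (wgt 1 \<sigma>) M) S"
    using rapid_schur[OF assms(1), of \<sigma>] by (metis order_refl)
  show ?thesis by (rule kop_weighted_lin[OF wgt_pos[OF order_refl] S assms(2,3)])
qed

text \<open>The logarithm of \<open>(R + |k|) / (1 + |k|)\<close> lies between 0 and
  \<open>ln R\<close>.\<close>

lemma wgt_equiv:
  assumes "R \<ge> 1"
  shows "wgt R \<sigma> k \<le> R powr \<bar>\<sigma>\<bar> * wgt 1 \<sigma> k" "wgt 1 \<sigma> k \<le> R powr \<bar>\<sigma>\<bar> * wgt R \<sigma> k"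
proof -
  have p: "0 < jb k" "0 < R + freq_norm k" using assms by (auto simp: add_pos_nonneg)
  have "R + freq_norm k \<le> R * jb k"
    using mult_right_mono[OF assms, of "freq_norm k"] by (simp add: algebra_simps)
  then have u: "ln (R + freq_norm k) \<le> ln R + ln (jb k)"
    using p assms ln_mono[of "R + freq_norm k" "R * jb k"] by (simp add: ln_mult)
  have l: "ln (jb k) \<le> ln (R + freq_norm k)" using p assms by simp
  have "\<sigma> * (ln (R + freq_norm k) - ln (jb k)) \<le> \<bar>\<sigma>\<bar> * ln R"
       "- \<sigma> * (ln (R + freq_norm k) - ln (jb k)) \<le> \<bar>\<sigma>\<bar> * ln R"
  proof -
    have "\<bar>\<sigma> * (ln (R + freq_norm k) - ln (jb k))\<bar> \<le> \<bar>\<sigma>\<bar> * ln R"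
      unfolding abs_mult using u l by (intro mult_left_mono) auto
    then show "\<sigma> * (ln (R + freq_norm k) - ln (jb k)) \<le> \<bar>\<sigma>\<bar> * ln R"
      "- \<sigma> * (ln (R + freq_norm k) - ln (jb k)) \<le> \<bar>\<sigma>\<bar> * ln R"
      by (simp_all only: abs_le_iff mult_minus_left)
  qed
  then show "wgt R \<sigma> k \<le> R powr \<bar>\<sigma>\<bar> * wgt 1 \<sigma> k" "wgt 1 \<sigma> k \<le> R powr \<bar>\<sigma>\<bar> * wgt R \<sigma> k"
    using p assms by (auto simp: wgt_def powr_def exp_add[symmetric] algebra_simps)
qed

text \<open>Coercivity is supposed without weight, whereas \<sigma> is arbitrary. Inversion is done
  in the norm with large \<open>R\<close> and carried back by norm equivalence, which costs the
  factor \<open>D * D\<close>.\<close>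

lemma rapid_coercive_inverse:
  assumes M: "rapid M" and c: "coercive M c" "c > 0"
  obtains C where "C \<ge> 0" "\<And>f. hsq \<sigma> f \<Longrightarrow> \<exists>a. hsq \<sigma> a \<and> kop M a = f"
    "\<And>a. hsq \<sigma> a \<Longrightarrow> hnorm \<sigma> a \<le> C * hnorm \<sigma> (kop M a)"
proof -
  obtain S where S: "\<And>R. R \<ge> 1 \<Longrightarrow> schur (conjk (wgt R \<sigma>) M) S"
    "\<And>R. R \<ge> 1 \<Longrightarrow> schur (\<lambda>k j. conjk (wgt R \<sigma>) M k j - M k j) (S / R)"
    using rapid_schur[OF M] by metis
  have S0: "S \<ge> 0" using schur_nonneg[OF S(1)[of 1]] by simp
  \<comment> \<open>Gives \<open>c * R = c + 2 * S > S\<close>, so a positive part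
    \<open>c - S / R\<close> of the coercivity survives.\<close>
  define R where "R = 1 + 2 * S / c"
  have R: "R \<ge> 1" using S0 c by (simp add: R_def)
  have "S < c * R" using S0 c by (simp add: R_def algebra_simps)
  then have c': "c - S / R > 0" using R by (simp add: pos_divide_less_eq)
  have co: "coercive (conjk (wgt R \<sigma>) M) (c - S / R)"
    by (rule coercive_perturb[OF c(1) S(2)[OF R]])
  note inv = kop_weighted_inverse[OF wgt_pos[OF R] S(1)[OF R] co c']
  define D where "D = R powr \<bar>\<sigma>\<bar>"
  have D: "D \<ge> 0" by (simp add: D_def)
  have e1: "wsq (wgt R \<sigma>) a \<and> wnorm (wgt R \<sigma>) a \<le> D * hnorm \<sigma> a" if "hsq \<sigma> a" for a
    using wnorm_mono[OF that less_imp_le[OF wgt_pos[OF R, of \<sigma>]] _ D, where b = a]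
      mult_right_mono[OF wgt_equiv(1)[OF R, of \<sigma>]]
    by (simp add: D_def mult.assoc)
  have e2: "hsq \<sigma> a \<and> hnorm \<sigma> a \<le> D * wnorm (wgt R \<sigma>) a" if "wsq (wgt R \<sigma>) a" for a
    using wnorm_mono[OF that less_imp_le[OF wgt_pos[OF order_refl, of \<sigma>]] _ D, where b = a]
      mult_right_mono[OF wgt_equiv(2)[OF R, of \<sigma>]]
    by (simp add: D_def mult.assoc)
  show ?thesis
  proof (rule that[of "D * D / (c - S / R)"])
    show "\<exists>a. hsq \<sigma> a \<and> kop M a = f" if "hsq \<sigma> f" for f
      using inv(1) e1[OF that] e2 by blast
    show "hnorm \<sigma> a \<le> D * D / (c - S / R) * hnorm \<sigma> (kop M a)" if a: "hsq \<sigma> a" for a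
    proof -
      have b: "hsq \<sigma> (kop M a)" using rapid_bounded[OF M, of \<sigma>] a by metis
      have "hnorm \<sigma> a \<le> D * (wnorm (wgt R \<sigma>) (kop M a) / (c - S / R))"
        using e2[of a] inv(2)[of a] e1[OF a] mult_left_mono[OF _ D] by (meson order_trans)
      also have "\<dots> \<le> D * (D * hnorm \<sigma> (kop M a) / (c - S / R))"
        using e1[OF b] D c' by (intro mult_left_mono divide_right_mono) auto
      finally show ?thesis by simp
    qed
  qed (use D c' in auto)
qed

section \<open>An Ingham-type inequality\<close>

text \<open>Telescoping through \<open>1 / (N + 1)^2 <= 1 / N - 1 / (N + 1)\<close>; the crude value
  2 is enough.\<close>

lemma sum_inverse_squares_le:
  assumes "finite B" "0 \<notin> B"
  shows "(\<Sum>n\<in>B. 1 / (real n)\<^sup>2) \<le> 2"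
proof -
  have *: "(\<Sum>n=1..N. 1 / (real n)\<^sup>2) \<le> 2 - 1 / real N" if "N \<ge> 1" for N
    using that
  proof (induction N rule: nat_induct_at_least)
    case (Suc N)
    have "1 / (real (Suc N))\<^sup>2 \<le> 1 / real N - 1 / real (Suc N)"
    proof -
      have "1 / (real (Suc N))\<^sup>2 \<le> 1 / (real N * real (Suc N))"
        using Suc.hyps by (intro divide_left_mono) (auto simp: power2_eq_square)
      also have "\<dots> = 1 / real N - 1 / real (Suc N)"
        using Suc.hyps by (simp add: field_simps)
      finally show ?thesis .
    qed
    then show ?case using Suc by simp
  qed simp
  define N where "N = Suc (Max (insert 0 B))"
  have "B \<subseteq> {1..N}"
  proof
    fix n assume n: "n \<in> B"
    have "n \<noteq> 0" using n assms(2) by metis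
    moreover have "n \<le> Max (insert 0 B)" using n assms(1) by (intro Max_ge) auto
    ultimately show "n \<in> {1..N}" unfolding N_def atLeastAtMost_iff by linarith
  qed
  then have "(\<Sum>n\<in>B. 1 / (real n)\<^sup>2) \<le> (\<Sum>n=1..N. 1 / (real n)\<^sup>2)"
    by (intro sum_mono2) auto
  also have "\<dots> \<le> 2 - 1 / real N" by (rule *) (simp add: N_def)
  also have "\<dots> \<le> 2" by simp
  finally show ?thesis .
qed

text \<open>The common content of (A) and (B) on a row or column off the axes: in (A) the
  eigenvalues are injective for fixed nonzero \<open>k1\<close> and even for fixed nonzero
  \<open>k2\<close>, in (B) the other way round.\<close>

definition two_to_one :: "(int \<Rightarrow> real) \<Rightarrow> real \<Rightarrow> bool" where
  "two_to_one l \<gamma> \<longleftrightarrow> (\<forall>j k. l j = l k \<longrightarrow> j = k \<or> j = - k) \<and> (\<forall>j k. l j \<noteq> l k \<longrightarrow> \<gamma> \<le> \<bar>l j - l k\<bar>)"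

text \<open>The line above \<open>l k\<close> is cut into cells of length \<gamma>, and
  \<open>\<phi> j >= 1\<close> is the number of the cell of \<open>l j\<close>. Two values in one
  cell are closer than the gap, hence equal, so a cell holds at most the two indices
  \<open>i\<close> and \<open>- i\<close>. This leaves twice the sum of inverse squares, divided by
  \<open>\<gamma>^2\<close>.\<close>

lemma two_to_one_sum_pos:
  assumes l: "two_to_one l \<gamma>" and \<gamma>: "\<gamma> > 0" and A: "finite A"
  shows "(\<Sum>j\<in>{j\<in>A. l j > l k}. 1 / (l j - l k)\<^sup>2) \<le> 4 / \<gamma>\<^sup>2"
proof -
  define \<phi> where "\<phi> j = nat \<lfloor>(l j - l k) / \<gamma>\<rfloor>" for j
  define S where "S = {j\<in>A. l j > l k}"
  have S: "finite S" using A by (simp add: S_def)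
  have \<phi>: "1 \<le> \<phi> j \<and> real (\<phi> j) \<le> (l j - l k) / \<gamma> \<and> (l j - l k) / \<gamma> < real (\<phi> j) + 1" if "j \<in> S" for j
  proof -
    have "l j \<noteq> l k" "l j > l k" using that by (auto simp: S_def)
    then have "\<gamma> \<le> l j - l k" using l unfolding two_to_one_def by (metis abs_of_pos diff_gt_0_iff_gt)
    then have "1 \<le> (l j - l k) / \<gamma>" using \<gamma> by simp
    then have "1 \<le> \<lfloor>(l j - l k) / \<gamma>\<rfloor>" by (simp add: le_floor_iff)
    then show ?thesis unfolding \<phi>_def by linarith
  qed
  have card: "card {j\<in>S. \<phi> j = n} \<le> 2" for n
  proof (cases "{j\<in>S. \<phi> j = n} = {}")
    case False
    then obtain i where i: "i \<in> S" "\<phi> i = n" by blast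
    have "{j\<in>S. \<phi> j = n} \<subseteq> {i, - i}"
    proof
      fix j assume j: "j \<in> {j\<in>S. \<phi> j = n}"
      then have "\<bar>(l j - l k) / \<gamma> - (l i - l k) / \<gamma>\<bar> < 1"
        using \<phi>[of j] \<phi>[of i] i by auto
      moreover have "(l j - l k) / \<gamma> - (l i - l k) / \<gamma> = (l j - l i) / \<gamma>"
        by (simp add: diff_divide_distrib)
      ultimately have "\<bar>l j - l i\<bar> < \<gamma>" using \<gamma> by (simp add: abs_divide)
      then have "l j = l i" using l unfolding two_to_one_def by (meson not_le)
      then show "j \<in> {i, - i}" using l by (auto simp: two_to_one_def)
    qed
    then have "card {j\<in>S. \<phi> j = n} \<le> card {i, - i}" by (intro card_mono) auto
    also have "\<dots> \<le> 2" by (simp add: card_insert_if)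
    finally show ?thesis .
  qed (simp only: card.empty)
  have "(\<Sum>j\<in>S. 1 / (l j - l k)\<^sup>2) \<le> (\<Sum>j\<in>S. 1 / \<gamma>\<^sup>2 * (1 / (real (\<phi> j))\<^sup>2))"
  proof (rule sum_mono)
    fix j assume j: "j \<in> S"
    have "\<gamma> * real (\<phi> j) \<le> l j - l k" using \<phi>[OF j] \<gamma> by (simp add: field_simps)
    then have "(\<gamma> * real (\<phi> j))\<^sup>2 \<le> (l j - l k)\<^sup>2" using \<gamma> by (intro power_mono) auto
    moreover have "0 < (\<gamma> * real (\<phi> j))\<^sup>2" using \<phi>[OF j] \<gamma> by auto
    ultimately have "1 / (l j - l k)\<^sup>2 \<le> 1 / (\<gamma> * real (\<phi> j))\<^sup>2" by (intro frac_le) auto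
    then show "1 / (l j - l k)\<^sup>2 \<le> 1 / \<gamma>\<^sup>2 * (1 / (real (\<phi> j))\<^sup>2)"
      by (simp add: power_mult_distrib)
  qed
  also have "\<dots> = 1 / \<gamma>\<^sup>2 * (\<Sum>j\<in>S. 1 / (real (\<phi> j))\<^sup>2)" by (simp add: sum_distrib_left)
  also have "\<dots> \<le> 1 / \<gamma>\<^sup>2 * 4"
  proof (rule mult_left_mono)
    have "(\<Sum>j\<in>S. 1 / (real (\<phi> j))\<^sup>2) = (\<Sum>n\<in>\<phi> ` S. \<Sum>j\<in>{j\<in>S. \<phi> j = n}. 1 / (real (\<phi> j))\<^sup>2)"
      by (rule sum.image_gen[OF S])
    also have "\<dots> = (\<Sum>n\<in>\<phi> ` S. real (card {j\<in>S. \<phi> j = n}) * (1 / (real n)\<^sup>2))"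
      by (intro sum.cong) auto
    also have "\<dots> \<le> (\<Sum>n\<in>\<phi> ` S. 2 * (1 / (real n)\<^sup>2))"
      by (intro sum_mono mult_right_mono) (use of_nat_mono[OF card, where 'a = real] in simp_all)
    also have "\<dots> = 2 * (\<Sum>n\<in>\<phi> ` S. 1 / (real n)\<^sup>2)" by (simp add: sum_distrib_left)
    also have "\<dots> \<le> 2 * 2"
    proof (intro mult_left_mono sum_inverse_squares_le)
      show "0 \<notin> \<phi> ` S" using \<phi> by (metis imageE not_one_le_zero)
    qed (use S in auto)
    finally show "(\<Sum>j\<in>S. 1 / (real (\<phi> j))\<^sup>2) \<le> 4" by simp
  qed simp
  finally show ?thesis by (simp add: S_def)
qed

lemma two_to_one_sum:
  assumes l: "two_to_one l \<gamma>" and \<gamma>: "\<gamma> > 0" and A: "finite A"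
  shows "(\<Sum>j\<in>{j\<in>A. l j \<noteq> l k}. 1 / (l j - l k)\<^sup>2) \<le> 8 / \<gamma>\<^sup>2"
proof -
  have l': "two_to_one (\<lambda>j. - l j) \<gamma>"
    using l by (auto simp: two_to_one_def abs_minus_commute)
  have eq: "{j\<in>A. l j \<noteq> l k} = {j\<in>A. l j > l k} \<union> {j\<in>A. - l j > - l k}" by auto
  have "(\<Sum>j\<in>{j\<in>A. l j \<noteq> l k}. 1 / (l j - l k)\<^sup>2)
      = (\<Sum>j\<in>{j\<in>A. l j > l k}. 1 / (l j - l k)\<^sup>2) + (\<Sum>j\<in>{j\<in>A. - l j > - l k}. 1 / (l j - l k)\<^sup>2)"
    unfolding eq using A by (intro sum.union_disjoint) auto
  moreover have "(\<Sum>j\<in>{j\<in>A. - l j > - l k}. 1 / (l j - l k)\<^sup>2) = (\<Sum>j\<in>{j\<in>A. - l j > - l k}. 1 / (- l j - - l k)\<^sup>2)"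
    by (intro sum.cong refl) (simp add: power2_eq_square algebra_simps)
  ultimately show ?thesis
    using two_to_one_sum_pos[OF l \<gamma> A, of k] two_to_one_sum_pos[OF l' \<gamma> A, of k] by linarith
qed

text \<open>The transform of the parabola \<open>\<tau> (P - \<tau>)\<close> on
  \<open>[0, P]\<close>. Because the parabola vanishes at both ends, the transform decays like
  \<open>1 / d^2\<close>, which is summable along a sequence with a gap; a sharp cutoff would give
  only \<open>1 / d\<close>.\<close>

definition bump_hat :: "real \<Rightarrow> real \<Rightarrow> complex" where
  "bump_hat P d = integral {0..P} (\<lambda>\<tau>. of_real (\<tau> * (P - \<tau>)) * cis (d * \<tau>))"

lemma bump_has_integral:
  "((\<lambda>\<tau>. of_real (\<tau> * (P - \<tau>)) * cis (d * \<tau>)) has_integral bump_hat P d) {0..P}"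
  unfolding bump_hat_def
  by (intro integrable_integral integrable_continuous_real continuous_intros)

lemma bump_hat_0: "P \<ge> 0 \<Longrightarrow> bump_hat P 0 = of_real (P ^ 3 / 6)"
proof -
  assume P: "P \<ge> 0"
  have "((\<lambda>\<tau>. complex_of_real (\<tau> * (P - \<tau>)) * cis (0 * \<tau>)) has_integral
      of_real (P * P\<^sup>2 / 2 - P ^ 3 / 3) - of_real (P * 0\<^sup>2 / 2 - 0 ^ 3 / 3)) {0..P}"
  proof (rule fundamental_theorem_of_calculus[OF P])
    fix \<tau>
    have "((\<lambda>\<tau>. P * \<tau>\<^sup>2 / 2 - \<tau> ^ 3 / 3) has_real_derivative \<tau> * (P - \<tau>)) (at \<tau> within {0..P})"
      by (auto intro!: derivative_eq_intros simp: power2_eq_square algebra_simps)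
    then show "((\<lambda>\<tau>. complex_of_real (P * \<tau>\<^sup>2 / 2 - \<tau> ^ 3 / 3)) has_vector_derivative
        of_real (\<tau> * (P - \<tau>)) * cis (0 * \<tau>)) (at \<tau> within {0..P})"
      using has_vector_derivative_of_real[of _ "\<tau> * (P - \<tau>)" "at \<tau> within {0..P}", where 'a = complex]
      by (simp only: has_real_derivative_iff_has_vector_derivative cis_zero mult_zero_left mult_1_right)
  qed
  then have "bump_hat P 0 = of_real (P * P\<^sup>2 / 2 - P ^ 3 / 3)"
    unfolding bump_hat_def by (intro integral_unique) simp
  also have "P * P\<^sup>2 / 2 - P ^ 3 / 3 = P ^ 3 / 6" by (simp add: power2_eq_square power3_eq_cube)
  finally show ?thesis .
qed

lemma has_vector_derivative_cis:
  "((\<lambda>\<tau>. cis (d * \<tau>)) has_vector_derivative (\<i> * of_real d * cis (d * \<tau>))) (at \<tau> within S)"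
proof -
  have "((\<lambda>\<tau>. exp ((\<i> * of_real d) * of_real \<tau>)) has_vector_derivative
     (\<i> * of_real d) * exp ((\<i> * of_real d) * of_real \<tau>)) (at \<tau> within S)"
    by (rule has_vector_derivative_real_field) (auto intro!: derivative_eq_intros)
  then show ?thesis by (simp add: cis_conv_exp mult_ac)
qed

lemma bump_hat_bound:
  assumes P: "P \<ge> 0" and \<gamma>: "\<gamma> > 0" "\<gamma> \<le> \<bar>d\<bar>"
  shows "cmod (bump_hat P d) \<le> (2 * P + 4 / \<gamma>) * (1 / d\<^sup>2)"
proof -
  define m where "m = \<i> * complex_of_real d"
  have d: "d \<noteq> 0" using \<gamma> by auto
  then have m: "m \<noteq> 0" by (simp add: m_def)
  have cm: "cmod m = \<bar>d\<bar>" by (simp add: m_def norm_mult)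
  \<comment> \<open>The antiderivative found by integrating by parts until the polynomial is
    exhausted. Its first term vanishes at both endpoints; each endpoint then contributes
    \<open>P / d^2 + 2 / |d|^3\<close>.\<close>
  define F where "F \<tau> = (of_real (\<tau> * (P - \<tau>)) / m - of_real (P - 2 * \<tau>) / m\<^sup>2 - 2 / m ^ 3) * cis (d * \<tau>)" for \<tau>
  have "((\<lambda>\<tau>. of_real (\<tau> * (P - \<tau>)) * cis (d * \<tau>)) has_integral (F P - F 0)) {0..P}"
  proof (rule fundamental_theorem_of_calculus[OF P])
    fix \<tau> assume "\<tau> \<in> {0..P}"
    have a: "((\<lambda>\<tau>. complex_of_real (\<tau> * (P - \<tau>))) has_vector_derivative of_real (P - 2 * \<tau>)) (at \<tau> within {0..P})"
      by (intro has_vector_derivative_of_real)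
        (auto simp: has_real_derivative_iff_has_vector_derivative[symmetric] intro!: derivative_eq_intros)
    have b: "((\<lambda>\<tau>. complex_of_real (P - 2 * \<tau>)) has_vector_derivative of_real (- 2)) (at \<tau> within {0..P})"
      by (intro has_vector_derivative_of_real)
        (auto simp: has_real_derivative_iff_has_vector_derivative[symmetric] intro!: derivative_eq_intros)
    have "(F has_vector_derivative ((of_real (\<tau> * (P - \<tau>)) / m - of_real (P - 2 * \<tau>) / m\<^sup>2 - 2 / m ^ 3) * (m * cis (d * \<tau>))
        + (of_real (P - 2 * \<tau>) / m - of_real (- 2) / m\<^sup>2 - 0) * cis (d * \<tau>))) (at \<tau> within {0..P})"
      unfolding F_def m_def[symmetric]
      by (intro has_vector_derivative_mult has_vector_derivative_diff has_vector_derivative_divide a b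
          has_vector_derivative_const has_vector_derivative_cis[of d, folded m_def])
    moreover have "(of_real (\<tau> * (P - \<tau>)) / m - of_real (P - 2 * \<tau>) / m\<^sup>2 - 2 / m ^ 3) * (m * cis (d * \<tau>))
        + (of_real (P - 2 * \<tau>) / m - of_real (- 2) / m\<^sup>2 - 0) * cis (d * \<tau>) = of_real (\<tau> * (P - \<tau>)) * cis (d * \<tau>)"
      using m by (simp add: field_simps power2_eq_square power3_eq_cube)
    ultimately show "(F has_vector_derivative of_real (\<tau> * (P - \<tau>)) * cis (d * \<tau>)) (at \<tau> within {0..P})" by simp
  qed
  then have "bump_hat P d = F P - F 0" unfolding bump_hat_def by (rule integral_unique)
  moreover have "cmod (F \<tau>) \<le> (P + 2 / \<gamma>) * (1 / d\<^sup>2)" if "\<tau> = 0 \<or> \<tau> = P" for \<tau>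
  proof -
    have "cmod (F \<tau>) = cmod (of_real (\<tau> * (P - \<tau>)) / m - of_real (P - 2 * \<tau>) / m\<^sup>2 - 2 / m ^ 3)"
      by (simp add: F_def norm_mult)
    also have "of_real (\<tau> * (P - \<tau>)) / m = 0" using that by auto
    also have "cmod (0 - of_real (P - 2 * \<tau>) / m\<^sup>2 - 2 / m ^ 3) \<le> cmod (of_real (P - 2 * \<tau>) / m\<^sup>2) + cmod (2 / m ^ 3)"
      by (rule order.trans[OF norm_triangle_ineq4]) simp
    also have "\<dots> = P / d\<^sup>2 + 2 / \<bar>d\<bar> ^ 3"
      using that P unfolding norm_divide norm_power cm norm_of_real by auto
    also have "2 / \<bar>d\<bar> ^ 3 = 2 / \<bar>d\<bar> * (1 / d\<^sup>2)"
      by (simp add: power3_eq_cube power2_eq_square abs_mult_self_eq mult.assoc)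
    also have "\<dots> \<le> 2 / \<gamma> * (1 / d\<^sup>2)"
      using \<gamma> by (intro mult_right_mono divide_left_mono) auto
    finally show ?thesis by (simp add: distrib_right add_divide_distrib)
  qed
  from this[of 0] this[of P] have "cmod (F P - F 0) \<le> (P + 2 / \<gamma>) * (1 / d\<^sup>2) + (P + 2 / \<gamma>) * (1 / d\<^sup>2)"
    by (intro order.trans[OF norm_triangle_ineq4] add_mono) auto
  ultimately have "cmod (bump_hat P d) \<le> (P + 2 / \<gamma>) * (1 / d\<^sup>2) + (P + 2 / \<gamma>) * (1 / d\<^sup>2)" by simp
  then show ?thesis by (simp add: distrib_right add_divide_distrib)
qed

text \<open>Compared with its diagonal \<open>w0\<close>, the kernel has two defects in a row: the
  partner \<open>- k\<close> with the same eigenvalue, of size at most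
  \<open>w0 (1 - \<delta>)\<close>, and the nonresonant indices, whose total is at most
  \<open>8 K / \<gamma>^2\<close>. The length \<open>P\<close> makes the latter at most
  \<open>w0 \<delta> / 2\<close>.\<close>

lemma bump_kernel_coercive:
  assumes l: "two_to_one l \<gamma>" and \<gamma>: "\<gamma> > 0"
    and \<delta>: "0 < \<delta>" and g0: "gh 0 = 1" and g1: "\<And>n::int. n \<noteq> 0 \<Longrightarrow> cmod (gh n) \<le> 1 - \<delta>"
    and P: "P = 1 + 96 * (2 + 4 / \<gamma>) / (\<gamma>\<^sup>2 * \<delta>)"
  shows "coercive (\<lambda>k j. gh (k - j) * bump_hat P (l j - l k)) (P ^ 3 / 6 * (\<delta> / 2))"
proof -
  have \<delta>1: "\<delta> \<le> 1" using g1[of 1] norm_ge_zero[of "gh 1"] by linarith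
  have P1: "P \<ge> 1" using \<gamma> \<delta> by (simp add: P)
  define w0 where "w0 = P ^ 3 / 6"
  have w0: "w0 > 0" using P1 by (simp add: w0_def)
  define K where "K = 2 * P + 4 / \<gamma>"
  have K: "K \<ge> 0" using P1 \<gamma> by (simp add: K_def)
  define H where "H k j = gh (k - j) * bump_hat P (l j - l k)" for k j
  define I :: "int \<Rightarrow> int \<Rightarrow> complex" where "I k j = (if k = j then of_real w0 else 0)" for k j
  have "coercive I w0"
    unfolding coercive_def
  proof (intro allI impI)
    fix A :: "int set" and a assume A: "finite A"
    have "(\<Sum>k\<in>A. \<Sum>j\<in>A. I k j * a j * cnj (a k)) = (\<Sum>k\<in>A. of_real w0 * a k * cnj (a k))"
    proof (intro sum.cong refl)
      fix k assume k: "k \<in> A"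
      have "(\<Sum>j\<in>A. I k j * a j * cnj (a k)) = (\<Sum>j\<in>A. if k = j then of_real w0 * a k * cnj (a k) else 0)"
        by (intro sum.cong) (auto simp: I_def)
      then show "(\<Sum>j\<in>A. I k j * a j * cnj (a k)) = of_real w0 * a k * cnj (a k)"
        using k A by simp
    qed
    also have "\<dots> = of_real (w0 * (\<Sum>k\<in>A. (cmod (a k))\<^sup>2))"
      by (simp add: sum_distrib_left mult.assoc complex_norm_square[symmetric] del: of_real_power)
    finally show "w0 * (\<Sum>k\<in>A. (cmod (a k))\<^sup>2) \<le> kform I A a" by (simp add: kform_def)
  qed
  moreover have "schur (\<lambda>k j. H k j - I k j) (w0 * (1 - \<delta> / 2))"
  proof -
    have gle: "cmod (gh n) \<le> 1" for n using g0 g1[of n] \<delta> by (cases "n = 0") auto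
    have bd: "cmod (H k j - I k j) \<le> (if l j \<noteq> l k then K * (1 / (l j - l k)\<^sup>2) else if j = k then 0 else w0 * (1 - \<delta>))" for k j
    proof (cases "l j = l k")
      case False
      then have "j \<noteq> k" by auto
      moreover have "cmod (H k j) \<le> 1 * (K * (1 / (l j - l k)\<^sup>2))"
        unfolding H_def norm_mult K_def
        by (intro mult_mono gle bump_hat_bound \<gamma>) (use l False P1 in \<open>auto simp: two_to_one_def\<close>)
      ultimately show ?thesis using False by (simp add: I_def)
    next
      case True
      show ?thesis
      proof (cases "j = k")
        case False
        then have "cmod (H k j) \<le> (1 - \<delta>) * w0"
          using P1 g1[of "k - j"] w0 \<delta>1 unfolding H_def norm_mult True
          by (intro mult_mono) (auto simp: bump_hat_0 w0_def norm_power)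
        then show ?thesis using True False by (simp add: I_def mult.commute)
      qed (use P1 in \<open>simp add: H_def I_def g0 bump_hat_0 w0_def\<close>)
    qed
    have row: "(\<Sum>j\<in>A. if l j \<noteq> l k then K * (1 / (l j - l k)\<^sup>2) else if j = k then 0 else w0 * (1 - \<delta>)) \<le> w0 * (1 - \<delta> / 2)"
      if A: "finite A" for A k
    proof -
      have split: "(\<Sum>j\<in>A. if l j \<noteq> l k then K * (1 / (l j - l k)\<^sup>2) else if j = k then 0 else w0 * (1 - \<delta>))
         = (\<Sum>j\<in>{j\<in>A. l j \<noteq> l k}. K * (1 / (l j - l k)\<^sup>2)) + (\<Sum>j\<in>{j\<in>A. \<not> l j \<noteq> l k}. if j = k then 0 else w0 * (1 - \<delta>))"
        unfolding sum.If_cases[OF A] by (simp add: Int_def)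
      have 1: "(\<Sum>j\<in>{j\<in>A. l j \<noteq> l k}. K * (1 / (l j - l k)\<^sup>2)) \<le> K * (8 / \<gamma>\<^sup>2)"
        unfolding sum_distrib_left[symmetric] by (intro mult_left_mono two_to_one_sum l \<gamma> A K)
      have 2: "(\<Sum>j\<in>{j\<in>A. \<not> l j \<noteq> l k}. if j = k then 0 else w0 * (1 - \<delta>))
          \<le> (\<Sum>j\<in>{- k}. w0 * (1 - \<delta>))"
      proof -
        have "(\<Sum>j\<in>{j\<in>A. \<not> l j \<noteq> l k}. if j = k then 0 else w0 * (1 - \<delta>))
          \<le> (\<Sum>j\<in>{k, - k}. if j = k then 0 else w0 * (1 - \<delta>))"
          using l w0 \<delta>1 by (intro sum_mono2) (auto simp: two_to_one_def)
        also have "\<dots> \<le> (\<Sum>j\<in>{- k}. w0 * (1 - \<delta>))"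
          \<comment> \<open>For \<open>k = 0\<close> the partner is the index itself and the left
            side is 0.\<close>
          using w0 \<delta>1 by (cases "k = - k") auto
        finally show ?thesis .
      qed
      \<comment> \<open>The origin of the number 96 in \<open>P\<close>: since
        \<open>w0 = P^3 / 6\<close>, the claim is \<open>96 K <= P^3 \<gamma>^2 \<delta>\<close>,
        and \<open>K <= P (2 + 4 / \<gamma>)\<close> because \<open>P >= 1\<close>.\<close>
      have 3: "K * (8 / \<gamma>\<^sup>2) \<le> w0 * (\<delta> / 2)"
      proof -
        have "96 * (2 + 4 / \<gamma>) / (\<gamma>\<^sup>2 * \<delta>) \<le> P" using P by simp
        then have "96 * (2 + 4 / \<gamma>) \<le> P * (\<gamma>\<^sup>2 * \<delta>)"
          using \<gamma> \<delta> by (subst (asm) pos_divide_le_eq) auto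
        also have "\<dots> \<le> P\<^sup>2 * (\<gamma>\<^sup>2 * \<delta>)"
          using P1 \<delta> by (intro mult_right_mono) (auto simp: power2_eq_square)
        finally have "P * (96 * (2 + 4 / \<gamma>)) \<le> P * (P\<^sup>2 * (\<gamma>\<^sup>2 * \<delta>))"
          using P1 by (intro mult_left_mono) auto
        moreover have "96 * K \<le> 96 * (P * (2 + 4 / \<gamma>))"
          using P1 \<gamma> mult_right_mono[OF P1, of "384 / \<gamma>"] by (simp add: K_def algebra_simps)
        ultimately have "96 * K \<le> P * (P\<^sup>2 * (\<gamma>\<^sup>2 * \<delta>))"
          by (simp only: mult.left_commute[of P 96])
        then have "96 * K \<le> P ^ 3 * (\<gamma>\<^sup>2 * \<delta>)"
          by (simp add: power2_eq_square power3_eq_cube mult.assoc)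
        then show ?thesis using \<gamma> by (simp add: w0_def field_simps)
      qed
      have 4: "(\<Sum>j\<in>{- k}. w0 * (1 - \<delta>)) = w0 * (1 - \<delta> / 2) - w0 * (\<delta> / 2)"
        by (simp add: algebra_simps)
      from split 1 2 3 4 show ?thesis by linarith
    qed
    show ?thesis
      unfolding schur_def
    proof (intro conjI allI impI)
      fix k :: int and A :: "int set" assume A: "finite A"
      show "(\<Sum>j\<in>A. cmod (H k j - I k j)) \<le> w0 * (1 - \<delta> / 2)"
        by (rule order.trans[OF sum_mono[OF bd] row[OF A]])
      have "cmod (H j k - I j k) \<le> (if l j \<noteq> l k then K * (1 / (l j - l k)\<^sup>2) else if j = k then 0 else w0 * (1 - \<delta>))" for j
        using bd[of j k] power2_commute[of "l j" "l k"] by (auto split: if_splits)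
      then show "(\<Sum>j\<in>A. cmod (H j k - I j k)) \<le> w0 * (1 - \<delta> / 2)"
        by (rule order.trans[OF sum_mono row[OF A]])
    qed
  qed
  ultimately have "coercive H (w0 - w0 * (1 - \<delta> / 2))" by (rule coercive_perturb)
  moreover have "w0 - w0 * (1 - \<delta> / 2) = P ^ 3 / 6 * (\<delta> / 2)" unfolding w0_def by (simp add: field_simps)
  ultimately show ?thesis by (simp add: H_def[abs_def])
qed

section \<open>From the bump window to the resolvent kernel\<close>

lemma double_sum_cis:
  "(\<Sum>k\<in>A. \<Sum>j\<in>A. z j * cnj (z k) * cis ((l j - l k) * \<tau>)) = of_real ((cmod (\<Sum>j\<in>A. z j * cis (l j * \<tau>)))\<^sup>2)"
proof -
  have "of_real ((cmod (\<Sum>j\<in>A. z j * cis (l j * \<tau>)))\<^sup>2)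
     = (\<Sum>j\<in>A. z j * cis (l j * \<tau>)) * cnj (\<Sum>j\<in>A. z j * cis (l j * \<tau>))"
    by (simp only: complex_norm_square)
  also have "\<dots> = (\<Sum>k\<in>A. \<Sum>j\<in>A. z j * cnj (z k) * cis ((l j - l k) * \<tau>))"
    unfolding cnj_sum sum_product
    by (subst sum.swap, intro sum.cong refl)
      (simp add: cis_cnj cis_mult left_diff_distrib mult.assoc mult.left_commute[of _ "cnj _"])
  finally show ?thesis by simp
qed

text \<open>Both forms integrate the same nonnegative function
  \<open>f \<tau> = |sum z_j exp (i l_j \<tau>)|^2\<close>, with weight
  \<open>exp (- rate \<tau>)\<close> on the half line and \<open>\<tau> (P - \<tau>)\<close> on
  \<open>[0, P]\<close>. On the window the parabola is at most \<open>P^2\<close> and the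
  exponential at least \<open>exp (- rate P)\<close>, whence the constant; outside it nonnegative
  mass is dropped.\<close>

lemma resolvent_form_ge_bump_form:
  fixes l :: "'i \<Rightarrow> real"
  assumes rate: "rate > 0" and P: "P > 0" and A: "finite A"
  shows "exp (- rate * P) / P\<^sup>2 * Re (\<Sum>k\<in>A. \<Sum>j\<in>A. bump_hat P (l j - l k) * z j * cnj (z k))
    \<le> Re (\<Sum>k\<in>A. \<Sum>j\<in>A. 1 / (of_real rate + \<i> * of_real (l k - l j)) * z j * cnj (z k))"
proof -
  define f where "f \<tau> = (cmod (\<Sum>j\<in>A. z j * cis (l j * \<tau>)))\<^sup>2" for \<tau>
  define m where "m k j = of_real rate + \<i> * complex_of_real (l k - l j)" for k j
  have m: "m k j \<noteq> 0" for k j using rate by (auto simp: m_def complex_eq_iff)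
  \<comment> \<open>The resolvent form with the time integral cut at \<open>n\<close>: it increases
    with \<open>n\<close> and tends to the full form.\<close>
  define I where "I n = Re (\<Sum>k\<in>A. \<Sum>j\<in>A. (1 - exp (- m k j * of_real n)) / m k j * z j * cnj (z k))" for n
  have f0: "f \<tau> \<ge> 0" for \<tau> by (simp add: f_def)
  have fc: "continuous_on S f" for S unfolding f_def by (intro continuous_intros)
  have int: "((\<lambda>\<tau>. exp (- rate * \<tau>) * f \<tau>) has_integral I n) {0..n}" if n: "n \<ge> 0" for n
  proof -
    have "((\<lambda>\<tau>. exp (- m k j * of_real \<tau>)) has_integral (1 - exp (- m k j * of_real n)) / m k j) {0..n}" for k j
    proof -
      have "((\<lambda>\<tau>. exp (- m k j * of_real \<tau>)) has_integral
          (- exp (- m k j * of_real n) / m k j) - (- exp (- m k j * of_real 0) / m k j)) {0..n}"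
        using m[of k j]
        by (intro fundamental_theorem_of_calculus[OF n] has_vector_derivative_real_field)
          (auto intro!: derivative_eq_intros)
      then show ?thesis by (simp add: diff_divide_distrib)
    qed
    then have "((\<lambda>\<tau>. \<Sum>k\<in>A. \<Sum>j\<in>A. exp (- m k j * of_real \<tau>) * (z j * cnj (z k))) has_integral
        (\<Sum>k\<in>A. \<Sum>j\<in>A. (1 - exp (- m k j * of_real n)) / m k j * (z j * cnj (z k)))) {0..n}"
      by (intro has_integral_sum A has_integral_mult_left)
    from has_integral_linear[OF this bounded_linear_Re]
    have "((\<lambda>\<tau>. Re (\<Sum>k\<in>A. \<Sum>j\<in>A. exp (- m k j * of_real \<tau>) * (z j * cnj (z k)))) has_integral I n) {0..n}"
      by (simp add: I_def o_def mult.assoc)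
    moreover have "Re (\<Sum>k\<in>A. \<Sum>j\<in>A. exp (- m k j * of_real \<tau>) * (z j * cnj (z k))) = exp (- rate * \<tau>) * f \<tau>" for \<tau>
    proof -
      have "exp (- m k j * of_real \<tau>) = of_real (exp (- rate * \<tau>)) * cis ((l j - l k) * \<tau>)" for k j
        by (simp add: m_def cis_conv_exp exp_of_real[symmetric] exp_add[symmetric] algebra_simps)
      then have "(\<Sum>k\<in>A. \<Sum>j\<in>A. exp (- m k j * of_real \<tau>) * (z j * cnj (z k)))
          = of_real (exp (- rate * \<tau>)) * (\<Sum>k\<in>A. \<Sum>j\<in>A. z j * cnj (z k) * cis ((l j - l k) * \<tau>))"
        by (simp add: sum_distrib_left mult_ac)
      then show ?thesis unfolding double_sum_cis f_def by (simp only: of_real_mult[symmetric] Re_complex_of_real)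
    qed
    ultimately show ?thesis by simp
  qed
  have bump: "((\<lambda>\<tau>. \<tau> * (P - \<tau>) * f \<tau>) has_integral
      Re (\<Sum>k\<in>A. \<Sum>j\<in>A. bump_hat P (l j - l k) * z j * cnj (z k))) {0..P}"
  proof -
    have "((\<lambda>\<tau>. \<Sum>k\<in>A. \<Sum>j\<in>A. of_real (\<tau> * (P - \<tau>)) * cis ((l j - l k) * \<tau>) * (z j * cnj (z k))) has_integral
        (\<Sum>k\<in>A. \<Sum>j\<in>A. bump_hat P (l j - l k) * (z j * cnj (z k)))) {0..P}"
      by (intro has_integral_sum A has_integral_mult_left bump_has_integral)
    from has_integral_linear[OF this bounded_linear_Re]
    have "((\<lambda>\<tau>. Re (\<Sum>k\<in>A. \<Sum>j\<in>A. of_real (\<tau> * (P - \<tau>)) * cis ((l j - l k) * \<tau>) * (z j * cnj (z k)))) has_integral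
        Re (\<Sum>k\<in>A. \<Sum>j\<in>A. bump_hat P (l j - l k) * z j * cnj (z k))) {0..P}"
      by (simp add: o_def mult.assoc)
    moreover have "Re (\<Sum>k\<in>A. \<Sum>j\<in>A. of_real (\<tau> * (P - \<tau>)) * cis ((l j - l k) * \<tau>) * (z j * cnj (z k)))
        = \<tau> * (P - \<tau>) * f \<tau>" for \<tau>
    proof -
      have "(\<Sum>k\<in>A. \<Sum>j\<in>A. of_real (\<tau> * (P - \<tau>)) * cis ((l j - l k) * \<tau>) * (z j * cnj (z k)))
          = of_real (\<tau> * (P - \<tau>)) * (\<Sum>k\<in>A. \<Sum>j\<in>A. z j * cnj (z k) * cis ((l j - l k) * \<tau>))"
        by (simp add: sum_distrib_left mult_ac)
      then show ?thesis unfolding double_sum_cis f_def by (simp only: of_real_mult[symmetric] Re_complex_of_real)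
    qed
    ultimately show ?thesis by simp
  qed
  have le: "exp (- rate * P) / P\<^sup>2 * Re (\<Sum>k\<in>A. \<Sum>j\<in>A. bump_hat P (l j - l k) * z j * cnj (z k)) \<le> I n" if n: "n \<ge> P" for n
  proof -
    have "exp (- rate * P) / P\<^sup>2 * Re (\<Sum>k\<in>A. \<Sum>j\<in>A. bump_hat P (l j - l k) * z j * cnj (z k)) \<le> I P"
    proof (rule has_integral_le[OF has_integral_mult_right[OF bump] int])
      fix \<tau> assume \<tau>: "\<tau> \<in> {0..P}"
      have "\<tau> * (P - \<tau>) \<le> P * P" using \<tau> by (intro mult_mono) auto
      then have "exp (- rate * P) / P\<^sup>2 * (\<tau> * (P - \<tau>)) \<le> exp (- rate * P) / P\<^sup>2 * P\<^sup>2"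
        by (intro mult_left_mono) (auto simp: power2_eq_square)
      also have "\<dots> \<le> exp (- rate * \<tau>)" using P rate \<tau> by simp
      finally show "exp (- rate * P) / P\<^sup>2 * (\<tau> * (P - \<tau>) * f \<tau>) \<le> exp (- rate * \<tau>) * f \<tau>"
        using mult_right_mono[OF _ f0] by (simp only: mult.assoc[symmetric])
    qed (use P in simp)
    also have "I P \<le> I n"
      by (rule has_integral_subset_le[OF _ int int]) (use n P f0 in auto)
    finally show ?thesis .
  qed
  have "(I \<longlongrightarrow> Re (\<Sum>k\<in>A. \<Sum>j\<in>A. (1 - 0) / m k j * z j * cnj (z k))) at_top"
  proof -
    have "((\<lambda>n. exp (- m k j * of_real n)) \<longlongrightarrow> 0) at_top" for k j
    proof (rule tendsto_norm_zero_cancel)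
      have "((\<lambda>n. exp (- (rate * n))) \<longlongrightarrow> 0) at_top"
        using rate by (intro filterlim_compose[OF exp_at_bot] filterlim_uminus_at_bot_at_top[THEN filterlim_compose]
            filterlim_tendsto_pos_mult_at_top[OF tendsto_const] filterlim_ident)
      then show "((\<lambda>n. cmod (exp (- m k j * of_real n))) \<longlongrightarrow> 0) at_top"
        by (simp add: m_def)
    qed
    then show ?thesis unfolding I_def by (intro tendsto_intros m)
  qed
  then have "exp (- rate * P) / P\<^sup>2 * Re (\<Sum>k\<in>A. \<Sum>j\<in>A. bump_hat P (l j - l k) * z j * cnj (z k))
      \<le> Re (\<Sum>k\<in>A. \<Sum>j\<in>A. (1 - 0) / m k j * z j * cnj (z k))"
    by (rule tendsto_lowerbound[OF _ eventually_mono[OF eventually_ge_at_top[of P] le]]) auto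
  then show ?thesis by (simp add: m_def)
qed

text \<open>The factor \<open>gh (k - j)\<close> is spread over \<open>y\<close>, and the
  exponentials are absorbed in the coefficients. An inequality between the forms of two kernels
  \<open>M\<close> for all coefficient families thus holds for each \<open>y\<close>, and
  \<open>g >= 0\<close> preserves it under integration.\<close>

lemma form_has_integral:
  fixes gh :: "int \<Rightarrow> complex"
  assumes A: "finite A" and g: "continuous_on {0..2 * pi} g"
    and gh: "\<And>n. gh n = integral {0..2 * pi} (\<lambda>y. of_real (g y) * cis (- of_int n * y))"
  shows "((\<lambda>y. g y * Re (\<Sum>k\<in>A. \<Sum>j\<in>A. M k j * (a j * cis (of_int j * y)) * cnj (a k * cis (of_int k * y)))) has_integral
     Re (\<Sum>k\<in>A. \<Sum>j\<in>A. gh (k - j) * M k j * a j * cnj (a k))) {0..2 * pi}"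
proof -
  have "((\<lambda>y. complex_of_real (g y) * cis (- of_int (k - j) * y)) has_integral gh (k - j)) {0..2 * pi}" for k j
    unfolding gh by (intro integrable_integral integrable_continuous_real continuous_intros g)
  then have "((\<lambda>y. \<Sum>k\<in>A. \<Sum>j\<in>A. complex_of_real (g y) * cis (- of_int (k - j) * y) * (M k j * a j * cnj (a k))) has_integral
      (\<Sum>k\<in>A. \<Sum>j\<in>A. gh (k - j) * (M k j * a j * cnj (a k)))) {0..2 * pi}"
    by (intro has_integral_sum A has_integral_mult_left)
  from has_integral_linear[OF this bounded_linear_Re]
  have "((\<lambda>y. Re (\<Sum>k\<in>A. \<Sum>j\<in>A. complex_of_real (g y) * cis (- of_int (k - j) * y) * (M k j * a j * cnj (a k)))) has_integral
     Re (\<Sum>k\<in>A. \<Sum>j\<in>A. gh (k - j) * M k j * a j * cnj (a k))) {0..2 * pi}"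
    by (simp add: o_def mult.assoc)
  moreover have "Re (\<Sum>k\<in>A. \<Sum>j\<in>A. complex_of_real (g y) * cis (- of_int (k - j) * y) * (M k j * a j * cnj (a k)))
      = g y * Re (\<Sum>k\<in>A. \<Sum>j\<in>A. M k j * (a j * cis (of_int j * y)) * cnj (a k * cis (of_int k * y)))" for y
  proof -
    have "cis (- of_int (k - j) * y) = cis (of_int j * y) * cnj (cis (of_int k * y))" for k j :: int
      by (simp add: cis_cnj cis_mult algebra_simps)
    then have "(\<Sum>k\<in>A. \<Sum>j\<in>A. complex_of_real (g y) * cis (- of_int (k - j) * y) * (M k j * a j * cnj (a k)))
      = of_real (g y) * (\<Sum>k\<in>A. \<Sum>j\<in>A. M k j * (a j * cis (of_int j * y)) * cnj (a k * cis (of_int k * y)))"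
      by (simp add: sum_distrib_left mult_ac)
    then show ?thesis by simp
  qed
  ultimately show ?thesis by simp
qed

text \<open>The order of quantifiers is the point: one \<open>c\<close> serves every eigenvalue
  sequence with gap \<gamma>, hence all rows simultaneously.\<close>

lemma row_coercive:
  fixes gh :: "int \<Rightarrow> complex"
  assumes rate: "rate > 0" and \<gamma>: "\<gamma> > 0" and \<delta>: "0 < \<delta>"
    and g: "continuous_on {0..2 * pi} g" "\<And>y. g y \<ge> 0"
    and gh: "\<And>n. gh n = integral {0..2 * pi} (\<lambda>y. of_real (g y) * cis (- of_int n * y))"
    and g0: "gh 0 = 1" and g1: "\<And>n. n \<noteq> 0 \<Longrightarrow> cmod (gh n) \<le> 1 - \<delta>"
  obtains c where "c > 0"
    "\<And>l. two_to_one l \<gamma> \<Longrightarrow> coercive (\<lambda>k j. gh (k - j) * (1 / (of_real rate + \<i> * of_real (l k - l j)))) c"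
proof -
  define P where "P = 1 + 96 * (2 + 4 / \<gamma>) / (\<gamma>\<^sup>2 * \<delta>)"
  have P1: "P \<ge> 1" using \<gamma> \<delta> by (simp add: P_def)
  define e where "e = exp (- rate * P) / P\<^sup>2"
  have e: "e > 0" using P1 by (simp add: e_def)
  define c where "c = e * (P ^ 3 / 6 * (\<delta> / 2))"
  have "c > 0" using e P1 \<delta> by (simp add: c_def)
  moreover have "coercive (\<lambda>k j. gh (k - j) * (1 / (of_real rate + \<i> * of_real (l k - l j)))) c"
    if l: "two_to_one l \<gamma>" for l
    unfolding coercive_def
  proof (intro allI impI)
    fix A :: "int set" and a :: "int \<Rightarrow> complex" assume A: "finite A"
    let ?z = "\<lambda>y j. a j * cis (of_int j * y)"
    have "c * (\<Sum>k\<in>A. (cmod (a k))\<^sup>2) \<le> e * kform (\<lambda>k j. gh (k - j) * bump_hat P (l j - l k)) A a"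
      using bump_kernel_coercive[where gh = gh, OF l \<gamma> \<delta> g0 g1 P_def] A e
      unfolding coercive_def c_def mult.assoc by (intro mult_left_mono) (auto simp: mult.assoc)
    also have "\<dots> \<le> kform (\<lambda>k j. gh (k - j) * (1 / (of_real rate + \<i> * of_real (l k - l j)))) A a"
      unfolding kform_def
    proof (rule has_integral_le[OF has_integral_mult_right[OF form_has_integral[OF A g(1) gh]] form_has_integral[OF A g(1) gh]])
      fix y assume "y \<in> {0..2 * pi}"
      have "e * Re (\<Sum>k\<in>A. \<Sum>j\<in>A. bump_hat P (l j - l k) * ?z y j * cnj (?z y k))
         \<le> Re (\<Sum>k\<in>A. \<Sum>j\<in>A. 1 / (of_real rate + \<i> * of_real (l k - l j)) * ?z y j * cnj (?z y k))"
        unfolding e_def using P1 by (intro resolvent_form_ge_bump_form rate A) auto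
      from mult_left_mono[OF this g(2)[of y]]
      show "e * (g y * Re (\<Sum>k\<in>A. \<Sum>j\<in>A. bump_hat P (l j - l k) * ?z y j * cnj (?z y k)))
         \<le> g y * Re (\<Sum>k\<in>A. \<Sum>j\<in>A. 1 / (of_real rate + \<i> * of_real (l k - l j)) * ?z y j * cnj (?z y k))"
        by (simp only: mult.left_commute)
    qed
    finally show "c * (\<Sum>k\<in>A. (cmod (a k))\<^sup>2) \<le> kform (\<lambda>k j. gh (k - j) * (1 / (of_real rate + \<i> * of_real (l k - l j)))) A a" .
  qed
  ultimately show ?thesis by (rule that)
qed

section \<open>The control kernel and its coercivity\<close>

text \<open>The Fourier matrix of \<open>G\<close>, as \<open>G_fourier\<close> confirms. One factor
  \<open>1 / (2 * pi)\<close> comes from \<open>G1\<close> or \<open>G2\<close>, the other from the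
  Fourier coefficient of the profile; the guards \<open>\<noteq> 0\<close> record the removed
  partial means. Row and column 0 therefore vanish and the mean cannot be controlled.\<close>

definition Gker :: "(int \<Rightarrow> complex) \<Rightarrow> (int \<Rightarrow> complex) \<Rightarrow> int \<times> int \<Rightarrow> int \<times> int \<Rightarrow> complex" where
  "Gker gh1 gh2 k j = of_real (1 / (2 * pi)\<^sup>2) *
     ((if fst k = fst j \<and> fst k \<noteq> 0 then gh2 (snd k - snd j) else 0)
    + (if snd k = snd j \<and> snd k \<noteq> 0 then gh1 (fst k - fst j) else 0))"

text \<open>The solution of the Sylvester equation \<open>i (\<lambda>\<^sub>k - \<lambda>\<^sub>j) T k j + rate T k j = G k j\<close>, with the
  constant mode, on which the control does not act, added by hand.\<close>

definition Tker :: "real \<Rightarrow> (int \<times> int \<Rightarrow> real) \<Rightarrow> (int \<Rightarrow> complex) \<Rightarrow> (int \<Rightarrow> complex) \<Rightarrow>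
    int \<times> int \<Rightarrow> int \<times> int \<Rightarrow> complex" where
  "Tker rate l gh1 gh2 k j = Gker gh1 gh2 k j * (1 / (of_real rate + \<i> * of_real (l k - l j)))
     + (if k = 0 \<and> j = 0 then 1 else 0)"

lemma kform_rows:
  assumes B: "finite B"
  shows "kform (\<lambda>k j. if fst k = fst j \<and> P (fst k) then N (fst k) (snd k) (snd j) else 0) (B \<times> B) b
    = (\<Sum>m\<in>B. if P m then kform (N m) B (\<lambda>n. b (m, n)) else 0)"
proof -
  have "(\<Sum>k\<in>B \<times> B. \<Sum>j\<in>B \<times> B. (if fst k = fst j \<and> P (fst k) then N (fst k) (snd k) (snd j) else 0) * b j * cnj (b k))
     = (\<Sum>m\<in>B. \<Sum>n\<in>B. \<Sum>m'\<in>B. \<Sum>n'\<in>B. (if m = m' \<and> P m then N m n n' else 0) * b (m', n') * cnj (b (m, n)))"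
    unfolding sum.cartesian_product' fst_conv snd_conv ..
  also have "\<dots> = (\<Sum>m\<in>B. \<Sum>n\<in>B. \<Sum>m'\<in>B. if m = m' then (if P m then \<Sum>n'\<in>B. N m n n' * b (m, n') * cnj (b (m, n)) else 0) else 0)"
    by (intro sum.cong refl) auto
  also have "\<dots> = (\<Sum>m\<in>B. \<Sum>n\<in>B. if P m then \<Sum>n'\<in>B. N m n n' * b (m, n') * cnj (b (m, n)) else 0)"
    using B by (intro sum.cong refl) simp
  also have "\<dots> = (\<Sum>m\<in>B. if P m then \<Sum>n\<in>B. \<Sum>n'\<in>B. N m n n' * b (m, n') * cnj (b (m, n)) else 0)"
    by (intro sum.cong refl) auto
  finally show ?thesis unfolding kform_def by (simp add: if_distrib[of Re] cong: if_cong)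
qed

lemma kform_swap:
  "kform M (B \<times> B) b = kform (\<lambda>k j. M (prod.swap k) (prod.swap j)) (B \<times> B) (\<lambda>k. b (prod.swap k))"
proof -
  have sw: "(\<Sum>k\<in>B \<times> B. f k) = (\<Sum>k\<in>B \<times> B. f (prod.swap k))" for f :: "_ \<Rightarrow> complex"
    by (rule sum.reindex_bij_witness[of _ prod.swap prod.swap]) auto
  show ?thesis unfolding kform_def
    by (subst sw, subst (2) sw) simp
qed

text \<open>Three nonnegative forms are added: rows with nonzero first frequency, columns with
  nonzero second frequency, and the constant mode. Every lattice point is seen by at least one of
  them.\<close>

lemma Tker_coercive:
  fixes gh1 gh2 :: "int \<Rightarrow> complex"
  assumes rate: "rate > 0" and \<gamma>: "\<gamma> > 0" and \<delta>: "0 < \<delta>"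
    and g: "continuous_on {0..2 * pi} g1" "\<And>y. g1 y \<ge> 0" "continuous_on {0..2 * pi} g2" "\<And>y. g2 y \<ge> 0"
    and gh1: "\<And>n. gh1 n = integral {0..2 * pi} (\<lambda>y. of_real (g1 y) * cis (- of_int n * y))"
    and gh2: "\<And>n. gh2 n = integral {0..2 * pi} (\<lambda>y. of_real (g2 y) * cis (- of_int n * y))"
    and gh0: "gh1 0 = 1" "gh2 0 = 1"
    and \<delta>1: "\<And>n. n \<noteq> 0 \<Longrightarrow> cmod (gh1 n) \<le> 1 - \<delta>" and \<delta>2: "\<And>n. n \<noteq> 0 \<Longrightarrow> cmod (gh2 n) \<le> 1 - \<delta>"
    and row: "\<And>m. m \<noteq> 0 \<Longrightarrow> two_to_one (\<lambda>n. l (m, n)) \<gamma>" and col: "\<And>n. n \<noteq> 0 \<Longrightarrow> two_to_one (\<lambda>m. l (m, n)) \<gamma>"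
  obtains c where "c > 0" "coercive (Tker rate l gh1 gh2) c"
proof -
  let ?E = "\<lambda>l k j. 1 / (complex_of_real rate + \<i> * of_real (l k - l j))"
  obtain c1 where c1: "c1 > 0" "\<And>l. two_to_one l \<gamma> \<Longrightarrow> coercive (\<lambda>k j. gh1 (k - j) * ?E l k j) c1"
    by (rule row_coercive[OF rate \<gamma> \<delta> g(1,2) gh1 gh0(1) \<delta>1], assumption) (rule that)
  obtain c2 where c2: "c2 > 0" "\<And>l. two_to_one l \<gamma> \<Longrightarrow> coercive (\<lambda>k j. gh2 (k - j) * ?E l k j) c2"
    by (rule row_coercive[OF rate \<gamma> \<delta> g(3,4) gh2 gh0(2) \<delta>2], assumption) (rule that)
  define q where "q = 1 / (2 * pi)\<^sup>2"
  have q: "q > 0" by (simp add: q_def)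
  \<comment> \<open>The minimum with 1 is for the constant mode, whose form is exactly the squared
    modulus.\<close>
  define c where "c = min (min (q * c1) (q * c2)) 1"
  have c: "c > 0" "c \<le> q * c1" "c \<le> q * c2" "c \<le> 1" using c1 c2 q by (auto simp: c_def)
  define N2 where "N2 m n n' = of_real q * (gh2 (n - n') * ?E (\<lambda>n. l (m, n)) n n')" for m n n'
  define N1 where "N1 n m m' = of_real q * (gh1 (m - m') * ?E (\<lambda>m. l (m, n)) m m')" for n m m'
  define M2 where "M2 k j = (if fst k = fst j \<and> fst k \<noteq> 0 then N2 (fst k) (snd k) (snd j) else 0)" for k j :: "int \<times> int"
  define M1 where "M1 k j = (if snd k = snd j \<and> snd k \<noteq> 0 then N1 (snd k) (fst k) (fst j) else 0)" for k j :: "int \<times> int"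
  define M0 :: "int \<times> int \<Rightarrow> int \<times> int \<Rightarrow> complex" where "M0 k j = (if k = 0 \<and> j = 0 then 1 else 0)" for k j
  have T: "Tker rate l gh1 gh2 = (\<lambda>k j. (M2 k j + M1 k j) + M0 k j)"
  proof (intro ext)
    fix k j
    have "M2 k j = of_real q * (if fst k = fst j \<and> fst k \<noteq> 0 then gh2 (snd k - snd j) else 0) * ?E l k j"
      by (cases k; cases j) (auto simp: M2_def N2_def)
    moreover have "M1 k j = of_real q * (if snd k = snd j \<and> snd k \<noteq> 0 then gh1 (fst k - fst j) else 0) * ?E l k j"
      by (cases k; cases j) (auto simp: M1_def N1_def)
    ultimately show "Tker rate l gh1 gh2 k j = (M2 k j + M1 k j) + M0 k j"
      unfolding Tker_def Gker_def M0_def q_def[symmetric] by (simp only: ring_distribs)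
  qed
  have scale: "q * d * (\<Sum>k\<in>A. (cmod (a k))\<^sup>2) \<le> kform (\<lambda>k j. of_real q * N k j) A a"
    if "coercive N d" "finite A" for N :: "int \<Rightarrow> int \<Rightarrow> complex" and d A a
  proof -
    have "kform (\<lambda>k j. of_real q * N k j) A a = q * kform N A a"
      by (simp add: kform_def mult.assoc sum_distrib_left[symmetric])
    then show ?thesis
      using mult_left_mono[of "d * (\<Sum>k\<in>A. (cmod (a k))\<^sup>2)" "kform N A a" q] that q
      by (simp add: coercive_def mult.assoc)
  qed
  \<comment> \<open>Squares are treated first because they are unions of complete rows and of
    complete columns; \<open>kform_swap\<close> turns columns into rows.\<close>
  have box: "c * (\<Sum>k\<in>B \<times> B. (cmod (b k))\<^sup>2) \<le> kform (Tker rate l gh1 gh2) (B \<times> B) b"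
    if B: "finite B" for B :: "int set" and b
  proof -
    have 2: "(\<Sum>m\<in>B. if m \<noteq> 0 then c * (\<Sum>n\<in>B. (cmod (b (m, n)))\<^sup>2) else 0) \<le> kform M2 (B \<times> B) b"
      unfolding M2_def kform_rows[where P = "\<lambda>m. m \<noteq> 0", OF B]
    proof (intro sum_mono)
      fix m assume "m \<in> B"
      have "c * (\<Sum>n\<in>B. (cmod (b (m, n)))\<^sup>2) \<le> kform (N2 m) B (\<lambda>n. b (m, n))" if "m \<noteq> 0"
        using scale[OF c2(2)[OF row[OF that]] B, of "\<lambda>n. b (m, n)"] mult_right_mono[OF c(3), of "\<Sum>n\<in>B. (cmod (b (m, n)))\<^sup>2"]
        by (simp add: N2_def[abs_def] sum_nonneg)
      then show "(if m \<noteq> 0 then c * (\<Sum>n\<in>B. (cmod (b (m, n)))\<^sup>2) else 0) \<le> (if m \<noteq> 0 then kform (N2 m) B (\<lambda>n. b (m, n)) else 0)"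
        by simp
    qed
    have 1: "(\<Sum>n\<in>B. if n \<noteq> 0 then c * (\<Sum>m\<in>B. (cmod (b (m, n)))\<^sup>2) else 0) \<le> kform M1 (B \<times> B) b"
      unfolding kform_swap[of M1] M1_def fst_swap snd_swap kform_rows[where P = "\<lambda>m. m \<noteq> 0", OF B] swap_simp
    proof (intro sum_mono)
      fix n assume "n \<in> B"
      have "c * (\<Sum>m\<in>B. (cmod (b (m, n)))\<^sup>2) \<le> kform (N1 n) B (\<lambda>m. b (m, n))" if "n \<noteq> 0"
        using scale[OF c1(2)[OF col[OF that]] B, of "\<lambda>m. b (m, n)"] mult_right_mono[OF c(2), of "\<Sum>m\<in>B. (cmod (b (m, n)))\<^sup>2"]
        by (simp add: N1_def[abs_def] sum_nonneg)
      then show "(if n \<noteq> 0 then c * (\<Sum>m\<in>B. (cmod (b (m, n)))\<^sup>2) else 0) \<le> (if n \<noteq> 0 then kform (N1 n) B (\<lambda>m. b (m, n)) else 0)"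
        by simp
    qed
    have 0: "kform M0 (B \<times> B) b = (if 0 \<in> B then (cmod (b 0))\<^sup>2 else 0)"
    proof -
      have "(\<Sum>k\<in>B \<times> B. \<Sum>j\<in>B \<times> B. M0 k j * b j * cnj (b k))
         = (\<Sum>k\<in>B \<times> B. \<Sum>j\<in>B \<times> B. if j = 0 then (if k = 0 then b 0 * cnj (b 0) else 0) else 0)"
        by (intro sum.cong refl) (auto simp: M0_def)
      also have "\<dots> = (if 0 \<in> B \<times> B then b 0 * cnj (b 0) else 0)"
        using B by simp
      also have "\<dots> = of_real (if 0 \<in> B then (cmod (b 0))\<^sup>2 else 0)"
        by (auto simp: zero_prod_def complex_norm_square[symmetric] simp del: of_real_power)
      finally show ?thesis by (simp add: kform_def)
    qed
    have "c * (\<Sum>k\<in>B \<times> B. (cmod (b k))\<^sup>2) = (\<Sum>m\<in>B. \<Sum>n\<in>B. c * (cmod (b (m, n)))\<^sup>2)"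
      by (simp add: sum.cartesian_product' sum_distrib_left)
    also have "\<dots> \<le> (\<Sum>m\<in>B. \<Sum>n\<in>B. (if m \<noteq> 0 then c * (cmod (b (m, n)))\<^sup>2 else 0) + (if n \<noteq> 0 then c * (cmod (b (m, n)))\<^sup>2 else 0)
         + (if n = 0 then if m = 0 then (cmod (b 0))\<^sup>2 else 0 else 0))"
      using c by (intro sum_mono) (auto simp: zero_prod_def mult_left_le_one_le)
    also have "\<dots> = (\<Sum>m\<in>B. if m \<noteq> 0 then c * (\<Sum>n\<in>B. (cmod (b (m, n)))\<^sup>2) else 0)
        + (\<Sum>n\<in>B. if n \<noteq> 0 then c * (\<Sum>m\<in>B. (cmod (b (m, n)))\<^sup>2) else 0) + (if 0 \<in> B then (cmod (b 0))\<^sup>2 else 0)"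
    proof -
      have "(\<Sum>m\<in>B. \<Sum>n\<in>B. if m \<noteq> 0 then c * (cmod (b (m, n)))\<^sup>2 else 0) = (\<Sum>m\<in>B. if m \<noteq> 0 then c * (\<Sum>n\<in>B. (cmod (b (m, n)))\<^sup>2) else 0)"
        by (intro sum.cong refl) (auto simp: sum_distrib_left)
      moreover have "(\<Sum>m\<in>B. \<Sum>n\<in>B. if n \<noteq> 0 then c * (cmod (b (m, n)))\<^sup>2 else 0) = (\<Sum>n\<in>B. if n \<noteq> 0 then c * (\<Sum>m\<in>B. (cmod (b (m, n)))\<^sup>2) else 0)"
        by (subst sum.swap, intro sum.cong refl) (auto simp: sum_distrib_left)
      moreover have "(\<Sum>m\<in>B. \<Sum>n\<in>B. if n = 0 then if m = 0 then (cmod (b 0))\<^sup>2 else 0 else 0) = (if 0 \<in> B then (cmod (b 0))\<^sup>2 else 0)"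
        using B by (simp add: if_distrib[of "sum _"] cong: if_cong)
      ultimately show ?thesis by (simp only: sum.distrib)
    qed
    also have "\<dots> \<le> kform M2 (B \<times> B) b + kform M1 (B \<times> B) b + kform M0 (B \<times> B) b"
      using 1 2 0 by linarith
    finally show ?thesis unfolding T kform_add .
  qed
  \<comment> \<open>An arbitrary finite set is enclosed in a square and the family extended by zero,
    which changes neither the form nor the norm.\<close>
  have "coercive (Tker rate l gh1 gh2) c"
    unfolding coercive_def
  proof (intro allI impI)
    fix A :: "(int \<times> int) set" and a :: "int \<times> int \<Rightarrow> complex" assume A: "finite A"
    define B where "B = fst ` A \<union> snd ` A"
    have B: "finite B" "A \<subseteq> B \<times> B" using A by (auto simp: B_def) (metis fst_conv snd_conv image_eqI)+
    define b where "b k = (if k \<in> A then a k else 0)" for k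
    have s: "(\<Sum>k\<in>B \<times> B. f k) = (\<Sum>k\<in>A. f k)" if "\<And>k. k \<notin> A \<Longrightarrow> f k = 0" for f :: "int \<times> int \<Rightarrow> 'b::comm_monoid_add"
      using B that by (intro sum.mono_neutral_right) auto
    have "kform (Tker rate l gh1 gh2) (B \<times> B) b = kform (Tker rate l gh1 gh2) A b"
      unfolding kform_def by (subst s, simp add: b_def, subst s, simp add: b_def) simp
    also have "\<dots> = kform (Tker rate l gh1 gh2) A a"
      unfolding kform_def by (auto simp: b_def intro!: sum.cong)
    finally have "kform (Tker rate l gh1 gh2) (B \<times> B) b = kform (Tker rate l gh1 gh2) A a" .
    moreover have "(\<Sum>k\<in>B \<times> B. (cmod (b k))\<^sup>2) = (\<Sum>k\<in>A. (cmod (a k))\<^sup>2)"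
      by (subst s) (auto simp: b_def intro!: sum.cong)
    ultimately show "c * (\<Sum>k\<in>A. (cmod (a k))\<^sup>2) \<le> kform (Tker rate l gh1 gh2) A a"
      using box[OF B(1), of b] by simp
  qed
  then show ?thesis using that c(1) by blast
qed

section \<open>Test functions\<close>

lemma Ck_continuous: "Ck n f \<Longrightarrow> continuous_on UNIV f"
  by (cases n) auto

lemma Ck_decr: "Ck (Suc n) f \<Longrightarrow> Ck n f"
proof (induction n arbitrary: f)
  case (Suc n)
  then show ?case
    unfolding Ck.simps(2)[of "Suc n" f] Ck.simps(2)[of n f] by blast
qed (simp only: Ck.simps)

lemma Ck_has_derivs:
  assumes "Ck (Suc n) f"
  shows "((\<lambda>x'. f (x', y)) has_vector_derivative pdx f (x, y)) (at x)"
    and "((\<lambda>y'. f (x, y')) has_vector_derivative pdy f (x, y)) (at y)"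
  using assms by (auto simp: pdx_def pdy_def vector_derivative_works[symmetric])

lemma pd_eqI:
  "(\<And>x y. ((\<lambda>x'. f (x', y)) has_vector_derivative g (x, y)) (at x)) \<Longrightarrow> pdx f = g"
  "(\<And>x y. ((\<lambda>y'. f (x, y')) has_vector_derivative g (x, y)) (at y)) \<Longrightarrow> pdy f = g"
  by (auto simp: pdx_def pdy_def fun_eq_iff intro!: vector_derivative_at)

lemma Ck_SucI:
  assumes "continuous_on UNIV f"
    and "\<And>x y. ((\<lambda>x'. f (x', y)) has_vector_derivative fx (x, y)) (at x)"
    and "\<And>x y. ((\<lambda>y'. f (x, y')) has_vector_derivative fy (x, y)) (at y)"
    and "Ck n fx" "Ck n fy"
  shows "Ck (Suc n) f"
proof -
  have "pdx f = fx" "pdy f = fy" using pd_eqI assms(2,3) by blast+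
  moreover have "(\<lambda>x'. f (x', y)) differentiable (at x)" "(\<lambda>y'. f (x, y')) differentiable (at y)" for x y
    using assms(2,3) differentiableI_vector by blast+
  ultimately show ?thesis using assms by simp
qed

lemma Ck_lin:
  assumes "Ck n f" "Ck n g"
  shows "Ck n (\<lambda>p. a * f p + b * g p)"
  using assms
proof (induction n arbitrary: f g)
  case (Suc n)
  note d = Ck_has_derivs[OF Suc.prems(1)] Ck_has_derivs[OF Suc.prems(2)]
  show ?case
  proof (rule Ck_SucI)
    show "continuous_on UNIV (\<lambda>p. a * f p + b * g p)"
      by (intro continuous_intros Ck_continuous[OF Suc.prems(1)] Ck_continuous[OF Suc.prems(2)])
    show "((\<lambda>x'. a * f (x', y) + b * g (x', y)) has_vector_derivative (\<lambda>p. a * pdx f p + b * pdx g p) (x, y)) (at x)" for x y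
      by (intro has_vector_derivative_add has_vector_derivative_mult_right d)
    show "((\<lambda>y'. a * f (x, y') + b * g (x, y')) has_vector_derivative (\<lambda>p. a * pdy f p + b * pdy g p) (x, y)) (at y)" for x y
      by (intro has_vector_derivative_add has_vector_derivative_mult_right d)
  qed (use Suc in auto)
qed (auto intro!: continuous_intros)

lemma pd_lin:
  assumes "Ck 1 f" "Ck 1 g"
  shows "pdx (\<lambda>p. a * f p + b * g p) = (\<lambda>p. a * pdx f p + b * pdx g p)"
    and "pdy (\<lambda>p. a * f p + b * g p) = (\<lambda>p. a * pdy f p + b * pdy g p)"
  using assms
  by (auto intro!: pd_eqI has_vector_derivative_add has_vector_derivative_mult_right Ck_has_derivs[of 0])

lemma pd_mult:
  assumes "Ck 1 f" "Ck 1 g"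
  shows "pdx (\<lambda>p. f p * g p) = (\<lambda>p. f p * pdx g p + pdx f p * g p)"
    and "pdy (\<lambda>p. f p * g p) = (\<lambda>p. f p * pdy g p + pdy f p * g p)"
  using assms by (auto intro!: pd_eqI has_vector_derivative_mult Ck_has_derivs[of 0])

lemma Ck_mult:
  assumes "Ck n f" "Ck n g"
  shows "Ck n (\<lambda>p. f p * g p)"
  using assms
proof (induction n arbitrary: f g)
  case (Suc n)
  note d = Ck_has_derivs[OF Suc.prems(1)] Ck_has_derivs[OF Suc.prems(2)]
  note c = Ck_decr[OF Suc.prems(1)] Ck_decr[OF Suc.prems(2)]
  have p: "Ck n (pdx f)" "Ck n (pdy f)" "Ck n (pdx g)" "Ck n (pdy g)" using Suc.prems by auto
  show ?case
  proof (rule Ck_SucI)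
    show "continuous_on UNIV (\<lambda>p. f p * g p)"
      by (intro continuous_intros Ck_continuous[OF Suc.prems(1)] Ck_continuous[OF Suc.prems(2)])
    show "((\<lambda>x'. f (x', y) * g (x', y)) has_vector_derivative (\<lambda>p. f p * pdx g p + pdx f p * g p) (x, y)) (at x)" for x y
      by (intro has_vector_derivative_mult d)
    show "((\<lambda>y'. f (x, y') * g (x, y')) has_vector_derivative (\<lambda>p. f p * pdy g p + pdy f p * g p) (x, y)) (at y)" for x y
      by (intro has_vector_derivative_mult d)
    show "Ck n (\<lambda>p. f p * pdx g p + pdx f p * g p)" "Ck n (\<lambda>p. f p * pdy g p + pdy f p * g p)"
      using Ck_lin[of n _ _ 1 1, simplified] Suc.IH c p by auto
  qed
qed (auto intro!: continuous_intros)

lemma Ck_const: "Ck n (\<lambda>_. c)"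
proof (induction n arbitrary: c)
  case (Suc n)
  show ?case by (rule Ck_SucI[where fx = "\<lambda>_. 0" and fy = "\<lambda>_. 0"]) (auto intro: Suc)
qed auto

lemma test_funD:
  assumes "\<phi> \<in> test_fun"
  shows "Ck n \<phi>" "continuous_on S \<phi>" "periodic2 \<phi>"
  using assms continuous_on_subset[OF Ck_continuous[of 0 \<phi>], of S] by (auto simp: test_fun_def)

lemma test_fun_derivs:
  assumes "\<phi> \<in> test_fun"
  shows "((\<lambda>x'. \<phi> (x', y)) has_vector_derivative pdx \<phi> (x, y)) (at x)"
    and "((\<lambda>y'. \<phi> (x, y')) has_vector_derivative pdy \<phi> (x, y)) (at y)"
  using Ck_has_derivs[OF test_funD(1)[OF assms]] by auto

lemma has_vector_derivative_shift_eq: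
  fixes c :: real
  assumes "(f has_vector_derivative D) (at (x + c))"
  shows "((\<lambda>x. f (x + c)) has_vector_derivative D) (at x)"
proof -
  have "((\<lambda>x. x + c) has_vector_derivative 1) (at x)"
    by (auto intro!: derivative_eq_intros)
  from vector_diff_chain_at[OF this assms] show ?thesis by (simp add: o_def)
qed

lemma test_fun_pd:
  assumes "\<phi> \<in> test_fun"
  shows "pdx \<phi> \<in> test_fun" "pdy \<phi> \<in> test_fun"
proof -
  have C: "Ck n (pdx \<phi>)" "Ck n (pdy \<phi>)" for n
    using test_funD(1)[OF assms, of "Suc n"] by auto
  have p: "\<phi> (x + 2 * pi, y) = \<phi> (x, y)" "\<phi> (x, y + 2 * pi) = \<phi> (x, y)" for x y
    using test_funD(3)[OF assms] by (auto simp: periodic2_def)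
  note d = test_fun_derivs[OF assms]
  have "pdx \<phi> (x + 2 * pi, y) = pdx \<phi> (x, y)" "pdy \<phi> (x, y + 2 * pi) = pdy \<phi> (x, y)"
       "pdx \<phi> (x, y + 2 * pi) = pdx \<phi> (x, y)" "pdy \<phi> (x + 2 * pi, y) = pdy \<phi> (x, y)" for x y
    using has_vector_derivative_shift_eq[OF d(1)[of y "x + 2 * pi"]] has_vector_derivative_shift_eq[OF d(2)[of x "y + 2 * pi"]]
      d(1)[where x = x and y = y] d(2)[where x = x and y = y]
      d(1)[where x = x and y = "y + 2 * pi"] d(2)[where x = "x + 2 * pi" and y = y]
    unfolding p by (metis vector_derivative_at)+
  then have "periodic2 (pdx \<phi>)" "periodic2 (pdy \<phi>)" by (auto simp: periodic2_def)
  then show "pdx \<phi> \<in> test_fun" "pdy \<phi> \<in> test_fun" using C by (auto simp: test_fun_def)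
qed

lemma test_fun_pd_pow:
  assumes "\<phi> \<in> test_fun"
  shows "(pdx ^^ m) \<phi> \<in> test_fun" "(pdy ^^ m) \<phi> \<in> test_fun"
  by (induction m) (use assms test_fun_pd in auto)

lemma test_fun_lin:
  assumes "\<phi> \<in> test_fun" "\<psi> \<in> test_fun"
  shows "(\<lambda>p. a * \<phi> p + b * \<psi> p) \<in> test_fun"
  using assms Ck_lin by (auto simp: test_fun_def periodic2_def)

lemma test_fun_mult:
  assumes "\<phi> \<in> test_fun" "\<psi> \<in> test_fun"
  shows "(\<lambda>p. \<phi> p * \<psi> p) \<in> test_fun"
  using assms Ck_mult by (auto simp: test_fun_def periodic2_def)

lemma test_fun_const: "(\<lambda>_. c) \<in> test_fun"
  by (auto simp: test_fun_def periodic2_def Ck_const)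

lemma test_fun_cmult: "\<phi> \<in> test_fun \<Longrightarrow> (\<lambda>p. a * \<phi> p) \<in> test_fun"
  by (rule test_fun_mult[OF test_fun_const])

lemma test_fun_sum: "finite A \<Longrightarrow> (\<And>i. i \<in> A \<Longrightarrow> f i \<in> test_fun) \<Longrightarrow> (\<lambda>p. \<Sum>i\<in>A. f i p) \<in> test_fun"
proof (induction A rule: finite_induct)
  case (insert i A)
  then have "(\<lambda>p. 1 * f i p + 1 * (\<Sum>i\<in>A. f i p)) \<in> test_fun"
    by (intro test_fun_lin) auto
  then show ?case using insert by simp
qed (simp add: test_fun_const)

section \<open>The characters of the torus as test functions\<close>

definition ech :: "int \<times> int \<Rightarrow> real \<times> real \<Rightarrow> complex" where
  "ech k = (\<lambda>(x, y). cis (of_int (fst k) * x + of_int (snd k) * y))"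

lemma ech_uminus: "ech (- k) = (\<lambda>(x, y). cis (- (of_int (fst k) * x + of_int (snd k) * y)))"
  by (auto simp: ech_def)

lemma ech_mult: "ech k p * ech j p = ech (k + j) p"
  by (cases p) (simp add: ech_def cis_mult algebra_simps)

lemma norm_ech [simp]: "cmod (ech k p) = 1"
  by (cases p) (simp add: ech_def)

lemma ech_zero [simp]: "ech 0 p = 1"
  by (cases p) (simp add: ech_def)

lemma cis_int_2pi: "cis (of_int n * (2 * pi)) = 1"
  by (metis cis_multiple_2pi Ints_of_int mult.commute)

lemma cis_periodic: "cis (of_int n * (x + 2 * pi) + z) = cis (of_int n * x + z)"
proof -
  have "cis (of_int n * (x + 2 * pi) + z) = cis (of_int n * x + z) * cis (of_int n * (2 * pi))"
    by (simp add: cis_mult algebra_simps)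
  then show ?thesis by (simp only: cis_int_2pi mult_1_right)
qed

lemma ech_derivs:
  "((\<lambda>x'. c * ech k (x', y)) has_vector_derivative (c * (\<i> * of_int (fst k))) * ech k (x, y)) (at x)"
  "((\<lambda>y'. c * ech k (x, y')) has_vector_derivative (c * (\<i> * of_int (snd k))) * ech k (x, y)) (at y)"
proof -
  have "((\<lambda>x'. (c * cis (of_int (snd k) * y)) * cis (of_int (fst k) * x')) has_vector_derivative
      (c * cis (of_int (snd k) * y)) * (\<i> * of_real (of_int (fst k)) * cis (of_int (fst k) * x))) (at x)"
    by (intro has_vector_derivative_mult_right has_vector_derivative_cis)
  then show "((\<lambda>x'. c * ech k (x', y)) has_vector_derivative (c * (\<i> * of_int (fst k))) * ech k (x, y)) (at x)"
    by (simp add: ech_def cis_mult[symmetric] mult_ac)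
  have "((\<lambda>y'. (c * cis (of_int (fst k) * x)) * cis (of_int (snd k) * y')) has_vector_derivative
      (c * cis (of_int (fst k) * x)) * (\<i> * of_real (of_int (snd k)) * cis (of_int (snd k) * y))) (at y)"
    by (intro has_vector_derivative_mult_right has_vector_derivative_cis)
  then show "((\<lambda>y'. c * ech k (x, y')) has_vector_derivative (c * (\<i> * of_int (snd k))) * ech k (x, y)) (at y)"
    by (simp add: ech_def cis_mult[symmetric] mult_ac)
qed

lemma pd_ech:
  "pdx (\<lambda>p. c * ech k p) = (\<lambda>p. (c * (\<i> * of_int (fst k))) * ech k p)"
  "pdy (\<lambda>p. c * ech k p) = (\<lambda>p. (c * (\<i> * of_int (snd k))) * ech k p)"
  by (rule pd_eqI, rule ech_derivs)+

lemma continuous_on_ech [continuous_intros]: "continuous_on S (ech k)"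
  unfolding ech_def case_prod_beta by (intro continuous_intros)

lemma Ck_ech: "Ck n (\<lambda>p. c * ech k p)"
proof (induction n arbitrary: c)
  case (Suc n)
  show ?case by (rule Ck_SucI[OF _ ech_derivs]) (auto intro!: continuous_intros Suc)
qed (auto intro!: continuous_intros)

lemma periodic2_ech: "periodic2 (ech k)"
  using cis_periodic[of "fst k" _ "of_int (snd k) * _"] cis_periodic[of "snd k" _ "of_int (fst k) * _"]
  by (simp add: periodic2_def ech_def add.commute[of "of_int (fst k) * _"])

lemma test_fun_ech: "ech k \<in> test_fun"
  using Ck_ech[of _ 1 k] by (simp add: test_fun_def periodic2_ech)

section \<open>Lifting one-variable profiles, and reduction modulo the period\<close>

definition smooth1 :: "(real \<Rightarrow> real) \<Rightarrow> bool" where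
  "smooth1 g \<longleftrightarrow> (\<forall>n x. (deriv ^^ n) g differentiable (at x))"

lemma smooth1_deriv:
  assumes "smooth1 g"
  shows "smooth1 (deriv g)" "(g has_real_derivative deriv g x) (at x)" "continuous_on S g"
proof -
  show "smooth1 (deriv g)"
    unfolding smooth1_def
  proof (intro allI)
    fix n x
    show "(deriv ^^ n) (deriv g) differentiable (at x)"
      using assms[unfolded smooth1_def, rule_format, of "Suc n" x] by (simp add: funpow_swap1)
  qed
  have d: "g differentiable (at x)" for x
    using assms[unfolded smooth1_def, rule_format, of 0 x] by simp
  then show "(g has_real_derivative deriv g x) (at x)"
    by (simp add: DERIV_deriv_iff_real_differentiable)
  show "continuous_on S g"
    using d by (meson differentiable_at_imp_differentiable_on differentiable_imp_continuous_on
        differentiable_on_subset)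
qed

lemma smooth1_vector_derivative:
  assumes "smooth1 g"
  shows "((\<lambda>x. complex_of_real (g x)) has_vector_derivative of_real (deriv g x)) (at x)"
  using smooth1_deriv(2)[OF assms, of x]
  by (intro has_vector_derivative_of_real) (simp add: has_real_derivative_iff_has_vector_derivative)

lemma Ck_lift:
  assumes "smooth1 g"
  shows "Ck n (\<lambda>(x, y). of_real (g x))" "Ck n (\<lambda>(x, y). of_real (g y))"
proof -
  have c: "continuous_on UNIV (\<lambda>(x::real, y::real). complex_of_real (g x))" "continuous_on UNIV (\<lambda>(x::real, y::real). complex_of_real (g y))"
    if "smooth1 g" for g
    unfolding case_prod_beta
    by (intro continuous_intros continuous_on_compose2[OF smooth1_deriv(3)[OF that, of UNIV]]; simp)+
  show "Ck n (\<lambda>(x, y). of_real (g x))"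
    using assms
  proof (induction n arbitrary: g)
    case (Suc n)
    show ?case
      by (rule Ck_SucI[where fx = "\<lambda>(x, y). of_real (deriv g x)" and fy = "\<lambda>_. 0"])
        (use Suc smooth1_deriv smooth1_vector_derivative c in \<open>auto simp: Ck_const\<close>)
  qed (use c in auto)
  show "Ck n (\<lambda>(x, y). of_real (g y))"
    using assms
  proof (induction n arbitrary: g)
    case (Suc n)
    show ?case
      by (rule Ck_SucI[where fy = "\<lambda>(x, y). of_real (deriv g y)" and fx = "\<lambda>_. 0"])
        (use Suc smooth1_deriv smooth1_vector_derivative c in \<open>auto simp: Ck_const\<close>)
  qed (use c in auto)
qed

lemma test_fun_lift:
  assumes "smooth1 g" "periodic1 g"
  shows "(\<lambda>(x, y). of_real (g x)) \<in> test_fun" "(\<lambda>(x, y). of_real (g y)) \<in> test_fun"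
  using assms Ck_lift by (auto simp: test_fun_def periodic2_def periodic1_def)

lemma periodic1_shift:
  assumes "\<And>x. f (x + 2 * pi) = f x"
  shows "f (x + of_int n * (2 * pi)) = f x"
proof -
  have p: "f (x + of_nat n * (2 * pi)) = f x" for n x
  proof (induction n)
    case (Suc n)
    show ?case using assms[of "x + of_nat n * (2 * pi)"] Suc by (simp add: algebra_simps)
  qed simp
  show ?thesis
    using p[of x "nat n"] p[of "x + of_int n * (2 * pi)" "nat (- n)"] by (cases "n \<ge> 0") auto
qed

lemma periodic_reduce: obtains n :: int where "x + of_int n * (2 * pi) \<in> {0..<2 * pi}"
proof -
  define m where "m = \<lfloor>x / (2 * pi)\<rfloor>"
  have "of_int m \<le> x / (2 * pi)" "x / (2 * pi) < of_int m + 1" by (auto simp: m_def)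
  then have "of_int m * (2 * pi) \<le> x" "x < (of_int m + 1) * (2 * pi)"
    by (auto simp: pos_le_divide_eq pos_divide_less_eq)
  then have "x + of_int (- m) * (2 * pi) \<in> {0..<2 * pi}" by (simp add: algebra_simps)
  then show ?thesis by (rule that)
qed

lemma periodic2_bounded:
  assumes "periodic2 f" "continuous_on UNIV f"
  obtains B where "\<And>p. cmod (f p) \<le> B"
proof -
  have "bounded (f ` cbox (0, 0) (2 * pi, 2 * pi))"
    by (intro compact_imp_bounded compact_continuous_image continuous_on_subset[OF assms(2)]) auto
  then obtain B where B: "\<And>p. p \<in> cbox (0, 0) (2 * pi, 2 * pi) \<Longrightarrow> cmod (f p) \<le> B"
    by (auto simp: bounded_iff)
  have "cmod (f (x, y)) \<le> B" for x y
  proof -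
    obtain m where m: "x + of_int m * (2 * pi) \<in> {0..<2 * pi}" by (rule periodic_reduce)
    obtain n where n: "y + of_int n * (2 * pi) \<in> {0..<2 * pi}" by (rule periodic_reduce)
    have "f (x + of_int m * (2 * pi), y + of_int n * (2 * pi)) = f (x, y)"
      using periodic1_shift[of "\<lambda>x. f (x, y + of_int n * (2 * pi))" x m] periodic1_shift[of "\<lambda>y. f (x, y)" y n] assms(1)
      by (simp add: periodic2_def)
    then show ?thesis using B[of "(x + of_int m * (2 * pi), y + of_int n * (2 * pi))"] m n
      by (simp add: cbox_Pair_eq)
  qed
  then show ?thesis using that[of B] by auto
qed

section \<open>Fourier coefficients of test functions\<close>

definition torus :: "(real \<times> real) set" where "torus = cbox (0, 0) (2 * pi, 2 * pi)"

text \<open>With the sign \<open>+\<close> in the exponent and without normalisation, the pairing of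
  a distribution \<open>u\<close> with \<phi> is the sum of
  \<open>fourier u k * pc \<phi> k\<close>, without reflection of \<open>k\<close>.\<close>

definition pc :: "(real \<times> real \<Rightarrow> complex) \<Rightarrow> int \<times> int \<Rightarrow> complex" where
  "pc \<phi> k = integral torus (\<lambda>p. \<phi> p * ech k p)"

lemma integrable_torus: "continuous_on UNIV f \<Longrightarrow> f integrable_on torus" for f :: "real \<times> real \<Rightarrow> complex"
  unfolding torus_def by (rule integrable_continuous) (rule continuous_on_subset, auto)

lemma integral_torus:
  fixes f :: "real \<times> real \<Rightarrow> complex"
  assumes "continuous_on UNIV f"
  shows "integral torus f = integral {0..2 * pi} (\<lambda>x. integral {0..2 * pi} (\<lambda>y. f (x, y)))"
    and "integral torus f = integral {0..2 * pi} (\<lambda>y. integral {0..2 * pi} (\<lambda>x. f (x, y)))"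
proof -
  show 1: "integral torus f = integral {0..2 * pi} (\<lambda>x. integral {0..2 * pi} (\<lambda>y. f (x, y)))"
    unfolding torus_def
    using integral_prod_continuous[OF continuous_on_subset[OF assms subset_UNIV], of 0 0 "2 * pi" "2 * pi"]
    by (simp only: cbox_interval)
  show "integral torus f = integral {0..2 * pi} (\<lambda>y. integral {0..2 * pi} (\<lambda>x. f (x, y)))"
    unfolding 1
    using integral_swap_continuous[of 0 0 "2 * pi" "2 * pi" "\<lambda>x y. f (x, y)"] continuous_on_subset[OF assms]
    by (simp add: case_prod_beta)
qed

lemma integral_torus_pd:
  assumes "\<psi> \<in> test_fun"
  shows "integral torus (pdx \<psi>) = 0" "integral torus (pdy \<psi>) = 0"
proof -
  have c: "continuous_on UNIV (pdx \<psi>)" "continuous_on UNIV (pdy \<psi>)"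
    using test_funD(2)[OF test_fun_pd(1)[OF assms]] test_funD(2)[OF test_fun_pd(2)[OF assms]] by auto
  have p: "\<psi> (2 * pi, y) = \<psi> (0, y)" "\<psi> (y, 2 * pi) = \<psi> (y, 0)" for y
    using test_funD(3)[OF assms] unfolding periodic2_def by (metis add_0)+
  have "((\<lambda>x. pdx \<psi> (x, y)) has_integral (\<psi> (2 * pi, y) - \<psi> (0, y))) {0..2 * pi}" for y
    by (rule fundamental_theorem_of_calculus)
      (auto intro!: has_vector_derivative_at_within test_fun_derivs[OF assms])
  from integral_unique[OF this] show "integral torus (pdx \<psi>) = 0"
    by (simp add: integral_torus(2)[OF c(1)] p)
  have "((\<lambda>y. pdy \<psi> (x, y)) has_integral (\<psi> (x, 2 * pi) - \<psi> (x, 0))) {0..2 * pi}" for x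
    by (rule fundamental_theorem_of_calculus)
      (auto intro!: has_vector_derivative_at_within test_fun_derivs[OF assms])
  from integral_unique[OF this] show "integral torus (pdy \<psi>) = 0"
    by (simp add: integral_torus(1)[OF c(2)] p)
qed

text \<open>Periodicity makes the integral of the derivative of \<open>\<phi> * ech k\<close>
  vanish; the product rule gives the formula.\<close>

lemma pc_pd:
  assumes "\<phi> \<in> test_fun"
  shows "pc (pdx \<phi>) k = - (\<i> * of_int (fst k)) * pc \<phi> k" "pc (pdy \<phi>) k = - (\<i> * of_int (snd k)) * pc \<phi> k"
proof -
  have t: "(\<lambda>p. \<phi> p * ech k p) \<in> test_fun" by (intro test_fun_mult assms test_fun_ech)
  have i: "(\<lambda>p. \<phi> p * ech k p) integrable_on torus"
    by (intro integrable_torus continuous_intros test_funD(2)[OF assms])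
  have ix: "(\<lambda>p. pdx \<phi> p * ech k p) integrable_on torus"
    by (intro integrable_torus continuous_intros test_funD(2)[OF test_fun_pd(1)[OF assms]])
  have iy: "(\<lambda>p. pdy \<phi> p * ech k p) integrable_on torus"
    by (intro integrable_torus continuous_intros test_funD(2)[OF test_fun_pd(2)[OF assms]])
  have e: "pdx (ech k) = (\<lambda>p. \<i> * of_int (fst k) * ech k p)" "pdy (ech k) = (\<lambda>p. \<i> * of_int (snd k) * ech k p)"
    using pd_ech[of 1 k] by auto
  have "0 = integral torus (\<lambda>p. (\<i> * of_int (fst k)) * (\<phi> p * ech k p) + pdx \<phi> p * ech k p)"
    using integral_torus_pd(1)[OF t]
    by (simp add: pd_mult[OF test_funD(1)[OF assms] test_funD(1)[OF test_fun_ech]] e mult_ac)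
  also have "\<dots> = (\<i> * of_int (fst k)) * pc \<phi> k + pc (pdx \<phi>) k"
    unfolding pc_def by (subst integral_add) (auto intro!: integrable_on_mult_right i ix simp del: mult.assoc)
  finally show "pc (pdx \<phi>) k = - (\<i> * of_int (fst k)) * pc \<phi> k"
    by (simp add: eq_neg_iff_add_eq_0 add.commute)
  have "0 = integral torus (\<lambda>p. (\<i> * of_int (snd k)) * (\<phi> p * ech k p) + pdy \<phi> p * ech k p)"
    using integral_torus_pd(2)[OF t]
    by (simp add: pd_mult[OF test_funD(1)[OF assms] test_funD(1)[OF test_fun_ech]] e mult_ac)
  also have "\<dots> = (\<i> * of_int (snd k)) * pc \<phi> k + pc (pdy \<phi>) k"
    unfolding pc_def by (subst integral_add) (auto intro!: integrable_on_mult_right i iy simp del: mult.assoc)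
  finally show "pc (pdy \<phi>) k = - (\<i> * of_int (snd k)) * pc \<phi> k"
    by (simp add: eq_neg_iff_add_eq_0 add.commute)
qed

lemma pc_pd_pow:
  assumes "\<phi> \<in> test_fun"
  shows "pc ((pdx ^^ m) ((pdy ^^ n) \<phi>)) k = (- (\<i> * of_int (fst k))) ^ m * (- (\<i> * of_int (snd k))) ^ n * pc \<phi> k"
proof -
  have y: "pc ((pdy ^^ n) \<phi>) k = (- (\<i> * of_int (snd k))) ^ n * pc \<phi> k"
    by (induction n) (use test_fun_pd_pow(2)[OF assms] in \<open>auto simp: pc_pd mult.assoc\<close>)
  show ?thesis
    by (induction m) (use test_fun_pd_pow(1)[OF test_fun_pd_pow(2)[OF assms]] y in \<open>auto simp: pc_pd mult.assoc\<close>)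
qed

lemma content_torus: "measure lborel torus = (2 * pi)\<^sup>2"
  by (simp add: torus_def content_Pair power2_eq_square)

lemma pc_bound:
  assumes "continuous_on UNIV \<phi>" "\<And>p. cmod (\<phi> p) \<le> B"
  shows "cmod (pc \<phi> k) \<le> (2 * pi)\<^sup>2 * B"
proof -
  have B: "0 \<le> B" using assms(2)[of 0] norm_ge_zero[of "\<phi> 0"] by linarith
  have "cmod (pc \<phi> k) \<le> B * measure lborel torus"
    unfolding pc_def torus_def
    by (rule integrable_bound[OF B])
      (use assms integrable_torus[of "\<lambda>p. \<phi> p * ech k p"] in \<open>auto simp: norm_mult torus_def intro!: continuous_intros\<close>)
  then show ?thesis by (simp add: content_torus mult.commute)
qed

text \<open>The inner clause of \<open>distribution\<close> made a predicate: \<open>B\<close>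
  bounds the \<open>C^N\<close> norm, which is never formed as a supremum.\<close>

definition cN_bound :: "nat \<Rightarrow> (real \<times> real \<Rightarrow> complex) \<Rightarrow> real \<Rightarrow> bool" where
  "cN_bound N \<phi> B \<longleftrightarrow> (\<forall>m n p. m + n \<le> N \<longrightarrow> cmod ((pdx ^^ m) ((pdy ^^ n) \<phi>) p) \<le> B)"

lemma cN_bound_exists:
  assumes "\<phi> \<in> test_fun"
  obtains B where "cN_bound N \<phi> B"
proof -
  have "\<exists>B. \<forall>p. cmod ((pdx ^^ m) ((pdy ^^ n) \<phi>) p) \<le> B" for m n
  proof -
    have t: "(pdx ^^ m) ((pdy ^^ n) \<phi>) \<in> test_fun" by (intro test_fun_pd_pow assms)
    show ?thesis using periodic2_bounded[OF test_funD(3)[OF t] test_funD(2)[OF t]] by metis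
  qed
  then obtain B where B: "\<And>m n p. cmod ((pdx ^^ m) ((pdy ^^ n) \<phi>) p) \<le> B m n" by metis
  have B0: "0 \<le> B m n" for m n using B[of m n 0] by (rule order.trans[rotated]) simp
  have "B m n \<le> (\<Sum>m\<le>N. \<Sum>n\<le>N. B m n)" if "m + n \<le> N" for m n
  proof -
    have "B m n \<le> (\<Sum>n\<le>N. B m n)" using that B0 by (intro member_le_sum) auto
    also have "\<dots> \<le> (\<Sum>m\<le>N. \<Sum>n\<le>N. B m n)"
      using that B0 by (intro member_le_sum[of m "{..N}" "\<lambda>m. \<Sum>n\<le>N. B m n"]) (auto intro!: sum_nonneg)
    finally show ?thesis .
  qed
  then have "cN_bound N \<phi> (\<Sum>m\<le>N. \<Sum>n\<le>N. B m n)"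
    unfolding cN_bound_def using B order_trans by blast
  then show ?thesis by (rule that)
qed

lemma one_plus_power_le: "(1 + x) ^ N \<le> 2 ^ N * (1 + x ^ N)" if "x \<ge> 0" for x :: real
proof -
  have "(1 + x) ^ N \<le> (2 * max 1 x) ^ N" using that by (intro power_mono) auto
  also have "\<dots> = 2 ^ N * (max 1 x) ^ N" by (simp add: power_mult_distrib)
  also have "(max 1 x) ^ N \<le> 1 + x ^ N" using that by (auto simp: max_def)
  finally show ?thesis by simp
qed

text \<open>Two factors \<open>2 ^ N\<close> from \<open>one_plus_power_le\<close>, one per
  variable, four terms of the expanded product, and the area of the torus.\<close>

definition pc_const :: "nat \<Rightarrow> real" where "pc_const N = 4 ^ N * 4 * (2 * pi)\<^sup>2"

text \<open>Order \<open>2 * N\<close> is asked because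
  \<open>jb k <= (1 + |k1|) (1 + |k2|)\<close>, so up to \<open>N\<close> derivatives are spent in
  each variable.\<close>

lemma pc_decay:
  assumes "\<phi> \<in> test_fun" "cN_bound (2 * N) \<phi> B"
  shows "cmod (pc \<phi> k) * jb k ^ N \<le> pc_const N * B"
proof -
  let ?a = "\<bar>real_of_int (fst k)\<bar>" and ?b = "\<bar>real_of_int (snd k)\<bar>" and ?X = "(2 * pi)\<^sup>2 * B"
  have d: "?a ^ m * ?b ^ n * cmod (pc \<phi> k) \<le> ?X" if "m + n \<le> 2 * N" for m n
  proof -
    have t: "(pdx ^^ m) ((pdy ^^ n) \<phi>) \<in> test_fun" by (intro test_fun_pd_pow assms)
    have "cmod (pc ((pdx ^^ m) ((pdy ^^ n) \<phi>)) k) \<le> ?X"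
      by (rule pc_bound[OF test_funD(2)[OF t]]) (use assms(2) that in \<open>auto simp: cN_bound_def\<close>)
    then show ?thesis unfolding pc_pd_pow[OF assms(1)] by (simp add: norm_mult norm_power)
  qed
  have "jb k \<le> (1 + ?a) * (1 + ?b)"
    using freq_norm_le[of k] mult_nonneg_nonneg[of ?a ?b] by (simp add: algebra_simps del: mult_nonneg_nonneg)
  then have "jb k ^ N \<le> ((1 + ?a) * (1 + ?b)) ^ N" by (intro power_mono) auto
  also have "\<dots> = (1 + ?a) ^ N * (1 + ?b) ^ N" by (rule power_mult_distrib)
  also have "\<dots> \<le> (2 ^ N * (1 + ?a ^ N)) * (2 ^ N * (1 + ?b ^ N))"
    by (intro mult_mono one_plus_power_le) auto
  finally have "cmod (pc \<phi> k) * jb k ^ N \<le> cmod (pc \<phi> k) * ((2 ^ N * (1 + ?a ^ N)) * (2 ^ N * (1 + ?b ^ N)))"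
    by (rule mult_left_mono) simp
  also have "\<dots> = 2 ^ N * 2 ^ N * (?a ^ 0 * ?b ^ 0 * cmod (pc \<phi> k) + ?a ^ N * ?b ^ 0 * cmod (pc \<phi> k)
      + ?a ^ 0 * ?b ^ N * cmod (pc \<phi> k) + ?a ^ N * ?b ^ N * cmod (pc \<phi> k))"
    by (simp add: algebra_simps)
  also have "\<dots> \<le> 2 ^ N * 2 ^ N * (?X + ?X + ?X + ?X)"
    by (intro mult_left_mono add_mono d) auto
  also have "\<dots> = pc_const N * B"
    by (simp add: pc_const_def power_mult_distrib[symmetric])
  finally show ?thesis .
qed

section \<open>Fourier inversion\<close>

text \<open>The Weierstrass test along finite index sets: the error outside \<open>A\<close> is at
  most the tail of \<open>M\<close>, uniformly in the argument.\<close>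

lemma uniform_limit_infsum:
  fixes f :: "'i \<Rightarrow> 'x \<Rightarrow> 'b::banach"
  assumes "\<And>i x. x \<in> X \<Longrightarrow> norm (f i x) \<le> M i" "M summable_on UNIV"
  shows "uniform_limit X (\<lambda>A x. \<Sum>i\<in>A. f i x) (\<lambda>x. \<Sum>\<^sub>\<infinity>i. f i x) (finite_subsets_at_top UNIV)"
proof (rule uniform_limitI)
  fix e :: real assume e: "e > 0"
  have M: "M summable_on Y" for Y using assms(2) by (rule summable_on_subset_banach) simp
  have "((\<lambda>A. sum M A) \<longlongrightarrow> infsum M UNIV) (finite_subsets_at_top UNIV)"
    by (rule infsum_tendsto[OF assms(2)])
  then have "\<forall>\<^sub>F A in finite_subsets_at_top UNIV. dist (sum M A) (infsum M UNIV) < e"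
    using e by (rule tendstoD)
  moreover have "\<forall>\<^sub>F A in finite_subsets_at_top (UNIV :: 'i set). finite A"
    by (rule eventually_finite_subsets_at_top_weakI)
  ultimately show "\<forall>\<^sub>F A in finite_subsets_at_top UNIV. \<forall>x\<in>X. dist (\<Sum>i\<in>A. f i x) (\<Sum>\<^sub>\<infinity>i. f i x) < e"
  proof eventually_elim
    case (elim A)
    show ?case
    proof
      fix x assume x: "x \<in> X"
      have n: "(\<lambda>i. norm (f i x)) summable_on Y" for Y
        by (rule summable_on_real_comparison[OF M]) (use assms(1)[OF x] in auto)
      then have s: "(\<lambda>i. f i x) summable_on Y" for Y
        by (rule Infinite_Sum.abs_summable_summable)
      have "(\<Sum>\<^sub>\<infinity>i. f i x) = (\<Sum>i\<in>A. f i x) + (\<Sum>\<^sub>\<infinity>i\<in>- A. f i x)"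
        using infsum_Un_disjoint[OF s s, of A "- A"] elim(2) by (simp add: Compl_partition)
      then have "dist (\<Sum>i\<in>A. f i x) (\<Sum>\<^sub>\<infinity>i. f i x) = norm (\<Sum>\<^sub>\<infinity>i\<in>- A. f i x)"
        by (simp add: dist_norm)
      also have "\<dots> \<le> (\<Sum>\<^sub>\<infinity>i\<in>- A. norm (f i x))" by (rule norm_infsum_bound) (rule n)
      also have "\<dots> \<le> (\<Sum>\<^sub>\<infinity>i\<in>- A. M i)" by (rule infsum_mono[OF n M]) (rule assms(1)[OF x])
      also have "(\<Sum>\<^sub>\<infinity>i\<in>- A. M i) = infsum M UNIV - sum M A"
        using infsum_Un_disjoint[OF M M, of A "- A"] elim(2) by (simp add: Compl_partition)
      also have "\<dots> < e" using elim(1) by (simp add: dist_real_def)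
      finally show "dist (\<Sum>i\<in>A. f i x) (\<Sum>\<^sub>\<infinity>i. f i x) < e" .
    qed
  qed
qed

lemma half_one_plus_cos_nonneg: "0 \<le> (1 + cos t) / 2" for t :: real
proof -
  have "0 \<le> 1 + cos t" using cos_ge_minus_one[of t] by linarith
  then show ?thesis by (rule divide_nonneg_pos) simp
qed

lemma cos_le_cos_away:
  assumes "0 \<le> d" "d \<le> pi" "d \<le> \<bar>t\<bar>" "\<bar>t\<bar> \<le> 2 * pi - d"
  shows "cos t \<le> cos d"
proof (cases "\<bar>t\<bar> \<le> pi")
  case True
  have "cos \<bar>t\<bar> \<le> cos d" using assms True by (intro cos_monotone_0_pi_le) auto
  then show ?thesis by simp
next
  case False
  have "cos (2 * pi - \<bar>t\<bar>) \<le> cos d" using assms False by (intro cos_monotone_0_pi_le) auto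
  moreover have "cos (2 * pi - \<bar>t\<bar>) = cos t" by (simp add: cos_diff)
  ultimately show ?thesis by simp
qed

text \<open>The powers of \<open>(1 + cos (x - x0)) / 2\<close> are trigonometric polynomials concentrating at \<open>x0\<close>.\<close>

lemma fourier_unique_interior:
  fixes h :: "real \<Rightarrow> complex"
  assumes c: "continuous_on UNIV h"
    and z: "\<And>k::int. integral {0..2 * pi} (\<lambda>x. h x * cis (of_int k * x)) = 0"
    and x0: "0 < x0" "x0 < 2 * pi"
  shows "h x0 = 0"
proof (rule ccontr)
  assume nz: "h x0 \<noteq> 0"
  define K where "K n x = ((1 + cos (x - x0)) / 2) ^ n" for n x
  have c': "continuous_on S h" for S using continuous_on_subset[OF c] by auto
  have Kc: "continuous_on S (K n)" for S n unfolding K_def by (intro continuous_intros) auto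
  have KI: "integral {0..2 * pi} (\<lambda>x. h x * cis (of_int k * x) * of_real (K n x)) = 0" for n and k :: int
  proof (induction n arbitrary: k)
    case 0
    then show ?case using z by (simp add: K_def)
  next
    case (Suc n)
    let ?J = "\<lambda>k x. h x * cis (of_int k * x) * complex_of_real (K n x)"
    have i: "(?J k has_integral 0) {0..2 * pi}" for k
    proof -
      have "?J k integrable_on {0..2 * pi}"
        by (intro integrable_continuous_real continuous_intros c' Kc)
      from integrable_integral[OF this] show ?thesis unfolding Suc[of k] .
    qed
    \<comment> \<open>Multiplication by \<open>(1 + cos (x - x0)) / 2\<close> mixes the frequencies
      \<open>k\<close>, \<open>k + 1\<close> and \<open>k - 1\<close>, which is why the induction
      keeps \<open>k\<close> arbitrary.\<close>
    have "((\<lambda>x. 1/2 * ?J k x + (cis (- x0) / 4 * ?J (k + 1) x + cis x0 / 4 * ?J (k - 1) x)) has_integral (1/2 * 0 + (cis (- x0) / 4 * 0 + cis x0 / 4 * 0))) {0..2 * pi}"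
      by (intro has_integral_add has_integral_mult_right i)
    moreover have eq: "1/2 * ?J k x + (cis (- x0) / 4 * ?J (k + 1) x + cis x0 / 4 * ?J (k - 1) x) = ?J k x * of_real ((1 + cos (x - x0)) / 2)" for x
    proof -
      have 1: "cis (of_int (k + 1) * x) = cis (of_int k * x) * cis x" "cis (of_int (k - 1) * x) = cis (of_int k * x) * cis (- x)"
        by (simp_all add: cis_mult algebra_simps)
      have 2: "complex_of_real (cos (x - x0)) = (cis x * cis (- x0) + cis (- x) * cis x0) / 2"
        by (simp add: cis_mult complex_eq_iff cos_diff sin_diff cos_add sin_add algebra_simps)
      show ?thesis unfolding 1 of_real_divide of_real_add 2 by (simp add: field_simps)
    qed
    ultimately have "((\<lambda>x. ?J k x * of_real ((1 + cos (x - x0)) / 2)) has_integral 0) {0..2 * pi}"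
      unfolding eq by (simp only: mult_zero_right add_0_left)
    moreover have "of_real (K (Suc n) x) = complex_of_real (K n x) * of_real ((1 + cos (x - x0)) / 2)" for x
      by (simp only: K_def power_Suc2 of_real_mult)
    ultimately have "((\<lambda>x. h x * cis (of_int k * x) * of_real (K (Suc n) x)) has_integral 0) {0..2 * pi}"
      by (simp only: mult.assoc)
    then show ?case by (rule integral_unique)
  qed
  define f where "f x = Re (cnj (h x0) * h x)" for x
  have fc: "continuous_on S f" for S unfolding f_def by (intro continuous_intros c')
  have fK: "((\<lambda>x. f x * K n x) has_integral 0) {0..2 * pi}" for n
  proof -
    have "((\<lambda>x. h x * of_real (K n x)) has_integral 0) {0..2 * pi}"
    proof -
      have "(\<lambda>x. h x * of_real (K n x)) integrable_on {0..2 * pi}"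
        by (intro integrable_continuous_real continuous_intros c' Kc)
      from integrable_integral[OF this] show ?thesis using KI[of 0 n] by simp
    qed
    from has_integral_linear[OF has_integral_mult_right[OF this, of "cnj (h x0)"] bounded_linear_Re]
    have "((\<lambda>x. Re (cnj (h x0) * (h x * of_real (K n x)))) has_integral 0) {0..2 * pi}"
      by (simp only: o_def mult_zero_right zero_complex.sel)
    moreover have "Re (cnj (h x0) * (h x * of_real (K n x))) = f x * K n x" for x
      by (simp add: f_def algebra_simps)
    ultimately show ?thesis by (simp only:)
  qed
  have "f x0 = (cmod (h x0))\<^sup>2" unfolding f_def mult.commute[of "cnj _"] by (rule Re_mult_cnj_self)
  then have f0: "f x0 > 0" using nz by simp
  have "isCont f x0" using fc[of UNIV] by (simp add: continuous_on_eq_continuous_at)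
  then obtain d0 where d0: "d0 > 0" "\<And>x. \<bar>x - x0\<bar> < d0 \<Longrightarrow> \<bar>f x - f x0\<bar> < f x0 / 2"
    using f0 unfolding continuous_at_eps_delta dist_real_def by (metis half_gt_zero)
  \<comment> \<open>Being at most \<open>x0\<close> and \<open>2 * pi - x0\<close>, it keeps the
    window inside one period and makes \<open>cos_le_cos_away\<close> applicable to every other
    point of the interval.\<close>
  define d where "d = min (min d0 (pi)) (min x0 (2 * pi - x0))"
  have d: "d > 0" "d \<le> d0" "d \<le> pi" "d \<le> x0" "d \<le> 2 * pi - x0" using d0 x0 by (auto simp: d_def)
  define m where "m = f x0 / 2"
  have m: "m > 0" using f0 by (simp add: m_def)
  have near: "f x > m" if "\<bar>x - x0\<bar> < d" for x
    using d0(2)[of x] that d unfolding m_def by (auto simp: abs_if split: if_splits)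
  obtain B where B: "\<And>x. x \<in> {0..2 * pi} \<Longrightarrow> \<bar>f x\<bar> \<le> B"
    using compact_imp_bounded[OF compact_continuous_image[OF fc compact_Icc[of 0 "2 * pi"]]]
    unfolding bounded_iff by (metis imageI real_norm_def)
  have B0: "B \<ge> 0" using B[of 0] by auto
  define q1 where "q1 = (1 + cos (d / 2)) / 2"
  define q2 where "q2 = (1 + cos d) / 2"
  have q: "0 \<le> q2" "q2 < q1" "0 < q1"
  proof -
    show "0 \<le> q2" unfolding q2_def by (rule half_one_plus_cos_nonneg)
    have "cos d < cos (d / 2)" using d by (intro cos_monotone_0_pi) auto
    then show "q2 < q1" by (simp add: q1_def q2_def)
    then show "0 < q1" using \<open>0 \<le> q2\<close> by linarith
  qed
  \<comment> \<open>\<open>q1\<close> and \<open>q2\<close> are the values of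
    \<open>(1 + cos) / 2\<close> at distance \<open>d / 2\<close> and \<open>d\<close> from
    \<open>x0\<close>. The inner window contributes at least \<open>m * d * q1 ^ n\<close>, the ring
    between is nonnegative, and the rest loses at most \<open>2 * pi * B * q2 ^ n\<close>. As
    \<open>q2 < q1\<close>, a large \<open>n\<close> is contradictory.\<close>
  have main: "m * d * q1 ^ n \<le> 2 * pi * B * q2 ^ n" for n
  proof -
    let ?I = "{x0 - d / 2..x0 + d / 2}"
    have "((\<lambda>x. m * q1 ^ n) has_integral ((x0 + d / 2) - (x0 - d / 2)) * (m * q1 ^ n)) ?I"
      using has_integral_const_real[of "m * q1 ^ n" "x0 - d / 2" "x0 + d / 2"] d by simp
    then have "((\<lambda>x. if x \<in> ?I then m * q1 ^ n else 0) has_integral (d * (m * q1 ^ n))) {0..2 * pi}"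
      using d by (subst has_integral_restrict) auto
    moreover have "((\<lambda>x. B * q2 ^ n) has_integral (2 * pi * (B * q2 ^ n))) {0..2 * pi}"
      using has_integral_const_real[of "B * q2 ^ n" 0 "2 * pi"] by simp
    ultimately have "((\<lambda>x. (if x \<in> ?I then m * q1 ^ n else 0) - B * q2 ^ n) has_integral (d * (m * q1 ^ n) - 2 * pi * (B * q2 ^ n))) {0..2 * pi}"
      by (rule has_integral_diff)
    then have "d * (m * q1 ^ n) - 2 * pi * (B * q2 ^ n) \<le> 0"
    proof (rule has_integral_le[OF _ fK[of n]])
      fix x assume x: "x \<in> {0..2 * pi}"
      have Kp: "K n x \<ge> 0" unfolding K_def by (intro zero_le_power half_one_plus_cos_nonneg)
      have Bq: "0 \<le> B * q2 ^ n" using B0 q by auto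
      consider "\<bar>x - x0\<bar> \<le> d / 2" | "d / 2 < \<bar>x - x0\<bar>" "\<bar>x - x0\<bar> < d" | "d \<le> \<bar>x - x0\<bar>" by linarith
      then show "(if x \<in> ?I then m * q1 ^ n else 0) - B * q2 ^ n \<le> f x * K n x"
      proof cases
        case 1
        have "cos (d / 2) \<le> cos \<bar>x - x0\<bar>" using d 1 by (intro cos_monotone_0_pi_le) auto
        then have "q1 \<le> (1 + cos (x - x0)) / 2" by (simp add: q1_def)
        then have "q1 ^ n \<le> K n x" unfolding K_def using q by (intro power_mono) auto
        then have "m * q1 ^ n \<le> f x * K n x"
          using near[of x] 1 d m q by (intro mult_mono) auto
        moreover have "0 \<le> m * q1 ^ n" using m q by simp
        ultimately show ?thesis using Bq by (auto split: if_splits)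
      next
        case 2
        have "0 \<le> f x * K n x" using near[OF 2(2)] m Kp by simp
        moreover have "x \<notin> ?I" using 2(1) by (auto simp: abs_if split: if_splits)
        ultimately show ?thesis using Bq by (auto split: if_splits)
      next
        case 3
        have "cos (x - x0) \<le> cos d" using 3 d x by (intro cos_le_cos_away) auto
        then have "(1 + cos (x - x0)) / 2 \<le> q2" by (simp add: q2_def)
        then have Kq: "K n x \<le> q2 ^ n" unfolding K_def by (intro power_mono half_one_plus_cos_nonneg)
        have "\<bar>f x * K n x\<bar> \<le> B * q2 ^ n"
          unfolding abs_mult using B[OF x] Kq Kp B0 by (intro mult_mono) auto
        moreover have "x \<notin> ?I" using 3 d by (auto simp: abs_if split: if_splits)
        ultimately show ?thesis by (auto simp: abs_le_iff split: if_splits)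
      qed
    qed
    then show ?thesis by (simp add: mult_ac)
  qed
  have "(\<lambda>n. 2 * pi * B * (q2 / q1) ^ n) \<longlonglongrightarrow> 2 * pi * B * 0"
    using q by (intro tendsto_mult tendsto_const LIMSEQ_power_zero) auto
  moreover have "m * d \<le> 2 * pi * B * (q2 / q1) ^ n" for n
    using main[of n] q by (simp add: power_divide pos_le_divide_eq)
  ultimately have "m * d \<le> 0" by (intro LIMSEQ_le_const) auto
  then show False using m d by (simp add: mult_le_0_iff)
qed

text \<open>The concentration argument needs an interior point; continuity adds the endpoints and
  periodicity the rest of the line.\<close>

lemma fourier_unique1:
  fixes h :: "real \<Rightarrow> complex"
  assumes c: "continuous_on UNIV h" and p: "\<And>x. h (x + 2 * pi) = h x"
    and z: "\<And>k::int. integral {0..2 * pi} (\<lambda>x. h x * cis (of_int k * x)) = 0"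
  shows "h x = 0"
proof -
  have "closure {0<..<2 * pi} \<subseteq> {x. h x = 0}"
  proof (rule closure_minimal)
    show "{0<..<2 * pi} \<subseteq> {x. h x = 0}" using fourier_unique_interior[OF c z] by auto
    have "closed (h -` {0})" by (rule closed_vimage[OF closed_singleton c])
    then show "closed {x. h x = 0}" by (simp add: vimage_def)
  qed
  then have "h x = 0" if "x \<in> {0..2 * pi}" for x using that by auto
  moreover obtain n :: int where "x + of_int n * (2 * pi) \<in> {0..<2 * pi}" by (rule periodic_reduce)
  moreover have "h (x + of_int n * (2 * pi)) = h x" by (rule periodic1_shift[where f = h, OF p])
  ultimately show ?thesis by fastforce
qed

text \<open>Uniqueness in one variable is used twice: the partial coefficients \<open>f k2\<close>
  in \<open>y\<close> vanish as functions of \<open>x\<close>, and then so does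
  \<open>h (x, y)\<close> as a function of \<open>y\<close>.\<close>

lemma fourier_unique2:
  fixes h :: "real \<times> real \<Rightarrow> complex"
  assumes c: "continuous_on UNIV h" and p: "periodic2 h" and z: "\<And>k. pc h k = 0"
  shows "h q = 0"
proof -
  define f where "f k2 x = integral {0..2 * pi} (\<lambda>y. h (x, y) * cis (of_int k2 * y))" for k2 :: int and x
  have f0: "f k2 x = 0" for k2 x
  proof (rule fourier_unique1[of "f k2"])
    have "continuous_on (UNIV \<times> cbox 0 (2 * pi)) (\<lambda>(x, y). h (x, y) * cis (of_int k2 * y))"
      unfolding case_prod_beta by (intro continuous_intros continuous_on_compose2[OF c]) auto
    from integral_continuous_on_param[OF this]
    show "continuous_on UNIV (f k2)" by (simp add: f_def[abs_def])
    show "f k2 (x + 2 * pi) = f k2 x" for x using p by (simp add: f_def periodic2_def)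
    fix k1 :: int
    have "0 = pc h (k1, k2)" using z by simp
    also have "\<dots> = integral {0..2 * pi} (\<lambda>x. integral {0..2 * pi} (\<lambda>y. h (x, y) * ech (k1, k2) (x, y)))"
      unfolding pc_def by (rule integral_torus) (intro continuous_intros c)
    also have "\<dots> = integral {0..2 * pi} (\<lambda>x. f k2 x * cis (of_int k1 * x))"
    proof (rule arg_cong[where f = "integral _"], rule ext)
      fix x
      have "(\<lambda>y. h (x, y) * ech (k1, k2) (x, y)) = (\<lambda>y. h (x, y) * cis (of_int k2 * y) * cis (of_int k1 * x))"
        by (simp add: ech_def cis_mult[symmetric] mult_ac)
      then show "integral {0..2 * pi} (\<lambda>y. h (x, y) * ech (k1, k2) (x, y)) = f k2 x * cis (of_int k1 * x)"
        by (simp add: f_def)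
    qed
    finally show "integral {0..2 * pi} (\<lambda>x. f k2 x * cis (of_int k1 * x)) = 0" by simp
  qed
  have "h (x, y) = 0" for x y
  proof (rule fourier_unique1[of "\<lambda>y. h (x, y)"])
    show "continuous_on UNIV (\<lambda>y. h (x, y))" by (intro continuous_on_compose2[OF c] continuous_intros) auto
    show "\<And>y. h (x, y + 2 * pi) = h (x, y)" using p by (simp add: periodic2_def)
    show "\<And>k::int. integral {0..2 * pi} (\<lambda>y. h (x, y) * cis (of_int k * y)) = 0" using f0 by (simp add: f_def)
  qed
  then show ?thesis by (cases q) simp
qed

section \<open>Rules for coefficients, termwise integration and the inversion formula\<close>

lemma pc_cmult: "pc (\<lambda>p. c * \<phi> p) k = c * pc \<phi> k"
  by (simp add: pc_def mult.assoc)

lemma pc_lin: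
  assumes "continuous_on UNIV \<phi>" "continuous_on UNIV \<psi>"
  shows "pc (\<lambda>p. a * \<phi> p + b * \<psi> p) k = a * pc \<phi> k + b * pc \<psi> k"
proof -
  have i: "(\<lambda>p. \<phi> p * ech k p) integrable_on torus" "(\<lambda>p. \<psi> p * ech k p) integrable_on torus"
    by (intro integrable_torus continuous_intros assms)+
  have "pc (\<lambda>p. a * \<phi> p + b * \<psi> p) k = integral torus (\<lambda>p. a * (\<phi> p * ech k p) + b * (\<psi> p * ech k p))"
    by (simp add: pc_def algebra_simps)
  also have "\<dots> = integral torus (\<lambda>p. a * (\<phi> p * ech k p)) + integral torus (\<lambda>p. b * (\<psi> p * ech k p))"
    by (intro integral_add integrable_on_mult_right i)
  finally show ?thesis by (simp add: pc_def)
qed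

lemma pc_shift: "pc (\<lambda>p. \<phi> p * ech j p) k = pc \<phi> (j + k)"
  by (simp add: pc_def mult.assoc ech_mult)

lemma pc_one: "pc (\<lambda>_. 1) k = (if k = 0 then (2 * pi)\<^sup>2 else 0)"
proof (cases "k = 0")
  case True
  have "pc (\<lambda>_. 1) 0 = measure lborel torus *\<^sub>R (1::complex)"
    by (simp add: pc_def torus_def)
  then show ?thesis using True by (simp add: content_torus scaleR_conv_of_real)
next
  case False
  have 1: "pdx (\<lambda>_. 1) = (\<lambda>_. 0)" "pdy (\<lambda>_. 1) = (\<lambda>_. 0)" by (rule pd_eqI, simp)+
  have "pc (\<lambda>_. 0) k = 0" by (simp add: pc_def)
  then have "of_int (fst k) * pc (\<lambda>_. 1) k = 0" "of_int (snd k) * pc (\<lambda>_. 1) k = 0"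
    using pc_pd[OF test_fun_const, of 1 k] unfolding 1 by auto
  then show ?thesis using False by (auto simp: prod_eq_iff)
qed

lemma pc_ech: "pc (ech j) k = (if j + k = 0 then (2 * pi)\<^sup>2 else 0)"
  using pc_shift[of "\<lambda>_. 1" j k] by (simp add: pc_one)

lemma pc_summable:
  assumes "\<phi> \<in> test_fun"
  shows "(\<lambda>k. jb k ^ N * cmod (pc \<phi> k)) summable_on UNIV"
proof -
  obtain B where B: "cN_bound (2 * (N + 4)) \<phi> B" by (rule cN_bound_exists[OF assms])
  show ?thesis
  proof (rule summable_on_real_comparison)
    show "(\<lambda>k. pc_const (N + 4) * B * (1 / jb k ^ 4)) summable_on UNIV"
      by (intro summable_on_cmult_right summable_on_jb4)
    fix k
    have "0 < jb k ^ 4" by (intro zero_less_power add_pos_nonneg) auto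
    then show "\<bar>jb k ^ N * cmod (pc \<phi> k)\<bar> \<le> pc_const (N + 4) * B * (1 / jb k ^ 4)"
      using pc_decay[OF assms B, of k] by (simp add: pos_le_divide_eq power_add mult_ac abs_mult)
  qed
qed

lemma infsum_uniform_integral:
  fixes f :: "'i \<Rightarrow> real \<times> real \<Rightarrow> complex"
  assumes c: "\<And>i. continuous_on UNIV (f i)" and M: "\<And>i p. cmod (f i p) \<le> M i" "M summable_on UNIV"
  shows "continuous_on UNIV (\<lambda>p. \<Sum>\<^sub>\<infinity>i. f i p)"
    and "((\<lambda>i. integral torus (f i)) has_sum integral torus (\<lambda>p. \<Sum>\<^sub>\<infinity>i. f i p)) UNIV"
proof -
  have u: "uniform_limit X (\<lambda>A p. \<Sum>i\<in>A. f i p) (\<lambda>p. \<Sum>\<^sub>\<infinity>i. f i p) (finite_subsets_at_top UNIV)" for X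
    by (rule uniform_limit_infsum) (use M in auto)
  show "continuous_on UNIV (\<lambda>p. \<Sum>\<^sub>\<infinity>i. f i p)"
    by (rule uniform_limit_theorem[OF always_eventually u]) (auto intro!: continuous_intros c)
  obtain I J where IJ: "\<And>A. ((\<lambda>p. \<Sum>i\<in>A. f i p) has_integral I A) torus"
    "((\<lambda>p. \<Sum>\<^sub>\<infinity>i. f i p) has_integral J) torus" "(I \<longlongrightarrow> J) (finite_subsets_at_top UNIV)"
    unfolding torus_def
    by (rule uniform_limit_integral_cbox[OF u[of "cbox (0, 0) (2 * pi, 2 * pi)"]])
      (auto intro!: continuous_on_sum continuous_on_subset[OF c])
  have "I A = (\<Sum>i\<in>A. integral torus (f i))" if "finite A" for A
    using integral_unique[OF IJ(1)] integral_sum[OF that, of f torus] integrable_torus[OF c] by simp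
  then have "((\<lambda>A. \<Sum>i\<in>A. integral torus (f i)) \<longlongrightarrow> J) (finite_subsets_at_top UNIV)"
    using IJ(3) by (rule_tac Lim_transform_eventually[OF IJ(3)]) (auto intro!: eventually_finite_subsets_at_top_weakI)
  then show "((\<lambda>i. integral torus (f i)) has_sum integral torus (\<lambda>p. \<Sum>\<^sub>\<infinity>i. f i p)) UNIV"
    using integral_unique[OF IJ(2)] by (simp add: has_sum_def)
qed

text \<open>Because of the sign in \<open>pc\<close>, this is the usual Fourier coefficient at
  \<open>- k\<close>; hence the character \<open>ech (- k)\<close> in the inversion formula.\<close>

definition fc :: "(real \<times> real \<Rightarrow> complex) \<Rightarrow> int \<times> int \<Rightarrow> complex" where
  "fc \<phi> k = pc \<phi> k / (2 * pi)\<^sup>2"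

lemma fc_summable: "\<phi> \<in> test_fun \<Longrightarrow> (\<lambda>k. jb k ^ N * cmod (fc \<phi> k)) summable_on UNIV"
  using summable_on_cmult_left[OF pc_summable, of \<phi> N "inverse ((2 * pi)\<^sup>2)"]
  by (simp add: fc_def norm_divide norm_power norm_mult field_simps)

text \<open>The absolutely convergent series defines a continuous periodic function with the same
  coefficients as \<phi>, and \<open>fourier_unique2\<close> identifies the two.\<close>

lemma fourier_inversion:
  assumes "\<phi> \<in> test_fun"
  shows "(\<Sum>\<^sub>\<infinity>k. fc \<phi> k * ech (- k) p) = \<phi> p"
proof -
  define F where "F p = (\<Sum>\<^sub>\<infinity>k. fc \<phi> k * ech (- k) p)" for p
  have s: "(\<lambda>k. cmod (fc \<phi> k)) summable_on UNIV" using fc_summable[OF assms, of 0] by simp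
  have Fc: "continuous_on UNIV F"
    unfolding F_def by (rule infsum_uniform_integral[where M = "\<lambda>k. cmod (fc \<phi> k)"])
      (auto intro!: continuous_intros s simp: norm_mult)
  have Fp: "periodic2 F"
    using periodic2_ech unfolding periodic2_def F_def by simp
  have "pc F j = pc \<phi> j" for j
  proof -
    have "((\<lambda>k. integral torus (\<lambda>p. fc \<phi> k * ech (- k) p * ech j p)) has_sum
        integral torus (\<lambda>p. \<Sum>\<^sub>\<infinity>k. fc \<phi> k * ech (- k) p * ech j p)) UNIV"
      by (rule infsum_uniform_integral[where M = "\<lambda>k. cmod (fc \<phi> k)"])
        (auto intro!: continuous_intros s simp: norm_mult)
    moreover have "(\<lambda>p. \<Sum>\<^sub>\<infinity>k. fc \<phi> k * ech (- k) p * ech j p) = (\<lambda>p. F p * ech j p)"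
      unfolding F_def infsum_cmult_left' ..
    moreover have "integral torus (\<lambda>p. fc \<phi> k * ech (- k) p * ech j p) = (if k = j then pc \<phi> j else 0)" for k
    proof -
      have "integral torus (\<lambda>p. fc \<phi> k * ech (- k) p * ech j p) = fc \<phi> k * pc (ech (- k)) j"
        unfolding pc_def[symmetric] by (rule pc_cmult)
      then show ?thesis by (simp add: pc_ech fc_def)
    qed
    ultimately have "((\<lambda>k. if k = j then pc \<phi> j else 0) has_sum pc F j) UNIV"
      by (simp add: pc_def)
    moreover have "((\<lambda>k. if k = j then pc \<phi> j else 0) has_sum pc \<phi> j) UNIV"
      by (rule has_sum_finite_neutralI[of "{j}"]) auto
    ultimately show ?thesis by (rule has_sum_unique)
  qed
  then have "pc (\<lambda>p. 1 * F p + (- 1) * \<phi> p) j = 0" for j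
    by (subst pc_lin[OF Fc test_funD(2)[OF assms]]) simp
  moreover have "continuous_on UNIV (\<lambda>p. 1 * F p + (- 1) * \<phi> p)"
    by (intro continuous_intros Fc test_funD(2)[OF assms])
  moreover have "periodic2 (\<lambda>p. 1 * F p + (- 1) * \<phi> p)"
    using Fp test_funD(3)[OF assms] by (simp add: periodic2_def)
  ultimately have "1 * F p + (- 1) * \<phi> p = 0" for p
    using fourier_unique2[of "\<lambda>p. 1 * F p + (- 1) * \<phi> p"] by blast
  then show ?thesis by (simp add: F_def)
qed

section \<open>Convergence of partial Fourier sums with all derivatives\<close>

lemma pd_pow_lin:
  assumes "\<phi> \<in> test_fun" "\<psi> \<in> test_fun"
  shows "(pdx ^^ m) ((pdy ^^ n) (\<lambda>p. a * \<phi> p + b * \<psi> p)) = (\<lambda>p. a * (pdx ^^ m) ((pdy ^^ n) \<phi>) p + b * (pdx ^^ m) ((pdy ^^ n) \<psi>) p)"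
proof -
  have y: "(pdy ^^ n) (\<lambda>p. a * \<phi> p + b * \<psi> p) = (\<lambda>p. a * (pdy ^^ n) \<phi> p + b * (pdy ^^ n) \<psi> p)"
  proof (induction n)
    case (Suc n)
    show ?case
      unfolding funpow.simps o_apply Suc
      by (rule pd_lin) (intro test_funD(1) test_fun_pd_pow assms)+
  qed simp
  show ?thesis unfolding y
  proof (induction m)
    case (Suc m)
    show ?case
      unfolding funpow.simps o_apply Suc
      by (rule pd_lin) (intro test_funD(1) test_fun_pd_pow assms)+
  qed simp
qed

lemma pd_pow_ech:
  "(pdx ^^ m) ((pdy ^^ n) (\<lambda>p. c * ech k p)) = (\<lambda>p. c * ((\<i> * of_int (fst k)) ^ m * (\<i> * of_int (snd k)) ^ n) * ech k p)"
proof -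
  have y: "(pdy ^^ n) (\<lambda>p. c * ech k p) = (\<lambda>p. (c * (\<i> * of_int (snd k)) ^ n) * ech k p)" for n
  proof (induction n)
    case (Suc n)
    then have "(pdy ^^ Suc n) (\<lambda>p. c * ech k p) = (\<lambda>p. (c * (\<i> * of_int (snd k)) ^ n * (\<i> * of_int (snd k))) * ech k p)"
      by (simp add: pd_ech)
    then show ?case by (simp add: mult_ac)
  qed simp
  have x: "(pdx ^^ m) (\<lambda>p. c * ech k p) = (\<lambda>p. (c * (\<i> * of_int (fst k)) ^ m) * ech k p)" for c m
  proof (induction m)
    case (Suc n)
    then have "(pdx ^^ Suc n) (\<lambda>p. c * ech k p) = (\<lambda>p. (c * (\<i> * of_int (fst k)) ^ n * (\<i> * of_int (fst k))) * ech k p)"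
      by (simp add: pd_ech)
    then show ?case by (simp add: mult_ac)
  qed simp
  show ?thesis unfolding y x by (simp add: mult_ac)
qed

lemma pd_pow_sum_ech:
  assumes "finite A"
  shows "(pdx ^^ m) ((pdy ^^ n) (\<lambda>p. \<Sum>k\<in>A. c k * ech (- k) p)) p
    = (\<Sum>k\<in>A. c k * ((- (\<i> * of_int (fst k))) ^ m * (- (\<i> * of_int (snd k))) ^ n) * ech (- k) p)"
  using assms
proof (induction A rule: finite_induct)
  case empty
  show ?case using pd_pow_ech[of m n 0 0] by simp
next
  case (insert k A)
  have "(\<lambda>p. \<Sum>k\<in>insert k A. c k * ech (- k) p) = (\<lambda>p. 1 * (c k * ech (- k) p) + 1 * (\<Sum>k\<in>A. c k * ech (- k) p))"
    using insert by simp
  moreover have "(\<lambda>p. c k * ech (- k) p) \<in> test_fun" "(\<lambda>p. \<Sum>k\<in>A. c k * ech (- k) p) \<in> test_fun"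
    using insert by (auto intro!: test_fun_sum test_fun_cmult test_fun_ech)
  ultimately show ?case
    using pd_pow_lin[of "\<lambda>p. c k * ech (- k) p" "\<lambda>p. \<Sum>k\<in>A. c k * ech (- k) p" m n 1 1] insert
    by (simp add: pd_pow_ech)
qed

text \<open>Inversion is applied to each derivative of \<phi>, whose coefficients carry at most
  \<open>N\<close> extra powers of the frequency. The tails tend to zero, so Fourier sums converge
  in the topology in which distributions are continuous.\<close>

lemma partial_sum_cN_bound:
  assumes \<phi>: "\<phi> \<in> test_fun" and A: "finite A"
  shows "cN_bound N (\<lambda>p. 1 * \<phi> p + (- 1) * (\<Sum>k\<in>A. fc \<phi> k * ech (- k) p)) (\<Sum>\<^sub>\<infinity>k\<in>- A. jb k ^ N * cmod (fc \<phi> k))"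
  unfolding cN_bound_def
proof (intro allI impI)
  fix m n p assume mn: "m + n \<le> N"
  let ?\<psi> = "(pdx ^^ m) ((pdy ^^ n) \<phi>)"
  have t: "?\<psi> \<in> test_fun" by (intro test_fun_pd_pow \<phi>)
  have fc: "fc ?\<psi> k = fc \<phi> k * ((- (\<i> * of_int (fst k))) ^ m * (- (\<i> * of_int (snd k))) ^ n)" for k
    by (simp add: fc_def pc_pd_pow[OF \<phi>])
  have sa: "(\<lambda>p. \<Sum>k\<in>A. fc \<phi> k * ech (- k) p) \<in> test_fun"
    by (intro test_fun_sum A test_fun_cmult test_fun_ech)
  have sum: "(\<lambda>k. cmod (fc ?\<psi> k * ech (- k) p)) summable_on X" for X
    using summable_on_subset_banach[OF fc_summable[OF t, of 0], of X] by (simp add: norm_mult)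
  note sum' = Infinite_Sum.abs_summable_summable[OF sum]
  have "(pdx ^^ m) ((pdy ^^ n) (\<lambda>p. 1 * \<phi> p + (- 1) * (\<Sum>k\<in>A. fc \<phi> k * ech (- k) p))) p
     = ?\<psi> p - (\<Sum>k\<in>A. fc ?\<psi> k * ech (- k) p)"
    unfolding pd_pow_lin[OF \<phi> sa] pd_pow_sum_ech[OF A] fc by simp
  also have "?\<psi> p = (\<Sum>k\<in>A. fc ?\<psi> k * ech (- k) p) + (\<Sum>\<^sub>\<infinity>k\<in>- A. fc ?\<psi> k * ech (- k) p)"
    unfolding fourier_inversion[OF t, of p, symmetric]
    using infsum_Un_disjoint[OF sum' sum', of A "- A"] A by (simp add: Compl_partition)
  finally have "cmod ((pdx ^^ m) ((pdy ^^ n) (\<lambda>p. 1 * \<phi> p + (- 1) * (\<Sum>k\<in>A. fc \<phi> k * ech (- k) p))) p)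
      = cmod (\<Sum>\<^sub>\<infinity>k\<in>- A. fc ?\<psi> k * ech (- k) p)" by simp
  also have "\<dots> \<le> (\<Sum>\<^sub>\<infinity>k\<in>- A. cmod (fc ?\<psi> k * ech (- k) p))"
    by (rule norm_infsum_bound[OF sum])
  also have "\<dots> \<le> (\<Sum>\<^sub>\<infinity>k\<in>- A. jb k ^ N * cmod (fc \<phi> k))"
  proof (rule infsum_mono[OF sum])
    show "(\<lambda>k. jb k ^ N * cmod (fc \<phi> k)) summable_on - A"
      using summable_on_subset_banach[OF fc_summable[OF \<phi>]] by simp
    fix k
    have "\<bar>real_of_int (fst k)\<bar> ^ m * \<bar>real_of_int (snd k)\<bar> ^ n \<le> jb k ^ m * jb k ^ n"
      using abs_le_freq_norm[of k] by (intro mult_mono power_mono) auto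
    also have "\<dots> \<le> jb k ^ N" unfolding power_add[symmetric] by (rule power_increasing[OF mn]) simp
    finally show "cmod (fc ?\<psi> k * ech (- k) p) \<le> jb k ^ N * cmod (fc \<phi> k)"
      by (simp add: fc norm_mult norm_power mult.commute mult_left_mono)
  qed
  finally show "cmod ((pdx ^^ m) ((pdy ^^ n) (\<lambda>p. 1 * \<phi> p + (- 1) * (\<Sum>k\<in>A. fc \<phi> k * ech (- k) p))) p)
     \<le> (\<Sum>\<^sub>\<infinity>k\<in>- A. jb k ^ N * cmod (fc \<phi> k))" .
qed

section \<open>Distributions and their Fourier coefficients\<close>

lemma distribution_iff:
  "distribution u \<longleftrightarrow> u \<in> extensional test_fun \<and>
     (\<forall>\<phi>\<in>test_fun. \<forall>\<psi>\<in>test_fun. \<forall>a b. u (\<lambda>p. a * \<phi> p + b * \<psi> p) = a * u \<phi> + b * u \<psi>) \<and>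
     (\<exists>C N. \<forall>\<phi>\<in>test_fun. \<forall>B. cN_bound N \<phi> B \<longrightarrow> cmod (u \<phi>) \<le> C * B)"
  by (simp add: distribution_def cN_bound_def)

lemma distribution_lin:
  "distribution u \<Longrightarrow> \<phi> \<in> test_fun \<Longrightarrow> \<psi> \<in> test_fun \<Longrightarrow> u (\<lambda>p. a * \<phi> p + b * \<psi> p) = a * u \<phi> + b * u \<psi>"
  by (simp add: distribution_iff)

lemma distribution_cmult: "distribution u \<Longrightarrow> \<phi> \<in> test_fun \<Longrightarrow> u (\<lambda>p. a * \<phi> p) = a * u \<phi>"
  using distribution_lin[of u \<phi> \<phi> a 0] by simp

lemma distribution_sum:
  assumes "distribution u" "finite A" "\<And>k. k \<in> A \<Longrightarrow> f k \<in> test_fun"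
  shows "u (\<lambda>p. \<Sum>k\<in>A. c k * f k p) = (\<Sum>k\<in>A. c k * u (f k))"
  using assms(2,3)
proof (induction A rule: finite_induct)
  case empty
  show ?case using distribution_cmult[OF assms(1) test_fun_const, of 0 1] by simp
next
  case (insert k A)
  have "(\<lambda>p. \<Sum>k\<in>A. c k * f k p) \<in> test_fun" using insert by (intro test_fun_sum test_fun_cmult) auto
  then show ?case
    using distribution_lin[OF assms(1), of "f k" "\<lambda>p. \<Sum>k\<in>A. c k * f k p" "c k" 1] insert by simp
qed

lemma fourier_ech: "fourier u k = u (ech (- k)) / (2 * pi)\<^sup>2"
  by (simp add: fourier_def ech_uminus)

text \<open>At most polynomial growth is exactly the property of Fourier coefficients of
  distributions: \<open>fourier_polyg\<close> and \<open>distribution_synth\<close> are the two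
  directions.\<close>

definition polyg :: "(int \<times> int \<Rightarrow> complex) \<Rightarrow> bool" where
  "polyg a \<longleftrightarrow> (\<exists>C N. \<forall>k. cmod (a k) \<le> C * jb k ^ N)"

lemma cN_bound_ech: "cN_bound N (ech k) (jb k ^ N)"
  unfolding cN_bound_def
proof (intro allI impI)
  fix m n p assume mn: "m + n \<le> N"
  have "cmod ((pdx ^^ m) ((pdy ^^ n) (ech k)) p) = \<bar>real_of_int (fst k)\<bar> ^ m * \<bar>real_of_int (snd k)\<bar> ^ n"
    using pd_pow_ech[of m n 1 k] by (simp add: norm_mult norm_power)
  also have "\<dots> \<le> jb k ^ m * jb k ^ n"
    using abs_le_freq_norm[of k] by (intro mult_mono power_mono) auto
  also have "\<dots> \<le> jb k ^ N" unfolding power_add[symmetric] by (rule power_increasing[OF mn]) simp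
  finally show "cmod ((pdx ^^ m) ((pdy ^^ n) (ech k)) p) \<le> jb k ^ N" .
qed

lemma fourier_polyg:
  assumes "distribution u"
  shows "polyg (fourier u)"
proof -
  obtain C N where C: "\<And>\<phi> B. \<phi> \<in> test_fun \<Longrightarrow> cN_bound N \<phi> B \<Longrightarrow> cmod (u \<phi>) \<le> C * B"
    using assms unfolding distribution_iff by blast
  have "cmod (fourier u k) \<le> C / (2 * pi)\<^sup>2 * jb k ^ N" for k
    using C[OF test_fun_ech cN_bound_ech, of "- k"]
    by (simp add: fourier_ech norm_divide norm_mult norm_power divide_right_mono)
  then show ?thesis unfolding polyg_def by blast
qed

text \<open>A distribution is bounded by some \<open>C^N\<close> norm, so it may be applied termwise
  to the Fourier series of \<phi>. From here on distributions are handled as coefficient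
  families.\<close>

lemma distribution_pairing:
  assumes u: "distribution u" and \<phi>: "\<phi> \<in> test_fun"
  shows "((\<lambda>k. fourier u k * pc \<phi> k) has_sum u \<phi>) UNIV"
proof -
  obtain C N where C: "\<And>\<phi> B. \<phi> \<in> test_fun \<Longrightarrow> cN_bound N \<phi> B \<Longrightarrow> cmod (u \<phi>) \<le> C * B"
    using u unfolding distribution_iff by blast
  let ?F = "finite_subsets_at_top (UNIV :: (int \<times> int) set)"
  let ?r = "\<lambda>A. \<Sum>\<^sub>\<infinity>k\<in>- A. jb k ^ N * cmod (fc \<phi> k)"
  let ?S = "\<lambda>A p. \<Sum>k\<in>A. fc \<phi> k * ech (- k) p"
  have s: "(\<lambda>k. jb k ^ N * cmod (fc \<phi> k)) summable_on X" for X
    by (rule summable_on_subset_banach[OF fc_summable[OF \<phi>]]) simp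
  have r: "?r A = (\<Sum>\<^sub>\<infinity>k. jb k ^ N * cmod (fc \<phi> k)) - (\<Sum>k\<in>A. jb k ^ N * cmod (fc \<phi> k))" if "finite A" for A
    using infsum_Un_disjoint[OF s s, of A "- A"] that by (simp add: Compl_partition)
  have b: "cmod (u \<phi> - (\<Sum>k\<in>A. fourier u k * pc \<phi> k)) \<le> C * ?r A" if A: "finite A" for A
  proof -
    have t: "?S A \<in> test_fun" by (intro test_fun_sum A test_fun_cmult test_fun_ech)
    have "u (?S A) = (\<Sum>k\<in>A. fourier u k * pc \<phi> k)"
      by (subst distribution_sum[OF u A test_fun_ech]) (simp add: fc_def fourier_ech mult_ac)
    then have "u (\<lambda>p. 1 * \<phi> p + (- 1) * ?S A p) = u \<phi> - (\<Sum>k\<in>A. fourier u k * pc \<phi> k)"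
      using distribution_lin[OF u \<phi> t, of 1 "- 1"] by simp
    moreover have "(\<lambda>p. 1 * \<phi> p + (- 1) * ?S A p) \<in> test_fun" by (intro test_fun_lin \<phi> t)
    ultimately show ?thesis using C[OF _ partial_sum_cN_bound[OF \<phi> A]] by metis
  qed
  have "((\<lambda>A. C * ((\<Sum>\<^sub>\<infinity>k. jb k ^ N * cmod (fc \<phi> k)) - (\<Sum>k\<in>A. jb k ^ N * cmod (fc \<phi> k)))) \<longlongrightarrow>
     C * ((\<Sum>\<^sub>\<infinity>k. jb k ^ N * cmod (fc \<phi> k)) - (\<Sum>\<^sub>\<infinity>k. jb k ^ N * cmod (fc \<phi> k)))) ?F"
    by (intro tendsto_intros infsum_tendsto s)
  then have "((\<lambda>A. C * ((\<Sum>\<^sub>\<infinity>k. jb k ^ N * cmod (fc \<phi> k)) - (\<Sum>k\<in>A. jb k ^ N * cmod (fc \<phi> k)))) \<longlongrightarrow> 0) ?F"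
    by (simp only: diff_self mult_zero_right)
  moreover have "\<forall>\<^sub>F A in ?F. norm (u \<phi> - (\<Sum>k\<in>A. fourier u k * pc \<phi> k))
      \<le> C * ((\<Sum>\<^sub>\<infinity>k. jb k ^ N * cmod (fc \<phi> k)) - (\<Sum>k\<in>A. jb k ^ N * cmod (fc \<phi> k)))"
  proof (rule eventually_finite_subsets_at_top_weakI)
    fix A :: "(int \<times> int) set" assume A: "finite A"
    show "norm (u \<phi> - (\<Sum>k\<in>A. fourier u k * pc \<phi> k))
      \<le> C * ((\<Sum>\<^sub>\<infinity>k. jb k ^ N * cmod (fc \<phi> k)) - (\<Sum>k\<in>A. jb k ^ N * cmod (fc \<phi> k)))"
      using b[OF A] unfolding r[OF A] .
  qed
  ultimately have "((\<lambda>A. u \<phi> - (\<Sum>k\<in>A. fourier u k * pc \<phi> k)) \<longlongrightarrow> 0) ?F"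
    by (rule Lim_null_comparison[rotated])
  then have "((\<lambda>A. u \<phi> - (u \<phi> - (\<Sum>k\<in>A. fourier u k * pc \<phi> k))) \<longlongrightarrow> u \<phi> - 0) ?F"
    by (intro tendsto_diff tendsto_const)
  then show ?thesis by (simp add: has_sum_def)
qed

lemma distribution_eqI:
  assumes "distribution u" "distribution v" "\<And>k. fourier u k = fourier v k"
  shows "u = v"
proof (rule extensionalityI[of _ test_fun])
  show "u \<in> extensional test_fun" "v \<in> extensional test_fun"
    using assms(1,2) by (auto simp: distribution_iff)
  fix \<phi> assume "\<phi> \<in> test_fun"
  then show "u \<phi> = v \<phi>"
    using has_sum_unique[OF distribution_pairing[OF assms(1)]] distribution_pairing[OF assms(2)] assms(3)
    by simp
qed

text \<open>The inverse of \<open>fourier\<close> on families of polynomial growth; every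
  distribution constructed below is given in this form.\<close>

definition synth :: "(int \<times> int \<Rightarrow> complex) \<Rightarrow> functional" where
  "synth a = (\<lambda>\<phi>\<in>test_fun. \<Sum>\<^sub>\<infinity>k. a k * pc \<phi> k)"

lemma polyg_pc_bound:
  assumes C: "\<And>k. cmod (a k) \<le> C * jb k ^ N" and \<phi>: "\<phi> \<in> test_fun" and B: "cN_bound (2 * (N + 4)) \<phi> B"
  shows "cmod (a k * pc \<phi> k) \<le> C * pc_const (N + 4) * B * (1 / jb k ^ 4)"
proof -
  have p: "0 < jb k ^ 4" by (intro zero_less_power add_pos_nonneg) auto
  have C0: "0 \<le> C"
    using C[of 0] by (simp add: freq_norm_def) (rule order.trans[rotated], assumption, simp)
  have "cmod (a k * pc \<phi> k) * jb k ^ 4 \<le> C * jb k ^ N * cmod (pc \<phi> k) * jb k ^ 4"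
    unfolding norm_mult by (intro mult_right_mono C) auto
  also have "\<dots> = C * (cmod (pc \<phi> k) * jb k ^ (N + 4))" by (simp add: power_add mult_ac)
  also have "\<dots> \<le> C * (pc_const (N + 4) * B)"
    by (intro mult_left_mono pc_decay[OF \<phi> B] C0)
  finally show ?thesis using p by (simp add: pos_le_divide_eq mult.assoc)
qed

lemma polyg_pc_summable:
  assumes "polyg a" "\<phi> \<in> test_fun"
  shows "(\<lambda>k. cmod (a k * pc \<phi> k)) summable_on UNIV" "(\<lambda>k. a k * pc \<phi> k) summable_on UNIV"
proof -
  obtain C N where C: "\<And>k. cmod (a k) \<le> C * jb k ^ N" using assms(1) by (auto simp: polyg_def)
  obtain B where B: "cN_bound (2 * (N + 4)) \<phi> B" by (rule cN_bound_exists[OF assms(2)])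
  show "(\<lambda>k. cmod (a k * pc \<phi> k)) summable_on UNIV"
    by (rule summable_on_real_comparison[OF summable_on_cmult_right[OF summable_on_jb4]])
      (use polyg_pc_bound[OF C assms(2) B] in simp)
  then show "(\<lambda>k. a k * pc \<phi> k) summable_on UNIV" by (rule Infinite_Sum.abs_summable_summable)
qed

lemma distribution_synth:
  assumes a: "polyg a"
  shows "distribution (synth a)"
  unfolding distribution_iff
proof (intro conjI ballI allI)
  show "synth a \<in> extensional test_fun" by (simp add: synth_def)
  fix \<phi> \<psi> and c d :: complex assume t: "\<phi> \<in> test_fun" "\<psi> \<in> test_fun"
  have "(\<Sum>\<^sub>\<infinity>k. a k * pc (\<lambda>p. c * \<phi> p + d * \<psi> p) k) = (\<Sum>\<^sub>\<infinity>k. c * (a k * pc \<phi> k) + d * (a k * pc \<psi> k))"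
    by (simp add: pc_lin[OF test_funD(2)[OF t(1)] test_funD(2)[OF t(2)]] algebra_simps)
  also have "\<dots> = (\<Sum>\<^sub>\<infinity>k. c * (a k * pc \<phi> k)) + (\<Sum>\<^sub>\<infinity>k. d * (a k * pc \<psi> k))"
    by (intro infsum_add summable_on_cmult_right polyg_pc_summable(2)[OF a] t)
  finally show "synth a (\<lambda>p. c * \<phi> p + d * \<psi> p) = c * synth a \<phi> + d * synth a \<psi>"
    using t test_fun_lin[OF t] by (simp add: synth_def infsum_cmult_right')
next
  obtain C N where C: "\<And>k. cmod (a k) \<le> C * jb k ^ N" using a by (auto simp: polyg_def)
  have "cmod (synth a \<phi>) \<le> C * pc_const (N + 4) * jb_sum * B" if t: "\<phi> \<in> test_fun" and B: "cN_bound (2 * (N + 4)) \<phi> B" for \<phi> B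
  proof -
    have "cmod (synth a \<phi>) \<le> (\<Sum>\<^sub>\<infinity>k. cmod (a k * pc \<phi> k))"
      using t norm_infsum_bound[OF polyg_pc_summable(1)[OF a t]] by (simp add: synth_def)
    also have "\<dots> \<le> (\<Sum>\<^sub>\<infinity>k. C * pc_const (N + 4) * B * (1 / jb k ^ 4))"
      by (intro infsum_mono polyg_pc_summable(1)[OF a t] summable_on_cmult_right summable_on_jb4 polyg_pc_bound[OF C t B])
    also have "\<dots> = C * pc_const (N + 4) * B * jb_sum" unfolding jb_sum_def by (rule infsum_cmult_right')
    finally show ?thesis by (simp add: mult_ac)
  qed
  then show "\<exists>C N. \<forall>\<phi>\<in>test_fun. \<forall>B. cN_bound N \<phi> B \<longrightarrow> cmod (synth a \<phi>) \<le> C * B" by blast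
qed

lemma fourier_synth: "fourier (synth a) k = a k"
proof -
  have "(\<Sum>\<^sub>\<infinity>j. a j * pc (ech (- k)) j) = a k * (2 * pi)\<^sup>2"
    by (rule infsumI, rule has_sum_finite_neutralI[of "{k}"]) (auto simp: pc_ech)
  then show ?thesis by (simp add: fourier_ech synth_def test_fun_ech)
qed

lemma synth_fourier: "distribution u \<Longrightarrow> synth (fourier u) = u"
  by (intro distribution_eqI distribution_synth fourier_polyg) (auto simp: fourier_synth)

text \<open>Discharges the definite description in \<open>multiplier\<close>: existence by
  \<open>distribution_synth\<close>, uniqueness by \<open>distribution_eqI\<close>.\<close>

lemma multiplier_eq:
  assumes "polyg (\<lambda>k. m k * fourier u k)"
  shows "multiplier m u = synth (\<lambda>k. m k * fourier u k)"
  unfolding multiplier_def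
  by (rule the_equality) (auto intro: distribution_synth[OF assms] distribution_eqI simp: fourier_synth distribution_synth[OF assms])

lemma polyg_add: "polyg a \<Longrightarrow> polyg b \<Longrightarrow> polyg (\<lambda>k. c * a k + d * b k)"
proof -
  assume "polyg a" "polyg b"
  then obtain C N D M where *: "\<And>k. cmod (a k) \<le> C * jb k ^ N" "\<And>k. cmod (b k) \<le> D * jb k ^ M"
    unfolding polyg_def by metis
  have "cmod (c * a k + d * b k) \<le> (cmod c * \<bar>C\<bar> + cmod d * \<bar>D\<bar>) * jb k ^ (N + M)" for k
  proof -
    have 1: "jb k ^ N \<le> jb k ^ (N + M)" "jb k ^ M \<le> jb k ^ (N + M)" by (intro power_increasing; simp)+
    have "cmod (a k) \<le> \<bar>C\<bar> * jb k ^ N" using *(1)[of k] by (rule order.trans) (simp add: mult_right_mono)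
    also have "\<dots> \<le> \<bar>C\<bar> * jb k ^ (N + M)" by (intro mult_left_mono 1) auto
    finally have a: "cmod (a k) \<le> \<bar>C\<bar> * jb k ^ (N + M)" .
    have "cmod (b k) \<le> \<bar>D\<bar> * jb k ^ M" using *(2)[of k] by (rule order.trans) (simp add: mult_right_mono)
    also have "\<dots> \<le> \<bar>D\<bar> * jb k ^ (N + M)" by (intro mult_left_mono 1) auto
    finally have b: "cmod (b k) \<le> \<bar>D\<bar> * jb k ^ (N + M)" .
    have "cmod (c * a k + d * b k) \<le> cmod c * cmod (a k) + cmod d * cmod (b k)"
      by (rule order.trans[OF norm_triangle_ineq]) (simp add: norm_mult)
    also have "\<dots> \<le> cmod c * (\<bar>C\<bar> * jb k ^ (N + M)) + cmod d * (\<bar>D\<bar> * jb k ^ (N + M))"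
      by (intro add_mono mult_left_mono a b) auto
    finally show ?thesis by (simp add: algebra_simps)
  qed
  then show ?thesis unfolding polyg_def by blast
qed

lemma polyg_mult: "polyg a \<Longrightarrow> polyg b \<Longrightarrow> polyg (\<lambda>k. a k * b k)"
proof -
  assume "polyg a" "polyg b"
  then obtain C N D M where *: "\<And>k. cmod (a k) \<le> C * jb k ^ N" "\<And>k. cmod (b k) \<le> D * jb k ^ M"
    unfolding polyg_def by metis
  have "cmod (a k * b k) \<le> (C * D) * jb k ^ (N + M)" for k
    using mult_mono[OF *(1)[of k] *(2)[of k]] order.trans[OF norm_ge_zero *(1)[of k]]
    by (simp add: norm_mult power_add mult_ac)
  then show ?thesis unfolding polyg_def by blast
qed

lemma polyg_bounded: "(\<And>k. cmod (a k) \<le> C) \<Longrightarrow> polyg a"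
  unfolding polyg_def by (intro exI[of _ C] exI[of _ 0]) simp

lemma dist_lin_synth:
  assumes "distribution u" "distribution v"
  shows "distribution (dist_lin a u b v)" "fourier (dist_lin a u b v) k = a * fourier u k + b * fourier v k"
proof -
  show f: "fourier (dist_lin a u b v) k = a * fourier u k + b * fourier v k" for k
    by (simp add: fourier_ech dist_lin_def test_fun_ech add_divide_distrib)
  have "dist_lin a u b v = synth (\<lambda>k. a * fourier u k + b * fourier v k)"
  proof (rule extensionalityI[of _ test_fun])
    fix \<phi> assume t: "\<phi> \<in> test_fun"
    have "((\<lambda>k. a * (fourier u k * pc \<phi> k) + b * (fourier v k * pc \<phi> k)) has_sum (a * u \<phi> + b * v \<phi>)) UNIV"
      by (intro has_sum_add has_sum_cmult_right distribution_pairing assms t)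
    from infsumI[OF this] show "dist_lin a u b v \<phi> = synth (\<lambda>k. a * fourier u k + b * fourier v k) \<phi>"
      using t by (simp add: dist_lin_def synth_def algebra_simps)
  qed (auto simp: dist_lin_def synth_def)
  then show "distribution (dist_lin a u b v)"
    using distribution_synth[OF polyg_add[OF fourier_polyg[OF assms(1)] fourier_polyg[OF assms(2)]]] by simp
qed

lemma polyg_freq: "polyg (\<lambda>k. of_int (fst k))"
proof -
  have "cmod (of_int (fst k)) \<le> 1 * jb k ^ 1" for k
    using abs_le_freq_norm(1)[of k] by simp
  then show ?thesis unfolding polyg_def by blast
qed

lemma dist_dx_synth:
  assumes "distribution u"
  shows "distribution (dist_dx u)" "fourier (dist_dx u) k = \<i> * of_int (fst k) * fourier u k"
proof -
  have p: "polyg (\<lambda>k. \<i> * of_int (fst k) * fourier u k)"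
    by (intro polyg_mult fourier_polyg assms polyg_freq polyg_bounded[of _ 1]) simp
  have "dist_dx u = synth (\<lambda>k. \<i> * of_int (fst k) * fourier u k)"
  proof (rule extensionalityI[of _ test_fun])
    fix \<phi> assume t: "\<phi> \<in> test_fun"
    have "((\<lambda>k. - (fourier u k * pc (pdx \<phi>) k)) has_sum - u (pdx \<phi>)) UNIV"
      by (intro has_sum_uminusI distribution_pairing assms test_fun_pd t)
    from infsumI[OF this] show "dist_dx u \<phi> = synth (\<lambda>k. \<i> * of_int (fst k) * fourier u k) \<phi>"
      using t by (simp add: dist_dx_def synth_def pc_pd mult_ac)
  qed (auto simp: dist_dx_def synth_def)
  then show "distribution (dist_dx u)" "fourier (dist_dx u) k = \<i> * of_int (fst k) * fourier u k"
    using distribution_synth[OF p] by (auto simp: fourier_synth)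
qed

section \<open>The control operator on the Fourier side\<close>

text \<open>The convolution theorem: the Fourier series of \<open>g\<close> is inserted and
  integrated term by term.\<close>

lemma pc_mult:
  assumes g: "g \<in> test_fun" and \<phi>: "\<phi> \<in> test_fun"
  shows "((\<lambda>n. fc g n * pc \<phi> (k - n)) has_sum pc (\<lambda>p. g p * \<phi> p) k) UNIV"
proof -
  obtain B where B: "\<And>p. cmod (\<phi> p) \<le> B"
    using periodic2_bounded[OF test_funD(3)[OF \<phi>] test_funD(2)[OF \<phi>]] by metis
  have "((\<lambda>n. integral torus (\<lambda>p. fc g n * ech (- n) p * (\<phi> p * ech k p))) has_sum
      integral torus (\<lambda>p. \<Sum>\<^sub>\<infinity>n. fc g n * ech (- n) p * (\<phi> p * ech k p))) UNIV"
  proof (rule infsum_uniform_integral(2)[where M = "\<lambda>n. cmod (fc g n) * B"])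
    show "cmod (fc g n * ech (- n) p * (\<phi> p * ech k p)) \<le> cmod (fc g n) * B" for n p
      using B[of p] by (simp add: norm_mult mult_left_mono)
    show "(\<lambda>n. cmod (fc g n) * B) summable_on UNIV"
      using summable_on_cmult_left[OF fc_summable[OF g, of 0]] by simp
  qed (intro continuous_intros test_funD(2)[OF \<phi>])
  moreover have "(\<lambda>p. \<Sum>\<^sub>\<infinity>n. fc g n * ech (- n) p * (\<phi> p * ech k p)) = (\<lambda>p. g p * \<phi> p * ech k p)"
    unfolding infsum_cmult_left' fourier_inversion[OF g] by (simp add: mult.assoc)
  moreover have "integral torus (\<lambda>p. fc g n * ech (- n) p * (\<phi> p * ech k p)) = fc g n * pc \<phi> (k - n)" for n
  proof -
    have "integral torus (\<lambda>p. fc g n * ech (- n) p * (\<phi> p * ech k p)) = integral torus (\<lambda>p. fc g n * (\<phi> p * ech (k - n) p))"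
      using ech_mult[of "- n" _ k] by (intro arg_cong[where f = "integral torus"] ext) (simp add: mult_ac)
    then show ?thesis by (simp add: pc_def)
  qed
  ultimately show ?thesis by (simp add: pc_def)
qed

lemma jb_submult: "jb k \<le> jb n * jb (k - n)"
proof -
  have *: "1 + (a + b) \<le> (1 + a) * (1 + b)" if "0 \<le> a" "0 \<le> b" for a b :: real
    using that by (simp add: algebra_simps)
  have "freq_norm k \<le> freq_norm n + freq_norm (k - n)" using freq_norm_triangle[of n "k - n"] by simp
  then show ?thesis using *[OF freq_norm_nonneg freq_norm_nonneg, of n "k - n"] by linarith
qed

text \<open>The order estimate is made on coefficients instead of by the Leibniz rule.
  \<open>jb_submult\<close> distributes the weight over the convolution, so \<open>D\<close>, a
  weighted absolute sum for \<open>g\<close>, multiplies the decay constant of \<phi>.\<close>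

lemma distribution_mult_dist:
  assumes g: "g \<in> test_fun" and u: "distribution u"
  shows "distribution (mult_dist g u)"
  unfolding distribution_iff
proof (intro conjI ballI allI)
  show "mult_dist g u \<in> extensional test_fun" by (simp add: mult_dist_def)
  fix \<phi> \<psi> and c d :: complex assume t: "\<phi> \<in> test_fun" "\<psi> \<in> test_fun"
  have "(\<lambda>p. g p * (c * \<phi> p + d * \<psi> p)) = (\<lambda>p. c * (g p * \<phi> p) + d * (g p * \<psi> p))"
    by (simp add: algebra_simps)
  then show "mult_dist g u (\<lambda>p. c * \<phi> p + d * \<psi> p) = c * mult_dist g u \<phi> + d * mult_dist g u \<psi>"
    using distribution_lin[OF u test_fun_mult[OF g t(1)] test_fun_mult[OF g t(2)]] t test_fun_lin[OF t]
    by (simp add: mult_dist_def)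
next
  obtain C N where C: "\<And>k. cmod (fourier u k) \<le> C * jb k ^ N"
    using fourier_polyg[OF u] by (auto simp: polyg_def)
  have C0: "0 \<le> C"
    using C[of 0] by (simp add: freq_norm_def) (rule order.trans[rotated], assumption, simp)
  let ?M = "N + 4"
  define D where "D = (\<Sum>\<^sub>\<infinity>n. jb n ^ ?M * cmod (fc g n))"
  have "cmod (mult_dist g u \<phi>) \<le> C * (D * pc_const ?M) * jb_sum * B" if t: "\<phi> \<in> test_fun" and B: "cN_bound (2 * ?M) \<phi> B" for \<phi> B
  proof -
    note gt = test_fun_mult[OF g t]
    have d: "cmod (pc (\<lambda>p. g p * \<phi> p) k) * jb k ^ ?M \<le> D * (pc_const ?M * B)" for k
    proof -
      have X: "jb k ^ ?M * cmod (fc g n * pc \<phi> (k - n)) \<le> jb n ^ ?M * cmod (fc g n) * (pc_const ?M * B)" for n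
      proof -
        have "jb k ^ ?M * cmod (fc g n * pc \<phi> (k - n)) \<le> (jb n * jb (k - n)) ^ ?M * cmod (fc g n * pc \<phi> (k - n))"
          by (intro mult_right_mono power_mono jb_submult) auto
        also have "\<dots> = jb n ^ ?M * cmod (fc g n) * (cmod (pc \<phi> (k - n)) * jb (k - n) ^ ?M)"
          by (simp only: power_mult_distrib norm_mult mult_ac)
        also have "\<dots> \<le> jb n ^ ?M * cmod (fc g n) * (pc_const ?M * B)"
          by (intro mult_left_mono pc_decay[OF t B]) auto
        finally show ?thesis .
      qed
      have s: "(\<lambda>n. jb n ^ ?M * cmod (fc g n) * (pc_const ?M * B)) summable_on UNIV"
        by (intro summable_on_cmult_left fc_summable g)
      have s1: "(\<lambda>n. jb k ^ ?M * cmod (fc g n * pc \<phi> (k - n))) summable_on UNIV"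
        by (rule summable_on_real_comparison[OF s]) (use X in \<open>simp add: abs_mult\<close>)
      have "jb k ^ ?M \<noteq> 0" by (intro power_not_zero) (use freq_norm_nonneg[of k] in linarith)
      then have s2: "(\<lambda>n. cmod (fc g n * pc \<phi> (k - n))) summable_on UNIV"
        using summable_on_cmult_right[OF s1, of "inverse (jb k ^ ?M)"] by (simp add: mult.assoc[symmetric])
      have "jb k ^ ?M * cmod (pc (\<lambda>p. g p * \<phi> p) k) \<le> jb k ^ ?M * (\<Sum>\<^sub>\<infinity>n. cmod (fc g n * pc \<phi> (k - n)))"
        using norm_infsum_bound[OF s2] infsumI[OF pc_mult[OF g t, of k]] by (intro mult_left_mono) auto
      also have "\<dots> = (\<Sum>\<^sub>\<infinity>n. jb k ^ ?M * cmod (fc g n * pc \<phi> (k - n)))" by (rule infsum_cmult_right'[symmetric])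
      also have "\<dots> \<le> (\<Sum>\<^sub>\<infinity>n. jb n ^ ?M * cmod (fc g n) * (pc_const ?M * B))"
        by (rule infsum_mono[OF s1 s X])
      also have "\<dots> = D * (pc_const ?M * B)" unfolding D_def by (rule infsum_cmult_left')
      finally show ?thesis by (simp add: mult.commute)
    qed
    have e: "cmod (fourier u k * pc (\<lambda>p. g p * \<phi> p) k) \<le> C * (D * (pc_const ?M * B)) * (1 / jb k ^ 4)" for k
    proof -
      have p: "0 < jb k ^ 4" by (intro zero_less_power add_pos_nonneg) auto
      have "cmod (fourier u k * pc (\<lambda>p. g p * \<phi> p) k) * jb k ^ 4 \<le> C * jb k ^ N * cmod (pc (\<lambda>p. g p * \<phi> p) k) * jb k ^ 4"
        unfolding norm_mult by (intro mult_right_mono C) auto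
      also have "\<dots> = C * (cmod (pc (\<lambda>p. g p * \<phi> p) k) * jb k ^ ?M)" by (simp add: power_add mult_ac)
      also have "\<dots> \<le> C * (D * (pc_const ?M * B))" by (intro mult_left_mono d C0)
      finally show ?thesis using p by (simp add: pos_le_divide_eq)
    qed
    have s: "(\<lambda>k. cmod (fourier u k * pc (\<lambda>p. g p * \<phi> p) k)) summable_on UNIV"
      by (rule polyg_pc_summable[OF fourier_polyg[OF u] gt])
    have "cmod (mult_dist g u \<phi>) = cmod (\<Sum>\<^sub>\<infinity>k. fourier u k * pc (\<lambda>p. g p * \<phi> p) k)"
      using infsumI[OF distribution_pairing[OF u gt]] t by (simp add: mult_dist_def)
    also have "\<dots> \<le> (\<Sum>\<^sub>\<infinity>k. cmod (fourier u k * pc (\<lambda>p. g p * \<phi> p) k))" by (rule norm_infsum_bound[OF s])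
    also have "\<dots> \<le> (\<Sum>\<^sub>\<infinity>k. C * (D * (pc_const ?M * B)) * (1 / jb k ^ 4))"
      by (intro infsum_mono s summable_on_cmult_right summable_on_jb4 e)
    also have "\<dots> = C * (D * (pc_const ?M * B)) * jb_sum" unfolding jb_sum_def by (rule infsum_cmult_right')
    finally show ?thesis by (simp add: mult_ac)
  qed
  then show "\<exists>C N. \<forall>\<phi>\<in>test_fun. \<forall>B. cN_bound N \<phi> B \<longrightarrow> cmod (mult_dist g u \<phi>) \<le> C * B" by blast
qed

lemma fourier_mult_dist:
  assumes g: "g \<in> test_fun" and u: "distribution u"
  shows "((\<lambda>j. fc g (j - k) * fourier u j) has_sum fourier (mult_dist g u) k) UNIV"
proof -
  have "((\<lambda>j. fourier u j * pc (\<lambda>p. g p * ech (- k) p) j * (1 / (2 * pi)\<^sup>2)) has_sum u (\<lambda>p. g p * ech (- k) p) * (1 / (2 * pi)\<^sup>2)) UNIV"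
    by (intro has_sum_cmult_left distribution_pairing u test_fun_mult g test_fun_ech)
  then show ?thesis
    by (simp add: pc_shift fc_def fourier_ech mult_dist_def test_fun_ech mult_ac)
qed

section \<open>Partial integrals over one variable\<close>

definition Ix :: "(real \<times> real \<Rightarrow> complex) \<Rightarrow> real \<times> real \<Rightarrow> complex" where
  "Ix \<phi> = (\<lambda>(x, y). integral {0..2 * pi} (\<lambda>x'. \<phi> (x', y)))"

definition Iy :: "(real \<times> real \<Rightarrow> complex) \<Rightarrow> real \<times> real \<Rightarrow> complex" where
  "Iy \<phi> = (\<lambda>(x, y). integral {0..2 * pi} (\<lambda>y'. \<phi> (x, y')))"

lemma continuous_I:
  assumes "continuous_on UNIV \<phi>"
  shows "continuous_on UNIV (Ix \<phi>)" "continuous_on UNIV (Iy \<phi>)"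
proof -
  have "continuous_on (UNIV \<times> cbox 0 (2 * pi)) (\<lambda>(q :: real \<times> real, x'). \<phi> (x', snd q))"
    unfolding case_prod_beta by (intro continuous_on_compose2[OF assms] continuous_intros) auto
  from integral_continuous_on_param[OF this] show "continuous_on UNIV (Ix \<phi>)"
    by (simp add: Ix_def case_prod_beta)
  have "continuous_on (UNIV \<times> cbox 0 (2 * pi)) (\<lambda>(q :: real \<times> real, y'). \<phi> (fst q, y'))"
    unfolding case_prod_beta by (intro continuous_on_compose2[OF assms] continuous_intros) auto
  from integral_continuous_on_param[OF this] show "continuous_on UNIV (Iy \<phi>)"
    by (simp add: Iy_def case_prod_beta)
qed

lemma I_derivs:
  assumes "\<phi> \<in> test_fun"
  shows "((\<lambda>y'. Ix \<phi> (x, y')) has_vector_derivative Ix (pdy \<phi>) (x, y)) (at y)"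
    and "((\<lambda>x'. Iy \<phi> (x', y)) has_vector_derivative Iy (pdx \<phi>) (x, y)) (at x)"
proof -
  have i: "(\<lambda>x'. \<phi> (x', y)) integrable_on cbox 0 (2 * pi)" "(\<lambda>y'. \<phi> (x, y')) integrable_on cbox 0 (2 * pi)" for x y
    by (intro integrable_continuous continuous_on_compose2[OF test_funD(2)[OF assms, of UNIV]] continuous_intros; simp)+
  have "continuous_on (UNIV \<times> cbox 0 (2 * pi)) (\<lambda>(y, x'). pdy \<phi> (x', y))"
    unfolding case_prod_beta
    by (intro continuous_on_compose2[OF test_funD(2)[OF test_fun_pd(2)[OF assms], of UNIV]] continuous_intros) auto
  from leibniz_rule_vector_derivative[of UNIV 0 "2 * pi" "\<lambda>y x'. \<phi> (x', y)", OF test_fun_derivs(2)[OF assms] i(1) this]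
  show "((\<lambda>y'. Ix \<phi> (x, y')) has_vector_derivative Ix (pdy \<phi>) (x, y)) (at y)"
    by (simp add: Ix_def)
  have "continuous_on (UNIV \<times> cbox 0 (2 * pi)) (\<lambda>(x, y'). pdx \<phi> (x, y'))"
    unfolding case_prod_beta
    by (intro continuous_on_compose2[OF test_funD(2)[OF test_fun_pd(1)[OF assms], of UNIV]] continuous_intros) auto
  from leibniz_rule_vector_derivative[of UNIV 0 "2 * pi" "\<lambda>x y'. \<phi> (x, y')", OF test_fun_derivs(1)[OF assms] i(2) this]
  show "((\<lambda>x'. Iy \<phi> (x', y)) has_vector_derivative Iy (pdx \<phi>) (x, y)) (at x)"
    by (simp add: Iy_def)
qed

text \<open>Differentiation passes under the integral in the remaining variable, and the derivative
  in the integrated variable is 0; hence the induction over all test functions.\<close>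

lemma test_fun_I:
  assumes "\<phi> \<in> test_fun"
  shows "Ix \<phi> \<in> test_fun" "Iy \<phi> \<in> test_fun"
proof -
  have "Ck n (Ix \<phi>)" if "\<phi> \<in> test_fun" for n \<phi>
    using that
  proof (induction n arbitrary: \<phi>)
    case (Suc n)
    show ?case
    proof (rule Ck_SucI[where fx = "\<lambda>_. 0", OF _ _ I_derivs(1)[OF Suc.prems]])
      show "((\<lambda>x'. Ix \<phi> (x', y)) has_vector_derivative 0) (at x)" for x y by (simp add: Ix_def)
    qed (use Suc test_fun_pd continuous_I test_funD(2) Ck_const in auto)
  qed (use continuous_I test_funD(2) in auto)
  then show "Ix \<phi> \<in> test_fun"
    using assms test_funD(3)[OF assms] by (auto simp: test_fun_def periodic2_def Ix_def)
  have "Ck n (Iy \<phi>)" if "\<phi> \<in> test_fun" for n \<phi>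
    using that
  proof (induction n arbitrary: \<phi>)
    case (Suc n)
    show ?case
    proof (rule Ck_SucI[where fy = "\<lambda>_. 0", OF _ I_derivs(2)[OF Suc.prems]])
      show "((\<lambda>y'. Iy \<phi> (x, y')) has_vector_derivative 0) (at y)" for x y by (simp add: Iy_def)
    qed (use Suc test_fun_pd continuous_I test_funD(2) Ck_const in auto)
  qed (use continuous_I test_funD(2) in auto)
  then show "Iy \<phi> \<in> test_fun"
    using assms test_funD(3)[OF assms] by (auto simp: test_fun_def periodic2_def Iy_def)
qed

lemma integral_cis: "integral {0..2 * pi} (\<lambda>x. cis (of_int n * x)) = (if n = 0 then 2 * pi else 0)"
proof (cases "n = 0")
  case True
  then show ?thesis by (simp add: cis_zero scaleR_conv_of_real)
next
  case False
  have "((\<lambda>x. \<i> * of_real (of_int n) * cis (of_int n * x)) has_integral (cis (of_int n * (2 * pi)) - cis (of_int n * 0))) {0..2 * pi}"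
    by (intro fundamental_theorem_of_calculus has_vector_derivative_cis) simp
  then have "integral {0..2 * pi} (\<lambda>x. \<i> * of_real (of_int n) * cis (of_int n * x)) = 1 - cis 0"
    unfolding cis_int_2pi mult_zero_right by (rule integral_unique)
  then show ?thesis using False unfolding integral_mult_right by (simp add: cis_zero)
qed

lemma pc_I:
  assumes "\<phi> \<in> test_fun"
  shows "pc (Ix \<phi>) k = (if fst k = 0 then 2 * pi * pc \<phi> k else 0)"
    and "pc (Iy \<phi>) k = (if snd k = 0 then 2 * pi * pc \<phi> k else 0)"
proof -
  note c = test_funD(2)[OF assms, of UNIV]
  note cI = continuous_I[OF c]
  have e: "ech k (x, y) = cis (of_int (fst k) * x) * cis (of_int (snd k) * y)" for x y
    by (simp add: ech_def cis_mult)
  have "pc (Ix \<phi>) k = integral {0..2 * pi} (\<lambda>y. integral {0..2 * pi} (\<lambda>x. Ix \<phi> (x, y) * ech k (x, y)))"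
    unfolding pc_def by (intro integral_torus continuous_intros cI)
  also have "\<dots> = integral {0..2 * pi} (\<lambda>y. (if fst k = 0 then 2 * pi else 0) * (integral {0..2 * pi} (\<lambda>x. \<phi> (x, y)) * cis (of_int (snd k) * y)))"
  proof (intro arg_cong[where f = "integral _"] ext)
    fix y
    have "(\<lambda>x. Ix \<phi> (x, y) * ech k (x, y)) = (\<lambda>x. cis (of_int (fst k) * x) * (integral {0..2 * pi} (\<lambda>x. \<phi> (x, y)) * cis (of_int (snd k) * y)))"
      by (simp add: Ix_def e mult_ac)
    then show "integral {0..2 * pi} (\<lambda>x. Ix \<phi> (x, y) * ech k (x, y)) = (if fst k = 0 then 2 * pi else 0) * (integral {0..2 * pi} (\<lambda>x. \<phi> (x, y)) * cis (of_int (snd k) * y))"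
      by (simp only: integral_mult_left integral_cis)
  qed
  also have "\<dots> = (if fst k = 0 then 2 * pi else 0) * integral {0..2 * pi} (\<lambda>y. integral {0..2 * pi} (\<lambda>x. \<phi> (x, y)) * cis (of_int (snd k) * y))"
    by (rule integral_mult_right)
  also have "\<dots> = (if fst k = 0 then 2 * pi * pc \<phi> k else 0)"
  proof (cases "fst k = 0")
    case True
    have "pc \<phi> k = integral {0..2 * pi} (\<lambda>y. integral {0..2 * pi} (\<lambda>x. \<phi> (x, y) * ech k (x, y)))"
      unfolding pc_def by (intro integral_torus continuous_intros c)
    then show ?thesis using True by (simp add: e)
  qed simp
  finally show "pc (Ix \<phi>) k = (if fst k = 0 then 2 * pi * pc \<phi> k else 0)" .
  have "pc (Iy \<phi>) k = integral {0..2 * pi} (\<lambda>x. integral {0..2 * pi} (\<lambda>y. Iy \<phi> (x, y) * ech k (x, y)))"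
    unfolding pc_def by (intro integral_torus continuous_intros cI)
  also have "\<dots> = integral {0..2 * pi} (\<lambda>x. (if snd k = 0 then 2 * pi else 0) * (integral {0..2 * pi} (\<lambda>y. \<phi> (x, y)) * cis (of_int (fst k) * x)))"
  proof (intro arg_cong[where f = "integral _"] ext)
    fix x
    have "(\<lambda>y. Iy \<phi> (x, y) * ech k (x, y)) = (\<lambda>y. cis (of_int (snd k) * y) * (integral {0..2 * pi} (\<lambda>y. \<phi> (x, y)) * cis (of_int (fst k) * x)))"
      by (simp add: Iy_def e mult_ac)
    then show "integral {0..2 * pi} (\<lambda>y. Iy \<phi> (x, y) * ech k (x, y)) = (if snd k = 0 then 2 * pi else 0) * (integral {0..2 * pi} (\<lambda>y. \<phi> (x, y)) * cis (of_int (fst k) * x))"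
      by (simp only: integral_mult_left integral_cis)
  qed
  also have "\<dots> = (if snd k = 0 then 2 * pi else 0) * integral {0..2 * pi} (\<lambda>x. integral {0..2 * pi} (\<lambda>y. \<phi> (x, y)) * cis (of_int (fst k) * x))"
    by (rule integral_mult_right)
  also have "\<dots> = (if snd k = 0 then 2 * pi * pc \<phi> k else 0)"
  proof (cases "snd k = 0")
    case True
    have "pc \<phi> k = integral {0..2 * pi} (\<lambda>x. integral {0..2 * pi} (\<lambda>y. \<phi> (x, y) * ech k (x, y)))"
      unfolding pc_def by (intro integral_torus continuous_intros c)
    then show ?thesis using True by (simp add: e)
  qed simp
  finally show "pc (Iy \<phi>) k = (if snd k = 0 then 2 * pi * pc \<phi> k else 0)" .
qed

lemma int_synth:
  assumes u: "distribution u"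
  shows "distribution (int_x u)" "fourier (int_x u) k = (if fst k = 0 then 2 * pi * fourier u k else 0)"
    and "distribution (int_y u)" "fourier (int_y u) k = (if snd k = 0 then 2 * pi * fourier u k else 0)"
proof -
  let ?a = "\<lambda>k. (if fst k = 0 then 2 * pi else 0) * fourier u k"
  let ?b = "\<lambda>k. (if snd k = 0 then 2 * pi else 0) * fourier u k"
  have p: "polyg ?a" "polyg ?b"
    by (intro polyg_mult fourier_polyg u polyg_bounded[of _ "2 * pi"]; simp)+
  have x: "int_x u = synth ?a"
  proof (rule extensionalityI[of _ test_fun])
    fix \<phi> assume t: "\<phi> \<in> test_fun"
    have eq: "fourier u k * pc (Ix \<phi>) k = ?a k * pc \<phi> k" for k by (simp add: pc_I[OF t])
    show "int_x u \<phi> = synth ?a \<phi>"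
      using t infsumI[OF distribution_pairing[OF u test_fun_I(1)[OF t]]] unfolding eq
      by (simp add: int_x_def synth_def Ix_def)
  qed (auto simp: int_x_def synth_def)
  have y: "int_y u = synth ?b"
  proof (rule extensionalityI[of _ test_fun])
    fix \<phi> assume t: "\<phi> \<in> test_fun"
    have eq: "fourier u k * pc (Iy \<phi>) k = ?b k * pc \<phi> k" for k by (simp add: pc_I[OF t])
    show "int_y u \<phi> = synth ?b \<phi>"
      using t infsumI[OF distribution_pairing[OF u test_fun_I(2)[OF t]]] unfolding eq
      by (simp add: int_y_def synth_def Iy_def)
  qed (auto simp: int_y_def synth_def)
  show "distribution (int_x u)" "fourier (int_x u) k = (if fst k = 0 then 2 * pi * fourier u k else 0)"
    "distribution (int_y u)" "fourier (int_y u) k = (if snd k = 0 then 2 * pi * fourier u k else 0)"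
    unfolding x y by (simp_all add: distribution_synth p fourier_synth)
qed

text \<open>Without the factor \<open>1 / (2 * pi)\<close>, so that the normalisation of the profile
  reads \<open>ghat g 0 = 1\<close> and all other coefficients are compared with 1.\<close>

definition ghat :: "(real \<Rightarrow> real) \<Rightarrow> int \<Rightarrow> complex" where
  "ghat g n = integral {0..2 * pi} (\<lambda>y. of_real (g y) * cis (- of_int n * y))"

lemma pc_lift:
  assumes "smooth1 g"
  shows "pc (\<lambda>(x, y). of_real (g y)) k = (if fst k = 0 then 2 * pi * ghat g (- snd k) else 0)"
    and "pc (\<lambda>(x, y). of_real (g x)) k = (if snd k = 0 then 2 * pi * ghat g (- fst k) else 0)"
proof -
  have c: "continuous_on UNIV (\<lambda>(x::real, y::real). complex_of_real (g y))" "continuous_on UNIV (\<lambda>(x::real, y::real). complex_of_real (g x))"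
    using Ck_continuous[OF Ck_lift(2)[OF assms, of 0]] Ck_continuous[OF Ck_lift(1)[OF assms, of 0]] by auto
  have e: "ech k (x, y) = cis (of_int (fst k) * x) * cis (of_int (snd k) * y)" for x y
    by (simp add: ech_def cis_mult)
  have "pc (\<lambda>(x, y). of_real (g y)) k = integral {0..2 * pi} (\<lambda>x. integral {0..2 * pi} (\<lambda>y. (case (x, y) of (x, y) \<Rightarrow> of_real (g y)) * ech k (x, y)))"
    unfolding pc_def by (intro integral_torus continuous_intros c)
  also have "\<dots> = integral {0..2 * pi} (\<lambda>x. cis (of_int (fst k) * x) * ghat g (- snd k))"
  proof (intro arg_cong[where f = "integral _"] ext)
    fix x
    have "(\<lambda>y. (case (x, y) of (x, y) \<Rightarrow> of_real (g y)) * ech k (x, y)) = (\<lambda>y. cis (of_int (fst k) * x) * (of_real (g y) * cis (of_int (snd k) * y)))"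
      by (simp add: e mult_ac)
    then show "integral {0..2 * pi} (\<lambda>y. (case (x, y) of (x, y) \<Rightarrow> of_real (g y)) * ech k (x, y)) = cis (of_int (fst k) * x) * ghat g (- snd k)"
      by (simp add: ghat_def)
  qed
  finally show "pc (\<lambda>(x, y). of_real (g y)) k = (if fst k = 0 then 2 * pi * ghat g (- snd k) else 0)"
    by (simp add: integral_cis)
  have "pc (\<lambda>(x, y). of_real (g x)) k = integral {0..2 * pi} (\<lambda>y. integral {0..2 * pi} (\<lambda>x. (case (x, y) of (x, y) \<Rightarrow> of_real (g x)) * ech k (x, y)))"
    unfolding pc_def by (intro integral_torus continuous_intros c)
  also have "\<dots> = integral {0..2 * pi} (\<lambda>y. cis (of_int (snd k) * y) * ghat g (- fst k))"
  proof (intro arg_cong[where f = "integral _"] ext)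
    fix y
    have "(\<lambda>x. (case (x, y) of (x, y) \<Rightarrow> of_real (g x)) * ech k (x, y)) = (\<lambda>x. cis (of_int (snd k) * y) * (of_real (g x) * cis (of_int (fst k) * x)))"
      by (simp add: e mult_ac)
    then show "integral {0..2 * pi} (\<lambda>x. (case (x, y) of (x, y) \<Rightarrow> of_real (g x)) * ech k (x, y)) = cis (of_int (snd k) * y) * ghat g (- fst k)"
      by (simp add: ghat_def)
  qed
  finally show "pc (\<lambda>(x, y). of_real (g x)) k = (if snd k = 0 then 2 * pi * ghat g (- fst k) else 0)"
    by (simp add: integral_cis)
qed

text \<open>Two reflections cancel: \<open>fourier_mult_dist\<close> yields \<open>fc\<close> at
  \<open>j - k\<close>, and \<open>pc_lift\<close> negates the argument, so \<open>ghat\<close> is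
  evaluated at a component of \<open>k - j\<close>.\<close>

lemma G_fourier:
  assumes g: "smooth1 g1" "periodic1 g1" "smooth1 g2" "periodic1 g2" and u: "distribution u"
  shows "distribution (G g1 g2 u)"
    and "fourier (G g1 g2 u) = kop (Gker (ghat g1) (ghat g2)) (fourier u)"
proof -
  let ?l1 = "\<lambda>(x, y). complex_of_real (g1 x)" and ?l2 = "\<lambda>(x, y). complex_of_real (g2 y)"
  have t: "?l1 \<in> test_fun" "?l2 \<in> test_fun" using test_fun_lift g by auto
  note d = int_synth[OF u]
  have d1: "distribution (G1 u)" "distribution (G2 u)"
    unfolding G1_def G2_def by (intro dist_lin_synth(1) u d)+
  have f1: "fourier (G1 u) j = (if fst j = 0 then 0 else 1 / (2 * pi) * fourier u j)" for j
    unfolding G1_def dist_lin_synth(2)[OF u d(1)] d(2) by (simp add: power2_eq_square)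
  have f2: "fourier (G2 u) j = (if snd j = 0 then 0 else 1 / (2 * pi) * fourier u j)" for j
    unfolding G2_def dist_lin_synth(2)[OF u d(3)] d(4) by (simp add: power2_eq_square)
  have m: "distribution (mult_dist ?l2 (G1 u))" "distribution (mult_dist ?l1 (G2 u))"
    by (intro distribution_mult_dist t d1)+
  show "distribution (G g1 g2 u)" unfolding G_def by (intro dist_lin_synth(1) m)
  show "fourier (G g1 g2 u) = kop (Gker (ghat g1) (ghat g2)) (fourier u)"
  proof
    fix k
    have "((\<lambda>j. fc ?l2 (j - k) * fourier (G1 u) j + fc ?l1 (j - k) * fourier (G2 u) j) has_sum fourier (G g1 g2 u) k) UNIV"
      unfolding G_def dist_lin_synth(2)[OF m] mult_1_left
      by (intro has_sum_add fourier_mult_dist t d1)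
    moreover have "fc ?l2 (j - k) * fourier (G1 u) j + fc ?l1 (j - k) * fourier (G2 u) j = Gker (ghat g1) (ghat g2) k j * fourier u j" for j
      unfolding f1 f2 fc_def pc_lift[OF g(3)] pc_lift[OF g(1)] Gker_def
      by (cases j; cases k) (auto simp: power2_eq_square field_simps)
    ultimately show "fourier (G g1 g2 u) k = kop (Gker (ghat g1) (ghat g2)) (fourier u) k"
      by (simp add: kop_def infsumI)
  qed
qed

section \<open>Consequences of the hypotheses\<close>

lemma control_profileD:
  assumes "control_profile g"
  shows "smooth1 g" "periodic1 g" "g x \<ge> 0" "integral {0..2 * pi} g = 1"
  using assms by (auto simp: control_profile_def smooth1_def)

lemma ghat_0: "control_profile g \<Longrightarrow> ghat g 0 = 1"
proof -
  assume g: "control_profile g"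
  have "((\<lambda>y. of_real (g y)) has_integral complex_of_real 1) {0..2 * pi}"
    using integrable_integral[OF integrable_continuous_real[OF smooth1_deriv(3)[OF control_profileD(1)[OF g]]], of 0 "2 * pi"]
    by (intro has_integral_of_real) (simp add: control_profileD(4)[OF g])
  then show ?thesis by (simp add: ghat_def cis_zero integral_unique)
qed

text \<open>Equality \<open>|ghat g n| = 1\<close> would force \<open>cis (n y)\<close> to be constant on the support of \<open>g\<close>.\<close>

lemma ghat_less_1:
  assumes g: "control_profile g" and n: "n \<noteq> 0"
  shows "cmod (ghat g n) < 1"
proof (rule ccontr)
  assume "\<not> cmod (ghat g n) < 1"
  then have ge: "1 \<le> cmod (ghat g n)" by simp
  note gd = control_profileD[OF g]
  note gc = smooth1_deriv(3)[OF gd(1)]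
  have nz: "ghat g n \<noteq> 0" using ge by auto
  \<comment> \<open>The phase of \<open>ghat g n\<close>. After rotation by \<open>cnj s\<close> the
    coefficient is its own modulus, so the nonnegative \<open>f\<close> below has integral
    \<open>1 - |ghat g n|\<close>, which the assumption makes 0.\<close>
  define s where "s = sgn (ghat g n)"
  have ns: "cmod s = 1" using nz by (simp add: s_def norm_sgn)
  have sg: "cnj s * ghat g n = of_real (cmod (ghat g n))"
  proof -
    have "ghat g n = of_real (cmod (ghat g n)) * s" using nz by (simp add: s_def sgn_eq)
    then have "cnj s * ghat g n = of_real (cmod (ghat g n)) * (s * cnj s)" by (simp add: mult_ac)
    then show ?thesis by (simp add: complex_norm_square[symmetric] ns)
  qed
  define f where "f y = g y * (1 - Re (cnj s * cis (- of_int n * y)))" for y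
  have Re1: "Re (cnj s * cis t) \<le> 1" for t
    using complex_Re_le_cmod[of "cnj s * cis t"] by (simp add: norm_mult ns)
  have fc: "continuous_on S f" for S unfolding f_def by (intro continuous_intros gc)
  have f0: "0 \<le> f y" for y unfolding f_def using gd(3)[of y] Re1[of "- of_int n * y"] by (intro mult_nonneg_nonneg) auto
  have "((\<lambda>y. of_real (g y) * cis (- of_int n * y)) has_integral ghat g n) {0..2 * pi}"
    unfolding ghat_def by (intro integrable_integral integrable_continuous_real continuous_intros gc)
  from has_integral_linear[OF has_integral_mult_right[OF this, of "cnj s"] bounded_linear_Re]
  have "((\<lambda>y. Re (cnj s * (of_real (g y) * cis (- of_int n * y)))) has_integral cmod (ghat g n)) {0..2 * pi}"
    unfolding o_def sg Re_complex_of_real .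
  moreover have "(g has_integral 1) {0..2 * pi}"
    using integrable_integral[OF integrable_continuous_real[OF gc]] gd(4) by metis
  ultimately have "((\<lambda>y. g y - Re (cnj s * (of_real (g y) * cis (- of_int n * y)))) has_integral (1 - cmod (ghat g n))) {0..2 * pi}"
    by (intro has_integral_diff)
  moreover have "g y - Re (cnj s * (of_real (g y) * cis (- of_int n * y))) = f y" for y
    by (simp add: f_def algebra_simps)
  ultimately have fi: "(f has_integral (1 - cmod (ghat g n))) {0..2 * pi}" by simp
  then have "integral {0..2 * pi} f = 0"
    using has_integral_nonneg[OF fi f0] ge by (simp add: integral_unique)
  then have fz: "f y = 0" if "y \<in> {0..2 * pi}" for y
    using integral_eq_0_iff[of 0 "2 * pi" f] fc f0 that by auto
  have "\<exists>x. g x \<noteq> 0"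
  proof (rule ccontr)
    assume "\<not> ?thesis"
    then have "g = (\<lambda>_. 0)" by auto
    then show False using gd(4) by simp
  qed
  then obtain x1 where x1: "g x1 \<noteq> 0" by blast
  obtain m :: int where m: "x1 + of_int m * (2 * pi) \<in> {0..<2 * pi}" by (rule periodic_reduce)
  define x0 where "x0 = x1 + of_int m * (2 * pi)"
  have "g x0 = g x1" unfolding x0_def
    using periodic1_shift[where f = g] gd(2) by (simp add: periodic1_def)
  then have gx0: "g x0 > 0" using x1 gd(3)[of x1] by simp
  have x0: "0 \<le> x0" "x0 < 2 * pi" using m by (auto simp: x0_def)
  have "isCont g x0" using gc[of UNIV] by (simp add: continuous_on_eq_continuous_at)
  then obtain e where e: "e > 0" "\<And>x. \<bar>x - x0\<bar> < e \<Longrightarrow> \<bar>g x - g x0\<bar> < g x0"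
    using gx0 unfolding continuous_at_eps_delta dist_real_def by metis
  \<comment> \<open>Small enough that \<open>x0 + \<eta>\<close> stays in the period and in the set
    where \<open>g > 0\<close>, and that \<open>|n| \<eta> <= 1 < 2 * pi\<close>, so that
    \<open>n \<eta>\<close> is no multiple of \<open>2 * pi\<close>.\<close>
  define \<eta> where "\<eta> = min (min (e / 2) ((2 * pi - x0) / 2)) (1 / \<bar>real_of_int n\<bar>)"
  have \<eta>: "\<eta> > 0" "\<eta> < e" "x0 + \<eta> < 2 * pi" "\<bar>real_of_int n\<bar> * \<eta> \<le> 1"
  proof -
    show "\<eta> > 0" using e x0 n by (simp add: \<eta>_def)
    show "\<eta> < e" using e by (simp add: \<eta>_def)
    have "\<eta> \<le> (2 * pi - x0) / 2"
      unfolding \<eta>_def by (rule min.coboundedI1[OF min.cobounded2])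
    then show "x0 + \<eta> < 2 * pi" using x0 by simp
    have "\<eta> \<le> 1 / \<bar>real_of_int n\<bar>" unfolding \<eta>_def by (rule min.cobounded2)
    then show "\<bar>real_of_int n\<bar> * \<eta> \<le> 1" using n by (simp add: field_simps)
  qed
  \<comment> \<open>Where \<open>g > 0\<close>, vanishing of \<open>f\<close> gives real part 1, and
    a complex number of modulus 1 with real part 1 is 1.\<close>
  have val: "cis (- of_int n * y) = s" if "y \<in> {0..2 * pi}" "g y > 0" for y
  proof -
    have 1: "Re (cnj s * cis (- of_int n * y)) = 1" using fz[OF that(1)] that(2) by (simp add: f_def)
    have "cmod (cnj s * cis (- of_int n * y)) = 1" by (simp add: norm_mult ns)
    then have "cnj s * cis (- of_int n * y) = 1"
      using 1 cmod_power2[of "cnj s * cis (- of_int n * y)"] by (simp only: complex_eq_iff) simp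
    then have "s * cnj s * cis (- of_int n * y) = s" by (simp add: mult.assoc)
    then show ?thesis by (simp add: complex_norm_square[symmetric] ns)
  qed
  have "g (x0 + \<eta>) > 0" using e(2)[of "x0 + \<eta>"] \<eta> by auto
  then have "cis (- of_int n * (x0 + \<eta>)) = cis (- of_int n * x0)"
    using val[of "x0 + \<eta>"] val[of x0] gx0 x0 \<eta> by auto
  moreover have "cis (- of_int n * (x0 + \<eta>)) = cis (- of_int n * x0) * cis (- of_int n * \<eta>)"
    by (simp add: cis_mult algebra_simps)
  ultimately have "cis (- of_int n * \<eta>) = 1" by simp
  then have "cos (of_int n * \<eta>) = 1" by (simp add: complex_eq_iff)
  then obtain q :: int where q: "of_int n * \<eta> = of_int q * 2 * pi" unfolding cos_one_2pi_int by blast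
  have "q \<noteq> 0" using q \<eta>(1) n by auto
  then have "1 \<le> \<bar>real_of_int q\<bar>" by linarith
  then have "2 * pi \<le> \<bar>real_of_int q\<bar> * (2 * pi)" by simp
  also have "\<dots> = \<bar>of_int n * \<eta>\<bar>" unfolding q by (simp add: abs_mult)
  also have "\<dots> = \<bar>real_of_int n\<bar> * \<eta>" using \<eta>(1) by (simp add: abs_mult)
  finally show False using \<eta>(4) pi_gt3 by linarith
qed

text \<open>Read off from the decay on the torus, applied to the lift of \<open>g\<close> that
  depends on \<open>y\<close> only.\<close>

lemma ghat_decay:
  assumes "smooth1 g" "periodic1 g"
  obtains C where "\<And>n. cmod (ghat g n) * (1 + \<bar>real_of_int n\<bar>) ^ N \<le> C"
proof -
  let ?f = "\<lambda>(x, y). complex_of_real (g y)"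
  have t: "?f \<in> test_fun" by (rule test_fun_lift[OF assms])
  obtain B where B: "cN_bound (2 * N) ?f B" by (rule cN_bound_exists[OF t])
  have "cmod (ghat g n) * (1 + \<bar>real_of_int n\<bar>) ^ N \<le> pc_const N * B / (2 * pi)" for n
  proof -
    have "cmod (pc ?f (0, - n)) * jb (0, - n) ^ N \<le> pc_const N * B" by (rule pc_decay[OF t B])
    then have "2 * pi * (cmod (ghat g n) * (1 + \<bar>real_of_int n\<bar>) ^ N) \<le> pc_const N * B"
      by (simp add: pc_lift[OF assms(1)] norm_mult freq_norm_def mult.assoc)
    then show ?thesis by (simp add: field_simps)
  qed
  then show ?thesis by (rule that)
qed

text \<open>Decay gives modulus at most 1/2 once \<open>|n| > 2 * C\<close>; the finitely many other
  indices are covered by a minimum over strict inequalities.\<close>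

lemma ghat_gap:
  assumes g: "control_profile g"
  obtains \<delta> where "\<delta> > 0" "\<And>n. n \<noteq> 0 \<Longrightarrow> cmod (ghat g n) \<le> 1 - \<delta>"
proof -
  obtain C where C: "\<And>n. cmod (ghat g n) * (1 + \<bar>real_of_int n\<bar>) ^ 1 \<le> C"
    using ghat_decay[OF control_profileD(1,2)[OF g], of 1] by blast
  define S where "S = {n::int. n \<noteq> 0 \<and> \<bar>real_of_int n\<bar> \<le> 2 * C}"
  have "S \<subseteq> {- \<lceil>2 * C\<rceil>..\<lceil>2 * C\<rceil>}" by (auto simp: S_def) linarith+
  then have S: "finite S" by (rule finite_subset) simp
  define \<delta> where "\<delta> = Min (insert (1/2) ((\<lambda>n. 1 - cmod (ghat g n)) ` S))"
  have "\<delta> > 0" unfolding \<delta>_def using S ghat_less_1[OF g] by (subst Min_gr_iff) (auto simp: S_def)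
  moreover have "cmod (ghat g n) \<le> 1 - \<delta>" if n: "n \<noteq> 0" for n
  proof (cases "n \<in> S")
    case True
    then have "\<delta> \<le> 1 - cmod (ghat g n)" unfolding \<delta>_def using S by (intro Min_le) auto
    then show ?thesis by simp
  next
    case False
    then have big: "2 * C < \<bar>real_of_int n\<bar>" using n by (simp add: S_def)
    have "cmod (ghat g n) * (1 + \<bar>real_of_int n\<bar>) \<le> C" using C[of n] by simp
    also have "C \<le> 1/2 * (1 + \<bar>real_of_int n\<bar>)" using big by simp
    finally have "cmod (ghat g n) \<le> 1/2" by (rule mult_right_le_imp_le) simp
    moreover have "\<delta> \<le> 1/2" unfolding \<delta>_def using S by (intro Min_le) auto
    ultimately show ?thesis by simp
  qed
  ultimately show ?thesis by (rule that)
qed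

text \<open>By maximality \<open>J\<close> represents every value of \<open>l\<close>, since
  otherwise \<open>k\<close> could be added. The gap between representatives is therefore a gap
  between any two distinct values.\<close>

lemma maximal_separated_gap:
  assumes J: "maximal_separated l J"
    and gap: "Inf {\<bar>l k - l k'\<bar> |k k'. k \<in> J \<and> k' \<in> J \<and> k \<noteq> k'} = \<gamma>"
    and ne: "l k \<noteq> l k'"
  shows "\<gamma> \<le> \<bar>l k - l k'\<bar>"
proof -
  have ex: "\<exists>j\<in>J. l j = l k" for k
  proof (rule ccontr)
    assume *: "\<not> ?thesis"
    then have "inj_on l (insert k J)"
      using J by (auto simp: maximal_separated_def inj_on_insert)
    then have "insert k J = J" using J unfolding maximal_separated_def by blast
    then show False using * by blast
  qed
  obtain j j' where j: "j \<in> J" "l j = l k" "j' \<in> J" "l j' = l k'" using ex by metis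
  have "j \<noteq> j'" using ne j by auto
  then have "\<bar>l k - l k'\<bar> \<in> {\<bar>l k - l k'\<bar> |k k'. k \<in> J \<and> k' \<in> J \<and> k \<noteq> k'}"
    using j by (intro CollectI exI[of _ j] exI[of _ j']) simp
  then show ?thesis unfolding gap[symmetric]
    by (rule cInf_lower) (auto intro!: bdd_belowI[of _ 0])
qed

lemma cond_two_to_one:
  assumes c: "cond_A l \<or> cond_B l" and gap: "\<And>k k'. l k \<noteq> l k' \<Longrightarrow> \<gamma> \<le> \<bar>l k - l k'\<bar>"
  shows "m \<noteq> 0 \<Longrightarrow> two_to_one (\<lambda>n. l (m, n)) \<gamma>" "n \<noteq> 0 \<Longrightarrow> two_to_one (\<lambda>m. l (m, n)) \<gamma>"
proof -
  have 1: "j = k \<or> j = - k" if "m \<noteq> 0" "l (m, j) = l (m, k)" for m j k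
    using c that unfolding cond_A_def cond_B_def by blast
  show "two_to_one (\<lambda>n. l (m, n)) \<gamma>" if "m \<noteq> 0"
    using 1[OF that] gap unfolding two_to_one_def by blast
  have 2: "j = k \<or> j = - k" if "n \<noteq> 0" "l (j, n) = l (k, n)" for n j k
    using c that unfolding cond_A_def cond_B_def by blast
  show "two_to_one (\<lambda>m. l (m, n)) \<gamma>" if "n \<noteq> 0"
    using 2[OF that] gap unfolding two_to_one_def by blast
qed

text \<open>Nonzero entries have \<open>k - j\<close> on a coordinate axis, where
  \<open>jb (k - j)\<close> is the one-dimensional weight of \<open>ghat_decay\<close>.\<close>

lemma rapid_Gker:
  assumes "smooth1 g1" "periodic1 g1" "smooth1 g2" "periodic1 g2"
  shows "rapid (Gker (ghat g1) (ghat g2))"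
  unfolding rapid_def
proof
  fix N :: nat
  obtain C1 where C1: "\<And>n. cmod (ghat g1 n) * (1 + \<bar>real_of_int n\<bar>) ^ N \<le> C1" using ghat_decay[OF assms(1,2), of N] by blast
  obtain C2 where C2: "\<And>n. cmod (ghat g2 n) * (1 + \<bar>real_of_int n\<bar>) ^ N \<le> C2" using ghat_decay[OF assms(3,4), of N] by blast
  have C0: "0 \<le> C1" "0 \<le> C2" by (rule order.trans[OF _ C1[of 0]], simp, rule order.trans[OF _ C2[of 0]], simp)
  have "cmod (Gker (ghat g1) (ghat g2) k j) * jb (k - j) ^ N \<le> 1 / (2 * pi)\<^sup>2 * (C2 + C1)" for k j
  proof -
    have a: "cmod (if fst k = fst j \<and> fst k \<noteq> 0 then ghat g2 (snd k - snd j) else 0) * jb (k - j) ^ N \<le> C2"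
    proof (cases "fst k = fst j")
      case True
      then have "jb (k - j) = 1 + \<bar>real_of_int (snd k - snd j)\<bar>" by (simp add: freq_norm_def)
      then show ?thesis using C2[of "snd k - snd j"] C0 by simp
    qed (use C0 in simp)
    have b: "cmod (if snd k = snd j \<and> snd k \<noteq> 0 then ghat g1 (fst k - fst j) else 0) * jb (k - j) ^ N \<le> C1"
    proof (cases "snd k = snd j")
      case True
      then have "jb (k - j) = 1 + \<bar>real_of_int (fst k - fst j)\<bar>" by (simp add: freq_norm_def)
      then show ?thesis using C1[of "fst k - fst j"] C0 by simp
    qed (use C0 in simp)
    have "cmod (Gker (ghat g1) (ghat g2) k j) * jb (k - j) ^ N \<le> 1 / (2 * pi)\<^sup>2 *
        (cmod (if fst k = fst j \<and> fst k \<noteq> 0 then ghat g2 (snd k - snd j) else 0) + cmod (if snd k = snd j \<and> snd k \<noteq> 0 then ghat g1 (fst k - fst j) else 0)) * jb (k - j) ^ N"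
      unfolding Gker_def norm_mult norm_of_real
      by (intro mult_right_mono mult_mono norm_triangle_ineq) auto
    also have "\<dots> \<le> 1 / (2 * pi)\<^sup>2 * (C2 + C1)"
      using add_mono[OF a b] unfolding mult.assoc distrib_right[symmetric] by (intro mult_left_mono) auto
    finally show ?thesis .
  qed
  then show "\<exists>C. \<forall>k j. cmod (Gker (ghat g1) (ghat g2) k j) * jb (k - j) ^ N \<le> C" by blast
qed

text \<open>The resolvent factor has modulus at most \<open>1 / rate\<close> whatever the
  eigenvalues are; the added constant mode sits at \<open>k = j = 0\<close>, where the weight is
  1.\<close>

lemma rapid_Tker:
  assumes "rapid (Gker gh1 gh2)" and rate: "rate > 0"
  shows "rapid (Tker rate l gh1 gh2)"
  unfolding rapid_def
proof
  fix N :: nat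
  obtain C where C: "\<And>k j. cmod (Gker gh1 gh2 k j) * jb (k - j) ^ N \<le> C"
    using assms(1) unfolding rapid_def by blast
  have "cmod (Tker rate l gh1 gh2 k j) * jb (k - j) ^ N \<le> C * (1 / rate) + 1" for k j
  proof -
    have "rate \<le> cmod (complex_of_real rate + \<i> * of_real (l k - l j))"
      using complex_Re_le_cmod[of "complex_of_real rate + \<i> * of_real (l k - l j)"] by simp
    then have r: "cmod (1 / (complex_of_real rate + \<i> * of_real (l k - l j))) \<le> 1 / rate"
      using rate by (simp add: norm_divide frac_le)
    have "cmod (Tker rate l gh1 gh2 k j) \<le> cmod (Gker gh1 gh2 k j) * cmod (1 / (complex_of_real rate + \<i> * of_real (l k - l j))) + cmod (if k = 0 \<and> j = 0 then 1 else 0 :: complex)"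
      unfolding Tker_def by (rule order.trans[OF norm_triangle_ineq]) (simp only: norm_mult order_refl)
    also have "\<dots> \<le> cmod (Gker gh1 gh2 k j) * (1 / rate) + (if k = 0 \<and> j = 0 then 1 else 0)"
      by (intro add_mono mult_left_mono r) auto
    finally have "cmod (Tker rate l gh1 gh2 k j) * jb (k - j) ^ N
        \<le> (cmod (Gker gh1 gh2 k j) * (1 / rate) + (if k = 0 \<and> j = 0 then 1 else 0)) * jb (k - j) ^ N"
      by (rule mult_right_mono) simp
    also have "\<dots> = (cmod (Gker gh1 gh2 k j) * jb (k - j) ^ N) * (1 / rate) + (if k = 0 \<and> j = 0 then 1 else 0)"
      by (simp add: distrib_right freq_norm_def)
    also have "\<dots> \<le> C * (1 / rate) + 1"
      using rate by (intro add_mono mult_right_mono C) auto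
    finally show ?thesis .
  qed
  then show "\<exists>C. \<forall>k j. cmod (Tker rate l gh1 gh2 k j) * jb (k - j) ^ N \<le> C" by blast
qed

section \<open>Limits and a Gronwall argument in weighted sequence spaces\<close>

text \<open>Dominated convergence for sums along an arbitrary filter: a finite set carries all but
  \<open>e / 2\<close> of the majorant, and on it the limit is taken termwise.\<close>

lemma infsum_dominated_tendsto_0:
  fixes f :: "'x \<Rightarrow> 'i \<Rightarrow> real"
  assumes M: "M summable_on UNIV" and dom: "\<forall>\<^sub>F x in F. \<forall>k. \<bar>f x k\<bar> \<le> M k"
    and lim: "\<And>k. ((\<lambda>x. f x k) \<longlongrightarrow> 0) F"
  shows "((\<lambda>x. \<Sum>\<^sub>\<infinity>k. f x k) \<longlongrightarrow> 0) F"
proof (rule tendstoI)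
  fix e :: real assume e: "e > 0"
  have Ms: "M summable_on Y" for Y using M by (rule summable_on_subset_banach) simp
  have "\<forall>\<^sub>F A in finite_subsets_at_top UNIV. finite A \<and> dist (sum M A) (infsum M UNIV) < e / 2"
  proof (rule eventually_conj)
    show "\<forall>\<^sub>F A in finite_subsets_at_top UNIV. dist (sum M A) (infsum M UNIV) < e / 2"
      by (rule tendstoD[OF infsum_tendsto[OF M]]) (use e in simp)
  qed (rule eventually_finite_subsets_at_top_weakI)
  then obtain A where A: "finite A" "dist (sum M A) (infsum M UNIV) < e / 2"
    using eventually_happens'[OF finite_subsets_at_top_neq_bot] by blast
  have "((\<lambda>x. \<Sum>k\<in>A. f x k) \<longlongrightarrow> (\<Sum>k\<in>A. 0)) F" by (intro tendsto_sum lim)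
  then have "\<forall>\<^sub>F x in F. \<bar>\<Sum>k\<in>A. f x k\<bar> < e / 2"
    using e by (auto dest!: tendstoD[of _ _ _ "e / 2"] simp: dist_real_def)
  with dom show "\<forall>\<^sub>F x in F. dist (\<Sum>\<^sub>\<infinity>k. f x k) 0 < e"
  proof eventually_elim
    case (elim x)
    have n: "(\<lambda>k. norm (f x k)) summable_on Y" for Y
      by (rule summable_on_real_comparison[OF Ms]) (use elim(1) in auto)
    note s = Infinite_Sum.abs_summable_summable[OF n]
    have "(\<Sum>\<^sub>\<infinity>k. f x k) = (\<Sum>k\<in>A. f x k) + (\<Sum>\<^sub>\<infinity>k\<in>- A. f x k)"
      using infsum_Un_disjoint[OF s s, of A "- A"] A(1) by (simp add: Compl_partition)
    moreover have "norm (\<Sum>\<^sub>\<infinity>k\<in>- A. f x k) \<le> (\<Sum>\<^sub>\<infinity>k\<in>- A. norm (f x k))" by (rule norm_infsum_bound[OF n])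
    moreover have "(\<Sum>\<^sub>\<infinity>k\<in>- A. norm (f x k)) \<le> (\<Sum>\<^sub>\<infinity>k\<in>- A. M k)"
      by (rule infsum_mono[OF n Ms]) (use elim(1) in auto)
    moreover have "(\<Sum>\<^sub>\<infinity>k\<in>- A. M k) = infsum M UNIV - sum M A"
      using infsum_Un_disjoint[OF Ms Ms, of A "- A"] A(1) by (simp add: Compl_partition)
    moreover have "infsum M UNIV - sum M A < e / 2" using A(2) unfolding dist_real_def by linarith
    ultimately show ?case using elim(2) unfolding dist_real_def real_norm_def by linarith
  qed
qed

lemma wnorm_dominated_tendsto_0:
  assumes w: "wsq W' w" and W: "\<And>k. 0 \<le> W k" and D: "0 \<le> D"
    and dom: "\<forall>\<^sub>F x in F. \<forall>k. W k * cmod (f x k) \<le> D * (W' k * cmod (w k))"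
    and lim: "\<And>k. ((\<lambda>x. f x k) \<longlongrightarrow> 0) F"
  shows "((\<lambda>x. wnorm W (f x)) \<longlongrightarrow> 0) F"
proof -
  have "((\<lambda>x. \<Sum>\<^sub>\<infinity>k. (W k * cmod (f x k))\<^sup>2) \<longlongrightarrow> 0) F"
  proof (rule infsum_dominated_tendsto_0)
    show "(\<lambda>k. D\<^sup>2 * (W' k * cmod (w k))\<^sup>2) summable_on UNIV"
      using w by (intro summable_on_cmult_right) (simp add: wsq_def)
    show "\<forall>\<^sub>F x in F. \<forall>k. \<bar>(W k * cmod (f x k))\<^sup>2\<bar> \<le> D\<^sup>2 * (W' k * cmod (w k))\<^sup>2"
      using dom
    proof eventually_elim
      case (elim x)
      then show ?case
        using W by (auto simp: power_mult_distrib[symmetric] intro!: power_mono simp del: power_mult_distrib)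
    qed
    fix k
    have "((\<lambda>x. (W k * cmod (f x k))\<^sup>2) \<longlongrightarrow> (W k * cmod 0)\<^sup>2) F" by (intro tendsto_intros lim)
    then show "((\<lambda>x. (W k * cmod (f x k))\<^sup>2) \<longlongrightarrow> 0) F" by simp
  qed
  from tendsto_real_sqrt[OF this] show ?thesis by (simp add: wnorm_def)
qed

lemma cauchy_schwarz_weighted:
  fixes a b :: "'i \<Rightarrow> real"
  shows "(\<Sum>k\<in>A. a k * b k) \<le> sqrt (\<Sum>k\<in>A. (a k)\<^sup>2) * sqrt (\<Sum>k\<in>A. (b k)\<^sup>2)"
  unfolding real_sqrt_mult[symmetric] by (rule real_le_rsqrt) (rule Cauchy_Schwarz_ineq_sum)

text \<open>A Minkowski inequality for integrals that are only given coordinatewise, without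
  vector-valued integration. The result is paired with itself over a finite index set, and
  Cauchy-Schwarz inside the integral leaves \<open>sqrt X\<close> times the majorant
  \<open>h\<close>.\<close>

lemma duhamel_norm_le:
  fixes d :: "'i \<Rightarrow> complex"
  assumes W: "\<And>k. 0 \<le> W k" and t: "0 \<le> t"
    and int: "\<And>k. ((\<lambda>\<tau>. e k \<tau> * f \<tau> k) has_integral d k) {0..t}"
    and e: "\<And>k \<tau>. cmod (e k \<tau>) \<le> 1"
    and f: "\<And>\<tau>. \<tau> \<in> {0..t} \<Longrightarrow> wsq W (f \<tau>)" "\<And>\<tau>. \<tau> \<in> {0..t} \<Longrightarrow> wnorm W (f \<tau>) \<le> h \<tau>"
    and h: "(h has_integral H) {0..t}"
  shows "wnorm W d \<le> H"
proof -
  have H0: "0 \<le> H"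
    by (rule has_integral_nonneg[OF h]) (use f(2) order.trans[OF wnorm_nonneg] in blast)
  show ?thesis
  proof (rule wsqI(2)[OF _ H0])
    fix A :: "'i set" assume A: "finite A"
    define X where "X = (\<Sum>k\<in>A. (W k * cmod (d k))\<^sup>2)"
    have X0: "0 \<le> X" unfolding X_def by (intro sum_nonneg) auto
    have "((\<lambda>\<tau>. \<Sum>k\<in>A. of_real ((W k)\<^sup>2) * cnj (d k) * (e k \<tau> * f \<tau> k)) has_integral (\<Sum>k\<in>A. of_real ((W k)\<^sup>2) * cnj (d k) * d k)) {0..t}"
      by (intro has_integral_sum A has_integral_mult_right int)
    moreover have "(\<Sum>k\<in>A. of_real ((W k)\<^sup>2) * cnj (d k) * d k) = of_real X"
    proof -
      have "of_real ((W k)\<^sup>2) * cnj (d k) * d k = of_real ((W k * cmod (d k))\<^sup>2)" for k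
        unfolding power_mult_distrib of_real_mult complex_norm_square[of "d k"] by (simp add: mult_ac)
      then show ?thesis by (simp only: X_def of_real_sum)
    qed
    ultimately have I: "((\<lambda>\<tau>. \<Sum>k\<in>A. of_real ((W k)\<^sup>2) * cnj (d k) * (e k \<tau> * f \<tau> k)) has_integral of_real X) {0..t}"
      by simp
    from has_integral_linear[OF I bounded_linear_Re]
    have R: "((\<lambda>\<tau>. Re (\<Sum>k\<in>A. of_real ((W k)\<^sup>2) * cnj (d k) * (e k \<tau> * f \<tau> k))) has_integral X) {0..t}"
      by (simp add: o_def del: of_real_power)
    have "X \<le> sqrt X * H"
    proof (rule has_integral_le[OF R has_integral_mult_right[OF h]])
      fix \<tau> assume \<tau>: "\<tau> \<in> {0..t}"
      have "Re (\<Sum>k\<in>A. of_real ((W k)\<^sup>2) * cnj (d k) * (e k \<tau> * f \<tau> k)) \<le> (\<Sum>k\<in>A. cmod (of_real ((W k)\<^sup>2) * cnj (d k) * (e k \<tau> * f \<tau> k)))"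
        by (rule order.trans[OF complex_Re_le_cmod norm_sum])
      also have "\<dots> \<le> (\<Sum>k\<in>A. (W k * cmod (d k)) * (W k * cmod (f \<tau> k)))"
      proof (rule sum_mono)
        fix k
        have "cmod (of_real ((W k)\<^sup>2) * cnj (d k) * (e k \<tau> * f \<tau> k)) = (W k * cmod (d k)) * (W k * cmod (f \<tau> k)) * cmod (e k \<tau>)"
          by (simp add: norm_mult power2_eq_square abs_mult_self_eq mult_ac del: of_real_mult of_real_power)
        also have "\<dots> \<le> (W k * cmod (d k)) * (W k * cmod (f \<tau> k)) * 1"
          using W by (intro mult_left_mono e) auto
        finally show "cmod (of_real ((W k)\<^sup>2) * cnj (d k) * (e k \<tau> * f \<tau> k)) \<le> (W k * cmod (d k)) * (W k * cmod (f \<tau> k))" by simp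
      qed
      also have "\<dots> \<le> sqrt X * sqrt (\<Sum>k\<in>A. (W k * cmod (f \<tau> k))\<^sup>2)"
        unfolding X_def by (rule cauchy_schwarz_weighted)
      also have "\<dots> \<le> sqrt X * h \<tau>"
      proof (rule mult_left_mono)
        have "sqrt (\<Sum>k\<in>A. (W k * cmod (f \<tau> k))\<^sup>2) \<le> wnorm W (f \<tau>)"
          using sum_le_wnorm[OF f(1)[OF \<tau>] A] by (intro real_le_lsqrt) auto
        then show "sqrt (\<Sum>k\<in>A. (W k * cmod (f \<tau> k))\<^sup>2) \<le> h \<tau>" using f(2)[OF \<tau>] by linarith
      qed (use X0 in simp)
      finally show "Re (\<Sum>k\<in>A. of_real ((W k)\<^sup>2) * cnj (d k) * (e k \<tau> * f \<tau> k)) \<le> sqrt X * h \<tau>" .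
    qed
    then have le: "sqrt X * sqrt X \<le> sqrt X * H" using X0 by simp
    have "sqrt X \<le> H"
    proof (cases "X = 0")
      case False
      then show ?thesis using mult_le_cancel_left_pos[of "sqrt X" "sqrt X" H] X0 le by simp
    qed (use H0 in simp)
    then have "(sqrt X)\<^sup>2 \<le> H\<^sup>2" using X0 by (intro power_mono) auto
    then show "(\<Sum>k\<in>A. (W k * cmod (d k))\<^sup>2) \<le> H\<^sup>2" using X0 by (simp add: X_def)
  qed
qed

text \<open>Iterating the integral inequality gives \<open>B * C ^ n * t ^ n / fact n\<close>, which
  tends to 0. Each round uses an explicit polynomial majorant, so the norm of \<open>d\<close>
  itself is never integrated.\<close>

lemma gronwall_zero:
  fixes d :: "real \<Rightarrow> 'i \<Rightarrow> complex"
  assumes W: "\<And>k. 0 < W k" and C: "0 \<le> C"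
    and int: "\<And>t k. 0 \<le> t \<Longrightarrow> t \<le> T \<Longrightarrow> ((\<lambda>\<tau>. e t k \<tau> * f \<tau> k) has_integral d t k) {0..t}"
    and e: "\<And>t k \<tau>. cmod (e t k \<tau>) \<le> 1"
    and d: "\<And>t. 0 \<le> t \<Longrightarrow> t \<le> T \<Longrightarrow> wsq W (d t)" "\<And>t. 0 \<le> t \<Longrightarrow> t \<le> T \<Longrightarrow> wnorm W (d t) \<le> B"
    and f: "\<And>t. 0 \<le> t \<Longrightarrow> t \<le> T \<Longrightarrow> wsq W (f t)" "\<And>t. 0 \<le> t \<Longrightarrow> t \<le> T \<Longrightarrow> wnorm W (f t) \<le> C * wnorm W (d t)"
    and t: "0 \<le> t" "t \<le> T"
  shows "d t k = 0"
proof -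
  have step: "wnorm W (d t) \<le> B * C ^ n * t ^ n / fact n" if "0 \<le> t" "t \<le> T" for n t
    using that
  proof (induction n arbitrary: t)
    case 0
    then show ?case using d(2) by simp
  next
    case (Suc n)
    have "((\<lambda>\<tau>. C * (B * C ^ n * \<tau> ^ n / fact n)) has_integral
        (B * C ^ Suc n * t ^ Suc n / fact (Suc n) - B * C ^ Suc n * 0 ^ Suc n / fact (Suc n))) {0..t}"
    proof (rule fundamental_theorem_of_calculus[OF Suc.prems(1)])
      fix \<tau>
      have "((\<lambda>\<tau>. B * C ^ Suc n * \<tau> ^ Suc n / fact (Suc n)) has_real_derivative
          (B * C ^ Suc n * (real (Suc n) * \<tau> ^ n) / fact (Suc n))) (at \<tau> within {0..t})"
        by (auto intro!: derivative_eq_intros simp del: power_Suc fact_Suc)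
      moreover have "B * C ^ Suc n * (real (Suc n) * \<tau> ^ n) / fact (Suc n) = C * (B * C ^ n * \<tau> ^ n / fact n)"
        by (simp add: field_simps del: of_nat_Suc)
      ultimately show "((\<lambda>\<tau>. B * C ^ Suc n * \<tau> ^ Suc n / fact (Suc n)) has_vector_derivative
          C * (B * C ^ n * \<tau> ^ n / fact n)) (at \<tau> within {0..t})"
        by (simp only: has_real_derivative_iff_has_vector_derivative)
    qed
    then have h: "((\<lambda>\<tau>. C * (B * C ^ n * \<tau> ^ n / fact n)) has_integral (B * C ^ Suc n * t ^ Suc n / fact (Suc n))) {0..t}"
      by simp
    show ?case
    proof (rule duhamel_norm_le[OF less_imp_le[OF W] Suc.prems(1) int[OF Suc.prems] e _ _ h])
      fix \<tau> assume "\<tau> \<in> {0..t}"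
      then have \<tau>: "0 \<le> \<tau>" "\<tau> \<le> T" using Suc.prems by auto
      show "wsq W (f \<tau>)" by (rule f(1)[OF \<tau>])
      show "wnorm W (f \<tau>) \<le> C * (B * C ^ n * \<tau> ^ n / fact n)"
        using f(2)[OF \<tau>] mult_left_mono[OF Suc.IH[OF \<tau>] C] by linarith
    qed
  qed
  have "(\<lambda>n. B * (inverse (fact n) * (C * t) ^ n)) \<longlonglongrightarrow> B * 0"
    by (intro tendsto_mult tendsto_const summable_LIMSEQ_zero summable_exp)
  then have "(\<lambda>n. B * C ^ n * t ^ n / fact n) \<longlonglongrightarrow> 0"
    by (simp add: power_mult_distrib divide_inverse mult_ac)
  then have "wnorm W (d t) \<le> 0"
    by (rule LIMSEQ_le_const) (use step[OF t] in auto)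
  then have "W k * cmod (d t k) \<le> 0"
    using coef_le_wnorm[OF d(1)[OF t] less_imp_le[OF W], of k] by linarith
  then show ?thesis using W[of k] by (simp add: mult_le_0_iff)
qed

section \<open>The diagonal target evolution\<close>

definition mu :: "real \<Rightarrow> (int \<times> int \<Rightarrow> real) \<Rightarrow> int \<times> int \<Rightarrow> complex" where
  "mu rate l k = (if k = 0 then 0 else \<i> * of_real (l k) - of_real rate)"

definition evo :: "real \<Rightarrow> (int \<times> int \<Rightarrow> real) \<Rightarrow> (int \<times> int \<Rightarrow> complex) \<Rightarrow> real \<Rightarrow> int \<times> int \<Rightarrow> complex" where
  "evo rate l w t k = exp (mu rate l k * of_real t) * w k"

lemma norm_exp_mu:
  assumes "rate > 0"
  shows "cmod (exp (mu rate l k * of_real t)) \<le> exp (rate * \<bar>t\<bar>)"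
proof (cases "k = 0")
  case False
  have "- (rate * t) \<le> rate * \<bar>t\<bar>"
    using mult_left_mono[of "- t" "\<bar>t\<bar>" rate] assms by simp
  then show ?thesis using False by (simp add: mu_def)
qed (use assms in \<open>simp add: mu_def\<close>)

text \<open>The mean value inequality on the half-plane \<open>Re z <= rate\<close>, which contains
  0 and every \<open>mu * h\<close>. The imaginary parts are unbounded in \<open>k\<close>, yet the
  constant is uniform.\<close>

lemma norm_exp_mu_diff:
  assumes "rate > 0" "\<bar>h\<bar> \<le> 1"
  shows "cmod (exp (mu rate l k * of_real h) - 1) \<le> exp rate * (cmod (mu rate l k) * \<bar>h\<bar>)"
proof -
  let ?z = "mu rate l k * complex_of_real h"
  have "Re ?z \<le> rate"
  proof (cases "k = 0")
    case False
    have "- (rate * h) \<le> rate * 1" using mult_left_mono[of "- h" 1 rate] assms by auto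
    then show ?thesis using False by (simp add: mu_def)
  qed (use assms in \<open>simp add: mu_def\<close>)
  then have "cmod (exp ?z - exp 0) \<le> exp rate * cmod (?z - 0)"
    using assms(1)
    by (intro field_differentiable_bound[of "{z. Re z \<le> rate}" exp exp] convex_halfspace_Re_le)
      (auto intro!: derivative_eq_intros)
  then show ?thesis by (simp add: norm_mult)
qed

lemma evo_wsq:
  assumes "rate > 0" "wsq W w" "\<And>k. 0 \<le> W k"
  shows "wsq W (evo rate l w t)"
proof (rule wnorm_mono(1)[OF assms(2,3), where D = "exp (rate * \<bar>t\<bar>)"])
  fix k
  have "cmod (evo rate l w t k) \<le> exp (rate * \<bar>t\<bar>) * cmod (w k)"
    unfolding evo_def norm_mult by (intro mult_right_mono norm_exp_mu assms) simp
  then show "W k * cmod (evo rate l w t k) \<le> exp (rate * \<bar>t\<bar>) * (W k * cmod (w k))"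
    using mult_left_mono[OF _ assms(3)[of k]] by (simp add: mult.left_commute)
qed simp

lemma evo_add: "evo rate l w (t + h) k = exp (mu rate l k * of_real h) * evo rate l w t k"
  by (simp add: evo_def exp_add[symmetric] algebra_simps)

text \<open>Dominated convergence; for \<open>|t' - t| < 1\<close> both terms are at most
  \<open>exp (rate * (|t| + 1))\<close> times the initial coefficient.\<close>

lemma evo_continuous:
  assumes rate: "rate > 0" and w: "wsq W w" and W: "\<And>k. 0 \<le> W k"
  shows "((\<lambda>t'. wnorm W (\<lambda>k. evo rate l w t' k - evo rate l w t k)) \<longlongrightarrow> 0) (at t within S)"
proof (rule wnorm_dominated_tendsto_0[OF w W, where D = "2 * exp (rate * (\<bar>t\<bar> + 1))"])
  have "\<forall>\<^sub>F t' in at t within S. dist t' t < 1"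
    by (rule eventually_at_ball'[THEN eventually_mono]) (auto simp: dist_commute)
  then show "\<forall>\<^sub>F t' in at t within S. \<forall>k. W k * cmod (evo rate l w t' k - evo rate l w t k)
      \<le> 2 * exp (rate * (\<bar>t\<bar> + 1)) * (W k * cmod (w k))"
  proof eventually_elim
    case (elim t')
    have b: "cmod (evo rate l w \<tau> k) \<le> exp (rate * (\<bar>t\<bar> + 1)) * cmod (w k)" if "\<bar>\<tau>\<bar> \<le> \<bar>t\<bar> + 1" for \<tau> k
    proof -
      have "cmod (exp (mu rate l k * of_real \<tau>)) \<le> exp (rate * \<bar>\<tau>\<bar>)" by (rule norm_exp_mu[OF rate])
      also have "\<dots> \<le> exp (rate * (\<bar>t\<bar> + 1))" using rate that by simp
      finally show ?thesis unfolding evo_def norm_mult by (rule mult_right_mono) simp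
    qed
    have "\<bar>t'\<bar> \<le> \<bar>t\<bar> + 1" using elim by (simp add: dist_real_def)
    then have "cmod (evo rate l w t' k - evo rate l w t k) \<le> 2 * exp (rate * (\<bar>t\<bar> + 1)) * cmod (w k)" for k
      using b[of t' k] b[of t k] norm_triangle_ineq4[of "evo rate l w t' k" "evo rate l w t k"] by simp
    then show ?case
      using mult_left_mono[OF _ W] by (simp add: mult.left_commute)
  qed
  fix k
  have "((\<lambda>t'. exp (mu rate l k * of_real t') * w k - exp (mu rate l k * of_real t) * w k) \<longlongrightarrow>
      exp (mu rate l k * of_real t) * w k - exp (mu rate l k * of_real t) * w k) (at t within S)"
    by (intro tendsto_intros)
  then show "((\<lambda>t'. evo rate l w t' k - evo rate l w t k) \<longlongrightarrow> 0) (at t within S)"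
    by (simp add: evo_def)
qed simp

text \<open>The generator has size \<open>jb ^ r\<close>, so the derivative exists with a loss of
  \<open>r\<close> orders: difference quotients are dominated by a multiple of \<open>|mu|\<close>,
  and dominated convergence applies in order \<open>s - r\<close>.\<close>

lemma evo_derivative:
  assumes rate: "rate > 0" and w: "hsq s w"
    and growth: "\<And>k. \<bar>l k\<bar> \<le> Cl * jb k powr r" and Cl: "0 \<le> Cl" and r: "r \<ge> 0"
  shows "((\<lambda>h. hnorm (s - r) (\<lambda>k. (1 / of_real h * evo rate l w (t + h) k + (- 1 / of_real h) * evo rate l w t k)
      - mu rate l k * evo rate l w t k)) \<longlongrightarrow> 0) (at 0)"
    and "hsq (s - r) (\<lambda>k. mu rate l k * evo rate l w t k)"
proof -
  \<comment> \<open>\<open>exp rate\<close> bounds the quotient and 1 the subtracted derivative,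
    both relative to \<open>|mu|\<close>; \<open>Cl + rate\<close> bounds \<open>|mu|\<close>
    relative to \<open>jb powr r\<close>; the last factor bounds the evolution at time
    \<open>t\<close>.\<close>
  define D where "D = (exp rate + 1) * (Cl + rate) * exp (rate * \<bar>t\<bar>)"
  have D0: "0 \<le> D" using rate Cl by (simp add: D_def)
  have W: "0 \<le> wgt 1 (s - r) k" for k by (simp add: wgt_def)
  have ev: "cmod (evo rate l w t k) \<le> exp (rate * \<bar>t\<bar>) * cmod (w k)" for k
    unfolding evo_def norm_mult by (intro mult_right_mono norm_exp_mu rate) simp
  have muj: "cmod (mu rate l k) \<le> (Cl + rate) * jb k powr r" for k
  proof -
    have "1 \<le> jb k powr r" using r by (intro ge_one_powr_ge_zero) auto
    then have "rate \<le> rate * jb k powr r" using rate by simp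
    moreover have "cmod (mu rate l k) \<le> \<bar>l k\<bar> + rate"
      using norm_triangle_ineq4[of "\<i> * of_real (l k)" "of_real rate"] rate by (simp add: mu_def norm_mult)
    ultimately show ?thesis using growth[of k] by (simp add: distrib_right)
  qed
  have ww: "wgt 1 (s - r) k * jb k powr r = wgt 1 s k" for k
    by (simp add: wgt_def powr_add[symmetric])
  have key: "wgt 1 (s - r) k * (c * (cmod (mu rate l k) * cmod (evo rate l w t k))) \<le> c * ((Cl + rate) * exp (rate * \<bar>t\<bar>)) * (wgt 1 s k * cmod (w k))"
    if "0 \<le> c" for c k
  proof -
    have "cmod (mu rate l k) * cmod (evo rate l w t k) \<le> ((Cl + rate) * jb k powr r) * (exp (rate * \<bar>t\<bar>) * cmod (w k))"
      using Cl rate by (intro mult_mono muj ev) auto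
    then have "wgt 1 (s - r) k * (c * (cmod (mu rate l k) * cmod (evo rate l w t k)))
       \<le> wgt 1 (s - r) k * (c * (((Cl + rate) * jb k powr r) * (exp (rate * \<bar>t\<bar>) * cmod (w k))))"
      using that W by (intro mult_left_mono) auto
    also have "\<dots> = c * ((Cl + rate) * exp (rate * \<bar>t\<bar>)) * ((wgt 1 (s - r) k * jb k powr r) * cmod (w k))"
      by (simp only: mult_ac)
    finally show ?thesis unfolding ww .
  qed
  show "hsq (s - r) (\<lambda>k. mu rate l k * evo rate l w t k)"
    by (rule wnorm_mono(1)[OF w W, where D = "1 * ((Cl + rate) * exp (rate * \<bar>t\<bar>))"])
      (use key[of 1] Cl rate in \<open>simp_all add: norm_mult\<close>)
  show "((\<lambda>h. hnorm (s - r) (\<lambda>k. (1 / of_real h * evo rate l w (t + h) k + (- 1 / of_real h) * evo rate l w t k)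
      - mu rate l k * evo rate l w t k)) \<longlongrightarrow> 0) (at 0)"
  proof (rule wnorm_dominated_tendsto_0[OF w W D0])
    have eq: "(1 / of_real h * evo rate l w (t + h) k + (- 1 / of_real h) * evo rate l w t k) - mu rate l k * evo rate l w t k
        = ((exp (mu rate l k * of_real h) - 1) / of_real h - mu rate l k) * evo rate l w t k" for h k
      unfolding evo_add by (simp add: field_simps diff_divide_distrib)
    have "\<forall>\<^sub>F h in at (0::real). dist h 0 < 1 \<and> h \<noteq> 0"
      unfolding eventually_at by (intro exI[of _ 1]) auto
    then show "\<forall>\<^sub>F h in at 0. \<forall>k. wgt 1 (s - r) k * cmod ((1 / of_real h * evo rate l w (t + h) k + (- 1 / of_real h) * evo rate l w t k)
      - mu rate l k * evo rate l w t k) \<le> D * (wgt 1 s k * cmod (w k))"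
    proof eventually_elim
      case (elim h)
      show ?case
      proof
        fix k
        have h: "\<bar>h\<bar> \<le> 1" "h \<noteq> 0" using elim by auto
        have "cmod ((exp (mu rate l k * of_real h) - 1) / of_real h) \<le> exp rate * cmod (mu rate l k)"
          using norm_exp_mu_diff[OF rate h(1), of l k] h(2) by (simp add: norm_divide divide_le_eq mult.assoc)
        then have "cmod ((exp (mu rate l k * of_real h) - 1) / of_real h - mu rate l k) \<le> (exp rate + 1) * cmod (mu rate l k)"
          by (rule order.trans[OF norm_triangle_ineq4 add_right_mono, THEN order.trans]) (simp add: distrib_right)
        then have "cmod (((exp (mu rate l k * of_real h) - 1) / of_real h - mu rate l k) * evo rate l w t k)
            \<le> (exp rate + 1) * (cmod (mu rate l k) * cmod (evo rate l w t k))"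
          unfolding norm_mult mult.assoc[symmetric] by (rule mult_right_mono) simp
        then have "wgt 1 (s - r) k * cmod (((exp (mu rate l k * of_real h) - 1) / of_real h - mu rate l k) * evo rate l w t k)
            \<le> wgt 1 (s - r) k * ((exp rate + 1) * (cmod (mu rate l k) * cmod (evo rate l w t k)))"
          by (rule mult_left_mono) (rule W)
        also have "\<dots> \<le> D * (wgt 1 s k * cmod (w k))"
          using key[of "exp rate + 1" k] by (simp add: D_def mult.assoc add_nonneg_nonneg)
        finally show "wgt 1 (s - r) k * cmod ((1 / of_real h * evo rate l w (t + h) k + (- 1 / of_real h) * evo rate l w t k)
            - mu rate l k * evo rate l w t k) \<le> D * (wgt 1 s k * cmod (w k))" unfolding eq .
      qed
    qed
    fix k
    have "((\<lambda>z. exp (mu rate l k * z)) has_field_derivative mu rate l k * exp (mu rate l k * 0)) (at 0)"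
      by (auto intro!: derivative_eq_intros)
    then have "((\<lambda>z. (exp (mu rate l k * (0 + z)) - exp (mu rate l k * 0)) / z) \<longlongrightarrow> mu rate l k * exp (mu rate l k * 0)) (at 0)"
      by (rule DERIV_D)
    moreover have "filterlim complex_of_real (at 0) (at 0)"
      by (rule filterlim_atI) (auto intro!: tendsto_eq_intros simp: eventually_at intro: exI[of _ 1])
    ultimately have "((\<lambda>h. (exp (mu rate l k * (0 + of_real h)) - exp (mu rate l k * 0)) / complex_of_real h) \<longlongrightarrow> mu rate l k * exp (mu rate l k * 0)) (at 0)"
      by (rule filterlim_compose)
    then have "((\<lambda>h. ((exp (mu rate l k * of_real h) - 1) / of_real h - mu rate l k) * evo rate l w t k) \<longlongrightarrow> (mu rate l k - mu rate l k) * evo rate l w t k) (at 0)"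
      by (intro tendsto_mult tendsto_diff tendsto_const) simp
    then show "((\<lambda>h. (1 / of_real h * evo rate l w (t + h) k + (- 1 / of_real h) * evo rate l w t k) - mu rate l k * evo rate l w t k) \<longlongrightarrow> 0) (at 0)"
      unfolding eq by simp
  qed
qed

text \<open>Arranged for summation over \<open>j\<close> in \<open>kop_T_mu\<close>. For
  \<open>j = 0\<close> both sides vanish: column 0 of the control matrix is zero, column 0 of
  \<open>T\<close> is the unit vector, and \<open>l 0 = 0\<close>.\<close>

lemma Tker_sylvester:
  assumes "rate > 0" "l 0 = 0"
  shows "Tker rate l gh1 gh2 k j * mu rate l j = \<i> * of_real (l k) * Tker rate l gh1 gh2 k j - Gker gh1 gh2 k j"
proof (cases "j = 0")
  case True
  then have "Gker gh1 gh2 k j = 0" by (auto simp: Gker_def)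
  then show ?thesis using True assms by (auto simp: Tker_def mu_def)
next
  case False
  have "complex_of_real rate + \<i> * of_real (l k - l j) \<noteq> 0" using assms by (auto simp: complex_eq_iff)
  moreover have "G * (1 / z) * (z' - z) = z' * (G * (1 / z)) - G" if "z \<noteq> 0" for G z z' :: complex
    using that by (simp add: field_simps)
  moreover have "mu rate l j = \<i> * of_real (l k) - (complex_of_real rate + \<i> * of_real (l k - l j))"
    using False by (simp add: mu_def algebra_simps)
  ultimately show ?thesis using False by (simp add: Tker_def del: times_divide_eq_right)
qed

lemma evo_decay:
  assumes t: "0 \<le> t" and w: "wsq W w" "w 0 = 0" and W: "\<And>k. 0 \<le> W k"
  shows "wnorm W (evo rate l w t) \<le> exp (- rate * t) * wnorm W w"
proof (rule wnorm_mono(2)[OF w(1) W])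
  fix k
  show "W k * cmod (evo rate l w t k) \<le> exp (- rate * t) * (W k * cmod (w k))"
  proof (cases "k = 0")
    case False
    then show ?thesis by (simp add: evo_def norm_mult mu_def mult_ac)
  qed (use w in \<open>simp add: evo_def\<close>)
qed simp

section \<open>Sobolev spaces in terms of Fourier coefficients\<close>

lemma Hs_weight_eq: "Hs_weight \<sigma> u k = (wgt 1 \<sigma> k * cmod (fourier u k))\<^sup>2"
proof -
  have "jb k powr (2 * \<sigma>) = (jb k powr \<sigma>)\<^sup>2"
    by (simp add: powr_add[symmetric] power2_eq_square)
  then show ?thesis by (simp add: Hs_weight_def wgt_def power_mult_distrib)
qed

lemma Hs_iff: "u \<in> Hs \<sigma> \<longleftrightarrow> distribution u \<and> hsq \<sigma> (fourier u)"
proof -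
  have "Hs_weight \<sigma> u = (\<lambda>k. (wgt 1 \<sigma> k * cmod (fourier u k))\<^sup>2)"
    by (rule ext) (rule Hs_weight_eq)
  then show ?thesis by (simp add: Hs_def wsq_def)
qed

lemma Hs_norm_eq: "Hs_norm \<sigma> u = 2 * pi * hnorm \<sigma> (fourier u)"
  by (simp add: Hs_norm_def wnorm_def Hs_weight_eq real_sqrt_mult)

text \<open>Holds for negative orders too, at the cost of \<open>|\<sigma>|\<close> powers, so
  elements of any order can be synthesised.\<close>

lemma hsq_polyg:
  assumes "hsq \<sigma> a"
  shows "polyg a"
proof -
  have "cmod (a k) \<le> hnorm \<sigma> a * jb k ^ nat \<lceil>\<bar>\<sigma>\<bar>\<rceil>" for k
  proof -
    have p: "0 < wgt 1 \<sigma> k" by (rule wgt_pos) simp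
    have "cmod (a k) \<le> hnorm \<sigma> a * (1 / wgt 1 \<sigma> k)"
      using coef_le_wnorm[OF assms less_imp_le[OF p]] p by (simp add: pos_le_divide_eq mult.commute)
    also have "1 / wgt 1 \<sigma> k = jb k powr (- \<sigma>)" by (simp add: wgt_def powr_minus_divide)
    also have "hnorm \<sigma> a * jb k powr (- \<sigma>) \<le> hnorm \<sigma> a * jb k powr \<bar>\<sigma>\<bar>"
      by (intro mult_left_mono powr_mono) auto
    also have "\<dots> \<le> hnorm \<sigma> a * jb k ^ nat \<lceil>\<bar>\<sigma>\<bar>\<rceil>"
      by (intro mult_left_mono powr_le_jb_power) auto
    finally show ?thesis .
  qed
  then show ?thesis unfolding polyg_def by blast
qed

lemma synth_Hs: "hsq \<sigma> a \<Longrightarrow> synth a \<in> Hs \<sigma>"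
  by (simp add: Hs_iff distribution_synth hsq_polyg fourier_synth[abs_def])

lemma fourier_synth_fun [simp]: "fourier (synth a) = a"
  by (rule ext) (rule fourier_synth)

lemma fourier_const_dist: "distribution (const_dist c)" "fourier (const_dist c) k = (if k = 0 then c else 0)"
proof -
  have p: "polyg (\<lambda>k. if k = 0 then c else 0)" by (rule polyg_bounded[of _ "cmod c"]) simp
  have "const_dist c = synth (\<lambda>k. if k = 0 then c else 0)"
  proof (rule extensionalityI[of _ test_fun])
    fix \<phi> assume t: "\<phi> \<in> test_fun"
    have "(\<Sum>\<^sub>\<infinity>k. (if k = 0 then c else 0) * pc \<phi> k) = c * pc \<phi> 0"
      by (rule infsumI, rule has_sum_finite_neutralI[of "{0}"]) auto
    then show "const_dist c \<phi> = synth (\<lambda>k. if k = 0 then c else 0) \<phi>"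
      using t by (simp add: const_dist_def dist_of_fun_def synth_def pc_def torus_def)
  qed (auto simp: const_dist_def dist_of_fun_def synth_def)
  then show "distribution (const_dist c)" "fourier (const_dist c) k = (if k = 0 then c else 0)"
    using distribution_synth[OF p] by simp_all
qed

lemma Hs_lin:
  assumes "u \<in> Hs \<sigma>" "v \<in> Hs \<sigma>"
  shows "dist_lin a u b v \<in> Hs \<sigma>" "fourier (dist_lin a u b v) = (\<lambda>k. a * fourier u k + b * fourier v k)"
proof -
  show f: "fourier (dist_lin a u b v) = (\<lambda>k. a * fourier u k + b * fourier v k)"
    using assms by (intro ext dist_lin_synth) (auto simp: Hs_iff)
  show "dist_lin a u b v \<in> Hs \<sigma>"
    using assms by (auto simp: Hs_iff f intro!: dist_lin_synth wsq_lin)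
qed

section \<open>The closed-loop system\<close>

lemma tendsto_zero_bound:
  fixes f g :: "'a \<Rightarrow> real"
  assumes g: "(g \<longlongrightarrow> c) F" "c = 0" and f: "\<And>x. 0 \<le> f x" "\<And>x. f x \<le> g x"
  shows "(f \<longlongrightarrow> 0) F"
proof (rule tendsto_sandwich[OF always_eventually always_eventually tendsto_const])
  show "(g \<longlongrightarrow> 0) F" using g by simp
qed (use f in auto)

text \<open>Of the spectral hypotheses only the invertibility of \<open>T\<close> on the space of
  order \<open>s\<close> is kept, in \<open>T_surj\<close> and \<open>T_lower\<close>; gap and
  profiles have entered through coercivity before.\<close>

locale closed_loop =
  fixes b :: "int \<times> int \<Rightarrow> real" and g1 g2 :: "real \<Rightarrow> real" and s r rate Cl Ci :: real
  assumes g: "smooth1 g1" "periodic1 g1" "smooth1 g2" "periodic1 g2"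
    and rate: "rate > 0" and s: "s \<ge> 0" and r: "r \<ge> 0"
    and Cl: "Cl \<ge> 0" and growth: "\<And>k. \<bar>eigen b k\<bar> \<le> Cl * jb k powr r"
    and polyb: "polyg (\<lambda>k. of_real (b k))"
    and Ci: "Ci \<ge> 0"
    and T_surj: "\<And>f. hsq s f \<Longrightarrow> \<exists>a. hsq s a \<and> kop (Tker rate (eigen b) (ghat g1) (ghat g2)) a = f"
    and T_lower: "\<And>a. hsq s a \<Longrightarrow> hnorm s a \<le> Ci * hnorm s (kop (Tker rate (eigen b) (ghat g1) (ghat g2)) a)"
begin

abbreviation l where "l \<equiv> eigen b"
abbreviation T where "T \<equiv> Tker rate l (ghat g1) (ghat g2)"
abbreviation Gk where "Gk \<equiv> Gker (ghat g1) (ghat g2)"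

lemma rapid_G: "rapid Gk" by (rule rapid_Gker[OF g])
lemma rapid_T: "rapid T" by (rule rapid_Tker[OF rapid_G rate])
lemma l0: "l 0 = 0" by (simp add: eigen_def)

lemma kop_hsq: "hsq \<sigma> a \<Longrightarrow> hsq \<sigma> (kop T a)" "hsq \<sigma> a \<Longrightarrow> hsq \<sigma> (kop Gk a)"
  using rapid_bounded[OF rapid_T, of \<sigma>] rapid_bounded[OF rapid_G, of \<sigma>] by metis+

section \<open>The inverse of \<open>T\<close> and the feedback operator\<close>

definition Tinv :: "(int \<times> int \<Rightarrow> complex) \<Rightarrow> int \<times> int \<Rightarrow> complex" where
  "Tinv f = (SOME a. hsq s a \<and> kop T a = f)"

lemma Tinv: "hsq s f \<Longrightarrow> hsq s (Tinv f)" "hsq s f \<Longrightarrow> kop T (Tinv f) = f"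
  using someI_ex[OF T_surj] unfolding Tinv_def by blast+

lemma T_inj:
  assumes "hsq s a" "hsq s a'" "kop T a = kop T a'"
  shows "a = a'"
proof
  fix k
  have d: "hsq s (\<lambda>k. 1 * a k + (- 1) * a' k)" by (rule wsq_lin[OF assms(1,2)])
  have "kop T (\<lambda>k. 1 * a k + (- 1) * a' k) = (\<lambda>_. 0)"
    unfolding rapid_lin[OF rapid_T assms(1,2)] assms(3) by simp
  then have "hnorm s (\<lambda>k. 1 * a k + (- 1) * a' k) \<le> 0"
    using T_lower[OF d] by (simp add: wnorm_def)
  then have "wgt 1 s k * cmod (1 * a k + (- 1) * a' k) \<le> 0"
    using coef_le_wnorm[OF d, of k] wgt_pos[of 1 s k] by simp
  then show "a k = a' k" using wgt_pos[of 1 s k] by (simp add: mult_le_0_iff)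
qed

lemma Tinv_kop: "hsq s a \<Longrightarrow> Tinv (kop T a) = a"
  by (rule T_inj[OF Tinv(1) _ Tinv(2)]) (auto intro: kop_hsq)

text \<open>The chosen preimage is unique by \<open>T_inj\<close>, so linearity follows by comparing
  images under \<open>T\<close>.\<close>

lemma Tinv_lin:
  assumes "hsq s f" "hsq s h"
  shows "Tinv (\<lambda>k. c * f k + d * h k) = (\<lambda>k. c * Tinv f k + d * Tinv h k)"
proof -
  have "kop T (\<lambda>k. c * Tinv f k + d * Tinv h k) = (\<lambda>k. c * f k + d * h k)"
    using rapid_lin[OF rapid_T Tinv(1)[OF assms(1)] Tinv(1)[OF assms(2)]] Tinv(2) assms by simp
  with Tinv_kop[OF wsq_lin[OF Tinv(1)[OF assms(1)] Tinv(1)[OF assms(2)]], of c d] show ?thesis by simp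
qed

lemma Tinv_norm: "hsq s f \<Longrightarrow> hnorm s (Tinv f) \<le> Ci * hnorm s f"
  using T_lower[OF Tinv(1)] Tinv(2) by metis

definition K :: "functional \<Rightarrow> functional" where
  "K u = synth (\<lambda>k. - Tinv (fourier u) k)"

lemma hsq_uminus: "hsq \<sigma> a \<Longrightarrow> hsq \<sigma> (\<lambda>k. - a k)"
  using wsq_lin[of "wgt 1 \<sigma>" a a "- 1" 0] by simp

lemma K_Hs: "u \<in> Hs s \<Longrightarrow> K u \<in> Hs s"
  unfolding K_def by (intro synth_Hs hsq_uminus Tinv) (simp add: Hs_iff)

lemma bounded_linear_K: "bounded_linear_Hs s K"
  unfolding bounded_linear_Hs_def
proof (intro conjI ballI allI)
  fix u v and c d :: complex assume u: "u \<in> Hs s" and v: "v \<in> Hs s"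
  show "K u \<in> Hs s" by (rule K_Hs[OF u])
  have h: "hsq s (fourier u)" "hsq s (fourier v)" using u v by (auto simp: Hs_iff)
  show "K (dist_lin c u d v) = dist_lin c (K u) d (K v)"
  proof (rule distribution_eqI)
    show "distribution (K (dist_lin c u d v))" using K_Hs[OF Hs_lin(1)[OF u v]] by (simp add: Hs_iff)
    show "distribution (dist_lin c (K u) d (K v))" using Hs_lin(1)[OF K_Hs[OF u] K_Hs[OF v]] by (simp add: Hs_iff)
    show "fourier (K (dist_lin c u d v)) k = fourier (dist_lin c (K u) d (K v)) k" for k
      unfolding Hs_lin(2)[OF K_Hs[OF u] K_Hs[OF v]]
      unfolding K_def fourier_synth_fun Hs_lin(2)[OF u v] Tinv_lin[OF h]
      by simp
  qed
next
  have "Hs_norm s (K u) \<le> Ci * Hs_norm s u" if "u \<in> Hs s" for u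
  proof -
    have "hnorm s (\<lambda>k. - Tinv (fourier u) k) \<le> Ci * hnorm s (fourier u)"
      using wnorm_cmult[of "wgt 1 s" "- 1" "Tinv (fourier u)"] Tinv_norm[of "fourier u"] that by (simp add: Hs_iff)
    then show ?thesis by (simp add: Hs_norm_eq K_def mult.left_commute)
  qed
  then show "\<exists>C. \<forall>u\<in>Hs s. Hs_norm s (K u) \<le> C * Hs_norm s u" by blast
qed

lemma GK:
  assumes "u \<in> Hs s"
  shows "G g1 g2 (K u) \<in> Hs s" "fourier (G g1 g2 (K u)) = (\<lambda>k. - kop Gk (Tinv (fourier u)) k)"
proof -
  have d: "distribution (K u)" using K_Hs[OF assms] by (simp add: Hs_iff)
  show f: "fourier (G g1 g2 (K u)) = (\<lambda>k. - kop Gk (Tinv (fourier u)) k)"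
    unfolding G_fourier(2)[OF g d]
    unfolding K_def fourier_synth_fun
    by (rule ext) (simp add: kop_def infsum_uminus)
  show "G g1 g2 (K u) \<in> Hs s"
    using assms by (simp add: Hs_iff f G_fourier(1)[OF g d]) (intro hsq_uminus kop_hsq Tinv, simp)
qed

lemma U_group_fourier:
  assumes "distribution u"
  shows "distribution (U_group b t u)" "fourier (U_group b t u) k = cis (l k * t) * fourier u k"
proof -
  have p: "polyg (\<lambda>k. cis (of_int (fst k) * b k * t) * fourier u k)"
    by (intro polyg_mult fourier_polyg assms polyg_bounded[of _ 1]) simp
  show "distribution (U_group b t u)" "fourier (U_group b t u) k = cis (l k * t) * fourier u k"
    unfolding U_group_def multiplier_eq[OF p] using distribution_synth[OF p] by (simp_all add: eigen_def)
qed

lemma A_fourier: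
  assumes "distribution u"
  shows "distribution (dist_dx (L_op b u))" "fourier (dist_dx (L_op b u)) k = \<i> * of_real (l k) * fourier u k"
proof -
  have p: "polyg (\<lambda>k. of_real (b k) * fourier u k)" by (intro polyg_mult polyb fourier_polyg assms)
  have L: "L_op b u = synth (\<lambda>k. of_real (b k) * fourier u k)"
    unfolding L_op_def by (rule multiplier_eq[OF p])
  have d: "distribution (L_op b u)" unfolding L by (rule distribution_synth[OF p])
  show "distribution (dist_dx (L_op b u))" by (rule dist_dx_synth[OF d])
  show "fourier (dist_dx (L_op b u)) k = \<i> * of_real (l k) * fourier u k"
    unfolding dist_dx_synth(2)[OF d] by (simp add: L eigen_def)
qed

text \<open>The conjugated flow \<open>T exp (t \<mu>) T^-1\<close>, written on
  coefficients.\<close>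

definition sol :: "functional \<Rightarrow> real \<Rightarrow> functional" where
  "sol u0 t = synth (kop T (evo rate l (Tinv (fourier u0)) t))"

section \<open>The solution for a fixed initial datum\<close>

context
  fixes u0 assumes u0: "u0 \<in> Hs s"
begin

abbreviation w where "w \<equiv> Tinv (fourier u0)"
abbreviation W where "W \<equiv> evo rate l w"

lemma wgt_nonneg: "0 \<le> wgt 1 \<sigma> k" by (simp add: wgt_def)

lemma hsq_w: "hsq s w" using u0 by (intro Tinv) (simp add: Hs_iff)
lemma hsq_W: "hsq s (W t)" by (rule evo_wsq[OF rate hsq_w wgt_nonneg])
lemma sol_Hs: "sol u0 t \<in> Hs s" unfolding sol_def by (intro synth_Hs kop_hsq hsq_W)
lemma sol_fourier: "fourier (sol u0 t) = kop T (W t)" by (simp add: sol_def)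
lemma Tinv_sol: "Tinv (fourier (sol u0 t)) = W t" unfolding sol_fourier by (rule Tinv_kop[OF hsq_W])
lemma GK_sol: "fourier (G g1 g2 (K (sol u0 t))) = (\<lambda>k. - kop Gk (W t) k)"
  by (simp add: GK(2)[OF sol_Hs] Tinv_sol)

lemma sol_0: "sol u0 0 = u0"
proof -
  have "W 0 = w" by (rule ext) (simp add: evo_def)
  then show ?thesis using u0 Tinv(2)[of "fourier u0"] by (simp add: sol_def Hs_iff synth_fourier)
qed

lemma kop_W_continuous:
  assumes "rapid M"
  shows "((\<lambda>t'. hnorm s (\<lambda>k. kop M (W t') k - kop M (W t) k)) \<longlongrightarrow> 0) (at t within S)"
proof -
  obtain B where B: "B \<ge> 0" "\<And>a. hsq s a \<Longrightarrow> hnorm s (kop M a) \<le> B * hnorm s a"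
    using rapid_bounded[OF assms, of s] by metis
  have "((\<lambda>t'. B * hnorm s (\<lambda>k. W t' k - W t k)) \<longlongrightarrow> B * 0) (at t within S)"
    by (intro tendsto_mult tendsto_const evo_continuous[OF rate hsq_w wgt_nonneg])
  moreover have "hnorm s (\<lambda>k. kop M (W t') k - kop M (W t) k) \<le> B * hnorm s (\<lambda>k. W t' k - W t k)" for t'
    using B(2)[OF wsq_lin[OF hsq_W hsq_W, of 1 t' "- 1" t]] rapid_lin[OF assms hsq_W hsq_W, of 1 t' "- 1" t] by simp
  ultimately show ?thesis
    by (rule tendsto_zero_bound[OF _ mult_zero_right wnorm_nonneg])
qed

lemma kop_W_coord_continuous:
  assumes "rapid M"
  shows "continuous_on S (\<lambda>t. kop M (W t) k)"
  unfolding continuous_on_def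
proof
  fix t
  have h: "hsq s (kop M (W t))" for t using rapid_bounded[OF assms, of s] hsq_W by metis
  have "((\<lambda>t'. hnorm s (\<lambda>k. kop M (W t') k - kop M (W t) k) / wgt 1 s k) \<longlongrightarrow> 0 / wgt 1 s k) (at t within S)"
    using wgt_pos[of 1 s k] by (intro tendsto_divide tendsto_const kop_W_continuous[OF assms]) auto
  moreover have "cmod (kop M (W t') k - kop M (W t) k) \<le> hnorm s (\<lambda>k. kop M (W t') k - kop M (W t) k) / wgt 1 s k" for t'
    using coef_le_wnorm[OF wsq_lin[OF h h, of 1 t' "- 1" t] wgt_nonneg, of k] wgt_pos[of 1 s k]
    by (simp add: pos_le_divide_eq mult.commute)
  ultimately have "((\<lambda>t'. cmod (kop M (W t') k - kop M (W t) k)) \<longlongrightarrow> 0) (at t within S)"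
    by (rule tendsto_zero_bound[OF _ div_0 norm_ge_zero])
  then have "((\<lambda>t'. kop M (W t') k - kop M (W t) k) \<longlongrightarrow> 0) (at t within S)"
    by (rule tendsto_norm_zero_cancel)
  then show "((\<lambda>t. kop M (W t) k) \<longlongrightarrow> kop M (W t) k) (at t within S)" by (rule LIM_zero_cancel)
qed

lemma Hs_dist_diff:
  assumes "u \<in> Hs s" "v \<in> Hs s"
  shows "dist_diff u v \<in> Hs s" "fourier (dist_diff u v) = (\<lambda>k. fourier u k - fourier v k)"
  using Hs_lin[OF assms, of 1 "- 1"] by auto

lemma sol_continuous: "continuous_Hs s (sol u0)"
  unfolding continuous_Hs_def
proof (intro allI impI conjI)
  fix t :: real
  show "sol u0 t \<in> Hs s" by (rule sol_Hs)
  have "((\<lambda>t'. 2 * pi * hnorm s (\<lambda>k. kop T (W t') k - kop T (W t) k)) \<longlongrightarrow> 2 * pi * 0) (at t within {0..})"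
    by (intro tendsto_mult tendsto_const kop_W_continuous[OF rapid_T])
  then show "((\<lambda>t'. Hs_norm s (dist_diff (sol u0 t') (sol u0 t))) \<longlongrightarrow> 0) (at t within {0..})"
    by (simp add: Hs_norm_eq Hs_dist_diff(2)[OF sol_Hs sol_Hs] sol_fourier)
qed

text \<open>The coefficients of the right-hand side of the equation along \<open>sol\<close>: the
  feedback \<open>- T^-1\<close> turns \<open>T (W t)\<close> into \<open>- W t\<close> before the
  control acts.\<close>

definition rhs :: "real \<Rightarrow> int \<times> int \<Rightarrow> complex" where
  "rhs t k = \<i> * of_real (l k) * kop T (W t) k - kop Gk (W t) k"

text \<open>The Sylvester identity summed over \<open>j\<close>. The time derivative of the flow,
  pushed through \<open>T\<close>, thus equals the right-hand side of the closed loop.\<close>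

lemma kop_T_mu: "kop T (\<lambda>k. mu rate l k * W t k) = rhs t"
proof
  fix k
  have "((\<lambda>j. T k j * W t j) has_sum kop T (W t) k) UNIV"
    unfolding kop_def
    by (rule has_sum_infsum[OF Infinite_Sum.abs_summable_summable[OF rapid_summable[OF rapid_T hsq_W]]])
  moreover have "((\<lambda>j. Gk k j * W t j) has_sum kop Gk (W t) k) UNIV"
    unfolding kop_def
    by (rule has_sum_infsum[OF Infinite_Sum.abs_summable_summable[OF rapid_summable[OF rapid_G hsq_W]]])
  ultimately have "((\<lambda>j. \<i> * of_real (l k) * (T k j * W t j) + - (Gk k j * W t j)) has_sum
      (\<i> * of_real (l k) * kop T (W t) k + - kop Gk (W t) k)) UNIV"
    by (rule has_sum_add[OF has_sum_cmult_right has_sum_uminusI])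
  moreover have "\<i> * of_real (l k) * (T k j * W t j) + - (Gk k j * W t j) = T k j * (mu rate l j * W t j)" for j
    using Tker_sylvester[of rate l "ghat g1" "ghat g2" k j, OF rate l0] by (simp add: mult.assoc[symmetric] left_diff_distrib)
  ultimately show "kop T (\<lambda>k. mu rate l k * W t k) k = rhs t k"
    by (simp add: kop_def rhs_def infsumI)
qed

lemma hsq_weaken: "hsq s a \<Longrightarrow> hsq (s - r) a"
proof -
  assume a: "hsq s a"
  have "wgt 1 (s - r) k \<le> wgt 1 s k" for k
    unfolding wgt_def using r by (intro powr_mono) auto
  then show ?thesis
    by (intro wnorm_mono(1)[OF a wgt_nonneg, where D = 1]) (auto intro: mult_right_mono)
qed

lemma hsq_rhs: "hsq (s - r) (rhs t)"
  unfolding kop_T_mu[symmetric]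
  by (intro kop_hsq evo_derivative(2)[OF rate hsq_w growth Cl r])

text \<open>\<open>T\<close> is bounded on the space of order \<open>s - r\<close> as well, so it
  carries the derivative of the diagonal flow to that of the solution.\<close>

lemma sol_derivative:
  "((\<lambda>h. hnorm (s - r) (\<lambda>k. (1 / of_real h * kop T (W (t + h)) k + (- 1 / of_real h) * kop T (W t) k) - rhs t k)) \<longlongrightarrow> 0) (at 0)"
proof -
  obtain B where B: "B \<ge> 0" "\<And>a. hsq (s - r) a \<Longrightarrow> hnorm (s - r) (kop T a) \<le> B * hnorm (s - r) a"
    using rapid_bounded[OF rapid_T, of "s - r"] by metis
  let ?d = "\<lambda>h k. (1 / of_real h * W (t + h) k + (- 1 / of_real h) * W t k) - mu rate l k * W t k"
  note hW = hsq_weaken[OF hsq_W]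
  note hm = evo_derivative(2)[OF rate hsq_w growth Cl r, of t]
  have 1: "kop T (\<lambda>k. 1 * (1 / of_real h * W (t + h) k + (- 1 / of_real h) * W t k) + (- 1) * (mu rate l k * W t k))
      = (\<lambda>k. (1 / of_real h * kop T (W (t + h)) k + (- 1 / of_real h) * kop T (W t) k) - rhs t k)" for h
    unfolding rapid_lin[OF rapid_T wsq_lin[OF hW hW] hm] rapid_lin[OF rapid_T hW hW] kop_T_mu by simp
  have 2: "hsq (s - r) (\<lambda>k. 1 * (1 / of_real h * W (t + h) k + (- 1 / of_real h) * W t k) + (- 1) * (mu rate l k * W t k))" for h
    by (intro wsq_lin hW hm)
  have "((\<lambda>h. B * hnorm (s - r) (?d h)) \<longlongrightarrow> B * 0) (at 0)"
    by (intro tendsto_mult tendsto_const evo_derivative(1)[OF rate hsq_w growth Cl r])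
  moreover have "hnorm (s - r) (\<lambda>k. (1 / of_real h * kop T (W (t + h)) k + (- 1 / of_real h) * kop T (W t) k) - rhs t k)
      \<le> B * hnorm (s - r) (?d h)" for h
    using B(2)[OF 2[of h]] unfolding 1 by simp
  ultimately show ?thesis
    by (rule tendsto_zero_bound[OF _ mult_zero_right wnorm_nonneg])
qed

lemma sol_coord_derivative: "((\<lambda>t. kop T (W t) k) has_vector_derivative rhs t k) (at t)"
proof -
  let ?q = "\<lambda>h k. (1 / of_real h * kop T (W (t + h)) k + (- 1 / of_real h) * kop T (W t) k) - rhs t k"
  note hW = hsq_weaken[OF kop_hsq(1)[OF hsq_W]]
  have h: "hsq (s - r) (?q h)" for h
    using wsq_lin[OF wsq_lin[OF hW hW, of "1 / of_real h" "t + h" "- 1 / of_real h" t] hsq_rhs, of 1 "- 1" t] by simp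
  have "((\<lambda>h. hnorm (s - r) (?q h) / wgt 1 (s - r) k) \<longlongrightarrow> 0 / wgt 1 (s - r) k) (at 0)"
    using wgt_pos[of 1 "s - r" k] by (intro tendsto_divide tendsto_const sol_derivative) auto
  moreover have "cmod (?q h k) \<le> hnorm (s - r) (?q h) / wgt 1 (s - r) k" for h
    using coef_le_wnorm[OF h[of h] wgt_nonneg, of k] wgt_pos[of 1 "s - r" k]
    by (simp add: pos_le_divide_eq mult.commute)
  ultimately have "((\<lambda>h. cmod (?q h k)) \<longlongrightarrow> 0) (at 0)"
    by (rule tendsto_zero_bound[OF _ div_0 norm_ge_zero])
  moreover have "\<forall>\<^sub>F h in at 0. cmod (?q h k) = norm (kop T (W (t + h)) k - kop T (W t) k - h *\<^sub>R rhs t k) / norm h"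
  proof -
    have "cmod (?q h k) = norm (kop T (W (t + h)) k - kop T (W t) k - h *\<^sub>R rhs t k) / norm h" if "h \<noteq> 0" for h
    proof -
      have "?q h k = (kop T (W (t + h)) k - kop T (W t) k - h *\<^sub>R rhs t k) / of_real h"
        using that by (simp add: scaleR_conv_of_real field_simps)
      then show ?thesis by (simp add: norm_divide)
    qed
    then show ?thesis by (auto simp: eventually_at intro: exI[of _ 1])
  qed
  ultimately have "((\<lambda>h. norm (kop T (W (t + h)) k - kop T (W t) k - h *\<^sub>R rhs t k) / norm h) \<longlongrightarrow> 0) (at 0)"
    by (rule Lim_transform_eventually)
  then show ?thesis
    by (simp add: has_vector_derivative_def has_derivative_at bounded_linear_scaleR_left)
qed

text \<open>Variation of constants: differentiating \<open>cis (l k * (t - \<tau>))\<close> times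
  the coefficient cancels the term with \<open>l k\<close> and leaves the control.\<close>

lemma sol_duhamel_coord:
  assumes "0 \<le> t"
  shows "((\<lambda>\<tau>. cis (l k * (t - \<tau>)) * (- kop Gk (W \<tau>) k)) has_integral (kop T (W t) k - cis (l k * t) * fourier u0 k)) {0..t}"
proof -
  have "((\<lambda>\<tau>. cis (l k * (t - \<tau>)) * (- kop Gk (W \<tau>) k)) has_integral
      (cis (l k * (t - t)) * kop T (W t) k - cis (l k * (t - 0)) * kop T (W 0) k)) {0..t}"
  proof (rule fundamental_theorem_of_calculus[OF assms])
    fix \<tau>
    have c: "((\<lambda>\<tau>. cis (l k * (t - \<tau>))) has_vector_derivative - (\<i> * of_real (l k)) * cis (l k * (t - \<tau>))) (at \<tau>)"
    proof -
      have "((\<lambda>\<tau>. cis (l k * t) * cis ((- l k) * \<tau>)) has_vector_derivative cis (l k * t) * (\<i> * of_real (- l k) * cis ((- l k) * \<tau>))) (at \<tau>)"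
        by (intro has_vector_derivative_mult_right has_vector_derivative_cis)
      moreover have "cis (l k * (t - \<tau>)) = cis (l k * t) * cis ((- l k) * \<tau>)" for \<tau>
        by (simp add: cis_mult algebra_simps)
      ultimately show ?thesis by (simp add: mult_ac)
    qed
    have "((\<lambda>\<tau>. cis (l k * (t - \<tau>)) * kop T (W \<tau>) k) has_vector_derivative
        (cis (l k * (t - \<tau>)) * rhs \<tau> k + (- (\<i> * of_real (l k)) * cis (l k * (t - \<tau>))) * kop T (W \<tau>) k)) (at \<tau>)"
      by (rule has_vector_derivative_mult[OF c sol_coord_derivative])
    then show "((\<lambda>\<tau>. cis (l k * (t - \<tau>)) * kop T (W \<tau>) k) has_vector_derivative
        cis (l k * (t - \<tau>)) * (- kop Gk (W \<tau>) k)) (at \<tau> within {0..t})"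
      by (rule has_vector_derivative_at_within[OF has_vector_derivative_eq_rhs]) (simp add: rhs_def algebra_simps)
  qed
  moreover have "kop T (W 0) = fourier u0"
    using arg_cong[OF sol_0, of fourier] by (simp add: sol_fourier)
  ultimately show ?thesis by (simp add: cis_zero)
qed

text \<open>The coordinate identities are weighted by \<open>pc \<phi> k\<close> and summed. The
  series converges uniformly in \<tau>, so sum and time integral may be exchanged.\<close>

lemma sol_mild: "mild_solution s b (\<lambda>v. G g1 g2 (K v)) u0 (sol u0)"
  unfolding mild_solution_def
proof (intro conjI allI impI ballI sol_continuous)
  fix t :: real and \<phi> assume t: "0 \<le> t" and \<phi>: "\<phi> \<in> test_fun"
  let ?F = "\<lambda>\<tau>. G g1 g2 (K (sol u0 \<tau>))"
  define f where "f k \<tau> = cis (l k * (t - \<tau>)) * (- kop Gk (W \<tau>) k) * pc \<phi> k" for k \<tau>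
  have dF: "distribution (?F \<tau>)" for \<tau> using GK(1)[OF sol_Hs] by (simp add: Hs_iff)
  have eq: "U_group b (t - \<tau>) (?F \<tau>) \<phi> = (\<Sum>\<^sub>\<infinity>k. f k \<tau>)" for \<tau>
    using infsumI[OF distribution_pairing[OF U_group_fourier(1)[OF dF] \<phi>], of "t - \<tau>" \<tau>]
    by (simp add: U_group_fourier(2)[OF dF] GK_sol f_def)
  obtain B where B: "B \<ge> 0" "\<And>a. hsq s a \<Longrightarrow> hnorm s (kop Gk a) \<le> B * hnorm s a"
    using rapid_bounded[OF rapid_G, of s] by metis
  define N where "N = B * (exp (rate * t) * hnorm s w)"
  have fb: "cmod (f k \<tau>) \<le> N * cmod (pc \<phi> k)" if \<tau>: "\<tau> \<in> {0..t}" for k \<tau>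
  proof -
    \<comment> \<open>Here \<open>s >= 0\<close> enters: single coefficients are bounded by the
      norm, uniformly in \<open>k\<close>.\<close>
    have 1: "1 \<le> wgt 1 s k" using s by (simp add: wgt_def ge_one_powr_ge_zero)
    have "cmod (kop Gk (W \<tau>) k) \<le> wgt 1 s k * cmod (kop Gk (W \<tau>) k)"
      using mult_right_mono[OF 1, of "cmod (kop Gk (W \<tau>) k)"] by simp
    also have "\<dots> \<le> hnorm s (kop Gk (W \<tau>))" by (rule coef_le_wnorm[OF kop_hsq(2)[OF hsq_W] wgt_nonneg])
    also have "\<dots> \<le> B * hnorm s (W \<tau>)" by (rule B(2)[OF hsq_W])
    also have "\<dots> \<le> N"
      unfolding N_def
    proof (intro mult_left_mono B(1) wnorm_mono(2)[OF hsq_w wgt_nonneg])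
      fix k
      have "cmod (exp (mu rate l k * of_real \<tau>)) \<le> exp (rate * \<bar>\<tau>\<bar>)" by (rule norm_exp_mu[OF rate])
      also have "\<dots> \<le> exp (rate * t)" using \<tau> rate by simp
      finally have "cmod (W \<tau> k) \<le> exp (rate * t) * cmod (w k)"
        unfolding evo_def norm_mult by (rule mult_right_mono) simp
      then show "wgt 1 s k * cmod (W \<tau> k) \<le> exp (rate * t) * (wgt 1 s k * cmod (w k))"
        using mult_left_mono[OF _ wgt_nonneg[of s k]] by (simp add: mult.left_commute)
    qed simp
    finally show ?thesis by (simp add: f_def norm_mult mult_right_mono)
  qed
  have ps: "(\<lambda>k. N * cmod (pc \<phi> k)) summable_on UNIV"
    using summable_on_cmult_right[OF pc_summable[OF \<phi>, of 0], of N] by simp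
  have "uniform_limit {0..t} (\<lambda>A \<tau>. \<Sum>k\<in>A. f k \<tau>) (\<lambda>\<tau>. \<Sum>\<^sub>\<infinity>k. f k \<tau>) (finite_subsets_at_top UNIV)"
    by (rule uniform_limit_infsum[OF fb ps])
  moreover have "continuous_on {0..t} (\<lambda>\<tau>. \<Sum>k\<in>A. f k \<tau>)" for A
    unfolding f_def by (intro continuous_intros kop_W_coord_continuous rapid_G)
  ultimately obtain I J where IJ: "\<And>A. ((\<lambda>\<tau>. \<Sum>k\<in>A. f k \<tau>) has_integral I A) {0..t}"
    "((\<lambda>\<tau>. \<Sum>\<^sub>\<infinity>k. f k \<tau>) has_integral J) {0..t}" "(I \<longlongrightarrow> J) (finite_subsets_at_top UNIV)"
    by (rule uniform_limit_integral) (simp, blast)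
  let ?e = "\<lambda>k. (kop T (W t) k - cis (l k * t) * fourier u0 k) * pc \<phi> k"
  have du: "distribution u0" "distribution (sol u0 t)" using u0 sol_Hs by (auto simp: Hs_iff)
  have "I A = (\<Sum>k\<in>A. ?e k)" if "finite A" for A
  proof (rule has_integral_unique[OF IJ(1)])
    show "((\<lambda>\<tau>. \<Sum>k\<in>A. f k \<tau>) has_integral (\<Sum>k\<in>A. ?e k)) {0..t}"
      unfolding f_def by (intro has_integral_sum that has_integral_mult_left sol_duhamel_coord t)
  qed
  then have "((\<lambda>A. \<Sum>k\<in>A. ?e k) \<longlongrightarrow> J) (finite_subsets_at_top UNIV)"
    by (intro Lim_transform_eventually[OF IJ(3)]) (auto intro!: eventually_finite_subsets_at_top_weakI)
  then have "(?e has_sum J) UNIV" by (simp add: has_sum_def)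
  moreover have "(?e has_sum (sol u0 t \<phi> + - U_group b t u0 \<phi>)) UNIV"
  proof -
    have "((\<lambda>k. fourier (sol u0 t) k * pc \<phi> k + - (fourier (U_group b t u0) k * pc \<phi> k)) has_sum (sol u0 t \<phi> + - U_group b t u0 \<phi>)) UNIV"
      by (intro has_sum_add has_sum_uminusI distribution_pairing du U_group_fourier(1) \<phi>)
    then show ?thesis by (simp add: sol_fourier U_group_fourier(2)[OF du(1)] left_diff_distrib)
  qed
  ultimately have "J = sol u0 t \<phi> - U_group b t u0 \<phi>" using has_sum_unique by fastforce
  then show "((\<lambda>\<tau>. U_group b (t - \<tau>) (?F \<tau>) \<phi>) has_integral (sol u0 t \<phi> - U_group b t u0 \<phi>)) {0..t}"
    using IJ(2) unfolding eq by simp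
qed

text \<open>Testing with \<open>ech (- k)\<close> turns the weak formulation into a scalar Duhamel
  formula for each Fourier coefficient.\<close>

lemma mild_coord:
  assumes m: "mild_solution s b (\<lambda>v. G g1 g2 (K v)) u0 v" and t: "0 \<le> t"
  shows "v t \<in> Hs s"
    "((\<lambda>\<tau>. cis (l k * (t - \<tau>)) * (- kop Gk (Tinv (fourier (v \<tau>))) k)) has_integral (fourier (v t) k - cis (l k * t) * fourier u0 k)) {0..t}"
proof -
  have H: "v \<tau> \<in> Hs s" if "0 \<le> \<tau>" for \<tau>
    using m that by (auto simp: mild_solution_def continuous_Hs_def)
  show "v t \<in> Hs s" by (rule H[OF t])
  have "((\<lambda>\<tau>. U_group b (t - \<tau>) (G g1 g2 (K (v \<tau>))) (ech (- k))) has_integral (v t (ech (- k)) - U_group b t u0 (ech (- k)))) {0..t}"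
    using m t test_fun_ech[of "- k"] unfolding mild_solution_def by blast
  from has_integral_mult_left[OF this, of "1 / (2 * pi)\<^sup>2"]
  have "((\<lambda>\<tau>. fourier (U_group b (t - \<tau>) (G g1 g2 (K (v \<tau>)))) k) has_integral (fourier (v t) k - fourier (U_group b t u0) k)) {0..t}"
    by (simp add: fourier_ech diff_divide_distrib)
  moreover have "fourier (U_group b (t - \<tau>) (G g1 g2 (K (v \<tau>)))) k = cis (l k * (t - \<tau>)) * (- kop Gk (Tinv (fourier (v \<tau>))) k)"
    if "\<tau> \<in> {0..t}" for \<tau>
  proof -
    have h: "v \<tau> \<in> Hs s" using H that by simp
    then have "distribution (G g1 g2 (K (v \<tau>)))" using GK(1) by (simp add: Hs_iff)
    then show ?thesis by (simp add: U_group_fourier(2) GK(2)[OF h])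
  qed
  ultimately have "((\<lambda>\<tau>. cis (l k * (t - \<tau>)) * (- kop Gk (Tinv (fourier (v \<tau>))) k)) has_integral (fourier (v t) k - fourier (U_group b t u0) k)) {0..t}"
    by (rule has_integral_eq[rotated])
  moreover have "distribution u0" using u0 by (simp add: Hs_iff)
  ultimately show "((\<lambda>\<tau>. cis (l k * (t - \<tau>)) * (- kop Gk (Tinv (fourier (v \<tau>))) k)) has_integral (fourier (v t) k - cis (l k * t) * fourier u0 k)) {0..t}"
    by (simp add: U_group_fourier(2))
qed

text \<open>By the reverse triangle inequality the norm is a continuous function of time on a
  compact interval. This supplies the starting bound of the Gronwall iteration.\<close>

lemma continuous_Hs_bounded:
  assumes "continuous_Hs s v" "0 \<le> a"
  obtains B where "\<And>t. 0 \<le> t \<Longrightarrow> t \<le> a \<Longrightarrow> hnorm s (fourier (v t)) \<le> B"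
proof -
  have H: "v t \<in> Hs s" if "0 \<le> t" for t using assms(1) that by (simp add: continuous_Hs_def)
  have "continuous_on {0..a} (\<lambda>t. hnorm s (fourier (v t)))"
    unfolding continuous_on_def
  proof
    fix t assume t: "t \<in> {0..a}"
    have "((\<lambda>t'. Hs_norm s (dist_diff (v t') (v t))) \<longlongrightarrow> 0) (at t within {0..})"
      using assms(1) t by (simp add: continuous_Hs_def)
    then have "((\<lambda>t'. Hs_norm s (dist_diff (v t') (v t))) \<longlongrightarrow> 0) (at t within {0..a})"
      by (rule tendsto_within_subset) auto
    then have z: "((\<lambda>t'. Hs_norm s (dist_diff (v t') (v t)) / (2 * pi)) \<longlongrightarrow> 0) (at t within {0..a})"
      using tendsto_divide[OF _ tendsto_const, of _ 0 _ "2 * pi"] by simp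
    have le: "\<bar>hnorm s (fourier (v t')) - hnorm s (fourier (v t))\<bar> \<le> Hs_norm s (dist_diff (v t') (v t)) / (2 * pi)" if "t' \<in> {0..a}" for t'
    proof -
      have h: "v t' \<in> Hs s" "v t \<in> Hs s" using that t H by auto
      let ?d = "\<lambda>k. fourier (v t') k - fourier (v t) k"
      have d: "hsq s ?d" using Hs_dist_diff[OF h] by (simp add: Hs_iff)
      have f: "hsq s (fourier (v t'))" "hsq s (fourier (v t))" using h by (auto simp: Hs_iff)
      have "hnorm s (fourier (v t')) \<le> hnorm s ?d + hnorm s (fourier (v t))"
        using wnorm_triangle[OF d f(2)] by simp
      moreover have "hnorm s (fourier (v t)) \<le> hnorm s (\<lambda>k. - ?d k) + hnorm s (fourier (v t'))"
        using wnorm_triangle[OF hsq_uminus[OF d] f(1)] by simp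
      moreover have "hnorm s (\<lambda>k. - ?d k) = hnorm s ?d" using wnorm_cmult[of "wgt 1 s" "- 1" ?d] by simp
      moreover have "Hs_norm s (dist_diff (v t') (v t)) / (2 * pi) = hnorm s ?d"
        by (simp add: Hs_norm_eq Hs_dist_diff(2)[OF h])
      ultimately show ?thesis by linarith
    qed
    have "((\<lambda>t'. hnorm s (fourier (v t')) - hnorm s (fourier (v t))) \<longlongrightarrow> 0) (at t within {0..a})"
      by (rule Lim_null_comparison[OF _ z]) (use le in \<open>auto simp: eventually_at_filter\<close>)
    then show "((\<lambda>t. hnorm s (fourier (v t))) \<longlongrightarrow> hnorm s (fourier (v t))) (at t within {0..a})"
      by (simp add: LIM_zero_iff)
  qed
  then have "bounded ((\<lambda>t. hnorm s (fourier (v t))) ` {0..a})"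
    by (intro compact_imp_bounded compact_continuous_image) auto
  then obtain B where B: "\<And>t. t \<in> {0..a} \<Longrightarrow> \<bar>hnorm s (fourier (v t))\<bar> \<le> B"
    unfolding bounded_iff by (metis imageI real_norm_def)
  show ?thesis by (rule that[of B]) (use B in fastforce)
qed

text \<open>In the difference of two solutions the initial datum cancels, and the control term is
  bounded by \<open>B * Ci\<close> times the difference, so \<open>gronwall_zero\<close>
  applies.\<close>

lemma sol_unique:
  assumes m: "mild_solution s b (\<lambda>v. G g1 g2 (K v)) u0 v" and t: "0 \<le> t"
  shows "v t = sol u0 t"
proof -
  have cv: "continuous_Hs s v" using m by (simp add: mild_solution_def)
  have H: "v \<tau> \<in> Hs s" if "0 \<le> \<tau>" for \<tau> by (rule mild_coord(1)[OF m that])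
  obtain B1 where B1: "\<And>\<tau>. 0 \<le> \<tau> \<Longrightarrow> \<tau> \<le> t \<Longrightarrow> hnorm s (fourier (v \<tau>)) \<le> B1"
    by (rule continuous_Hs_bounded[OF cv t]) blast
  obtain B2 where B2: "\<And>\<tau>. 0 \<le> \<tau> \<Longrightarrow> \<tau> \<le> t \<Longrightarrow> hnorm s (fourier (sol u0 \<tau>)) \<le> B2"
    by (rule continuous_Hs_bounded[OF sol_continuous t]) blast
  obtain B where B: "B \<ge> 0" "\<And>a. hsq s a \<Longrightarrow> hnorm s (kop Gk a) \<le> B * hnorm s a"
    using rapid_bounded[OF rapid_G, of s] by metis
  define d where "d \<tau> k = 1 * fourier (v \<tau>) k + (- 1) * fourier (sol u0 \<tau>) k" for \<tau> k
  define f where "f \<tau> k = - kop Gk (Tinv (d \<tau>)) k" for \<tau> k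
  have hv: "hsq s (fourier (v \<tau>))" if "0 \<le> \<tau>" for \<tau> using H[OF that] by (simp add: Hs_iff)
  have hs: "hsq s (fourier (sol u0 \<tau>))" for \<tau> using sol_Hs by (simp add: Hs_iff)
  have hd: "hsq s (d \<tau>)" if "0 \<le> \<tau>" for \<tau>
    unfolding d_def by (rule wsq_lin[OF hv[OF that] hs])
  have f_eq: "f \<tau> k = - kop Gk (Tinv (fourier (v \<tau>))) k - - kop Gk (Tinv (fourier (sol u0 \<tau>))) k" if "0 \<le> \<tau>" for \<tau> k
    unfolding f_def d_def Tinv_lin[OF hv[OF that] hs] rapid_lin[OF rapid_G Tinv(1)[OF hv[OF that]] Tinv(1)[OF hs]] by simp
  have "d t k = 0" for k
  proof (rule gronwall_zero[where W = "wgt 1 s" and C = "B * Ci" and T = t and B = "B1 + B2" and d = d and f = f and e = "\<lambda>t k \<tau>. cis (l k * (t - \<tau>))"])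
    show "0 < wgt 1 s k" for k by (rule wgt_pos) simp
    show "0 \<le> B * Ci" using B Ci by simp
    fix \<tau> assume \<tau>: "0 \<le> \<tau>" "\<tau> \<le> t"
    show "((\<lambda>\<sigma>. cis (l k * (\<tau> - \<sigma>)) * f \<sigma> k) has_integral d \<tau> k) {0..\<tau>}" for k
    proof -
      have "((\<lambda>\<sigma>. cis (l k * (\<tau> - \<sigma>)) * (- kop Gk (Tinv (fourier (v \<sigma>))) k) - cis (l k * (\<tau> - \<sigma>)) * (- kop Gk (Tinv (fourier (sol u0 \<sigma>))) k))
          has_integral ((fourier (v \<tau>) k - cis (l k * \<tau>) * fourier u0 k) - (fourier (sol u0 \<tau>) k - cis (l k * \<tau>) * fourier u0 k))) {0..\<tau>}"
        by (intro has_integral_diff mild_coord(2) m sol_mild \<tau>)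
      then have "((\<lambda>\<sigma>. cis (l k * (\<tau> - \<sigma>)) * (- kop Gk (Tinv (fourier (v \<sigma>))) k) - cis (l k * (\<tau> - \<sigma>)) * (- kop Gk (Tinv (fourier (sol u0 \<sigma>))) k))
          has_integral d \<tau> k) {0..\<tau>}" by (simp add: d_def)
      then show ?thesis
        by (rule has_integral_eq[rotated]) (simp only: f_eq atLeastAtMost_iff right_diff_distrib)
    qed
    show "hsq s (d \<tau>)" by (rule hd[OF \<tau>(1)])
    have "hnorm s (d \<tau>) \<le> hnorm s (fourier (v \<tau>)) + hnorm s (\<lambda>k. - 1 * fourier (sol u0 \<tau>) k)"
      unfolding d_def mult_1_left using wnorm_triangle[OF hv[OF \<tau>(1)], of "\<lambda>k. - 1 * fourier (sol u0 \<tau>) k"] hsq_uminus[OF hs] by simp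
    also have "hnorm s (\<lambda>k. - 1 * fourier (sol u0 \<tau>) k) = hnorm s (fourier (sol u0 \<tau>))"
      unfolding wnorm_cmult by simp
    finally show "hnorm s (d \<tau>) \<le> B1 + B2" using B1[OF \<tau>] B2[OF \<tau>] by linarith
    show "hsq s (f \<tau>)" unfolding f_def by (intro hsq_uminus kop_hsq Tinv hd \<tau>)
    have "hnorm s (f \<tau>) = hnorm s (kop Gk (Tinv (d \<tau>)))"
      unfolding f_def using wnorm_cmult[of "wgt 1 s" "- 1"] by simp
    also have "\<dots> \<le> B * hnorm s (Tinv (d \<tau>))" by (intro B(2) Tinv hd \<tau>)
    also have "\<dots> \<le> B * (Ci * hnorm s (d \<tau>))" by (intro mult_left_mono B(1) Tinv_norm hd \<tau>)
    finally show "hnorm s (f \<tau>) \<le> B * Ci * hnorm s (d \<tau>)" by (simp add: mult.assoc)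
  qed (use t in auto)
  then show ?thesis
    using H[OF t] sol_Hs[of t] by (intro distribution_eqI) (auto simp: Hs_iff d_def)
qed

lemma sol_has_derivative:
  "has_Hs_derivative (s - r) (sol u0) (dist_add (dist_dx (L_op b (sol u0 t))) (G g1 g2 (K (sol u0 t)))) t"
proof -
  let ?v = "dist_add (dist_dx (L_op b (sol u0 t))) (G g1 g2 (K (sol u0 t)))"
  have ds: "distribution (sol u0 t)" for t using sol_Hs by (simp add: Hs_iff)
  have dG: "distribution (G g1 g2 (K (sol u0 t)))" using GK(1)[OF sol_Hs] by (simp add: Hs_iff)
  have dv: "distribution ?v" by (intro dist_lin_synth(1) A_fourier(1) ds dG)
  have fv: "fourier ?v = rhs t"
  proof
    fix k
    show "fourier ?v k = rhs t k"
      unfolding dist_lin_synth(2)[OF A_fourier(1)[OF ds] dG] A_fourier(2)[OF ds] GK_sol sol_fourier rhs_def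
      by simp
  qed
  have fq: "fourier (dist_diff (dist_lin (1 / of_real h) (sol u0 (t + h)) (- 1 / of_real h) (sol u0 t)) ?v)
     = (\<lambda>k. (1 / of_real h * kop T (W (t + h)) k + (- 1 / of_real h) * kop T (W t) k) - rhs t k)" for h
  proof
    fix k
    show "fourier (dist_diff (dist_lin (1 / of_real h) (sol u0 (t + h)) (- 1 / of_real h) (sol u0 t)) ?v) k
     = (1 / of_real h * kop T (W (t + h)) k + (- 1 / of_real h) * kop T (W t) k) - rhs t k"
      unfolding dist_lin_synth(2)[OF dist_lin_synth(1)[OF ds ds] dv] dist_lin_synth(2)[OF ds ds] sol_fourier fv by simp
  qed
  have "((\<lambda>h. 2 * pi * hnorm (s - r) (\<lambda>k. (1 / of_real h * kop T (W (t + h)) k + (- 1 / of_real h) * kop T (W t) k) - rhs t k)) \<longlongrightarrow> 2 * pi * 0) (at 0)"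
    by (intro tendsto_mult tendsto_const sol_derivative)
  then show ?thesis
    unfolding has_Hs_derivative_def Hs_norm_eq fq using dv hsq_rhs by (simp add: Hs_iff fv)
qed

section \<open>Exponential decay modulo the mean\<close>

lemma T_zero_mode: "T k 0 = (if k = 0 then 1 else 0)" "T 0 k = (if k = 0 then 1 else 0)"
  by (auto simp: Tker_def Gker_def)

text \<open>Column 0 of \<open>T\<close> is a unit vector, so \<open>T\<close> fixes constants, and
  so does the flow: the deviation from the mean is the flow of \<open>w - z\<close>. Row 0 is a unit
  vector too, so \<open>w\<close> has the same mean as the datum and \<open>w - z\<close> has no
  constant mode; all its modes decay.\<close>

lemma sol_decay:
  assumes t: "0 \<le> t" and B: "\<And>a. hsq s a \<Longrightarrow> hnorm s (kop T a) \<le> B * hnorm s a" "0 \<le> B"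
  shows "Hs_norm s (dist_diff (sol u0 t) (const_dist (fourier u0 (0, 0))))
    \<le> B * Ci * exp (- rate * t) * Hs_norm s (dist_diff u0 (const_dist (fourier u0 (0, 0))))"
proof -
  let ?c = "fourier u0 (0, 0)"
  define z where "z k = (if k = (0, 0) then ?c else 0)" for k :: "int \<times> int"
  have du: "distribution u0" using u0 by (simp add: Hs_iff)
  have zz: "(0, 0) = (0 :: int \<times> int)" by (simp add: zero_prod_def)
  have fz: "fourier (const_dist ?c) = z" by (rule ext) (simp add: fourier_const_dist(2) z_def zz)
  have hz: "hsq s z"
    unfolding wsq_def by (rule finite_nonzero_values_imp_summable_on, rule finite_subset[of _ "{0}"]) (auto simp: z_def zz)
  have kz: "kop T z = z"
  proof
    fix k
    have "kop T z k = T k 0 * z 0"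
      unfolding kop_def by (rule infsumI, rule has_sum_finite_neutralI[of "{0}"]) (auto simp: z_def zz)
    then show "kop T z k = z k" by (simp add: T_zero_mode z_def zz)
  qed
  have hu: "hsq s (fourier u0)" using u0 by (simp add: Hs_iff)
  define w' where "w' k = 1 * w k + (- 1) * z k" for k
  have hw': "hsq s w'" unfolding w'_def by (rule wsq_lin[OF hsq_w hz])
  have Tw: "kop T w = fourier u0" by (rule Tinv(2)[OF hu])
  have Tw': "kop T w' = (\<lambda>k. fourier u0 k - z k)"
    unfolding w'_def rapid_lin[OF rapid_T hsq_w hz] kz Tw by simp
  have "kop T w 0 = w 0"
    unfolding kop_def by (rule infsumI, rule has_sum_finite_neutralI[of "{0}"]) (auto simp: T_zero_mode)
  then have w0: "w' 0 = 0" by (simp add: w'_def Tw z_def zz)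
  have ew: "evo rate l w' t = (\<lambda>k. 1 * W t k + (- 1) * z k)"
    by (rule ext) (simp add: evo_def w'_def z_def zz mu_def algebra_simps)
  have Te: "kop T (evo rate l w' t) = (\<lambda>k. kop T (W t) k - z k)"
    unfolding ew rapid_lin[OF rapid_T hsq_W hz] kz by simp
  have "hnorm s (\<lambda>k. kop T (W t) k - z k) \<le> B * hnorm s (evo rate l w' t)"
    unfolding Te[symmetric] by (rule B(1)[OF evo_wsq[OF rate hw' wgt_nonneg]])
  also have "\<dots> \<le> B * (exp (- rate * t) * hnorm s w')"
    by (intro mult_left_mono evo_decay[OF t hw' w0 wgt_nonneg] B(2))
  also have "\<dots> \<le> B * (exp (- rate * t) * (Ci * hnorm s (\<lambda>k. fourier u0 k - z k)))"
    unfolding Tw'[symmetric] by (intro mult_left_mono T_lower[OF hw'] B(2)) simp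
  finally have main: "hnorm s (\<lambda>k. kop T (W t) k - z k) \<le> B * (exp (- rate * t) * (Ci * hnorm s (\<lambda>k. fourier u0 k - z k)))" .
  have f1: "fourier (dist_diff (sol u0 t) (const_dist ?c)) = (\<lambda>k. kop T (W t) k - z k)"
  proof
    fix k
    have ds: "distribution (sol u0 t)" using sol_Hs by (simp add: Hs_iff)
    show "fourier (dist_diff (sol u0 t) (const_dist ?c)) k = kop T (W t) k - z k"
      unfolding dist_lin_synth(2)[OF ds fourier_const_dist(1)] sol_fourier fz by simp
  qed
  have f2: "fourier (dist_diff u0 (const_dist ?c)) = (\<lambda>k. fourier u0 k - z k)"
  proof
    fix k
    show "fourier (dist_diff u0 (const_dist ?c)) k = fourier u0 k - z k"
      unfolding dist_lin_synth(2)[OF du fourier_const_dist(1)] fz by simp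
  qed
  show ?thesis
    unfolding Hs_norm_eq f1 f2 using mult_left_mono[OF main, of "2 * pi"] by (simp add: mult_ac)
qed

end

lemma stabilization:
  "bounded_linear_Hs s K \<and>
    (\<exists>M>0. \<forall>u0\<in>Hs s. \<exists>u.
       mild_solution s b (\<lambda>v. G g1 g2 (K v)) u0 u \<and>
       (\<forall>v. mild_solution s b (\<lambda>w. G g1 g2 (K w)) u0 v \<longrightarrow> (\<forall>t\<ge>0. v t = u t)) \<and>
       u 0 = u0 \<and>
       (\<forall>t>0. has_Hs_derivative (s - r) u
                (dist_add (dist_dx (L_op b (u t))) (G g1 g2 (K (u t)))) t) \<and>
       (\<forall>t\<ge>0. Hs_norm s (dist_diff (u t) (const_dist (fourier u0 (0, 0))))
               \<le> M * exp (- rate * t) * Hs_norm s (dist_diff u0 (const_dist (fourier u0 (0, 0))))))"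
proof (intro conjI bounded_linear_K)
  obtain B where B: "B \<ge> 0" "\<And>a. hsq s a \<Longrightarrow> hnorm s (kop T a) \<le> B * hnorm s a"
    using rapid_bounded[OF rapid_T, of s] by metis
  \<comment> \<open>\<open>B * Ci\<close> bounds the norm of \<open>T\<close> times that of its
    inverse and does not involve the datum or the time; adding 1 makes it positive.\<close>
  define M where "M = B * Ci + 1"
  have M: "M > 0" "B * Ci \<le> M" using B Ci by (auto simp: M_def add_nonneg_pos)
  have "Hs_norm s (dist_diff (sol u0 t) (const_dist (fourier u0 (0, 0))))
      \<le> M * exp (- rate * t) * Hs_norm s (dist_diff u0 (const_dist (fourier u0 (0, 0))))"
    if "u0 \<in> Hs s" "0 \<le> t" for u0 t
  proof -
    have "0 \<le> Hs_norm s (dist_diff u0 (const_dist (fourier u0 (0, 0))))" by (simp add: Hs_norm_eq)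
    then have "B * Ci * exp (- rate * t) * Hs_norm s (dist_diff u0 (const_dist (fourier u0 (0, 0))))
        \<le> M * exp (- rate * t) * Hs_norm s (dist_diff u0 (const_dist (fourier u0 (0, 0))))"
      by (intro mult_right_mono M(2)) auto
    with sol_decay[OF that B(2,1)] show ?thesis by linarith
  qed
  then show "\<exists>M>0. \<forall>u0\<in>Hs s. \<exists>u.
       mild_solution s b (\<lambda>v. G g1 g2 (K v)) u0 u \<and>
       (\<forall>v. mild_solution s b (\<lambda>w. G g1 g2 (K w)) u0 v \<longrightarrow> (\<forall>t\<ge>0. v t = u t)) \<and>
       u 0 = u0 \<and>
       (\<forall>t>0. has_Hs_derivative (s - r) u
                (dist_add (dist_dx (L_op b (u t))) (G g1 g2 (K (u t)))) t) \<and>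
       (\<forall>t\<ge>0. Hs_norm s (dist_diff (u t) (const_dist (fourier u0 (0, 0))))
               \<le> M * exp (- rate * t) * Hs_norm s (dist_diff u0 (const_dist (fourier u0 (0, 0)))))"
    using M(1) sol_mild sol_unique sol_0 sol_has_derivative by blast
qed

end

text \<open>Only finitely many frequencies lie below \<open>N0\<close>, so their values are absorbed
  in the constant; \<open>r >= 1\<close> lets \<open>freq_norm\<close> be replaced by the larger
  \<open>jb\<close>.\<close>

lemma symbol_growth:
  assumes "r \<ge> 1" and "C > 0"
    and b: "\<And>k. freq_norm k \<ge> N0 \<Longrightarrow> \<bar>b k\<bar> \<le> C * freq_norm k powr (r - 1)"
  obtains D where "D \<ge> 0" "\<And>k. \<bar>b k\<bar> \<le> D * jb k powr (r - 1)"
proof -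
  define S where "S = {k. freq_norm k < N0}"
  define m where "m = \<lceil>\<bar>N0\<bar>\<rceil>"
  have "S \<subseteq> {- m..m} \<times> {- m..m}"
  proof
    fix k assume "k \<in> S"
    then have "\<bar>real_of_int (fst k)\<bar> \<le> \<bar>N0\<bar>" "\<bar>real_of_int (snd k)\<bar> \<le> \<bar>N0\<bar>"
      using abs_le_freq_norm[of k] by (auto simp: S_def)
    then have "\<bar>fst k\<bar> \<le> m" "\<bar>snd k\<bar> \<le> m" unfolding m_def by linarith+
    then show "k \<in> {- m..m} \<times> {- m..m}" by (cases k) auto
  qed
  then have S: "finite S" by (rule finite_subset) simp
  define D where "D = C + (\<Sum>k\<in>S. \<bar>b k\<bar>)"
  have D: "D \<ge> 0" "C \<le> D" using assms(2) by (auto simp: D_def sum_nonneg add_nonneg_nonneg)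
  have "\<bar>b k\<bar> \<le> D * jb k powr (r - 1)" for k
  proof (cases "k \<in> S")
    case True
    have "\<bar>b k\<bar> \<le> (\<Sum>k\<in>S. \<bar>b k\<bar>)" using True S by (intro member_le_sum) auto
    also have "\<dots> \<le> D * 1" using assms(2) by (simp add: D_def)
    also have "\<dots> \<le> D * jb k powr (r - 1)"
      using D assms(1) by (intro mult_left_mono ge_one_powr_ge_zero) auto
    finally show ?thesis .
  next
    case False
    then have "\<bar>b k\<bar> \<le> C * freq_norm k powr (r - 1)" by (intro b) (simp add: S_def)
    also have "\<dots> \<le> D * jb k powr (r - 1)"
      using D assms by (intro mult_mono powr_mono2) auto
    finally show ?thesis .
  qed
  with D(1) show ?thesis by (rule that)
qed

theorem theorem1p4:
  fixes r C N0 s rate :: real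
    and b :: "int \<times> int \<Rightarrow> real"
    and J :: "(int \<times> int) set"
    and g1 g2 :: "real \<Rightarrow> real"
  assumes "control_profile g1" and "control_profile g2"
    and "r \<ge> 1" and "C > 0" and "N0 \<ge> 0"
    and "\<And>k. freq_norm k \<ge> N0 \<Longrightarrow> \<bar>b k\<bar> \<le> C * freq_norm k powr (r - 1)"
    and "maximal_separated (eigen b) J"
    and "Inf {\<bar>eigen b k - eigen b k'\<bar> |k k'. k \<in> J \<and> k' \<in> J \<and> k \<noteq> k'} > 0"
    and "cond_A (eigen b) \<or> cond_B (eigen b)"
    and "s \<ge> 0" and "rate > 0"
  shows "\<exists>K. bounded_linear_Hs s K \<and>
    (\<exists>M>0. \<forall>u0\<in>Hs s. \<exists>u.
       mild_solution s b (\<lambda>v. G g1 g2 (K v)) u0 u \<and>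
       (\<forall>v. mild_solution s b (\<lambda>w. G g1 g2 (K w)) u0 v \<longrightarrow> (\<forall>t\<ge>0. v t = u t)) \<and>
       u 0 = u0 \<and>
       (\<forall>t>0. has_Hs_derivative (s - r) u
                (dist_add (dist_dx (L_op b (u t))) (G g1 g2 (K (u t)))) t) \<and>
       (\<forall>t\<ge>0. Hs_norm s (dist_diff (u t) (const_dist (fourier u0 (0, 0))))
               \<le> M * exp (- rate * t) * Hs_norm s (dist_diff u0 (const_dist (fourier u0 (0, 0))))))"
proof -
  define \<gamma> where "\<gamma> = Inf {\<bar>eigen b k - eigen b k'\<bar> |k k'. k \<in> J \<and> k' \<in> J \<and> k \<noteq> k'}"
  have \<gamma>: "\<gamma> > 0" using assms(8) by (simp add: \<gamma>_def)
  have gap: "\<gamma> \<le> \<bar>eigen b k - eigen b k'\<bar>" if "eigen b k \<noteq> eigen b k'" for k k'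
    by (rule maximal_separated_gap[OF assms(7) \<gamma>_def[symmetric] that])
  \<comment> \<open>Infimum and maximality enter only through this gap between distinct values on
    each row and column.\<close>
  note two = cond_two_to_one[OF assms(9) gap]
  obtain \<delta>1 where \<delta>1: "\<delta>1 > 0" "\<And>n. n \<noteq> 0 \<Longrightarrow> cmod (ghat g1 n) \<le> 1 - \<delta>1" by (rule ghat_gap[OF assms(1)]) blast
  obtain \<delta>2 where \<delta>2: "\<delta>2 > 0" "\<And>n. n \<noteq> 0 \<Longrightarrow> cmod (ghat g2 n) \<le> 1 - \<delta>2" by (rule ghat_gap[OF assms(2)]) blast
  define \<delta> where "\<delta> = min \<delta>1 \<delta>2"
  have \<delta>: "\<delta> > 0" "\<And>n. n \<noteq> 0 \<Longrightarrow> cmod (ghat g1 n) \<le> 1 - \<delta>" "\<And>n. n \<noteq> 0 \<Longrightarrow> cmod (ghat g2 n) \<le> 1 - \<delta>"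
    using \<delta>1 \<delta>2 by (fastforce simp: \<delta>_def)+
  note p1 = control_profileD[OF assms(1)] and p2 = control_profileD[OF assms(2)]
  obtain c where c: "c > 0" "coercive (Tker rate (eigen b) (ghat g1) (ghat g2)) c"
    by (rule Tker_coercive[OF assms(11) \<gamma> \<delta>(1) smooth1_deriv(3)[OF p1(1)] p1(3) smooth1_deriv(3)[OF p2(1)] p2(3)
          ghat_def ghat_def ghat_0[OF assms(1)] ghat_0[OF assms(2)] \<delta>(2,3) two]) blast+
  note rap = rapid_Tker[OF rapid_Gker[OF p1(1,2) p2(1,2)] assms(11), of "eigen b"]
  obtain Ci where Ci: "Ci \<ge> 0"
    "\<And>f. hsq s f \<Longrightarrow> \<exists>a. hsq s a \<and> kop (Tker rate (eigen b) (ghat g1) (ghat g2)) a = f"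
    "\<And>a. hsq s a \<Longrightarrow> hnorm s a \<le> Ci * hnorm s (kop (Tker rate (eigen b) (ghat g1) (ghat g2)) a)"
    by (rule rapid_coercive_inverse[OF rap c(2,1), of s]) blast
  obtain D where D: "D \<ge> 0" "\<And>k. \<bar>b k\<bar> \<le> D * jb k powr (r - 1)"
    by (rule symbol_growth[OF assms(3,4,6)]) blast+
  \<comment> \<open>The factor \<open>k1\<close> raises the order from \<open>r - 1\<close> to
    \<open>r\<close>, which is the loss of derivatives in the equation.\<close>
  have growth: "\<bar>eigen b k\<bar> \<le> D * jb k powr r" for k
  proof -
    have "\<bar>eigen b k\<bar> \<le> jb k * (D * jb k powr (r - 1))"
      unfolding eigen_def abs_mult using abs_le_freq_norm(1)[of k] D by (intro mult_mono) auto
    also have "jb k * (D * jb k powr (r - 1)) = D * (jb k powr 1 * jb k powr (r - 1))"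
      by (simp add: powr_one add_nonneg_nonneg)
    also have "\<dots> = D * jb k powr r" unfolding powr_add[symmetric] by simp
    finally show ?thesis .
  qed
  have "polyg (\<lambda>k. of_real (b k))"
  proof -
    have "cmod (of_real (b k)) \<le> D * jb k ^ nat \<lceil>\<bar>r - 1\<bar>\<rceil>" for k
      using D(2)[of k] mult_left_mono[OF powr_le_jb_power[of k "r - 1"] D(1)] assms(3) by simp
    then show ?thesis unfolding polyg_def by blast
  qed
  then interpret closed_loop b g1 g2 s r rate D Ci
    using p1(1,2) p2(1,2) assms(3,10,11) D(1) growth Ci by unfold_locales auto
  show ?thesis using stabilization by blast
qed

end
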